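(* Let $d\ge 1$, let $\delta>0$ and $\rho\in(0,\frac{\sqrt5+1}{2})$ be fixed constants (independent of $n$), and let $\{D_{\bm n}\}_n$, $\{J_{1_{\bm n}}\}_n$, $\{J_{2_{\bm n}}\}_n$ be $d$-level matrix-sequences, with $J_{1_{\bm n}}$ and $J_{2_{\bm n}}$ Hermitian positive semi-definite for all $n$. Assume that the spectral norms of $D_{\bm n}$, $J_{1_{\bm n}}$, $J_{2_{\bm n}}$ are uniformly bounded with respect to $n$, and that there are measurable functions $\kappa:[0,1]^d\times[-\pi,\pi]^d\to\mathbb{C}$ and $\xi_1,\xi_2:[0,1]^d\times[-\pi,\pi]^d\to\mathbb{R}$ with $\xi_1\ge 0$, $\xi_2\ge 0$ such that $\{D_{\bm n}\}_n\sim_{GLT}\kappa$, $\{J_{1_{\bm n}}\}_n\sim_{GLT}\xi_1$, $\{J_{2_{\bm n}}\}_n\sim_{GLT}\xi_2$. Define $$S_{\bm n}=\rho\Big(J_{1_{\bm n}}+\tfrac1\delta I_{\bm n}\Big)+D_{\bm n}^*\Big(\big(\rho J_{2_{\bm n}}+\tfrac{\rho}{\delta}I_{\bm n}\big)^{-1}+\tfrac{\delta}{\rho}I_{\bm n}\Big)^{-1}D_{\bm n}.$$ Then there exists a measurable function $\tau:[0,1]^d\times[-\pi,\pi]^d\to\mathbb{R}$ such that $\tau\ge 0$, $\tau\ne 0$ almost everywhere, and $\{S_{\bm n}\}_n\sim_{GLT}\tau$. Moreover, the matrices $S_{\bm n}$ are Hermitian positive definite, $\{S_{\bm n}\}_n\sim_\lambda\tau$,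 and $\{S_{\bm n}^{-1}\}_n\sim_\lambda\tau^{-1}$.
   Context: Multi-indices. A $d$-index is a vector $\bm n=(n_1,\dots,n_d)\in\mathbb{Z}^d$; $N(\bm n)=\prod_j n_j$; $\bm n\to\infty$ means $\min_j n_j\to\infty$. Operations on and inequalities between $d$-indices are componentwise; index ranges $\bm 1,\dots,\bm n$ are ordered lexicographically. A $d$-level matrix-sequence is a sequence $\{A_{\bm n}\}_n$, $n$ varying in an infinite subset of $\mathbb{N}$, where $\bm n=\bm n(n)\in\mathbb{N}^d$, $\bm n\to\infty$ as $n\to\infty$, and $A_{\bm n}$ is a complex $N(\bm n)\times N(\bm n)$ matrix with rows and columns indexed by $\bm 1,\dots,\bm n$. $I_{\bm n}$ is the identity of size $N(\bm n)$; $\|\cdot\|$ is the spectral norm; $^*$ is conjugate transpose. Approximating class of sequences (a.c.s.). For matrices $A_n,B_{n,m}$ of size $d_n\times d_n$ ($d_n\to\infty$), $\{B_{n,m}\}_n\xrightarrow{\text{a.c.s.}}\{A_n\}_n$ (as $m\to\infty$) means: for every $m$ there is $n_m$ such that for all $n\ge n_m$, $A_n=B_{n,m}+R_{n,m}+N_{n,m}$ with $\mathrm{rank}(R_{n,m})\le c(m)d_n$, $\|N_{n,m}\|\le\omega(m)$, where $n_m,c(m),\omega(m)$ depend only on $m$ and $c(m),\omega(m)\to0$ as $m\to\infty$. The same definition is used with a multi-index $\bm m\to\infty$ or a real parameter $\epsilon\to0$ in place of $m\to\infty$. Locally Toeplitz (LT) sequences. For $f\in L^1([-\pi,\pi]^d)$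 let $f_{\bm k}=(2\pi)^{-d}\int_{[-\pi,\pi]^d}f(\bm\theta)e^{-i\langle\bm k,\bm\theta\rangle}\,d\bm\theta$, $\bm k\in\mathbb{Z}^d$. For $v:[0,1]^d\to\mathbb{C}$ and $\bm m,\bm n\in\mathbb{N}^d$, put $\bm q=\lfloor\bm n/\bm m\rfloor$; the locally Toeplitz operator $LT_{\bm n}^{\bm m}(v,f)$ is the $N(\bm n)\times N(\bm n)$ matrix whose $(\bm i,\bm j)$ entry is $v(\bm a/\bm m)f_{\bm r-\bm s}$ if $\bm i=(\bm a-\bm 1)\bm q+\bm r$, $\bm j=(\bm a-\bm 1)\bm q+\bm s$ with $\bm 1\le\bm a\le\bm m$, $\bm 1\le\bm r,\bm s\le\bm q$, and $0$ otherwise (for $d=1$: the block diagonal matrix with blocks $v(a/m)T_{\lfloor n/m\rfloor}(f)$, $a=1,\dots,m$, padded with a zero block of size $n\bmod m$). If $v$ is Riemann-integrable and $f\in L^1([-\pi,\pi]^d)$, then $\{A_{\bm n}\}_n\sim_{LT}v\otimes f$ means $\{LT_{\bm n}^{\bm m}(v,f)\}_n\xrightarrow{\text{a.c.s.}}\{A_{\bm n}\}_n$ as $\bm m\to\infty$, where $(v\otimes f)(\bm x,\bm\theta)=v(\bm x)f(\bm\theta)$. Generalized locally Toeplitz (GLT) sequences. For measurable $\kappa:[0,1]^d\times[-\pi,\pi]^d\to\mathbb{C}$, $\{A_{\bm n}\}_n\sim_{GLT}\kappa$ means: for every $\epsilon>0$ there are finitely many $d$-level LT sequences $\{A^{(i,\epsilon)}_{\bm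 n}\}_n\sim_{LT}v_{i,\epsilon}\otimes f_{i,\epsilon}$, $i=1,\dots,N_\epsilon$, such that as $\epsilon\to0$, $\sum_i v_{i,\epsilon}\otimes f_{i,\epsilon}\to\kappa$ in measure and $\{\sum_i A_{\bm n}^{(i,\epsilon)}\}_n\xrightarrow{\text{a.c.s.}}\{A_{\bm n}\}_n$. Spectral distribution. For a matrix-sequence $\{A_n\}_n$ of sizes $d_n$ and measurable $f:D\subset\mathbb{R}^k\to\mathbb{C}$ with $0<\mu_k(D)<\infty$ ($\mu_k$ Lebesgue measure), $\{A_n\}_n\sim_\lambda f$ means $\lim_{n\to\infty}\frac1{d_n}\sum_{j=1}^{d_n}F(\lambda_j(A_n))=\frac1{\mu_k(D)}\int_DF(f(\bm x))\,d\bm x$ for every continuous compactly supported $F:\mathbb{C}\to\mathbb{C}$. *)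

theory Defs
  imports
    "HOL-Analysis.Analysis"
    "HOL-Library.Fun_Lexorder"
    "Jordan_Normal_Form.DL_Rank"
    "Jordan_Normal_Form.Schur_Decomposition"
    "Jordan_Normal_Form.Gauss_Jordan_Elimination"
    "Jordan_Normal_Form.Char_Poly"
begin

section \<open>Complex matrices\<close>

definition vec_nrm :: "complex Matrix.vec \<Rightarrow> real" where
  "vec_nrm x = sqrt (Re (x \<bullet>c x))"

definition spectral_norm :: "complex Matrix.mat \<Rightarrow> real" where
  "spectral_norm A = (SUP x \<in> {x \<in> carrier_vec (dim_col A). vec_nrm x \<le> 1}. vec_nrm (A *\<^sub>v x))"

definition mat_rank :: "complex Matrix.mat \<Rightarrow> nat" where
  "mat_rank A = vec_space.rank (dim_row A) A"

text \<open>Only meaningful for invertible matrices: the library function returns an option.\<close>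

definition mat_inv :: "complex Matrix.mat \<Rightarrow> complex Matrix.mat" where
  "mat_inv A = the (mat_inverse A)"

definition hermitian_mat :: "complex Matrix.mat \<Rightarrow> bool" where
  "hermitian_mat A \<longleftrightarrow> square_mat A \<and> mat_adjoint A = A"

text \<open>\<open>(A *\<^sub>v x) \<bullet>c x\<close> is \<open>x\<^sup>* A x\<close>, which is real for Hermitian \<open>A\<close>.\<close>

definition hermitian_psd :: "complex Matrix.mat \<Rightarrow> bool" where
  "hermitian_psd A \<longleftrightarrow> hermitian_mat A \<and>
     (\<forall>x \<in> carrier_vec (dim_row A). 0 \<le> Re ((A *\<^sub>v x) \<bullet>c x))"

definition hermitian_pd :: "complex Matrix.mat \<Rightarrow> bool" where
  "hermitian_pd A \<longleftrightarrow> hermitian_mat A \<and>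
     (\<forall>x \<in> carrier_vec (dim_row A). x \<noteq> 0\<^sub>v (dim_row A) \<longrightarrow> 0 < Re ((A *\<^sub>v x) \<bullet>c x))"

section \<open>Multi-indices and multilevel matrix-sequences\<close>

text \<open>
  A \<open>d\<close>-index is a function on a finite linearly ordered type \<open>'d\<close> with \<open>d\<close> elements
  (so \<open>d \<ge> 1\<close>); the order of \<open>'d\<close> is the order of the components. The order on functions is
  the componentwise one, so \<^term>\<open>{(\<lambda>_. 1)..n}\<close> is the range \<open>1, \<dots>, n\<close> of \<open>d\<close>-indices.
\<close>

definition mi_size :: "('d::finite \<Rightarrow> nat) \<Rightarrow> nat" where
  "mi_size n = (\<Prod>j\<in>UNIV. n j)"

definition mi_range :: "('d::finite \<Rightarrow> nat) \<Rightarrow> ('d \<Rightarrow> nat) set" where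
  "mi_range n = {(\<lambda>_. 1)..n}"

text \<open>The filter \<open>n \<rightarrow> \<infinity>\<close> for \<open>d\<close>-indices, that is, \<open>min\<^sub>j n\<^sub>j \<rightarrow> \<infinity>\<close>.\<close>

definition mi_at_top :: "('d::finite \<Rightarrow> nat) filter" where
  "mi_at_top = filtercomap (\<lambda>n. Min (range n)) at_top"

text \<open>
  The library matrices are indexed by \<open>0, \<dots>, N(n) - 1\<close>; \<open>mi_nth n k\<close> is the \<open>d\<close>-index labelling
  row (or column) \<open>k\<close>: the element of the range \<open>1, \<dots>, n\<close> with exactly \<open>k\<close> lexicographic
  predecessors. The relation \<^const>\<open>less_fun\<close> is the strict lexicographic order.
\<close>

definition mi_nth :: "('d::{finite,linorder} \<Rightarrow> nat) \<Rightarrow> nat \<Rightarrow> ('d \<Rightarrow> nat)" where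
  "mi_nth n k = (THE i. i \<in> mi_range n \<and> card {j \<in> mi_range n. less_fun j i} = k)"

definition mi_mat ::
    "('d::{finite,linorder} \<Rightarrow> nat) \<Rightarrow> (('d \<Rightarrow> nat) \<Rightarrow> ('d \<Rightarrow> nat) \<Rightarrow> complex) \<Rightarrow> complex Matrix.mat" where
  "mi_mat n a = Matrix.mat (mi_size n) (mi_size n) (\<lambda>(k, l). a (mi_nth n k) (mi_nth n l))"

text \<open>
  In a matrix-sequence the parameter \<open>n\<close> varies in an infinite set \<open>I\<close> of natural numbers, and
  \<open>nn n\<close> is the \<open>d\<close>-index with positive components associated with \<open>n\<close>.
\<close>

definition at_top_in :: "nat set \<Rightarrow> nat filter" where
  "at_top_in I = inf at_top (principal I)"

definition multilevel_seq ::
    "nat set \<Rightarrow> (nat \<Rightarrow> 'd::finite \<Rightarrow> nat) \<Rightarrow> (nat \<Rightarrow> complex Matrix.mat) \<Rightarrow> bool" where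
  "multilevel_seq I nn A \<longleftrightarrow>
     infinite I \<and> (\<forall>n\<in>I. \<forall>j. 1 \<le> nn n j) \<and> filterlim nn mi_at_top (at_top_in I) \<and>
     (\<forall>n\<in>I. A n \<in> carrier_mat (mi_size (nn n)) (mi_size (nn n)))"

section \<open>Approximating classes of sequences\<close>

text \<open>
  \<open>P\<close> is the set in which the parameter \<open>m\<close> varies and \<open>G\<close> the filter along which it tends to its
  limit. Both are needed: the decomposition is required for every \<open>m\<close> in \<open>P\<close>.
\<close>

definition acs ::
    "nat set \<Rightarrow> 'p set \<Rightarrow> 'p filter \<Rightarrow> ('p \<Rightarrow> nat \<Rightarrow> complex Matrix.mat) \<Rightarrow> (nat \<Rightarrow> complex Matrix.mat) \<Rightarrow> bool"
  where
  "acs I P G B A \<longleftrightarrow>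
     (\<exists>(n0 :: 'p \<Rightarrow> nat) (c :: 'p \<Rightarrow> real) (\<omega> :: 'p \<Rightarrow> real).
        (c \<longlongrightarrow> 0) G \<and> (\<omega> \<longlongrightarrow> 0) G \<and>
        (\<forall>m\<in>P. \<forall>n\<in>I. n0 m \<le> n \<longrightarrow>
           (let d = dim_row (A n) in
             B m n \<in> carrier_mat d d \<and>
             (\<exists>R \<in> carrier_mat d d. \<exists>N \<in> carrier_mat d d.
                A n = B m n + R + N \<and>
                real (mat_rank R) \<le> c m * real d \<and> spectral_norm N \<le> \<omega> m))))"

section \<open>Locally Toeplitz sequences\<close>

definition unit_cube :: "(real ^ 'd::finite) set" where
  "unit_cube = cbox (\<chi> j. 0) (\<chi> j. 1)"

definition angle_cube :: "(real ^ 'd::finite) set" where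
  "angle_cube = cbox (\<chi> j. - pi) (\<chi> j. pi)"

definition fourier_coeff :: "(real ^ 'd::finite \<Rightarrow> complex) \<Rightarrow> ('d \<Rightarrow> int) \<Rightarrow> complex" where
  "fourier_coeff f k =
     complex_of_real (1 / (2 * pi) ^ CARD('d)) *
     (LINT \<theta>|lebesgue_on angle_cube.
        f \<theta> * exp (- \<i> * complex_of_real (\<Sum>j\<in>UNIV. real_of_int (k j) * vec_nth \<theta> j)))"

text \<open>
  Riemann integrability, by convergence of the Riemann sums over arbitrarily tagged divisions into
  boxes as the mesh tends to \<open>0\<close>. The library integral is the more general gauge integral.
\<close>

definition riemann_integrable_on ::
    "('a::euclidean_space \<Rightarrow> 'b::real_normed_vector) \<Rightarrow> 'a set \<Rightarrow> bool" where
  "riemann_integrable_on v S \<longleftrightarrow>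
     (\<exists>y. \<forall>e>0. \<exists>\<delta>>0. \<forall>p. p tagged_division_of S \<and> (\<forall>(x, K)\<in>p. diameter K < \<delta>) \<longrightarrow>
        norm ((\<Sum>(x, K)\<in>p. measure lborel K *\<^sub>R v x) - y) < e)"

text \<open>
  The locally Toeplitz operator. For given \<open>i\<close>, \<open>j\<close> at most one summand is nonzero, since
  \<open>(a - 1) q + r\<close> with \<open>1 \<le> r \<le> q\<close> determines \<open>a\<close> and \<open>r\<close>; the entry is \<open>0\<close> if \<open>i\<close> and \<open>j\<close> are
  not of this form with the same \<open>a\<close>.
\<close>

definition LT_op ::
    "('d::{finite,linorder} \<Rightarrow> nat) \<Rightarrow> ('d \<Rightarrow> nat) \<Rightarrow> (real ^ 'd::{finite,linorder} \<Rightarrow> complex) \<Rightarrow> (real ^ 'd::{finite,linorder} \<Rightarrow> complex) \<Rightarrow>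
     complex Matrix.mat" where
  "LT_op n m v f =
     (let q = (\<lambda>l. n l div m l) in
      mi_mat n (\<lambda>i j.
        \<Sum>a\<in>mi_range m. \<Sum>r\<in>mi_range q. \<Sum>s\<in>mi_range q.
          if i = (\<lambda>l. (a l - 1) * q l + r l) \<and> j = (\<lambda>l. (a l - 1) * q l + s l)
          then v (\<chi> l. real (a l) / real (m l)) * fourier_coeff f (\<lambda>l. int (r l) - int (s l))
          else 0))"

definition LT_seq ::
    "nat set \<Rightarrow> (nat \<Rightarrow> 'd::{finite,linorder} \<Rightarrow> nat) \<Rightarrow> (nat \<Rightarrow> complex Matrix.mat) \<Rightarrow>
     (real ^ 'd::{finite,linorder} \<Rightarrow> complex) \<Rightarrow> (real ^ 'd::{finite,linorder} \<Rightarrow> complex) \<Rightarrow> bool" where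
  "LT_seq I nn A v f \<longleftrightarrow>
     multilevel_seq I nn A \<and>
     riemann_integrable_on v unit_cube \<and> integrable (lebesgue_on angle_cube) f \<and>
     acs I {m. \<forall>j. 1 \<le> m j} mi_at_top (\<lambda>m n. LT_op (nn n) m v f) A"

section \<open>Generalized locally Toeplitz sequences\<close>

definition symbol_domain :: "((real ^ 'd::finite) \<times> (real ^ 'd::finite)) set" where
  "symbol_domain = unit_cube \<times> angle_cube"

definition converges_in_measure_on ::
    "'a::euclidean_space set \<Rightarrow> ('p \<Rightarrow> 'a \<Rightarrow> complex) \<Rightarrow> ('a \<Rightarrow> complex) \<Rightarrow> 'p filter \<Rightarrow> bool" where
  "converges_in_measure_on S g h G \<longleftrightarrow>
     (\<forall>\<eta>>0. ((\<lambda>p. emeasure lebesgue {z \<in> S. \<eta> < norm (g p z - h z)}) \<longlongrightarrow> 0) G)"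

definition GLT_seq ::
    "nat set \<Rightarrow> (nat \<Rightarrow> 'd::{finite,linorder} \<Rightarrow> nat) \<Rightarrow> (nat \<Rightarrow> complex Matrix.mat) \<Rightarrow>
     ((real ^ 'd::{finite,linorder}) \<times> (real ^ 'd::{finite,linorder}) \<Rightarrow> complex) \<Rightarrow> bool" where
  "GLT_seq I nn A \<kappa> \<longleftrightarrow>
     multilevel_seq I nn A \<and> \<kappa> \<in> borel_measurable (lebesgue_on symbol_domain) \<and>
     (\<exists>(M :: real \<Rightarrow> nat) (L :: real \<Rightarrow> nat \<Rightarrow> nat \<Rightarrow> complex Matrix.mat)
        (v :: real \<Rightarrow> nat \<Rightarrow> real ^ 'd::{finite,linorder} \<Rightarrow> complex) (f :: real \<Rightarrow> nat \<Rightarrow> real ^ 'd::{finite,linorder} \<Rightarrow> complex).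
        (\<forall>\<epsilon>>0. \<forall>i\<in>{1..M \<epsilon>}. LT_seq I nn (L \<epsilon> i) (v \<epsilon> i) (f \<epsilon> i)) \<and>
        converges_in_measure_on symbol_domain
          (\<lambda>\<epsilon> (x, \<theta>). \<Sum>i\<in>{1..M \<epsilon>}. v \<epsilon> i x * f \<epsilon> i \<theta>) \<kappa> (at_right 0) \<and>
        acs I {0<..} (at_right 0)
          (\<lambda>\<epsilon> n. Matrix.mat (mi_size (nn n)) (mi_size (nn n))
                   (\<lambda>(k, l). \<Sum>i\<in>{1..M \<epsilon>}. L \<epsilon> i n $$ (k, l))) A)"

section \<open>Spectral distribution\<close>

text \<open>The eigenvalues, with algebraic multiplicities, are the roots of the characteristic polynomial.\<close>

definition spectral_distribution ::
    "nat set \<Rightarrow> (nat \<Rightarrow> complex Matrix.mat) \<Rightarrow> 'a::euclidean_space set \<Rightarrow> ('a \<Rightarrow> complex) \<Rightarrow> bool" where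
  "spectral_distribution I A S f \<longleftrightarrow>
     S \<in> sets lebesgue \<and> 0 < emeasure lebesgue S \<and> emeasure lebesgue S < \<infinity> \<and>
     f \<in> borel_measurable (lebesgue_on S) \<and>
     (\<forall>F :: complex \<Rightarrow> complex.
        continuous_on UNIV F \<and> compact (closure {z. F z \<noteq> 0}) \<longrightarrow>
        ((\<lambda>n. (\<Sum>z\<in>#proots (char_poly (A n)). F z) / of_nat (dim_row (A n))) \<longlongrightarrow>
           complex_of_real (1 / measure lebesgue S) * (LINT x|lebesgue_on S. F (f x)))
          (at_top_in I))"

section \<open>The Schur complement\<close>

definition schur_mat ::
    "real \<Rightarrow> real \<Rightarrow> complex Matrix.mat \<Rightarrow> complex Matrix.mat \<Rightarrow> complex Matrix.mat \<Rightarrow> complex Matrix.mat" where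
  "schur_mat \<rho> \<delta> D J1 J2 =
     (let I = 1\<^sub>m (dim_row D);
          r = complex_of_real \<rho>; e = complex_of_real \<delta> in
      r \<cdot>\<^sub>m (J1 + (1 / e) \<cdot>\<^sub>m I) +
      mat_adjoint D * mat_inv (mat_inv (r \<cdot>\<^sub>m J2 + (r / e) \<cdot>\<^sub>m I) + (e / r) \<cdot>\<^sub>m I) * D)"

end

theory Submission imports Defs begin

text \<open>
  A sequence is GLT with symbol \<open>\<kappa>\<close> iff for every \<open>\<epsilon> > 0\<close> there is a finite sum of diagonal matrices
  \<open>diag v(i/n)\<close>, \<open>v\<close> continuous, times shifts by \<open>k\<close> whose symbol \<open>\<Sum> v(x) e\<^sup>i\<^sup>\<langle>\<^sup>k\<^sup>,\<^sup>\<theta>\<^sup>\<rangle>\<close> is within \<open>\<epsilon>\<close>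
  of \<open>\<kappa>\<close> off a set of measure \<open>\<epsilon>\<close> and which for large \<open>n\<close> differs from the sequence by a matrix of
  relative rank \<open>\<epsilon>\<close> plus one of norm \<open>\<epsilon>\<close>. Products and adjoints of such sums are again such sums up to
  \<open>o(N(n))\<close> in squared Frobenius norm, so bounded GLT sequences form a *-algebra, and Neumann series
  yield inverses of uniformly positive definite sequences. The traces of powers of such sums are
  Riemann sums; with Weierstrass approximation and interlacing this gives the eigenvalue
  distribution of Hermitian GLT sequences. Finally \<open>S\<close> is Hermitian and at least \<open>\<rho>/\<delta>\<close>, with symbol
  \<open>\<tau> = \<rho>(\<xi>1 + 1/\<delta>) + |\<kappa>|\<^sup>2 / (1/(\<rho> \<xi>2 + \<rho>/\<delta>) + \<delta>/\<rho>)\<close>.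
\<close>

text \<open>Diagonal matrices times shifts carry no second index \<open>m\<close>, are bounded
  uniformly in \<open>n\<close>, and multiply exactly except in few boundary rows; this is why they
  replace LT operators. Two obstacles shape the rest. First, in an LT symbol \<open>v\<close> is
  only Riemann-integrable and \<open>f\<close> only integrable. So \<open>v\<close> is replaced by
  its values on a grid, and these by a continuous function cut off near the cell walls;
  \<open>f\<close> is replaced by a trigonometric polynomial, and the L1 error becomes rank plus
  norm through the trace of positive semidefinite matrices, since a Frobenius bound would ask for
  L2. Second, the norm bound of an approximant depends on its accuracy, so moments of the
  approximants do not simply pass to the sequence. Counts of eigenvalues do: a perturbation of rank
  \<open>r\<close> changes the sum of a monotone function with values in [0, 1] by at most
  \<open>r\<close>. Powers of clamped eigenvalues are such functions, and they bring the moments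
  back. Boundedness of the eigenvalues then passes to the symbol through the distribution itself,
  which makes the Neumann series converge on the symbol side too.\<close>

abbreviation "symM \<equiv> lebesgue_on symbol_domain"
abbreviation "angM \<equiv> lebesgue_on angle_cube"
type_synonym 'd sdom = "(real ^ 'd) \<times> (real ^ 'd)"

no_notation vec_nth (infixl \<open>$\<close> 90)

section \<open>Adjoints, the Euclidean norm and operator bounds\<close>

lemma adj_dims [simp]: "dim_row (mat_adjoint A) = dim_col A" "dim_col (mat_adjoint A) = dim_row A"
  by (auto simp: mat_adjoint_def)

lemma adj_carrier [simp]: "A \<in> carrier_mat n m \<Longrightarrow> mat_adjoint A \<in> carrier_mat m n"
  by auto

lemma adj_index [simp]:
  "i < dim_col A \<Longrightarrow> j < dim_row A \<Longrightarrow> mat_adjoint A $$ (i, j) = cnj (A $$ (j, i))"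
  for A :: "complex Matrix.mat"
  by (auto simp: mat_adjoint_def mat_of_rows_index)

lemma index_mult_sum:
  "A \<in> carrier_mat n m \<Longrightarrow> B \<in> carrier_mat m k \<Longrightarrow> i < n \<Longrightarrow> j < k \<Longrightarrow>
   (A * B) $$ (i, j) = (\<Sum>l<m. A $$ (i, l) * B $$ (l, j))"
  by (auto simp: scalar_prod_def lessThan_atLeast0)

lemma index_mult_vec_sum:
  "A \<in> carrier_mat n m \<Longrightarrow> x \<in> carrier_vec m \<Longrightarrow> i < n \<Longrightarrow>
   (A *\<^sub>v x) $ i = (\<Sum>l<m. A $$ (i, l) * x $ l)"
  by (auto simp: scalar_prod_def lessThan_atLeast0)

lemma adj_adj [simp]: "mat_adjoint (mat_adjoint A) = A" for A :: "complex Matrix.mat"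
  by (rule eq_matI) auto

lemma adj_add: "A \<in> carrier_mat n m \<Longrightarrow> B \<in> carrier_mat n m \<Longrightarrow>
   mat_adjoint (A + B) = mat_adjoint A + mat_adjoint B" for A :: "complex Matrix.mat"
  by (rule eq_matI) auto

lemma adj_minus: "A \<in> carrier_mat n m \<Longrightarrow> B \<in> carrier_mat n m \<Longrightarrow>
   mat_adjoint (A - B) = mat_adjoint A - mat_adjoint B" for A :: "complex Matrix.mat"
  by (rule eq_matI) auto

lemma adj_smult: "mat_adjoint (c \<cdot>\<^sub>m A) = cnj c \<cdot>\<^sub>m mat_adjoint A" for A :: "complex Matrix.mat"
  by (rule eq_matI) auto

lemma adj_one [simp]: "mat_adjoint (1\<^sub>m n) = (1\<^sub>m n :: complex Matrix.mat)"
  by (rule eq_matI) auto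

lemma adj_mult: "A \<in> carrier_mat n m \<Longrightarrow> B \<in> carrier_mat m k \<Longrightarrow>
   mat_adjoint (A * B) = mat_adjoint B * mat_adjoint A" for A :: "complex Matrix.mat"
  by (rule eq_matI) (auto simp: scalar_prod_def mult.commute intro!: sum.cong)

lemma cscalar_sum: "x \<in> carrier_vec n \<Longrightarrow> y \<in> carrier_vec n \<Longrightarrow>
   x \<bullet>c y = (\<Sum>i<n. x $ i * cnj (y $ i))" for x :: "complex Matrix.vec"
  by (auto simp: scalar_prod_def lessThan_atLeast0)

lemma adj_cscalar:
  assumes A: "A \<in> carrier_mat n m" and x: "x \<in> carrier_vec m" and y: "y \<in> carrier_vec n"
  shows "(A *\<^sub>v x) \<bullet>c y = x \<bullet>c (mat_adjoint A *\<^sub>v (y :: complex Matrix.vec))"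
proof -
  have ay: "mat_adjoint A *\<^sub>v y \<in> carrier_vec m" by (rule mult_mat_vec_carrier[OF adj_carrier[OF A] y])
  have "(A *\<^sub>v x) \<bullet>c y = (\<Sum>i<n. \<Sum>l<m. A $$ (i, l) * x $ l * cnj (y $ i))"
    using A x y by (subst cscalar_sum[of _ n]) (auto simp: index_mult_vec_sum sum_distrib_right simp del: index_mult_mat_vec)
  also have "\<dots> = (\<Sum>l<m. \<Sum>i<n. A $$ (i, l) * x $ l * cnj (y $ i))"
    by (rule sum.swap)
  also have "\<dots> = x \<bullet>c (mat_adjoint A *\<^sub>v y)"
    using A x y ay index_mult_vec_sum[of "mat_adjoint A" m n y]
    by (subst cscalar_sum[of _ m])
      (auto simp: sum_distrib_left algebra_simps simp del: index_mult_mat_vec intro!: sum.cong)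
  finally show ?thesis .
qed

lemma cscalar_self: "x \<in> carrier_vec n \<Longrightarrow> x \<bullet>c x = complex_of_real (\<Sum>i<n. (cmod (x $ i))\<^sup>2)"
  by (simp add: cscalar_sum complex_mult_cnj cmod_power2 flip: of_real_power)

lemma vec_nrm_L2: "x \<in> carrier_vec n \<Longrightarrow> vec_nrm x = L2_set (\<lambda>i. cmod (x $ i)) {..<n}"
  by (simp add: vec_nrm_def cscalar_self L2_set_def)

lemma vec_nrm_sq: "x \<in> carrier_vec n \<Longrightarrow> (vec_nrm x)\<^sup>2 = (\<Sum>i<n. (cmod (x $ i))\<^sup>2)"
  by (simp add: vec_nrm_def cscalar_self sum_nonneg)

lemma vec_nrm_sq_cscalar: "x \<in> carrier_vec n \<Longrightarrow> x \<bullet>c x = complex_of_real ((vec_nrm x)\<^sup>2)"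
  by (simp add: vec_nrm_sq cscalar_self)

lemma vec_nrm_nonneg [simp]: "0 \<le> vec_nrm x"
proof -
  have "x \<in> carrier_vec (dim_vec x)" by simp
  then show ?thesis by (simp only: vec_nrm_L2 L2_set_nonneg)
qed

lemma vec_nrm_zero [simp]: "vec_nrm (0\<^sub>v n) = 0"
  by (simp add: vec_nrm_L2[of _ n] L2_set_def)

lemma vec_nrm_eq_0: "x \<in> carrier_vec n \<Longrightarrow> vec_nrm x = 0 \<longleftrightarrow> x = 0\<^sub>v n"
  by (auto simp: vec_nrm_L2[of _ n] L2_set_eq_0_iff intro!: eq_vecI)

lemma vec_nrm_triangle: "x \<in> carrier_vec n \<Longrightarrow> y \<in> carrier_vec n \<Longrightarrow>
   vec_nrm (x + y) \<le> vec_nrm x + vec_nrm y"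
  unfolding vec_nrm_L2[of _ n, OF add_carrier_vec] vec_nrm_L2
  by (rule order_trans[OF L2_set_mono L2_set_triangle_ineq]) (auto simp: norm_triangle_ineq)

lemma vec_nrm_smult: "x \<in> carrier_vec n \<Longrightarrow> vec_nrm (c \<cdot>\<^sub>v x) = cmod c * vec_nrm x"
  by (auto simp: vec_nrm_L2[of _ n] norm_mult L2_set_right_distrib intro!: L2_set_cong)

lemma cscalar_cauchy:
  assumes "x \<in> carrier_vec n" "y \<in> carrier_vec n"
  shows "cmod (x \<bullet>c y) \<le> vec_nrm x * vec_nrm y"
proof -
  have "cmod (x \<bullet>c y) \<le> (\<Sum>i<n. \<bar>cmod (x $ i)\<bar> * \<bar>cmod (y $ i)\<bar>)"
    unfolding cscalar_sum[OF assms] by (rule order_trans[OF norm_sum]) (simp add: norm_mult)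
  also have "\<dots> \<le> vec_nrm x * vec_nrm y"
    unfolding vec_nrm_L2[OF assms(1)] vec_nrm_L2[OF assms(2)] by (rule L2_set_mult_ineq)
  finally show ?thesis .
qed

text \<open>Norm bounds are handled by this predicate rather than through the supremum
  in \<^const>\<open>spectral_norm\<close>.\<close>

definition nb :: "complex Matrix.mat \<Rightarrow> real \<Rightarrow> bool" where
  "nb A c \<longleftrightarrow> (\<forall>x\<in>carrier_vec (dim_col A). vec_nrm (A *\<^sub>v x) \<le> c * vec_nrm x)"

lemma nbD: "nb A c \<Longrightarrow> A \<in> carrier_mat n m \<Longrightarrow> x \<in> carrier_vec m \<Longrightarrow> vec_nrm (A *\<^sub>v x) \<le> c * vec_nrm x"
  by (auto simp: nb_def)

lemma nbI: "A \<in> carrier_mat n m \<Longrightarrow> (\<And>x. x \<in> carrier_vec m \<Longrightarrow> vec_nrm (A *\<^sub>v x) \<le> c * vec_nrm x) \<Longrightarrow> nb A c"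
  by (auto simp: nb_def)

lemma nb_mono: "nb A c \<Longrightarrow> c \<le> c' \<Longrightarrow> nb A c'"
  unfolding nb_def by (meson mult_right_mono order_trans vec_nrm_nonneg)

lemma nb_one: "nb (1\<^sub>m n) 1"
  by (auto simp: nb_def)

lemma zero_mat_mult_vec: "x \<in> carrier_vec m \<Longrightarrow> 0\<^sub>m n m *\<^sub>v x = 0\<^sub>v n" for x :: "complex Matrix.vec"
  by (rule eq_vecI) auto

lemma mat_mult_zero_vec: "A \<in> carrier_mat n m \<Longrightarrow> A *\<^sub>v 0\<^sub>v m = 0\<^sub>v n" for A :: "complex Matrix.mat"
  by (rule eq_vecI) auto

lemma nb_zero: "nb (0\<^sub>m n m) 0"
  by (auto simp: nb_def zero_mat_mult_vec)

lemma nb_add: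
  assumes A: "A \<in> carrier_mat n m" and B: "B \<in> carrier_mat n m" and a: "nb A a" and b: "nb B b"
  shows "nb (A + B) (a + b)"
proof (rule nbI)
  fix x :: "complex Matrix.vec" assume x: "x \<in> carrier_vec m"
  have "(A + B) *\<^sub>v x = A *\<^sub>v x + B *\<^sub>v x"
    using A B x by (rule add_mult_distrib_mat_vec)
  then have "vec_nrm ((A + B) *\<^sub>v x) \<le> vec_nrm (A *\<^sub>v x) + vec_nrm (B *\<^sub>v x)"
    using A B x by (auto intro!: vec_nrm_triangle[of _ n])
  then show "vec_nrm ((A + B) *\<^sub>v x) \<le> (a + b) * vec_nrm x"
    using nbD[OF a A x] nbD[OF b B x] by (simp add: algebra_simps)
qed (use A B in auto)

lemma smult_mat_vec: "A \<in> carrier_mat n m \<Longrightarrow> x \<in> carrier_vec m \<Longrightarrow>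
    (c \<cdot>\<^sub>m A) *\<^sub>v x = c \<cdot>\<^sub>v (A *\<^sub>v x)" for A :: "complex Matrix.mat"
  by (rule eq_vecI) (auto simp: scalar_prod_def sum_distrib_left mult.assoc)

lemma nb_smult:
  assumes A: "A \<in> carrier_mat n m" and a: "nb A a"
  shows "nb (c \<cdot>\<^sub>m A) (cmod c * a)"
proof (rule nbI)
  fix x :: "complex Matrix.vec" assume x: "x \<in> carrier_vec m"
  have "vec_nrm (A *\<^sub>v x) \<le> a * vec_nrm x" by (rule nbD[OF a A x])
  then show "vec_nrm ((c \<cdot>\<^sub>m A) *\<^sub>v x) \<le> cmod c * a * vec_nrm x"
    using A x by (subst smult_mat_vec) (auto simp: vec_nrm_smult[of _ n] mult.assoc intro: mult_left_mono)
qed (use A in auto)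

lemma nb_mult:
  assumes A: "A \<in> carrier_mat n m" and B: "B \<in> carrier_mat m k" and a: "nb A a" and b: "nb B b" and "0 \<le> a"
  shows "nb (A * B) (a * b)"
proof (rule nbI)
  fix x :: "complex Matrix.vec" assume x: "x \<in> carrier_vec k"
  have "(A * B) *\<^sub>v x = A *\<^sub>v (B *\<^sub>v x)" using A B x by (rule assoc_mult_mat_vec)
  then have "vec_nrm ((A * B) *\<^sub>v x) \<le> a * vec_nrm (B *\<^sub>v x)"
    using nbD[OF a A, of "B *\<^sub>v x"] B x by auto
  also have "\<dots> \<le> a * (b * vec_nrm x)"
    using nbD[OF b B x] \<open>0 \<le> a\<close> by (rule mult_left_mono)
  finally show "vec_nrm ((A * B) *\<^sub>v x) \<le> a * b * vec_nrm x" by (simp add: mult.assoc)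
qed (use A B in auto)

text \<open>For z = adjoint(A) y one has |z|^2 = <A z, y> <= a |z| |y| by Cauchy-Schwarz, and |z|
  cancels.\<close>

lemma nb_adj:
  assumes A: "A \<in> carrier_mat n m" and a: "nb A a" "0 \<le> a"
  shows "nb (mat_adjoint A) a"
proof (rule nbI)
  show "mat_adjoint A \<in> carrier_mat m n" using A by simp
  fix y :: "complex Matrix.vec" assume y: "y \<in> carrier_vec n"
  define z where "z = mat_adjoint A *\<^sub>v y"
  have z: "z \<in> carrier_vec m" using A y unfolding z_def by (metis adj_carrier mult_mat_vec_carrier)
  have Az: "A *\<^sub>v z \<in> carrier_vec n" using A z by simp
  have "z \<bullet>c (mat_adjoint A *\<^sub>v y) = (A *\<^sub>v z) \<bullet>c y"
    using adj_cscalar[OF A z y] by simp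
  then have "complex_of_real ((vec_nrm z)\<^sup>2) = (A *\<^sub>v z) \<bullet>c y"
    using vec_nrm_sq_cscalar[OF z] by (simp add: z_def)
  then have "(vec_nrm z)\<^sup>2 = cmod ((A *\<^sub>v z) \<bullet>c y)"
    by (metis abs_of_nonneg norm_of_real zero_le_power2)
  also have "\<dots> \<le> vec_nrm (A *\<^sub>v z) * vec_nrm y" by (rule cscalar_cauchy[OF Az y])
  also have "\<dots> \<le> a * vec_nrm z * vec_nrm y"
    using nbD[OF a(1) A z] by (intro mult_right_mono) auto
  finally have "vec_nrm z * vec_nrm z \<le> vec_nrm z * (a * vec_nrm y)"
    by (simp add: power2_eq_square mult_ac)
  then have "vec_nrm z \<le> a * vec_nrm y"
    using a(2) vec_nrm_nonneg[of z] by (cases "vec_nrm z = 0") (auto simp: mult_le_cancel_left)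
  then show "vec_nrm (mat_adjoint A *\<^sub>v y) \<le> a * vec_nrm y" by (simp add: z_def)
qed

text \<open>The squared Frobenius norm. As a sum over entries it reduces matrix estimates to
  counting rows.\<close>

definition frob2 :: "complex Matrix.mat \<Rightarrow> real" where
  "frob2 A = (\<Sum>i<dim_row A. \<Sum>j<dim_col A. (cmod (A $$ (i, j)))\<^sup>2)"

lemma frob2_nonneg [simp]: "0 \<le> frob2 A"
  by (auto simp: frob2_def intro!: sum_nonneg)

text \<open>Cauchy-Schwarz row by row. This bounds the set under the supremum in
  \<open>spectral_norm\<close>, without which the real-valued \<open>SUP\<close> carries no
  information.\<close>

lemma nb_frob: assumes A: "A \<in> carrier_mat n m" shows "nb A (sqrt (frob2 A))"
proof (rule nbI)
  fix x :: "complex Matrix.vec" assume x: "x \<in> carrier_vec m"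
  have Ax: "A *\<^sub>v x \<in> carrier_vec n" using A x by simp
  have "(vec_nrm (A *\<^sub>v x))\<^sup>2 = (\<Sum>i<n. (cmod (\<Sum>l<m. A $$ (i, l) * x $ l))\<^sup>2)"
    unfolding vec_nrm_sq[OF Ax] by (intro sum.cong refl) (simp add: index_mult_vec_sum[OF A x] del: index_mult_mat_vec)
  also have "\<dots> \<le> (\<Sum>i<n. (\<Sum>l<m. (cmod (A $$ (i, l)))\<^sup>2) * (vec_nrm x)\<^sup>2)"
  proof (intro sum_mono)
    fix i
    have "cmod (\<Sum>l<m. A $$ (i, l) * x $ l) \<le> (\<Sum>l<m. \<bar>cmod (A $$ (i, l))\<bar> * \<bar>cmod (x $ l)\<bar>)"
      by (rule order_trans[OF norm_sum]) (simp add: norm_mult)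
    also have "\<dots> \<le> L2_set (\<lambda>l. cmod (A $$ (i, l))) {..<m} * vec_nrm x"
      unfolding vec_nrm_L2[OF x] by (rule L2_set_mult_ineq)
    finally have "(cmod (\<Sum>l<m. A $$ (i, l) * x $ l))\<^sup>2 \<le> (L2_set (\<lambda>l. cmod (A $$ (i, l))) {..<m} * vec_nrm x)\<^sup>2"
      by (intro power_mono) auto
    also have "\<dots> = (\<Sum>l<m. (cmod (A $$ (i, l)))\<^sup>2) * (vec_nrm x)\<^sup>2"
      by (simp add: power_mult_distrib L2_set_def sum_nonneg)
    finally show "(cmod (\<Sum>l<m. A $$ (i, l) * x $ l))\<^sup>2 \<le> (\<Sum>l<m. (cmod (A $$ (i, l)))\<^sup>2) * (vec_nrm x)\<^sup>2" .
  qed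
  also have "\<dots> = (sqrt (frob2 A) * vec_nrm x)\<^sup>2"
    using A by (simp add: frob2_def sum_distrib_right power_mult_distrib sum_nonneg)
  finally show "vec_nrm (A *\<^sub>v x) \<le> sqrt (frob2 A) * vec_nrm x"
    by (rule power2_le_imp_le) auto
qed (use A in auto)

lemma spectral_norm_le_iff:
  assumes "0 \<le> c"
  shows "spectral_norm A \<le> c \<longleftrightarrow> nb A c"
proof -
  let ?B = "{x \<in> carrier_vec (dim_col A). vec_nrm x \<le> 1}"
  define n m where "n = dim_row A" and "m = dim_col A"
  have A: "A \<in> carrier_mat n m" by (simp add: n_def m_def)
  have ne: "?B \<noteq> {}" by (rule ex_in_conv[THEN iffD1], rule exI[of _ "0\<^sub>v (dim_col A)"]) simp
  have bdd: "bdd_above ((\<lambda>x. vec_nrm (A *\<^sub>v x)) ` ?B)"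
  proof (rule bdd_aboveI2)
    fix x assume x: "x \<in> ?B"
    then have "vec_nrm (A *\<^sub>v x) \<le> sqrt (frob2 A) * vec_nrm x"
      by (intro nbD[OF nb_frob[OF A] A]) (simp add: m_def)
    also have "\<dots> \<le> sqrt (frob2 A) * 1"
      using x by (intro mult_left_mono) auto
    finally show "vec_nrm (A *\<^sub>v x) \<le> sqrt (frob2 A)" by simp
  qed
  have "spectral_norm A \<le> c \<longleftrightarrow> (\<forall>x\<in>?B. vec_nrm (A *\<^sub>v x) \<le> c)"
    unfolding spectral_norm_def by (rule cSUP_le_iff[OF ne bdd])
  also have "\<dots> \<longleftrightarrow> nb A c"
  proof
    assume L: "\<forall>x\<in>?B. vec_nrm (A *\<^sub>v x) \<le> c"
    show "nb A c"
    proof (rule nbI[OF A])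
      fix x :: "complex Matrix.vec" assume x: "x \<in> carrier_vec m"
      show "vec_nrm (A *\<^sub>v x) \<le> c * vec_nrm x"
      proof (cases "vec_nrm x = 0")
        case True
        then have "x = 0\<^sub>v m" using vec_nrm_eq_0[OF x] by simp
        then show ?thesis using A by (simp add: mat_mult_zero_vec)
      next
        case False
        \<comment> \<open>The supremum ranges over the unit ball only, so \<open>x\<close> is
          rescaled to norm 1.\<close>
        define t where "t = complex_of_real (1 / vec_nrm x)"
        have tn: "cmod t = 1 / vec_nrm x" unfolding t_def norm_of_real by simp
        have y: "t \<cdot>\<^sub>v x \<in> ?B"
          using x False by (simp add: vec_nrm_smult[OF x] tn m_def)
        have "A *\<^sub>v (t \<cdot>\<^sub>v x) = t \<cdot>\<^sub>v (A *\<^sub>v x)" using A x by (rule mult_mat_vec)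
        then have "cmod t * vec_nrm (A *\<^sub>v x) \<le> c"
          using bspec[OF L y] A x by (simp add: vec_nrm_smult[of _ n])
        then show ?thesis using False vec_nrm_nonneg[of x] by (simp add: tn field_simps order_less_le)
      qed
    qed
  next
    assume R: "nb A c"
    show "\<forall>x\<in>?B. vec_nrm (A *\<^sub>v x) \<le> c"
    proof
      fix x assume x: "x \<in> ?B"
      then have "vec_nrm (A *\<^sub>v x) \<le> c * vec_nrm x"
        by (intro nbD[OF R A]) (simp add: m_def)
      also have "\<dots> \<le> c * 1" using x assms by (intro mult_left_mono) auto
      finally show "vec_nrm (A *\<^sub>v x) \<le> c" by simp
    qed
  qed
  finally show ?thesis .
qed

text \<open>The maximum provides the sign condition of \<open>spectral_norm_le_iff\<close>: the
  bounds \<open>\<omega> m\<close> in \<open>acs\<close> come without a sign.\<close>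

lemma nb_spectral_norm: "spectral_norm A \<le> c \<Longrightarrow> nb A (max c 0)"
  by (subst spectral_norm_le_iff[symmetric]) auto

section \<open>Rank in terms of outer products\<close>

text \<open>Rank at most \<open>r\<close>, witnessed by \<open>r\<close> outer products. On
  witnesses, sums, products and adjoints are computations with finite sums;
  \<open>lowrank_imp_mat_rank\<close> and \<open>mat_rank_imp_lowrank\<close> give the link to the
  dimension-based \<open>mat_rank\<close>.\<close>

definition lowrank :: "nat \<Rightarrow> complex Matrix.mat \<Rightarrow> bool" where
  "lowrank r X \<longleftrightarrow> (\<exists>u v. \<forall>i<dim_row X. \<forall>j<dim_col X. X $$ (i, j) = (\<Sum>k<r. u k i * v k j))"

lemma lowrank_add:
  assumes A: "A \<in> carrier_mat n m" and B: "B \<in> carrier_mat n m" and "lowrank r A" "lowrank s B"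
  shows "lowrank (r + s) (A + B)"
proof -
  obtain u v where uv: "\<forall>i<dim_row A. \<forall>j<dim_col A. A $$ (i, j) = (\<Sum>k<r. u k i * v k j)"
    using assms(3) unfolding lowrank_def by blast
  obtain u' v' where uv': "\<forall>i<dim_row B. \<forall>j<dim_col B. B $$ (i, j) = (\<Sum>k<s. u' k i * v' k j)"
    using assms(4) unfolding lowrank_def by blast
  have sp: "(\<Sum>k<r + s. g k) = (\<Sum>k<r. g k) + (\<Sum>k<s. g (r + k))" for g :: "nat \<Rightarrow> complex"
    by (induction s) (auto simp: add.assoc)
  show ?thesis unfolding lowrank_def
    using A B by (intro exI[of _ "\<lambda>k. if k < r then u k else u' (k - r)"] exI[of _ "\<lambda>k. if k < r then v k else v' (k - r)"])
      (use uv uv' in \<open>auto simp: sp\<close>)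
qed

lemma lowrank_mult_left:
  assumes A: "A \<in> carrier_mat n m" and B: "B \<in> carrier_mat m k" and "lowrank r B"
  shows "lowrank r (A * B)"
proof -
  obtain u v where uv: "\<And>i j. i < m \<Longrightarrow> j < k \<Longrightarrow> B $$ (i, j) = (\<Sum>l<r. u l i * v l j)"
    using assms unfolding lowrank_def by auto
  have "(A * B) $$ (i, j) = (\<Sum>l<r. (\<Sum>p<m. A $$ (i, p) * u l p) * v l j)" if "i < n" "j < k" for i j
  proof -
    have "(A * B) $$ (i, j) = (\<Sum>p<m. \<Sum>l<r. A $$ (i, p) * (u l p * v l j))"
      unfolding index_mult_sum[OF A B that] using that by (simp add: uv sum_distrib_left)
    also have "\<dots> = (\<Sum>l<r. \<Sum>p<m. A $$ (i, p) * (u l p * v l j))" by (rule sum.swap)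
    finally show ?thesis by (simp add: sum_distrib_right mult.assoc)
  qed
  then show ?thesis unfolding lowrank_def using A B
    by (intro exI[of _ "\<lambda>l i. \<Sum>p<m. A $$ (i, p) * u l p"] exI[of _ v]) auto
qed

lemma lowrank_adj: "lowrank r A \<Longrightarrow> lowrank r (mat_adjoint A)"
proof -
  assume "lowrank r A"
  then obtain u v where "\<forall>i<dim_row A. \<forall>j<dim_col A. A $$ (i, j) = (\<Sum>k<r. u k i * v k j)"
    unfolding lowrank_def by auto
  then show ?thesis unfolding lowrank_def
    by (intro exI[of _ "\<lambda>k i. cnj (v k i)"] exI[of _ "\<lambda>k i. cnj (u k i)"]) (auto simp: mult.commute)
qed

lemma lowrank_smult: "lowrank r A \<Longrightarrow> lowrank r (c \<cdot>\<^sub>m A)"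
proof -
  assume "lowrank r A"
  then obtain u v where "\<forall>i<dim_row A. \<forall>j<dim_col A. A $$ (i, j) = (\<Sum>k<r. u k i * v k j)"
    unfolding lowrank_def by auto
  then show ?thesis unfolding lowrank_def
    by (intro exI[of _ "\<lambda>k i. c * u k i"] exI[of _ v]) (auto simp: sum_distrib_left mult.assoc)
qed

lemma lowrank_zero: "lowrank 0 (0\<^sub>m n m)"
  by (auto simp: lowrank_def)

lemma lowrank_full: "lowrank (dim_row X) X"
  unfolding lowrank_def
  by (rule exI[of _ "\<lambda>k i. if k = i then 1 else 0"], rule exI[of _ "\<lambda>k j. X $$ (k, j)"])
    (auto simp: if_distrib[of "\<lambda>x. x * _"] cong: if_cong)

text \<open>Outer products have rank at most one and are split off one at a time by subadditivity of
  the rank.\<close>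

lemma lowrank_imp_mat_rank:
  assumes "X \<in> carrier_mat n m" "lowrank r X"
  shows "mat_rank X \<le> r"
  using assms
proof (induction r arbitrary: X)
  case 0
  interpret V: vec_space "TYPE(complex)" n .
  have "X = 0\<^sub>m n m" using 0 by (intro eq_matI) (auto simp: lowrank_def)
  then show ?case using V.rank_0I by (auto simp: mat_rank_def)
next
  case (Suc r)
  interpret V: vec_space "TYPE(complex)" n .
  obtain u v where uv: "\<And>i j. i < n \<Longrightarrow> j < m \<Longrightarrow> X $$ (i, j) = (\<Sum>k<Suc r. u k i * v k j)"
    using Suc.prems unfolding lowrank_def by auto
  define Y where "Y = Matrix.mat n m (\<lambda>(i, j). \<Sum>k<r. u k i * v k j)"
  define Z where "Z = Matrix.mat n m (\<lambda>(i, j). u r i * v r j)"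
  have Y: "Y \<in> carrier_mat n m" and Z: "Z \<in> carrier_mat n m" by (auto simp: Y_def Z_def)
  have X: "X = Y + Z" using Suc.prems by (intro eq_matI) (auto simp: Y_def Z_def uv)
  have "lowrank r Y" unfolding lowrank_def by (rule exI[of _ u], rule exI[of _ v]) (auto simp: Y_def)
  then have "mat_rank Y \<le> r" using Suc.IH Y by blast
  moreover have "V.rank Z \<le> 1"
    by (rule V.rank_le_1_product_entries[OF Z, of "u r" "v r"]) (auto simp: Z_def)
  moreover have "V.rank X \<le> V.rank Y + V.rank Z" unfolding X by (rule V.rank_subadditive[OF Y Z])
  ultimately show ?case using Y Suc.prems(1) by (auto simp: mat_rank_def)
qed

text \<open>A maximal independent set of columns spans the remaining ones; its members and the
  coordinates with respect to it are the two factors.\<close>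

lemma mat_rank_imp_lowrank:
  assumes X: "X \<in> carrier_mat n m"
  shows "lowrank (mat_rank X) X"
proof -
  interpret V: vec_space "TYPE(complex)" n .
  let ?P = "\<lambda>T. T \<subseteq> set (cols X) \<and> V.lin_indpt T"
  have cX: "set (cols X) \<subseteq> carrier_vec n" using X cols_dim by blast
  have e: "?P {}" unfolding V.lin_dep_def by blast
  obtain S where S: "finite S" "maximal S ?P"
    using maximal_exists_superset[of "set (cols X)" ?P "{}"] e by auto
  have SX: "S \<subseteq> set (cols X)" and li: "V.lin_indpt S" using S(2) by (auto simp: maximal_def)
  then have Sc: "S \<subseteq> carrier_vec n" using cX by auto
  have r: "mat_rank X = card S" using V.rank_card_indpt[OF X S(2)] X by (auto simp: mat_rank_def)
  have span: "col X j \<in> V.span S" if "j < m" for j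
  proof (cases "col X j \<in> S")
    case True then show ?thesis using V.span_mem[OF Sc] by blast
  next
    case False
    have c: "col X j \<in> set (cols X)" using that X by (auto simp: cols_def)
    have "\<not> ?P (insert (col X j) S)" using S(2) False unfolding maximal_def by blast
    then have "V.lin_dep (insert (col X j) S)" using c SX by auto
    then show ?thesis using V.lin_dep_iff_in_span[OF _ li, of "col X j"] Sc c cX False by auto
  qed
  obtain b where b: "bij_betw b {..<card S} S"
    using ex_bij_betw_nat_finite[OF S(1)] unfolding lessThan_atLeast0 by blast
  have "\<exists>a. \<forall>i<n. X $$ (i, j) = (\<Sum>k<card S. b k $ i * a k)" if j: "j < m" for j
  proof -
    have "\<exists>a. V.lincomb a S = col X j"
      using span[OF j] V.finite_in_span[OF S(1), of "col X j"] Sc by auto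
    then obtain a where a: "col X j = V.lincomb a S" by metis
    have "X $$ (i, j) = (\<Sum>k<card S. b k $ i * a (b k))" if i: "i < n" for i
    proof -
      have "X $$ (i, j) = col X j $ i" using X i j by auto
      also have "\<dots> = (\<Sum>x\<in>S. a x * x $ i)" unfolding a by (rule V.lincomb_index[OF i Sc])
      also have "\<dots> = (\<Sum>k<card S. a (b k) * b k $ i)" using sum.reindex_bij_betw[OF b, of "\<lambda>x. a x * x $ i"] by simp
      finally show ?thesis by (simp add: mult.commute)
    qed
    then show ?thesis by (intro exI[of _ "\<lambda>k. a (b k)"]) blast
  qed
  then have "\<forall>j\<in>{..<m}. \<exists>a. \<forall>i<n. X $$ (i, j) = (\<Sum>k<card S. b k $ i * a k)" by auto
  from bchoice[OF this] obtain a where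
    "\<forall>j\<in>{..<m}. \<forall>i<n. X $$ (i, j) = (\<Sum>k<card S. b k $ i * a j k)" by blast
  then show ?thesis unfolding lowrank_def r using X
    by (intro exI[of _ "\<lambda>k i. b k $ i"] exI[of _ "\<lambda>k j. a j k"]) auto
qed

text \<open>The conditions are padded with zero rows to a square matrix. Since \<open>k < d\<close>,
  its last row is zero, so expanding the determinant along that row gives 0.\<close>

lemma exists_orthogonal_vec:
  fixes w :: "nat \<Rightarrow> nat \<Rightarrow> complex"
  assumes "k < d"
  shows "\<exists>x\<in>carrier_vec d. x \<noteq> 0\<^sub>v d \<and> (\<forall>i<k. (\<Sum>j<d. w i j * x $ j) = 0)"
proof -
  define M where "M = Matrix.mat d d (\<lambda>(i, j). if i < k then w i j else 0)"
  have M: "M \<in> carrier_mat d d" by (simp add: M_def)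
  have "Determinant.det M = (\<Sum>j<d. M $$ (d - 1, j) * cofactor M (d - 1) j)"
    using assms by (intro laplace_expansion_row[OF M]) auto
  also have "\<dots> = 0" using assms by (intro sum.neutral) (auto simp: M_def)
  finally obtain x where x: "x \<in> carrier_vec d" "x \<noteq> 0\<^sub>v d" "M *\<^sub>v x = 0\<^sub>v d"
    using det_0_iff_vec_prod_zero[OF M] by auto
  have "(\<Sum>j<d. w i j * x $ j) = 0" if "i < k" for i
  proof -
    have "i < d" using that assms by simp
    then have "(\<Sum>j<d. w i j * x $ j) = (M *\<^sub>v x) $ i"
      using index_mult_vec_sum[OF M x(1), of i] that by (simp add: M_def del: index_mult_mat_vec)
    also have "\<dots> = 0" using x(3) \<open>i < d\<close> by simp
    finally show ?thesis .
  qed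
  then show ?thesis using x by blast
qed

section \<open>Unitary diagonalization\<close>

definition unitary :: "nat \<Rightarrow> complex Matrix.mat \<Rightarrow> bool" where
  "unitary d U \<longleftrightarrow> U \<in> carrier_mat d d \<and> mat_adjoint U * U = 1\<^sub>m d \<and> U * mat_adjoint U = 1\<^sub>m d"

lemma unitaryI: "U \<in> carrier_mat d d \<Longrightarrow> mat_adjoint U * U = 1\<^sub>m d \<Longrightarrow> unitary d U"
  unfolding unitary_def using mat_mult_left_right_inverse[of "mat_adjoint U" d U] by auto

lemma unitaryD: assumes "unitary d U"
  shows "U \<in> carrier_mat d d" "mat_adjoint U \<in> carrier_mat d d" "mat_adjoint U * U = 1\<^sub>m d" "U * mat_adjoint U = 1\<^sub>m d"
  using assms by (auto simp: unitary_def)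

lemma unitary_adj: "unitary d U \<Longrightarrow> unitary d (mat_adjoint U)"
  by (auto simp: unitary_def)

lemma unitary_mult:
  assumes "unitary d U" "unitary d V" shows "unitary d (U * V)"
proof (rule unitaryI)
  note U = unitaryD[OF assms(1)] and V = unitaryD[OF assms(2)]
  show "U * V \<in> carrier_mat d d" using U V by auto
  have "mat_adjoint (U * V) * (U * V) = mat_adjoint V * (mat_adjoint U * (U * V))"
    unfolding adj_mult[OF U(1) V(1)] using U V by (intro assoc_mult_mat) auto
  also have "mat_adjoint U * (U * V) = mat_adjoint U * U * V" using U V by (intro assoc_mult_mat[symmetric]) auto
  also have "\<dots> = V" unfolding U(3) using V by auto
  finally show "mat_adjoint (U * V) * (U * V) = 1\<^sub>m d" using V by simp
qed

lemma unitary_vec_nrm: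
  assumes U: "unitary d U" and x: "x \<in> carrier_vec d"
  shows "vec_nrm (U *\<^sub>v x) = vec_nrm x"
proof -
  note U = unitaryD[OF U]
  have Ux: "U *\<^sub>v x \<in> carrier_vec d" using U x by auto
  have "complex_of_real ((vec_nrm (U *\<^sub>v x))\<^sup>2) = (U *\<^sub>v x) \<bullet>c (U *\<^sub>v x)"
    using vec_nrm_sq_cscalar[OF Ux] by simp
  also have "\<dots> = x \<bullet>c (mat_adjoint U *\<^sub>v (U *\<^sub>v x))" by (rule adj_cscalar[OF U(1) x Ux])
  also have "mat_adjoint U *\<^sub>v (U *\<^sub>v x) = (mat_adjoint U * U) *\<^sub>v x"
    using U x by (intro assoc_mult_mat_vec[symmetric]) auto
  also have "\<dots> = x" unfolding U(3) using x by simp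
  also have "x \<bullet>c x = complex_of_real ((vec_nrm x)\<^sup>2)" by (rule vec_nrm_sq_cscalar[OF x])
  finally have "(vec_nrm (U *\<^sub>v x))\<^sup>2 = (vec_nrm x)\<^sup>2" by (simp only: of_real_eq_iff)
  then show ?thesis by (simp add: power2_eq_iff_nonneg)
qed

text \<open>Complete \<open>v\<close> to a basis and orthogonalize. This Gram-Schmidt keeps the
  first vector and does not normalize, so the columns are divided by their lengths and the first one
  stays a multiple of \<open>v\<close>.\<close>

lemma unitary_completion:
  assumes v: "v \<in> carrier_vec n" and v0: "v \<noteq> 0\<^sub>v n" and n: "0 < n"
  shows "\<exists>U c. unitary n U \<and> col U 0 = c \<cdot>\<^sub>v (v :: complex Matrix.vec)"
proof -
  interpret cof_vec_space n "TYPE(complex)" .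
  define b where "b = basis_completion v"
  from basis_completion[OF v v0, folded b_def]
  have dist_b: "distinct b" and indep: "\<not> lin_dep (set b)" and b: "set b \<subseteq> carrier_vec n"
    and hdb: "hd b = v" and len_b: "length b = n" by auto
  define ws where "ws = gram_schmidt n b"
  from hdb len_b n obtain vs where bv: "b = v # vs" by (cases b, auto)
  from gram_schmidt_result[OF b dist_b indep refl, folded ws_def]
  have ws: "set ws \<subseteq> carrier_vec n" "corthogonal ws" "length ws = n" by (auto simp: len_b)
  from gram_schmidt_hd[OF v, of vs, folded bv] have hdws: "hd ws = v" unfolding ws_def .
  have w0: "ws ! 0 = v" using hdws ws(3) n by (cases ws) auto
  have wc: "ws ! i \<in> carrier_vec n" if "i < n" for i using ws(1,3) that by (auto intro: nth_mem)
  have orth: "(\<Sum>l<n. ws ! i $ l * cnj (ws ! j $ l)) = 0 \<longleftrightarrow> i \<noteq> j" if "i < n" "j < n" for i j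
    using corthogonalD[OF ws(2), of i j] that ws(3) by (simp add: cscalar_sum[OF wc wc])
  define t where "t i = vec_nrm (ws ! i)" for i
  have t2: "complex_of_real (t i) * complex_of_real (t i) = (\<Sum>l<n. ws ! i $ l * cnj (ws ! i $ l))" if "i < n" for i
    using vec_nrm_sq_cscalar[OF wc[OF that]] cscalar_sum[OF wc[OF that] wc[OF that]]
    by (simp add: t_def power2_eq_square)
  have t0: "t i \<noteq> 0" if "i < n" for i
    using t2[OF that] orth[OF that that] by auto
  define U where "U = Matrix.mat n n (\<lambda>(l, i). ws ! i $ l / complex_of_real (t i))"
  have U: "U \<in> carrier_mat n n" by (simp add: U_def)
  have "mat_adjoint U * U = 1\<^sub>m n"
  proof (rule eq_matI)
    fix i j assume "i < dim_row (1\<^sub>m n :: complex Matrix.mat)" "j < dim_col (1\<^sub>m n :: complex Matrix.mat)"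
    then have ij: "i < n" "j < n" by auto
    have "(mat_adjoint U * U) $$ (i, j) = (\<Sum>l<n. ws ! j $ l * cnj (ws ! i $ l)) / (complex_of_real (t i) * complex_of_real (t j))"
      using ij U by (subst index_mult_sum[of _ n n _ n]) (auto simp: U_def sum_divide_distrib mult.commute)
    also have "\<dots> = 1\<^sub>m n $$ (i, j)"
      using orth[OF ij(2,1)] ij t0[OF ij(1)] by (cases "i = j") (auto simp: t2[symmetric])
    finally show "(mat_adjoint U * U) $$ (i, j) = 1\<^sub>m n $$ (i, j)" .
  qed (use U in auto)
  then have "unitary n U" by (rule unitaryI[OF U])
  moreover have "col U 0 = (1 / complex_of_real (t 0)) \<cdot>\<^sub>v v"
    using n v by (intro eq_vecI) (auto simp: U_def w0)
  ultimately show ?thesis by blast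
qed

text \<open>The matrix U diag(f) adjoint(U), see \<open>spec_eq\<close>. With \<open>U\<close> fixed
  and \<open>f\<close> varying this is a functional calculus: sums, products, adjoints and inverses
  act on the eigenvalues alone.\<close>

definition spec :: "nat \<Rightarrow> complex Matrix.mat \<Rightarrow> (nat \<Rightarrow> complex) \<Rightarrow> complex Matrix.mat" where
  "spec d U f = Matrix.mat d d (\<lambda>(i, j). \<Sum>l<d. U $$ (i, l) * f l * cnj (U $$ (j, l)))"

definition diagm :: "nat \<Rightarrow> (nat \<Rightarrow> complex) \<Rightarrow> complex Matrix.mat" where
  "diagm d f = Matrix.mat d d (\<lambda>(i, j). if i = j then f i else 0)"

lemma spec_carrier [simp]: "spec d U f \<in> carrier_mat d d" "diagm d f \<in> carrier_mat d d"
  "dim_row (spec d U f) = d" "dim_col (spec d U f) = d" "dim_row (diagm d f) = d" "dim_col (diagm d f) = d"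
  by (auto simp: spec_def diagm_def)

lemma mult_diagm_index:
  assumes "U \<in> carrier_mat d d" "i < d" "l < d"
  shows "(U * diagm d f) $$ (i, l) = U $$ (i, l) * f l"
proof -
  have "(U * diagm d f) $$ (i, l) = (\<Sum>k<d. U $$ (i, k) * (if k = l then f k else 0))"
    using assms by (subst index_mult_sum[of _ d d _ d]) (auto simp: diagm_def)
  also have "\<dots> = U $$ (i, l) * f l"
    using assms by (simp add: if_distrib[of "\<lambda>x. _ * x"] sum.delta cong: if_cong)
  finally show ?thesis .
qed

lemma spec_eq: "U \<in> carrier_mat d d \<Longrightarrow> spec d U f = U * diagm d f * mat_adjoint U"
  by (rule eq_matI)
    (auto simp: spec_def index_mult_sum[of "U * diagm d f" d d "mat_adjoint U" d] mult_diagm_index simp del: index_mult_mat(1))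

lemma diagm_mult: "diagm d f * diagm d g = diagm d (\<lambda>i. f i * g i)"
  by (rule eq_matI) (auto simp: mult_diagm_index[of _ d] simp del: index_mult_mat(1), auto simp: diagm_def)

lemma spec_mult:
  assumes U: "unitary d U" shows "spec d U f * spec d U g = spec d U (\<lambda>i. f i * g i)"
proof -
  note U = unitaryD[OF U]
  let ?A = "mat_adjoint U"
  have "spec d U f * spec d U g = U * diagm d f * ?A * (U * diagm d g * ?A)"
    using U by (simp add: spec_eq)
  also have "\<dots> = U * diagm d f * (?A * (U * diagm d g * ?A))"
    using U by (intro assoc_mult_mat) auto
  also have "U * diagm d g * ?A = U * (diagm d g * ?A)" using U by (intro assoc_mult_mat) auto
  also have "?A * (U * (diagm d g * ?A)) = ?A * U * (diagm d g * ?A)" using U by (intro assoc_mult_mat[symmetric]) auto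
  also have "\<dots> = diagm d g * ?A" unfolding U(3) using U by (intro left_mult_one_mat) auto
  also have "U * diagm d f * (diagm d g * ?A) = U * diagm d f * diagm d g * ?A"
    using U by (intro assoc_mult_mat[symmetric]) auto
  also have "U * diagm d f * diagm d g = U * (diagm d f * diagm d g)" using U by (intro assoc_mult_mat) auto
  finally show ?thesis using U by (simp add: spec_eq diagm_mult)
qed

lemma spec_one: "unitary d U \<Longrightarrow> spec d U (\<lambda>_. 1) = 1\<^sub>m d"
proof -
  assume U: "unitary d U"
  have "diagm d (\<lambda>_. 1) = 1\<^sub>m d" by (rule eq_matI) (auto simp: diagm_def)
  then show ?thesis using unitaryD[OF U] by (simp add: spec_eq)
qed

lemma spec_adj: "mat_adjoint (spec d U f) = spec d U (\<lambda>i. cnj (f i))"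
  by (rule eq_matI) (auto simp: spec_def mult_ac intro!: sum.cong)

lemma spec_add: "spec d U f + spec d U g = spec d U (\<lambda>i. f i + g i)"
  by (rule eq_matI) (auto simp: spec_def algebra_simps sum.distrib)

lemma spec_smult: "c \<cdot>\<^sub>m spec d U f = spec d U (\<lambda>i. c * f i)"
  by (rule eq_matI) (auto simp: spec_def sum_distrib_left mult_ac intro!: sum.cong)

lemma spec_cong: "(\<And>i. i < d \<Longrightarrow> f i = g i) \<Longrightarrow> spec d U f = spec d U g"
  by (rule eq_matI) (auto simp: spec_def)

lemma spec_mult_vec:
  assumes U: "U \<in> carrier_mat d d" and x: "x \<in> carrier_vec d"
  shows "spec d U f *\<^sub>v x = U *\<^sub>v Matrix.vec d (\<lambda>i. f i * (mat_adjoint U *\<^sub>v x) $ i)"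
proof -
  have D: "diagm d f *\<^sub>v y = Matrix.vec d (\<lambda>i. f i * y $ i)" if "y \<in> carrier_vec d" for y
  proof (rule eq_vecI)
    fix i assume "i < dim_vec (Matrix.vec d (\<lambda>i. f i * y $ i))"
    then show "(diagm d f *\<^sub>v y) $ i = Matrix.vec d (\<lambda>i. f i * y $ i) $ i"
      using that index_mult_vec_sum[of "diagm d f" d d y i]
      by (simp add: diagm_def if_distrib[of "\<lambda>x. x * _"] sum.delta' cong: if_cong del: index_mult_mat_vec)
  qed auto
  have ax: "mat_adjoint U *\<^sub>v x \<in> carrier_vec d" by (rule mult_mat_vec_carrier[OF adj_carrier[OF U] x])
  have "spec d U f *\<^sub>v x = U * diagm d f *\<^sub>v (mat_adjoint U *\<^sub>v x)"
    unfolding spec_eq[OF U] using U x by (intro assoc_mult_mat_vec) auto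
  also have "\<dots> = U *\<^sub>v (diagm d f *\<^sub>v (mat_adjoint U *\<^sub>v x))"
    using U ax by (intro assoc_mult_mat_vec) auto
  finally show ?thesis using D[OF ax] by simp
qed

lemma spec_nb:
  assumes U: "unitary d U" and f: "\<And>i. i < d \<Longrightarrow> cmod (f i) \<le> c" and "0 \<le> c"
  shows "nb (spec d U f) c"
proof (rule nbI[OF spec_carrier(1)])
  fix x :: "complex Matrix.vec" assume x: "x \<in> carrier_vec d"
  let ?y = "mat_adjoint U *\<^sub>v x"
  have y: "?y \<in> carrier_vec d" by (rule mult_mat_vec_carrier[OF unitaryD(2)[OF U] x])
  have "vec_nrm (spec d U f *\<^sub>v x) = vec_nrm (Matrix.vec d (\<lambda>i. f i * ?y $ i))"
    using spec_mult_vec[OF unitaryD(1)[OF U] x] unitary_vec_nrm[OF U] by simp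
  also have "\<dots> \<le> c * vec_nrm ?y"
  proof (rule power2_le_imp_le)
    have "(vec_nrm (Matrix.vec d (\<lambda>i. f i * ?y $ i)))\<^sup>2 = (\<Sum>i<d. (cmod (f i * ?y $ i))\<^sup>2)"
      by (subst vec_nrm_sq[of _ d]) (auto intro!: sum.cong simp del: index_mult_mat_vec)
    also have "\<dots> \<le> (\<Sum>i<d. c\<^sup>2 * (cmod (?y $ i))\<^sup>2)"
      unfolding norm_mult power_mult_distrib by (intro sum_mono mult_right_mono power_mono f) auto
    also have "\<dots> = (c * vec_nrm ?y)\<^sup>2" by (simp only: vec_nrm_sq[OF y] power_mult_distrib sum_distrib_left)
    finally show "(vec_nrm (Matrix.vec d (\<lambda>i. f i * ?y $ i)))\<^sup>2 \<le> (c * vec_nrm ?y)\<^sup>2" .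
  qed (use assms in auto)
  also have "vec_nrm ?y = vec_nrm x" by (rule unitary_vec_nrm[OF unitary_adj[OF U] x])
  finally show "vec_nrm (spec d U f *\<^sub>v x) \<le> c * vec_nrm x" .
qed

lemma spec_quad:
  assumes U: "unitary d U" and x: "x \<in> carrier_vec d"
  shows "(spec d U f *\<^sub>v x) \<bullet>c x = (\<Sum>i<d. f i * complex_of_real ((cmod ((mat_adjoint U *\<^sub>v x) $ i))\<^sup>2))"
proof -
  let ?y = "mat_adjoint U *\<^sub>v x"
  have y: "?y \<in> carrier_vec d" by (rule mult_mat_vec_carrier[OF unitaryD(2)[OF U] x])
  have "(spec d U f *\<^sub>v x) \<bullet>c x = Matrix.vec d (\<lambda>i. f i * ?y $ i) \<bullet>c ?y"
    unfolding spec_mult_vec[OF unitaryD(1)[OF U] x] by (rule adj_cscalar[OF unitaryD(1)[OF U] _ x]) simp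
  also have "\<dots> = (\<Sum>i<d. f i * complex_of_real ((cmod (?y $ i))\<^sup>2))"
    using y by (subst cscalar_sum[of _ d])
      (auto intro!: sum.cong simp: mult.assoc complex_mult_cnj cmod_power2 simp del: index_mult_mat_vec)
  finally show ?thesis .
qed

lemma spec_lowrank:
  assumes "S \<subseteq> {..<d}" and "\<And>i. i < d \<Longrightarrow> i \<notin> S \<Longrightarrow> f i = 0"
  shows "lowrank (card S) (spec d U f)"
proof -
  have fin: "finite S" using assms(1) finite_subset by blast
  obtain b where b: "bij_betw b {..<card S} S"
    using ex_bij_betw_nat_finite[OF fin] unfolding lessThan_atLeast0 by blast
  have "(\<Sum>l<d. U $$ (i, l) * f l * cnj (U $$ (j, l))) = (\<Sum>k<card S. U $$ (i, b k) * f (b k) * cnj (U $$ (j, b k)))" for i j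
  proof -
    have "(\<Sum>l<d. U $$ (i, l) * f l * cnj (U $$ (j, l))) = (\<Sum>l\<in>S. U $$ (i, l) * f l * cnj (U $$ (j, l)))"
      using assms by (intro sum.mono_neutral_right) auto
    also have "\<dots> = (\<Sum>k<card S. U $$ (i, b k) * f (b k) * cnj (U $$ (j, b k)))"
      by (rule sum.reindex_bij_betw[OF b, symmetric])
    finally show ?thesis .
  qed
  then show ?thesis unfolding lowrank_def
    by (intro exI[of _ "\<lambda>k i. U $$ (i, b k) * f (b k)"] exI[of _ "\<lambda>k j. cnj (U $$ (j, b k))"])
      (auto simp: spec_def)
qed

definition mtrace :: "complex Matrix.mat \<Rightarrow> complex" where
  "mtrace A = (\<Sum>i<dim_row A. A $$ (i, i))"

lemma spec_trace:
  assumes U: "unitary d U" shows "mtrace (spec d U f) = (\<Sum>i<d. f i)"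
proof -
  note U = unitaryD[OF U]
  have "mtrace (spec d U f) = (\<Sum>i<d. \<Sum>l<d. U $$ (i, l) * f l * cnj (U $$ (i, l)))"
    by (auto simp: mtrace_def spec_def)
  also have "\<dots> = (\<Sum>l<d. \<Sum>i<d. U $$ (i, l) * f l * cnj (U $$ (i, l)))" by (rule sum.swap)
  also have "\<dots> = (\<Sum>l<d. f l * (mat_adjoint U * U) $$ (l, l))"
    using U by (intro sum.cong refl, subst index_mult_sum[of _ d d _ d]) (auto simp: sum_distrib_left mult_ac)
  also have "\<dots> = (\<Sum>i<d. f i)" unfolding U(3) by (intro sum.cong) auto
  finally show ?thesis .
qed

lemma spec_proots:
  assumes U: "unitary d U" shows "proots (char_poly (spec d U f)) = mset (map f [0..<d])"
proof -
  note U = unitaryD[OF U]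
  have "similar_mat_wit (spec d U f) (diagm d f) U (mat_adjoint U)"
    unfolding spec_eq[OF U(1)] using U by (intro similar_mat_witI[of _ _ d]) auto
  then have "char_poly (spec d U f) = char_poly (diagm d f)"
    by (intro char_poly_similar) (auto simp: similar_mat_def)
  also have "\<dots> = (\<Prod>a\<leftarrow>diag_mat (diagm d f). [:- a, 1:])"
    by (rule char_poly_upper_triangular[of _ d]) (auto simp: diagm_def)
  also have "diag_mat (diagm d f) = map f [0..<d]" by (auto simp: diag_mat_def diagm_def)
  finally have "char_poly (spec d U f) = (\<Prod>a\<leftarrow>map f [0..<d]. [:- a, 1:])" .
  moreover have "proots (\<Prod>a\<leftarrow>xs. [:- a, 1:]) = mset xs" for xs :: "complex list"
  proof (induction xs)
    case (Cons a xs)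
    have nz: "(\<Prod>a\<leftarrow>xs. [:- a, 1:]) \<noteq> 0" by (auto simp: prod_list_zero_iff)
    then show ?case using Cons by (simp add: proots_mult del: mult_pCons_left)
  qed simp
  ultimately show ?thesis by (simp only:)
qed

text \<open>The characteristic polynomial splits over the complex numbers and has positive
  degree.\<close>

lemma hermitian_eigenvector:
  assumes "A \<in> carrier_mat n n" "0 < n"
  shows "\<exists>v e. v \<in> carrier_vec n \<and> v \<noteq> 0\<^sub>v n \<and> A *\<^sub>v v = e \<cdot>\<^sub>v (v :: complex Matrix.vec)"
proof -
  obtain as where as: "char_poly A = (\<Prod>a\<leftarrow>as. [:- a, 1:])" "length as = n"
    using char_poly_factorized[OF assms(1)] by blast
  then obtain a as' where "as = a # as'" using assms(2) by (cases as) auto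
  then have "poly (char_poly A) a = 0" using as by simp
  then have "eigenvalue A a" using eigenvalue_root_char_poly[OF assms(1)] by simp
  then show ?thesis using assms(1) unfolding eigenvalue_def eigenvector_def by auto
qed

text \<open>Deflation. A unitary \<open>W\<close> whose first column is an eigenvector turns
  \<open>A\<close> into a matrix whose first column is a multiple of the first unit vector; being
  Hermitian, it has the same first row, and the induction hypothesis applies to the trailing
  block.\<close>

theorem spectral_theorem:
  "A \<in> carrier_mat d d \<Longrightarrow> mat_adjoint A = A \<Longrightarrow>
   \<exists>U (\<alpha> :: nat \<Rightarrow> real). unitary d U \<and> A = spec d U (\<lambda>i. of_real (\<alpha> i))"
proof (induction d arbitrary: A)
  case 0
  then show ?case by (intro exI[of _ A]) (auto simp: unitary_def spec_def intro!: eq_matI)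
next
  case (Suc n)
  let ?n = "Suc n"
  note A = Suc.prems(1)
  obtain v e where v: "v \<in> carrier_vec ?n" "v \<noteq> 0\<^sub>v ?n" "A *\<^sub>v v = e \<cdot>\<^sub>v v"
    using hermitian_eigenvector[OF A] by auto
  obtain W c where W: "unitary ?n W" and c: "col W 0 = c \<cdot>\<^sub>v v"
    using unitary_completion[OF v(1,2)] by auto
  note Wc = unitaryD[OF W]
  define B where "B = mat_adjoint W * A * W"
  have B: "B \<in> carrier_mat ?n ?n" using A Wc by (auto simp: B_def)
  have adjB: "mat_adjoint B = B"
  proof -
    have "mat_adjoint B = mat_adjoint W * mat_adjoint (mat_adjoint W * A)"
      unfolding B_def using A Wc by (intro adj_mult) auto
    also have "mat_adjoint (mat_adjoint W * A) = A * W"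
      using A Wc Suc.prems(2) by (subst adj_mult) auto
    also have "mat_adjoint W * (A * W) = B" unfolding B_def using A Wc by (intro assoc_mult_mat[symmetric]) auto
    finally show ?thesis .
  qed
  have "col B 0 = (mat_adjoint W * A) *\<^sub>v col W 0"
    unfolding B_def using A Wc by (intro col_mult2) auto
  also have "\<dots> = mat_adjoint W *\<^sub>v (A *\<^sub>v col W 0)"
    using A Wc v(1) by (intro assoc_mult_mat_vec) (auto simp: c)
  also have "A *\<^sub>v col W 0 = e \<cdot>\<^sub>v col W 0"
    unfolding c using mult_mat_vec[OF A v(1), of c] v by (simp add: smult_smult_assoc mult.commute)
  also have "mat_adjoint W *\<^sub>v (e \<cdot>\<^sub>v col W 0) = e \<cdot>\<^sub>v (mat_adjoint W *\<^sub>v col W 0)"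
    using Wc v(1) by (intro mult_mat_vec) (auto simp: c)
  also have "mat_adjoint W *\<^sub>v col W 0 = col (mat_adjoint W * W) 0"
    using Wc by (intro col_mult2[symmetric]) auto
  finally have B0: "col B 0 = e \<cdot>\<^sub>v col (1\<^sub>m ?n) 0" unfolding Wc(3) .
  have Bi0: "B $$ (i, 0) = (if i = 0 then e else 0)" if "i < ?n" for i
    using arg_cong[OF B0, of "\<lambda>x. x $ i"] that B by auto
  have Bsym: "B $$ (i, j) = cnj (B $$ (j, i))" if "i < ?n" "j < ?n" for i j
    using arg_cong[OF adjB, of "\<lambda>X. X $$ (i, j)"] that B by auto
  have ce: "cnj e = e" using Bsym[of 0 0] Bi0[of 0] by simp
  \<comment> \<open>A diagonal entry of a Hermitian matrix is real, hence so is the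
    eigenvalue.\<close>
  have e: "e = complex_of_real (Re e)" using Bsym[of 0 0] Bi0[of 0] by (simp add: complex_eq_iff)
  have B0j: "B $$ (0, j) = (if j = 0 then e else 0)" if "j < ?n" for j
    using Bsym[of 0 j] Bi0[of j] that ce by (cases "j = 0") auto
  define C where "C = Matrix.mat n n (\<lambda>(i, j). B $$ (Suc i, Suc j))"
  have C: "C \<in> carrier_mat n n" by (simp add: C_def)
  have "mat_adjoint C = C" by (rule eq_matI) (auto simp: C_def Bsym[symmetric])
  from Suc.IH[OF C this] obtain U \<alpha> where U: "unitary n U" and CU: "C = spec n U (\<lambda>i. of_real (\<alpha> i))" by blast
  note Uc = unitaryD[OF U]
  \<comment> \<open>Bordering the smaller unitary by a 1 leaves the split-off eigenvector
    untouched.\<close>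
  define Z where "Z = Matrix.mat ?n ?n (\<lambda>(i, j). if i = 0 \<or> j = 0 then (if i = j then 1 else 0) else U $$ (i - 1, j - 1))"
  have Z: "Z \<in> carrier_mat ?n ?n" by (simp add: Z_def)
  have UU: "(\<Sum>l<n. cnj (U $$ (l, i)) * U $$ (l, j)) = (if i = j then 1 else 0)" if "i < n" "j < n" for i j
  proof -
    have "(\<Sum>l<n. cnj (U $$ (l, i)) * U $$ (l, j)) = (mat_adjoint U * U) $$ (i, j)"
      using that Uc by (subst index_mult_sum[of _ n n _ n]) auto
    then show ?thesis unfolding Uc(3) using that by simp
  qed
  have "mat_adjoint Z * Z = 1\<^sub>m ?n"
  proof (rule eq_matI)
    fix i j assume "i < dim_row (1\<^sub>m ?n :: complex Matrix.mat)" "j < dim_col (1\<^sub>m ?n :: complex Matrix.mat)"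
    then have ij: "i < ?n" "j < ?n" by auto
    have "(mat_adjoint Z * Z) $$ (i, j) = (\<Sum>l<?n. cnj (Z $$ (l, i)) * Z $$ (l, j))"
      using ij Z by (subst index_mult_sum[of _ ?n ?n _ ?n]) auto
    also have "\<dots> = 1\<^sub>m ?n $$ (i, j)"
      using ij UU[of "i - 1" "j - 1"] unfolding sum.lessThan_Suc_shift by (cases i; cases j) (auto simp: Z_def)
    finally show "(mat_adjoint Z * Z) $$ (i, j) = 1\<^sub>m ?n $$ (i, j)" .
  qed (use Z in auto)
  then have Zu: "unitary ?n Z" by (rule unitaryI[OF Z])
  define \<beta> where "\<beta> i = (case i of 0 \<Rightarrow> Re e | Suc k \<Rightarrow> \<alpha> k)" for i
  have BZ: "B = spec ?n Z (\<lambda>i. of_real (\<beta> i))"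
  proof (rule eq_matI)
    fix i j assume "i < dim_row (spec ?n Z (\<lambda>i. of_real (\<beta> i)))" "j < dim_col (spec ?n Z (\<lambda>i. of_real (\<beta> i)))"
    then have ij: "i < ?n" "j < ?n" by auto
    have CC: "B $$ (Suc p, Suc q) = (\<Sum>l<n. U $$ (p, l) * complex_of_real (\<alpha> l) * cnj (U $$ (q, l)))" if "p < n" "q < n" for p q
      using arg_cong[OF CU, of "\<lambda>X. X $$ (p, q)"] that by (simp add: C_def spec_def)
    have "spec ?n Z (\<lambda>i. of_real (\<beta> i)) $$ (i, j)
        = Z $$ (i, 0) * complex_of_real (\<beta> 0) * cnj (Z $$ (j, 0)) + (\<Sum>l<n. Z $$ (i, Suc l) * complex_of_real (\<beta> (Suc l)) * cnj (Z $$ (j, Suc l)))"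
      using ij by (simp add: spec_def sum.lessThan_Suc_shift del: sum.lessThan_Suc)
    also have "\<dots> = B $$ (i, j)"
      using ij Bi0[of i] B0j[of j] e CC[of "i - 1" "j - 1"]
      by (cases i; cases j) (auto simp: Z_def \<beta>_def)
    finally show "B $$ (i, j) = spec ?n Z (\<lambda>i. of_real (\<beta> i)) $$ (i, j)" by simp
  qed (use B in auto)
  have WZ: "unitary ?n (W * Z)" by (rule unitary_mult[OF W Zu])
  have "spec ?n (W * Z) (\<lambda>i. of_real (\<beta> i)) = W * B * mat_adjoint W"
  proof -
    let ?D = "diagm ?n (\<lambda>i. complex_of_real (\<beta> i))"
    have "spec ?n (W * Z) (\<lambda>i. of_real (\<beta> i)) = W * Z * ?D * (mat_adjoint Z * mat_adjoint W)"
      unfolding spec_eq[OF unitaryD(1)[OF WZ]] using Wc Z by (subst adj_mult) auto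
    also have "\<dots> = W * Z * ?D * mat_adjoint Z * mat_adjoint W"
      using Wc Z by (intro assoc_mult_mat[symmetric]) auto
    also have "W * Z * ?D = W * (Z * ?D)" using Wc Z by (intro assoc_mult_mat) auto
    also have "W * (Z * ?D) * mat_adjoint Z = W * (Z * ?D * mat_adjoint Z)" using Wc Z by (intro assoc_mult_mat) auto
    finally show ?thesis unfolding BZ spec_eq[OF Z] .
  qed
  also have "\<dots> = A"
  proof -
    have "W * B = W * (mat_adjoint W * (A * W))" unfolding B_def
      using A Wc by (subst assoc_mult_mat[of "mat_adjoint W" ?n ?n]) auto
    also have "\<dots> = W * mat_adjoint W * (A * W)" using A Wc by (intro assoc_mult_mat[symmetric]) auto
    also have "\<dots> = A * W" unfolding Wc(4) using A Wc by (intro left_mult_one_mat) auto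
    finally have "W * B * mat_adjoint W = A * W * mat_adjoint W" by simp
    also have "\<dots> = A * (W * mat_adjoint W)" using A Wc by (intro assoc_mult_mat) auto
    finally show ?thesis unfolding Wc(4) using A by simp
  qed
  finally show ?case using WZ by metis
qed

section \<open>Perturbation of eigenvalues\<close>

lemma lowrank_mult_vec_zero:
  assumes R: "R \<in> carrier_mat d d" and x: "(x :: complex Matrix.vec) \<in> carrier_vec d"
    and uv: "\<forall>i<dim_row R. \<forall>j<dim_col R. R $$ (i, j) = (\<Sum>k<r. u k i * v k j)"
    and z: "\<And>k. k < r \<Longrightarrow> (\<Sum>j<d. v k j * x $ j) = 0"
  shows "R *\<^sub>v x = 0\<^sub>v d"
proof (rule eq_vecI)
  fix i assume "i < dim_vec (0\<^sub>v d :: complex Matrix.vec)"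
  then have i: "i < d" by simp
  have "(R *\<^sub>v x) $ i = (\<Sum>j<d. \<Sum>k<r. u k i * (v k j * x $ j))"
    using index_mult_vec_sum[OF R x i] uv R i by (simp add: sum_distrib_right mult.assoc del: index_mult_mat_vec)
  also have "\<dots> = (\<Sum>k<r. \<Sum>j<d. u k i * (v k j * x $ j))" by (rule sum.swap)
  also have "\<dots> = 0" by (intro sum.neutral) (auto simp: sum_distrib_left[symmetric] z)
  finally show "(R *\<^sub>v x) $ i = 0\<^sub>v d $ i" using i by simp
qed (use R in auto)

text \<open>A nonzero vector orthogonal to the eigenvectors of \<open>A\<close> above \<open>s\<close>, to those of \<open>B\<close> up to
  \<open>s + \<epsilon>\<close> and to the row space of \<open>R\<close> would violate the comparison of the quadratic forms.\<close>

lemma interlacing: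
  fixes \<alpha> \<beta> :: "nat \<Rightarrow> real"
  assumes U: "unitary d U" and V: "unitary d V"
    and R: "R \<in> carrier_mat d d" and N: "N \<in> carrier_mat d d"
    and eq: "spec d U (\<lambda>i. of_real (\<alpha> i)) = spec d V (\<lambda>i. of_real (\<beta> i)) + R + N"
    and r: "lowrank r R" and \<epsilon>: "nb N \<epsilon>"
  shows "card {i. i < d \<and> \<alpha> i \<le> s} \<le> card {i. i < d \<and> \<beta> i \<le> s + \<epsilon>} + r"
proof (rule ccontr)
  let ?A = "spec d U (\<lambda>i. of_real (\<alpha> i))" and ?B = "spec d V (\<lambda>i. of_real (\<beta> i))"
  assume neg: "\<not> ?thesis"
  define P where "P = {i. i < d \<and> s < \<alpha> i}"
  define Q where "Q = {i. i < d \<and> \<beta> i \<le> s + \<epsilon>}"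
  have fin: "finite P" "finite Q" by (auto simp: P_def Q_def)
  have "card {i. i < d \<and> \<alpha> i \<le> s} + card P = card ({i. i < d \<and> \<alpha> i \<le> s} \<union> P)"
    by (rule card_Un_disjoint[symmetric]) (auto simp: P_def)
  also have "{i. i < d \<and> \<alpha> i \<le> s} \<union> P = {..<d}" by (auto simp: P_def)
  \<comment> \<open>If the claim fails, the three groups of linear conditions imposed below number
    fewer than \<open>d\<close>, since \<open>d - card P\<close> eigenvalues of the first matrix are
    at most \<open>s\<close>.\<close>
  finally have k: "card P + (card Q + r) < d" using neg by (simp add: Q_def)
  obtain b where b: "bij_betw b {..<card P} P"
    using ex_bij_betw_nat_finite[OF fin(1)] unfolding lessThan_atLeast0 by blast
  obtain c where c: "bij_betw c {..<card Q} Q"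
    using ex_bij_betw_nat_finite[OF fin(2)] unfolding lessThan_atLeast0 by blast
  obtain u v where uv: "\<forall>i<dim_row R. \<forall>j<dim_col R. R $$ (i, j) = (\<Sum>k<r. u k i * v k j)"
    using r unfolding lowrank_def by blast
  \<comment> \<open>Conjugated columns of \<open>U\<close> and \<open>V\<close> give the coordinates
    of \<open>x\<close> in the two eigenbases; the last \<open>r\<close> conditions put
    \<open>x\<close> into the kernel of \<open>R\<close>.\<close>
  define w where "w i j = (if i < card P then cnj (U $$ (j, b i)) else if i < card P + card Q
      then cnj (V $$ (j, c (i - card P))) else v (i - card P - card Q) j)" for i j
  obtain x where x: "x \<in> carrier_vec d" "x \<noteq> 0\<^sub>v d"
    and wx: "\<And>i. i < card P + (card Q + r) \<Longrightarrow> (\<Sum>j<d. w i j * x $ j) = 0"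
    using exists_orthogonal_vec[OF k, of w] by blast
  note Uc = unitaryD[OF U] and Vc = unitaryD[OF V]
  define y where "y = mat_adjoint U *\<^sub>v x"
  define z where "z = mat_adjoint V *\<^sub>v x"
  have y: "y \<in> carrier_vec d" and z: "z \<in> carrier_vec d"
    unfolding y_def z_def using mult_mat_vec_carrier[OF Uc(2) x(1)] mult_mat_vec_carrier[OF Vc(2) x(1)] by auto
  have ny: "vec_nrm y = vec_nrm x" and nz: "vec_nrm z = vec_nrm x"
    unfolding y_def z_def by (rule unitary_vec_nrm[OF unitary_adj x(1)], fact)+
  have y0: "y $ l = 0" if "l \<in> P" for l
  proof -
    have "l \<in> b ` {..<card P}" using b that by (simp add: bij_betw_def)
    then obtain i where i: "i < card P" "b i = l" by auto
    have "y $ l = (\<Sum>j<d. w i j * x $ j)"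
      using index_mult_vec_sum[OF Uc(2) x(1), of l] that i Uc by (simp add: y_def w_def P_def del: index_mult_mat_vec)
    then show ?thesis using wx[of i] i by simp
  qed
  have z0: "z $ l = 0" if "l \<in> Q" for l
  proof -
    have "l \<in> c ` {..<card Q}" using c that by (simp add: bij_betw_def)
    then obtain i where i: "i < card Q" "c i = l" by auto
    have "z $ l = (\<Sum>j<d. w (card P + i) j * x $ j)"
      using index_mult_vec_sum[OF Vc(2) x(1), of l] that i Vc by (simp add: z_def w_def Q_def del: index_mult_mat_vec)
    then show ?thesis using wx[of "card P + i"] i by simp
  qed
  have Rx: "R *\<^sub>v x = 0\<^sub>v d"
  proof (rule lowrank_mult_vec_zero[OF R x(1) uv])
    fix k assume "k < r"
    then show "(\<Sum>j<d. v k j * x $ j) = 0" using wx[of "card P + (card Q + k)"] by (simp add: w_def)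
  qed
  have Ax: "?A *\<^sub>v x = ?B *\<^sub>v x + N *\<^sub>v x"
  proof -
    have "?A *\<^sub>v x = (?B + R) *\<^sub>v x + N *\<^sub>v x" unfolding eq using R N x(1) by (intro add_mult_distrib_mat_vec) auto
    also have "(?B + R) *\<^sub>v x = ?B *\<^sub>v x + R *\<^sub>v x" using R x(1) by (intro add_mult_distrib_mat_vec) auto
    also have "\<dots> = ?B *\<^sub>v x" unfolding Rx using mult_mat_vec_carrier[OF spec_carrier(1) x(1)] by simp
    finally show ?thesis .
  qed
  have Bx: "?B *\<^sub>v x \<in> carrier_vec d" and Nx: "N *\<^sub>v x \<in> carrier_vec d"
    using mult_mat_vec_carrier[OF spec_carrier(1) x(1)] mult_mat_vec_carrier[OF N x(1)] by auto
  have "(?A *\<^sub>v x) \<bullet>c x = (?B *\<^sub>v x) \<bullet>c x + (N *\<^sub>v x) \<bullet>c x"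
    unfolding Ax using Bx Nx x(1) by (intro add_scalar_prod_distrib[of _ d]) auto
  then have "(\<Sum>i<d. \<alpha> i * (cmod (y $ i))\<^sup>2) = (\<Sum>i<d. \<beta> i * (cmod (z $ i))\<^sup>2) + Re ((N *\<^sub>v x) \<bullet>c x)"
    unfolding spec_quad[OF U x(1)] spec_quad[OF V x(1)] y_def z_def
    by (simp add: complex_eq_iff del: index_mult_mat_vec)
  \<comment> \<open>The form of the first matrix at \<open>x\<close> is at most \<open>s\<close>
    times the squared norm, that of the second exceeds \<open>s + \<epsilon>\<close> times it, and
    \<open>N\<close> accounts for at most \<open>\<epsilon>\<close> times it.\<close>
  moreover have "(\<Sum>i<d. \<alpha> i * (cmod (y $ i))\<^sup>2) \<le> (\<Sum>i<d. s * (cmod (y $ i))\<^sup>2)"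
  proof (intro sum_mono)
    fix i assume "i \<in> {..<d}"
    then show "\<alpha> i * (cmod (y $ i))\<^sup>2 \<le> s * (cmod (y $ i))\<^sup>2"
      using y0[of i] by (cases "i \<in> P") (auto simp: P_def intro!: mult_right_mono)
  qed
  moreover have "(\<Sum>i<d. s * (cmod (y $ i))\<^sup>2) = s * (vec_nrm x)\<^sup>2"
    unfolding ny[symmetric] vec_nrm_sq[OF y] by (simp add: sum_distrib_left)
  moreover have "(\<Sum>i<d. \<beta> i * (cmod (z $ i))\<^sup>2) > (\<Sum>i<d. (s + \<epsilon>) * (cmod (z $ i))\<^sup>2)"
  proof (rule sum_strict_mono_ex1)
    show "\<forall>i\<in>{..<d}. (s + \<epsilon>) * (cmod (z $ i))\<^sup>2 \<le> \<beta> i * (cmod (z $ i))\<^sup>2"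
    proof
      fix i assume "i \<in> {..<d}"
      then show "(s + \<epsilon>) * (cmod (z $ i))\<^sup>2 \<le> \<beta> i * (cmod (z $ i))\<^sup>2"
        using z0[of i] by (cases "i \<in> Q") (auto simp: Q_def intro!: mult_right_mono)
    qed
    have "vec_nrm z \<noteq> 0" unfolding nz using x vec_nrm_eq_0 by blast
    then have "z \<noteq> 0\<^sub>v d" using vec_nrm_eq_0[OF z] by blast
    then obtain i where i: "i < d" "z $ i \<noteq> 0" using z by (metis eq_vecI carrier_vecD index_zero_vec)
    then have "i \<notin> Q" using z0 by blast
    then show "\<exists>i\<in>{..<d}. (s + \<epsilon>) * (cmod (z $ i))\<^sup>2 < \<beta> i * (cmod (z $ i))\<^sup>2"
      using i by (intro bexI[of _ i]) (auto simp: Q_def)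
  qed auto
  moreover have "(\<Sum>i<d. (s + \<epsilon>) * (cmod (z $ i))\<^sup>2) = (s + \<epsilon>) * (vec_nrm x)\<^sup>2"
    unfolding nz[symmetric] vec_nrm_sq[OF z] by (simp add: sum_distrib_left)
  moreover have "- Re ((N *\<^sub>v x) \<bullet>c x) \<le> \<epsilon> * (vec_nrm x)\<^sup>2"
  proof -
    have "- Re ((N *\<^sub>v x) \<bullet>c x) \<le> cmod ((N *\<^sub>v x) \<bullet>c x)" using abs_Re_le_cmod[of "(N *\<^sub>v x) \<bullet>c x"] by linarith
    also have "\<dots> \<le> vec_nrm (N *\<^sub>v x) * vec_nrm x" by (rule cscalar_cauchy[OF Nx x(1)])
    also have "\<dots> \<le> \<epsilon> * vec_nrm x * vec_nrm x" by (intro mult_right_mono nbD[OF \<epsilon> N x(1)]) auto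
    finally show ?thesis by (simp add: power2_eq_square)
  qed
  ultimately show False by (simp add: algebra_simps)
qed

text \<open>Layer cake: a sum of values in [0, 1] is the integral over levels \<open>y\<close> in
  [0, 1) of the number of terms above \<open>y\<close>. Monotonicity of \<open>g\<close> turns each
  such count into a count of eigenvalues, so an error \<open>r\<close> in every count costs at most
  \<open>r\<close> in total.\<close>

lemma mono_sum_le:
  fixes \<alpha> \<gamma> :: "nat \<Rightarrow> real" and g :: "real \<Rightarrow> real"
  assumes g: "mono g" "\<And>t. 0 \<le> g t" "\<And>t. g t \<le> 1"
    and c: "\<And>s. card {i. i < d \<and> \<alpha> i \<le> s} \<le> card {i. i < d \<and> \<gamma> i \<le> s} + r"
  shows "(\<Sum>i<d. g (\<gamma> i)) \<le> (\<Sum>i<d. g (\<alpha> i)) + real r"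
proof -
  have up: "card {i. i < d \<and> y < g (\<gamma> i)} \<le> card {i. i < d \<and> y < g (\<alpha> i)} + r" for y
  proof -
    \<comment> \<open>The set of reals with \<open>g t \<le> y\<close> need not have a maximum;
      among the finitely many values that occur there is one, and it serves as the threshold
      \<open>s\<close> in the hypothesis on counts.\<close>
    define T where "T = {t \<in> \<alpha> ` {..<d} \<union> \<gamma> ` {..<d}. g t \<le> y}"
    have T: "finite T" by (simp add: T_def)
    have cc: "card {i. i < d \<and> y < g (f i)} + card {i. i < d \<and> g (f i) \<le> y} = d" for f :: "nat \<Rightarrow> real"
    proof -
      have "card {i. i < d \<and> y < g (f i)} + card {i. i < d \<and> g (f i) \<le> y}
        = card ({i. i < d \<and> y < g (f i)} \<union> {i. i < d \<and> g (f i) \<le> y})"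
        by (rule card_Un_disjoint[symmetric]) auto
      also have "{i. i < d \<and> y < g (f i)} \<union> {i. i < d \<and> g (f i) \<le> y} = {..<d}" by auto
      finally show ?thesis by simp
    qed
    have "card {i. i < d \<and> g (\<alpha> i) \<le> y} \<le> card {i. i < d \<and> g (\<gamma> i) \<le> y} + r"
    proof (cases "T = {}")
      case True
      then have "{i. i < d \<and> g (\<alpha> i) \<le> y} = {}" by (auto simp: T_def)
      then show ?thesis by (metis card.empty le0)
    next
      case False
      have MT: "Max T \<in> T" using T False by simp
      have eq: "{i. i < d \<and> g (f i) \<le> y} = {i. i < d \<and> f i \<le> Max T}" if "f ` {..<d} \<subseteq> \<alpha> ` {..<d} \<union> \<gamma> ` {..<d}" for f
      proof (intro Collect_cong conj_cong refl iffI)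
        fix i assume "i < d" "g (f i) \<le> y"
        then have "f i \<in> T" using that by (auto simp: T_def)
        then show "f i \<le> Max T" using T by simp
      next
        fix i assume "f i \<le> Max T"
        then have "g (f i) \<le> g (Max T)" using g(1) by (auto simp: mono_def)
        also have "\<dots> \<le> y" using MT by (simp add: T_def)
        finally show "g (f i) \<le> y" .
      qed
      show ?thesis unfolding eq[of \<alpha>, OF Un_upper1] eq[of \<gamma>, OF Un_upper2] by (rule c)
    qed
    then show ?thesis using cc[of \<alpha>] cc[of \<gamma>] by linarith
  qed
  have I: "integrable lborel (indicat_real {0..<t})" for t :: real
    by (cases "0 \<le> t") (auto intro!: integrable_real_indicator)
  have L: "(LINT y|lborel. indicat_real {0..<t} y) = t" if "0 \<le> t" for t :: real using that by simp
  have cs: "(\<Sum>i<d. indicat_real {0..<f i} y) = real (card {i. i < d \<and> y < f i})" if "0 \<le> y" for f y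
  proof -
    have "(\<Sum>i<d. indicat_real {0..<f i} y) = (\<Sum>i\<in>{i. i < d \<and> y < f i}. 1)"
      using that by (intro sum.mono_neutral_cong_right) (auto simp: indicator_def)
    then show ?thesis by simp
  qed
  have "(LINT y|lborel. (\<Sum>i<d. indicat_real {0..<g (\<gamma> i)} y))
      \<le> (LINT y|lborel. ((\<Sum>i<d. indicat_real {0..<g (\<alpha> i)} y) + real r * indicat_real {0..<1::real} y))"
  proof (rule integral_mono)
    fix y :: real
    show "(\<Sum>i<d. indicat_real {0..<g (\<gamma> i)} y) \<le> (\<Sum>i<d. indicat_real {0..<g (\<alpha> i)} y) + real r * indicat_real {0..<1::real} y"
    proof (cases "0 \<le> y \<and> y < 1")
      case True
      then show ?thesis using up[of y] cs[of y] by (simp add: indicator_def)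
    next
      case False
      then have "(\<Sum>i<d. indicat_real {0..<g (\<gamma> i)} y) = 0"
        using g(3) by (intro sum.neutral) (auto simp: indicator_def not_less intro: order_trans)
      moreover have "0 \<le> (\<Sum>i<d. indicat_real {0..<g (\<alpha> i)} y)" by (intro sum_nonneg) auto
      ultimately show ?thesis using False by (simp add: indicator_def)
    qed
  qed (intro Bochner_Integration.integrable_sum Bochner_Integration.integrable_add integrable_mult_right I)+
  also have "(LINT y|lborel. (\<Sum>i<d. indicat_real {0..<g (\<gamma> i)} y)) = (\<Sum>i<d. g (\<gamma> i))"
    by (subst Bochner_Integration.integral_sum) (auto simp: L g(2) intro: I)
  also have "(LINT y|lborel. ((\<Sum>i<d. indicat_real {0..<g (\<alpha> i)} y) + real r * indicat_real {0..<1::real} y))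
     = (LINT y|lborel. (\<Sum>i<d. indicat_real {0..<g (\<alpha> i)} y)) + (LINT y|lborel. real r * indicat_real {0..<1::real} y)"
    by (rule Bochner_Integration.integral_add) (intro Bochner_Integration.integrable_sum integrable_mult_right I)+
  also have "(LINT y|lborel. (\<Sum>i<d. indicat_real {0..<g (\<alpha> i)} y)) = (\<Sum>i<d. g (\<alpha> i))"
    by (subst Bochner_Integration.integral_sum) (auto simp: L g(2) intro: I)
  also have "(LINT y|lborel. real r * indicat_real {0..<1::real} y) = real r" by simp
  finally show ?thesis .
qed

text \<open>Shifting the \<open>\<beta> i\<close> down by \<open>\<epsilon>\<close> turns
  \<open>interlacing\<close> into the hypothesis of \<open>mono_sum_le\<close>; undoing the shift
  costs \<open>\<eta>\<close> per eigenvalue.\<close>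

lemma eigen_sum_compare:
  fixes \<alpha> \<beta> :: "nat \<Rightarrow> real" and g :: "real \<Rightarrow> real"
  assumes U: "unitary d U" and V: "unitary d V"
    and R: "R \<in> carrier_mat d d" and N: "N \<in> carrier_mat d d"
    and eq: "spec d U (\<lambda>i. of_real (\<alpha> i)) = spec d V (\<lambda>i. of_real (\<beta> i)) + R + N"
    and r: "lowrank r R" and \<epsilon>: "nb N \<epsilon>"
    and g: "mono g" "\<And>t. 0 \<le> g t" "\<And>t. g t \<le> 1" and \<eta>: "\<And>t. g t - g (t - \<epsilon>) \<le> \<eta>"
  shows "(\<Sum>i<d. g (\<beta> i)) \<le> (\<Sum>i<d. g (\<alpha> i)) + real r + real d * \<eta>"
proof -
  have "(\<Sum>i<d. g (\<beta> i)) \<le> (\<Sum>i<d. g (\<beta> i - \<epsilon>) + \<eta>)"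
    using \<eta> by (intro sum_mono) (simp add: algebra_simps)
  also have "\<dots> = (\<Sum>i<d. g (\<beta> i - \<epsilon>)) + real d * \<eta>" by (simp add: sum.distrib)
  also have "(\<Sum>i<d. g (\<beta> i - \<epsilon>)) \<le> (\<Sum>i<d. g (\<alpha> i)) + real r"
  proof (rule mono_sum_le[OF g])
    fix s
    have "{i. i < d \<and> \<beta> i - \<epsilon> \<le> s} = {i. i < d \<and> \<beta> i \<le> s + \<epsilon>}" by auto
    then show "card {i. i < d \<and> \<alpha> i \<le> s} \<le> card {i. i < d \<and> \<beta> i - \<epsilon> \<le> s} + r"
      using interlacing[OF U V R N eq r \<epsilon>, of s] by simp
  qed
  finally show ?thesis by simp
qed

section \<open>Perturbations of small rank plus small norm\<close>

text \<open>A single number bounds the relative rank and the norm, so errors in the sense of a.c.s.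
  can be added, compared and halved like real numbers.\<close>

definition small_pert :: "real \<Rightarrow> complex Matrix.mat \<Rightarrow> bool" where
  "small_pert \<epsilon> X \<longleftrightarrow> (\<exists>R N r. R \<in> carrier_mat (dim_row X) (dim_row X) \<and> N \<in> carrier_mat (dim_row X) (dim_row X) \<and>
     X = R + N \<and> lowrank r R \<and> real r \<le> \<epsilon> * real (dim_row X) \<and> nb N \<epsilon>)"

lemma small_pertE:
  assumes "small_pert \<epsilon> X" "X \<in> carrier_mat d d"
  obtains R N r where "R \<in> carrier_mat d d" "N \<in> carrier_mat d d" "X = R + N" "lowrank r R"
    "real r \<le> \<epsilon> * real d" "nb N \<epsilon>"
  using assms unfolding small_pert_def by auto

lemma small_pertI:
  assumes "R \<in> carrier_mat d d" "N \<in> carrier_mat d d" "X = R + N" "lowrank r R"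
    "real r \<le> \<epsilon> * real d" "nb N \<epsilon>"
  shows "small_pert \<epsilon> X"
  using assms unfolding small_pert_def by auto

lemma small_pert_mono:
  assumes "small_pert \<epsilon> X" "\<epsilon> \<le> \<epsilon>'" "X \<in> carrier_mat d d" shows "small_pert \<epsilon>' X"
proof -
  obtain R N r where *: "R \<in> carrier_mat d d" "N \<in> carrier_mat d d" "X = R + N" "lowrank r R"
    "real r \<le> \<epsilon> * real d" "nb N \<epsilon>" by (rule small_pertE[OF assms(1,3)])
  have "real r \<le> \<epsilon>' * real d" using *(5) mult_right_mono[OF assms(2), of "real d"] by simp
  then show ?thesis using assms(2) by (intro small_pertI[OF *(1-4) _ nb_mono[OF *(6)]])
qed

lemma small_pert_add:
  assumes "small_pert \<epsilon> X" "small_pert \<epsilon>' Y" and X: "X \<in> carrier_mat d d" and Y: "Y \<in> carrier_mat d d"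
  shows "small_pert (\<epsilon> + \<epsilon>') (X + Y)"
proof -
  obtain R N r where 1: "R \<in> carrier_mat d d" "N \<in> carrier_mat d d" "X = R + N" "lowrank r R"
    "real r \<le> \<epsilon> * real d" "nb N \<epsilon>" by (rule small_pertE[OF assms(1) X])
  obtain R' N' r' where 2: "R' \<in> carrier_mat d d" "N' \<in> carrier_mat d d" "Y = R' + N'" "lowrank r' R'"
    "real r' \<le> \<epsilon>' * real d" "nb N' \<epsilon>'" by (rule small_pertE[OF assms(2) Y])
  have "X + Y = (R + R') + (N + N')" unfolding 1(3) 2(3) using 1(1,2) 2(1,2) by (intro eq_matI) auto
  then show ?thesis using 1(5) 2(5)
    by (intro small_pertI[OF _ _ _ lowrank_add[OF 1(1) 2(1) 1(4) 2(4)] _ nb_add[OF 1(2) 2(2) 1(6) 2(6)]])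
      (use 1 2 in \<open>auto simp: algebra_simps\<close>)
qed

text \<open>Multiplication leaves the rank part at \<open>\<epsilon>\<close> and scales the norm
  part by \<open>c\<close>; the factor \<open>1 + c\<close> dominates both.\<close>

lemma small_pert_mult_left:
  assumes "small_pert \<epsilon> X" and X: "X \<in> carrier_mat d d" and Y: "Y \<in> carrier_mat d d" and c: "nb Y c" "0 \<le> c"
    and "0 \<le> \<epsilon>"
  shows "small_pert ((1 + c) * \<epsilon>) (Y * X)"
proof -
  obtain R N r where 1: "R \<in> carrier_mat d d" "N \<in> carrier_mat d d" "X = R + N" "lowrank r R"
    "real r \<le> \<epsilon> * real d" "nb N \<epsilon>" by (rule small_pertE[OF assms(1) X])
  have "Y * X = Y * R + Y * N" unfolding 1(3) using Y 1 by (intro mult_add_distrib_mat) auto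
  moreover have "real r \<le> (1 + c) * \<epsilon> * real d"
  proof -
    have "\<epsilon> * real d \<le> (1 + c) * \<epsilon> * real d"
      using assms by (intro mult_right_mono) (auto simp: algebra_simps)
    then show ?thesis using 1(5) by linarith
  qed
  moreover have "nb (Y * N) ((1 + c) * \<epsilon>)"
    by (rule nb_mono[OF nb_mult[OF Y 1(2) c(1) 1(6) c(2)]]) (use assms in \<open>simp add: algebra_simps\<close>)
  ultimately show ?thesis
    using Y 1 by (intro small_pertI[of "Y * R" d "Y * N" _ r]) (auto intro: lowrank_mult_left)
qed

lemma small_pert_adj:
  assumes "small_pert \<epsilon> X" and X: "X \<in> carrier_mat d d" and "0 \<le> \<epsilon>"
  shows "small_pert \<epsilon> (mat_adjoint X)"
proof -
  obtain R N r where 1: "R \<in> carrier_mat d d" "N \<in> carrier_mat d d" "X = R + N" "lowrank r R"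
    "real r \<le> \<epsilon> * real d" "nb N \<epsilon>" by (rule small_pertE[OF assms(1) X])
  show ?thesis unfolding 1(3) adj_add[OF 1(1,2)]
    by (rule small_pertI[of _ d, OF _ _ refl lowrank_adj[OF 1(4)] 1(5) nb_adj[OF 1(2,6) assms(3)]])
      (use 1 in auto)
qed

lemma small_pert_mult_right:
  assumes "small_pert \<epsilon> X" and X: "X \<in> carrier_mat d d" and Y: "Y \<in> carrier_mat d d" and c: "nb Y c" "0 \<le> c"
    and "0 \<le> \<epsilon>"
  shows "small_pert ((1 + c) * \<epsilon>) (X * Y)"
proof -
  have "small_pert ((1 + c) * \<epsilon>) (mat_adjoint Y * mat_adjoint X)"
    using assms by (intro small_pert_mult_left[of _ _ d] small_pert_adj nb_adj[of _ d d]) auto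
  then have "small_pert ((1 + c) * \<epsilon>) (mat_adjoint (mat_adjoint Y * mat_adjoint X))"
    using assms by (intro small_pert_adj[of _ _ d]) auto
  then show ?thesis using X Y by (subst (asm) adj_mult[of _ d d _ d]) auto
qed

lemma small_pert_smult:
  assumes "small_pert \<epsilon> X" and X: "X \<in> carrier_mat d d" and "0 \<le> \<epsilon>"
  shows "small_pert ((1 + cmod c) * \<epsilon>) (c \<cdot>\<^sub>m X)"
proof -
  have "small_pert ((1 + cmod c) * \<epsilon>) ((c \<cdot>\<^sub>m 1\<^sub>m d) * X)"
    using assms nb_smult[OF one_carrier_mat nb_one, of c d] by (intro small_pert_mult_left[of _ _ d]) auto
  also have "(c \<cdot>\<^sub>m 1\<^sub>m d) * X = c \<cdot>\<^sub>m X" using X by (simp add: mult_smult_assoc_mat[of _ d d])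
  finally show ?thesis .
qed

lemma small_pert_trans:
  assumes "small_pert \<epsilon> (X - Y)" "small_pert \<epsilon>' (Y - Z)"
    and X: "X \<in> carrier_mat d d" and Y: "Y \<in> carrier_mat d d" and Z: "Z \<in> carrier_mat d d"
  shows "small_pert (\<epsilon> + \<epsilon>') (X - Z)"
proof -
  have "X - Z = (X - Y) + (Y - Z)" using X Y Z by (intro eq_matI) auto
  then show ?thesis using small_pert_add[OF assms(1,2) minus_carrier_mat[OF Y] minus_carrier_mat[OF Z]] by simp
qed

lemma small_pert_nb: "nb X \<epsilon> \<Longrightarrow> 0 \<le> \<epsilon> \<Longrightarrow> X \<in> carrier_mat d d \<Longrightarrow> small_pert \<epsilon> X"
  by (rule small_pertI[of "0\<^sub>m d d" d X X 0]) (auto simp: lowrank_zero)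

lemma small_pert_zero: "0 \<le> \<epsilon> \<Longrightarrow> small_pert \<epsilon> (0\<^sub>m d d)"
  using nb_mono[OF nb_zero] by (intro small_pert_nb[of _ _ d]) auto

text \<open>Everything is put into the rank part. Hence 1 is always an admissible error, which
  \<open>acsI\<close> uses for those \<open>m\<close> where nothing better is known.\<close>

lemma small_pert_full: "1 \<le> \<epsilon> \<Longrightarrow> X \<in> carrier_mat d d \<Longrightarrow> small_pert \<epsilon> X"
  using lowrank_full[of X] nb_mono[OF nb_zero, of \<epsilon> d d] mult_right_mono[of 1 \<epsilon> "real d"]
  by (intro small_pertI[of X d "0\<^sub>m d d" X d]) auto

lemma nb_from_gram:
  assumes X: "X \<in> carrier_mat d d" and "nb (mat_adjoint X * X) (c\<^sup>2)" "0 \<le> c"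
  shows "nb X c"
proof (rule nbI[OF X])
  fix x :: "complex Matrix.vec" assume x: "x \<in> carrier_vec d"
  have G: "mat_adjoint X * X \<in> carrier_mat d d" using X by auto
  have Xx: "X *\<^sub>v x \<in> carrier_vec d" using X x by auto
  have Gx: "(mat_adjoint X * X) *\<^sub>v x \<in> carrier_vec d" by (rule mult_mat_vec_carrier[OF G x])
  have "complex_of_real ((vec_nrm (X *\<^sub>v x))\<^sup>2) = x \<bullet>c (mat_adjoint X *\<^sub>v (X *\<^sub>v x))"
    unfolding vec_nrm_sq_cscalar[OF Xx, symmetric] by (rule adj_cscalar[OF X x Xx])
  also have "mat_adjoint X *\<^sub>v (X *\<^sub>v x) = (mat_adjoint X * X) *\<^sub>v x"
    using X x by (intro assoc_mult_mat_vec[symmetric]) auto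
  finally have "(vec_nrm (X *\<^sub>v x))\<^sup>2 = cmod (x \<bullet>c ((mat_adjoint X * X) *\<^sub>v x))"
    by (metis abs_of_nonneg norm_of_real zero_le_power2)
  also have "\<dots> \<le> vec_nrm x * vec_nrm ((mat_adjoint X * X) *\<^sub>v x)" by (rule cscalar_cauchy[OF x Gx])
  also have "\<dots> \<le> vec_nrm x * (c\<^sup>2 * vec_nrm x)" by (intro mult_left_mono nbD[OF assms(2) G x]) auto
  also have "\<dots> = (c * vec_nrm x)\<^sup>2" by (simp add: power2_eq_square)
  finally show "vec_nrm (X *\<^sub>v x) \<le> c * vec_nrm x" using assms(3) by (auto intro: power2_le_imp_le)
qed

text \<open>The vector is column \<open>i\<close> of \<open>U\<close>, one unit eigenvector for all
  \<open>f\<close> simultaneously.\<close>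

lemma spec_eigen_quad:
  assumes U: "unitary d U" and i: "i < d"
  shows "\<exists>x\<in>carrier_vec d. vec_nrm x = 1 \<and> (\<forall>f. (spec d U f *\<^sub>v x) \<bullet>c x = f i)"
proof -
  note Uc = unitaryD[OF U]
  let ?x = "col U i"
  have x: "?x \<in> carrier_vec d" using Uc i by auto
  have "mat_adjoint U *\<^sub>v ?x = col (mat_adjoint U * U) i" using Uc i by (intro col_mult2[symmetric]) auto
  then have y: "mat_adjoint U *\<^sub>v ?x = unit_vec d i" unfolding Uc(3) using i by simp
  have "(vec_nrm (unit_vec d i :: complex Matrix.vec))\<^sup>2 = (\<Sum>j<d. if j = i then 1 else 0)"
  proof (subst vec_nrm_sq[of _ d])
    show "(\<Sum>j<d. (cmod (unit_vec d i $ j))\<^sup>2) = (\<Sum>j<d. if j = i then 1 else 0)"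
      by (rule sum.cong) (auto simp: unit_vec_def)
  qed simp
  then have "(vec_nrm (unit_vec d i :: complex Matrix.vec))\<^sup>2 = 1\<^sup>2" using i by simp
  then have "vec_nrm ?x = 1" using unitary_vec_nrm[OF unitary_adj[OF U] x] unfolding y
    by (metis power2_eq_iff_nonneg vec_nrm_nonneg zero_le_one)
  moreover have "(spec d U f *\<^sub>v ?x) \<bullet>c ?x = f i" for f
  proof -
    have "(\<Sum>j<d. f j * complex_of_real ((cmod (unit_vec d i $ j))\<^sup>2)) = (\<Sum>j<d. if j = i then f j else 0)"
      by (intro sum.cong) (auto simp: unit_vec_def)
    then show ?thesis unfolding spec_quad[OF U x] y using i by simp
  qed
  ultimately show ?thesis using x by blast
qed

text \<open>A truncated singular value decomposition without singular vectors. With the spectral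
  projections \<open>P\<close> and \<open>Q\<close> of the Gram matrix above and below
  \<open>\<epsilon>\<^sup>2\<close>, \<open>X * P\<close> has rank at most the number of large
  eigenvalues, and the Gram matrix of \<open>X * Q\<close> is bounded by
  \<open>\<epsilon>\<^sup>2\<close>.\<close>

lemma gram_truncation:
  assumes X: "X \<in> carrier_mat d d" and U: "unitary d U"
    and G: "mat_adjoint X * X = spec d U (\<lambda>i. of_real (\<alpha> i))"
    and S: "real (card {i. i < d \<and> \<epsilon>\<^sup>2 < \<alpha> i}) \<le> \<epsilon> * real d" and "0 \<le> \<epsilon>"
  shows "small_pert \<epsilon> X"
proof -
  define S where "S = {i. i < d \<and> \<epsilon>\<^sup>2 < \<alpha> i}"
  define P where "P = spec d U (indicator S)"
  define Q where "Q = spec d U (indicator (- S))"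
  have PQ: "P \<in> carrier_mat d d" "Q \<in> carrier_mat d d" by (auto simp: P_def Q_def)
  have "P + Q = spec d U (\<lambda>i. indicator S i + indicator (- S) i)" unfolding P_def Q_def by (rule spec_add)
  also have "\<dots> = spec d U (\<lambda>_. 1)" by (rule spec_cong) (auto simp: indicator_def)
  finally have "P + Q = 1\<^sub>m d" using spec_one[OF U] by simp
  then have eq: "X = X * P + X * Q" using mult_add_distrib_mat[OF X PQ] X by simp
  have al: "0 \<le> \<alpha> i" if i: "i < d" for i
  proof -
    obtain x where x: "x \<in> carrier_vec d" "((mat_adjoint X * X) *\<^sub>v x) \<bullet>c x = complex_of_real (\<alpha> i)"
      using spec_eigen_quad[OF U i] unfolding G by blast
    have Xx: "X *\<^sub>v x \<in> carrier_vec d" using X x by auto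
    have "(mat_adjoint X * X) *\<^sub>v x = mat_adjoint X *\<^sub>v (X *\<^sub>v x)"
      using X x by (intro assoc_mult_mat_vec) auto
    then have "complex_of_real (\<alpha> i) = (X *\<^sub>v x) \<bullet>c (X *\<^sub>v x)"
      using x(2) adj_cscalar[OF adj_carrier[OF X] Xx x(1)] by simp
    also have "\<dots> = complex_of_real ((vec_nrm (X *\<^sub>v x))\<^sup>2)" by (rule vec_nrm_sq_cscalar[OF Xx])
    finally have "\<alpha> i = (vec_nrm (X *\<^sub>v x))\<^sup>2" by (simp only: of_real_eq_iff)
    then show ?thesis by simp
  qed
  have "nb (X * Q) \<epsilon>"
  proof (rule nb_from_gram[of _ d])
    have aQ: "mat_adjoint Q = Q" unfolding Q_def spec_adj by (rule spec_cong) (auto simp: indicator_def)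
    have "mat_adjoint (X * Q) * (X * Q) = Q * mat_adjoint X * (X * Q)"
      using adj_mult[OF X PQ(2)] aQ by simp
    also have "\<dots> = Q * (mat_adjoint X * (X * Q))" using X PQ by (intro assoc_mult_mat) auto
    also have "mat_adjoint X * (X * Q) = mat_adjoint X * X * Q" using X PQ by (intro assoc_mult_mat[symmetric]) auto
    finally have "mat_adjoint (X * Q) * (X * Q) = spec d U (\<lambda>i. indicator (- S) i * (complex_of_real (\<alpha> i) * indicator (- S) i))"
      unfolding G by (simp add: Q_def spec_mult[OF U])
    moreover have "nb \<dots> (\<epsilon>\<^sup>2)"
      by (rule spec_nb[OF U]) (auto simp: indicator_def S_def al)
    ultimately show "nb (mat_adjoint (X * Q) * (X * Q)) (\<epsilon>\<^sup>2)" by simp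
  qed (use X PQ assms in auto)
  moreover have "lowrank (card S) (X * P)" unfolding P_def
    by (rule lowrank_mult_left[OF X spec_carrier(1) spec_lowrank]) (auto simp: S_def)
  ultimately show ?thesis using X PQ eq S by (intro small_pertI[of "X * P" d "X * Q" X "card S"]) (auto simp: S_def)
qed

lemma mtrace_gram: "X \<in> carrier_mat d d \<Longrightarrow> mtrace (mat_adjoint X * X) = complex_of_real (frob2 X)"
proof -
  assume X: "X \<in> carrier_mat d d"
  have "mtrace (mat_adjoint X * X) = (\<Sum>i<d. \<Sum>l<d. complex_of_real ((cmod (X $$ (l, i)))\<^sup>2))"
    unfolding mtrace_def using X
    by (auto intro!: sum.cong simp: index_mult_sum[of _ d d _ d] complex_mult_cnj cmod_power2 mult.commute simp del: index_mult_mat(1))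
  also have "\<dots> = (\<Sum>l<d. \<Sum>i<d. complex_of_real ((cmod (X $$ (l, i)))\<^sup>2))" by (rule sum.swap)
  finally show ?thesis using X by (simp add: frob2_def)
qed

lemma markov_count:
  fixes \<alpha> :: "nat \<Rightarrow> real"
  assumes "\<And>i. i < d \<Longrightarrow> 0 \<le> \<alpha> i"
  shows "t * real (card {i. i < d \<and> t < \<alpha> i}) \<le> (\<Sum>i<d. \<alpha> i)"
proof -
  have "t * real (card {i. i < d \<and> t < \<alpha> i}) = (\<Sum>i\<in>{i. i < d \<and> t < \<alpha> i}. t)" by simp
  also have "\<dots> \<le> (\<Sum>i\<in>{i. i < d \<and> t < \<alpha> i}. \<alpha> i)" by (intro sum_mono) auto
  also have "\<dots> \<le> (\<Sum>i<d. \<alpha> i)" using assms by (intro sum_mono2) auto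
  finally show ?thesis .
qed

text \<open>The eigenvalues of the Gram matrix sum to \<open>frob2 X\<close>. By Markov, at most
  \<open>\<epsilon> ^ 3 * d / \<epsilon> ^ 2 = \<epsilon> * d\<close> of them exceed
  \<open>\<epsilon> ^ 2\<close>; this is the origin of the cube.\<close>

lemma frob2_small_pert:
  assumes X: "X \<in> carrier_mat d d" and f: "frob2 X \<le> \<epsilon> ^ 3 * real d" and "0 < \<epsilon>"
  shows "small_pert \<epsilon> X"
proof -
  have G: "mat_adjoint X * X \<in> carrier_mat d d" using X by auto
  have "mat_adjoint (mat_adjoint X * X) = mat_adjoint X * X" using X by (subst adj_mult) auto
  then obtain U \<alpha> where U: "unitary d U" and eq: "mat_adjoint X * X = spec d U (\<lambda>i. of_real (\<alpha> i))"
    using spectral_theorem[OF G] by blast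
  have al: "0 \<le> \<alpha> i" if i: "i < d" for i
  proof -
    obtain x where x: "x \<in> carrier_vec d" "((mat_adjoint X * X) *\<^sub>v x) \<bullet>c x = complex_of_real (\<alpha> i)"
      using spec_eigen_quad[OF U i] unfolding eq by blast
    have Xx: "X *\<^sub>v x \<in> carrier_vec d" using X x by auto
    have "(mat_adjoint X * X) *\<^sub>v x = mat_adjoint X *\<^sub>v (X *\<^sub>v x)"
      using X x by (intro assoc_mult_mat_vec) auto
    then have "complex_of_real (\<alpha> i) = (X *\<^sub>v x) \<bullet>c (X *\<^sub>v x)"
      using x(2) adj_cscalar[OF adj_carrier[OF X] Xx x(1)] by simp
    also have "\<dots> = complex_of_real ((vec_nrm (X *\<^sub>v x))\<^sup>2)" by (rule vec_nrm_sq_cscalar[OF Xx])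
    finally have "\<alpha> i = (vec_nrm (X *\<^sub>v x))\<^sup>2" by (simp only: of_real_eq_iff)
    then show ?thesis by simp
  qed
  have "complex_of_real (\<Sum>i<d. \<alpha> i) = complex_of_real (frob2 X)"
    using spec_trace[OF U, of "\<lambda>i. complex_of_real (\<alpha> i)"] mtrace_gram[OF X] eq by simp
  then have "(\<Sum>i<d. \<alpha> i) = frob2 X" by (simp only: of_real_eq_iff)
  then have "\<epsilon>\<^sup>2 * real (card {i. i < d \<and> \<epsilon>\<^sup>2 < \<alpha> i}) \<le> \<epsilon>\<^sup>2 * (\<epsilon> * real d)"
    using markov_count[of d \<alpha> "\<epsilon>\<^sup>2"] al f by (simp add: power2_eq_square power3_eq_cube mult.assoc)
  then show ?thesis using \<open>0 < \<epsilon>\<close> by (intro gram_truncation[OF X U eq]) auto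
qed

lemma psd_spec:
  assumes "X \<in> carrier_mat d d" "mat_adjoint X = X"
    and q: "\<And>x. x \<in> carrier_vec d \<Longrightarrow> c * (vec_nrm x)\<^sup>2 \<le> Re ((X *\<^sub>v x) \<bullet>c x)"
  obtains U \<alpha> where "unitary d U" "X = spec d U (\<lambda>i. of_real (\<alpha> i))" "\<And>i. i < d \<Longrightarrow> c \<le> \<alpha> i"
proof -
  obtain U \<alpha> where U: "unitary d U" and eq: "X = spec d U (\<lambda>i. of_real (\<alpha> i))"
    using spectral_theorem[OF assms(1,2)] by blast
  have "c \<le> \<alpha> i" if i: "i < d" for i
  proof -
    obtain x where x: "x \<in> carrier_vec d" "vec_nrm x = 1" "(X *\<^sub>v x) \<bullet>c x = complex_of_real (\<alpha> i)"
      using spec_eigen_quad[OF U i] unfolding eq by blast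
    then show ?thesis using q[OF x(1)] by simp
  qed
  then show ?thesis using that U eq by blast
qed

text \<open>For a positive semidefinite matrix the eigenvalues themselves sum to the trace, so
  Markov is applied to them at level \<open>\<epsilon>\<close>. A trace bound is what an L1 bound on
  a Toeplitz symbol provides.\<close>

lemma psd_trace_small_pert:
  assumes X: "X \<in> carrier_mat d d" "mat_adjoint X = X"
    and q: "\<And>x. x \<in> carrier_vec d \<Longrightarrow> 0 \<le> Re ((X *\<^sub>v x) \<bullet>c x)"
    and t: "Re (mtrace X) \<le> \<epsilon>\<^sup>2 * real d" and "0 < \<epsilon>"
  shows "small_pert \<epsilon> X"
proof -
  obtain U \<alpha> where U: "unitary d U" and eq: "X = spec d U (\<lambda>i. of_real (\<alpha> i))"
    and al: "\<And>i. i < d \<Longrightarrow> 0 \<le> \<alpha> i"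
    using psd_spec[OF X, of 0] q by auto
  have "(\<Sum>i<d. \<alpha> i) = Re (mtrace X)" unfolding eq spec_trace[OF U] by simp
  then have "\<epsilon> * real (card {i. i < d \<and> \<epsilon> < \<alpha> i}) \<le> \<epsilon> * (\<epsilon> * real d)"
    using markov_count[of d \<alpha> \<epsilon>] al t by (simp add: power2_eq_square mult.assoc)
  then have c: "real (card {i. i < d \<and> \<epsilon> < \<alpha> i}) \<le> \<epsilon> * real d" using \<open>0 < \<epsilon>\<close> by simp
  have "{i. i < d \<and> \<epsilon>\<^sup>2 < (\<alpha> i)\<^sup>2} = {i. i < d \<and> \<epsilon> < \<alpha> i}"
    using al \<open>0 < \<epsilon>\<close> by (intro Collect_cong conj_cong refl) (auto intro: power_strict_mono power2_less_imp_less)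
  moreover have "mat_adjoint X * X = spec d U (\<lambda>i. of_real ((\<alpha> i)\<^sup>2))"
    unfolding X(2) unfolding eq spec_mult[OF U] by (simp add: power2_eq_square)
  ultimately show ?thesis using c \<open>0 < \<epsilon>\<close> by (intro gram_truncation[OF X(1) U, of "\<lambda>i. (\<alpha> i)\<^sup>2"]) auto
qed

text \<open>\<open>mat_inverse\<close> returns \<open>None\<close> outside the units of the matrix
  ring, so membership in the units comes first.\<close>

lemma mat_inv_eq:
  assumes X: "X \<in> carrier_mat d d" and Y: "Y \<in> carrier_mat d d" and XY: "X * Y = 1\<^sub>m d" and YX: "Y * X = 1\<^sub>m d"
  shows "mat_inv X = Y"
proof -
  have "X \<in> Units (ring_mat TYPE(complex) d ())"
    using assms unfolding Units_def by (auto simp: ring_mat_simps)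
  then obtain B where B: "mat_inverse X = Some B" using mat_inverse(1)[OF X] by fastforce
  then have B': "X * B = 1\<^sub>m d" "B \<in> carrier_mat d d" using mat_inverse(2)[OF X] by auto
  have "B = Y * X * B" unfolding YX using B' by simp
  also have "\<dots> = Y * (X * B)" using X Y B' by (intro assoc_mult_mat) auto
  also have "\<dots> = Y" using Y B' by simp
  finally show ?thesis by (simp add: mat_inv_def B)
qed

lemma spec_mat_inv:
  assumes U: "unitary d U" and f: "\<And>i. i < d \<Longrightarrow> f i \<noteq> 0"
  shows "mat_inv (spec d U f) = spec d U (\<lambda>i. inverse (f i))"
proof (rule mat_inv_eq[of _ d])
  have "spec d U (\<lambda>i. f i * inverse (f i)) = spec d U (\<lambda>_. 1)"
    using f by (intro spec_cong) auto
  then show "spec d U f * spec d U (\<lambda>i. inverse (f i)) = 1\<^sub>m d" "spec d U (\<lambda>i. inverse (f i)) * spec d U f = 1\<^sub>m d"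
    by (simp_all add: spec_mult[OF U] spec_one[OF U] mult.commute)
qed auto

section \<open>Matrices indexed by multi-indices\<close>

text \<open>Schur's test: write each term as sqrt|a| times sqrt|a||x|, apply Cauchy-Schwarz with the
  row bound, exchange the sums and apply the column bound.\<close>

lemma schur_test:
  assumes A: "A \<in> carrier_mat d d" and c: "0 \<le> c"
    and row: "\<And>i. i < d \<Longrightarrow> (\<Sum>j<d. cmod (A $$ (i, j))) \<le> c"
    and col: "\<And>j. j < d \<Longrightarrow> (\<Sum>i<d. cmod (A $$ (i, j))) \<le> c"
  shows "nb A c"
proof (rule nbI[OF A])
  fix x :: "complex Matrix.vec" assume x: "x \<in> carrier_vec d"
  let ?a = "\<lambda>i j. cmod (A $$ (i, j))"
  have Ax: "A *\<^sub>v x \<in> carrier_vec d" using A x by simp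
  have "(vec_nrm (A *\<^sub>v x))\<^sup>2 = (\<Sum>i<d. (cmod (\<Sum>j<d. A $$ (i, j) * x $ j))\<^sup>2)"
    unfolding vec_nrm_sq[OF Ax] by (intro sum.cong refl) (simp add: index_mult_vec_sum[OF A x] del: index_mult_mat_vec)
  also have "\<dots> \<le> (\<Sum>i<d. c * (\<Sum>j<d. ?a i j * (cmod (x $ j))\<^sup>2))"
  proof (intro sum_mono)
    fix i assume "i \<in> {..<d}"
    then have i: "i < d" by simp
    have "cmod (\<Sum>j<d. A $$ (i, j) * x $ j) \<le> (\<Sum>j<d. \<bar>sqrt (?a i j)\<bar> * \<bar>sqrt (?a i j) * cmod (x $ j)\<bar>)"
      by (rule order_trans[OF norm_sum]) (simp add: norm_mult abs_mult mult.assoc[symmetric])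
    also have "\<dots> \<le> L2_set (\<lambda>j. sqrt (?a i j)) {..<d} * L2_set (\<lambda>j. sqrt (?a i j) * cmod (x $ j)) {..<d}"
      by (rule L2_set_mult_ineq)
    finally have "(cmod (\<Sum>j<d. A $$ (i, j) * x $ j))\<^sup>2
        \<le> (L2_set (\<lambda>j. sqrt (?a i j)) {..<d} * L2_set (\<lambda>j. sqrt (?a i j) * cmod (x $ j)) {..<d})\<^sup>2"
      by (intro power_mono) auto
    also have "\<dots> = (\<Sum>j<d. ?a i j) * (\<Sum>j<d. ?a i j * (cmod (x $ j))\<^sup>2)"
      by (simp add: power_mult_distrib L2_set_def sum_nonneg)
    also have "\<dots> \<le> c * (\<Sum>j<d. ?a i j * (cmod (x $ j))\<^sup>2)"
      by (intro mult_right_mono row i sum_nonneg) auto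
    finally show "(cmod (\<Sum>j<d. A $$ (i, j) * x $ j))\<^sup>2 \<le> c * (\<Sum>j<d. ?a i j * (cmod (x $ j))\<^sup>2)" .
  qed
  also have "\<dots> = c * (\<Sum>i<d. \<Sum>j<d. ?a i j * (cmod (x $ j))\<^sup>2)" by (simp add: sum_distrib_left)
  also have "(\<Sum>i<d. \<Sum>j<d. ?a i j * (cmod (x $ j))\<^sup>2) = (\<Sum>j<d. \<Sum>i<d. ?a i j * (cmod (x $ j))\<^sup>2)" by (rule sum.swap)
  also have "\<dots> = (\<Sum>j<d. (\<Sum>i<d. ?a i j) * (cmod (x $ j))\<^sup>2)" by (simp add: sum_distrib_right)
  also have "\<dots> \<le> (\<Sum>j<d. c * (cmod (x $ j))\<^sup>2)" by (intro sum_mono mult_right_mono col) auto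
  also have "\<dots> = c * (vec_nrm x)\<^sup>2" by (simp add: vec_nrm_sq[OF x] sum_distrib_left)
  also have "c * (c * (vec_nrm x)\<^sup>2) = (c * vec_nrm x)\<^sup>2" by (simp add: power2_eq_square)
  finally have "(vec_nrm (A *\<^sub>v x))\<^sup>2 \<le> (c * vec_nrm x)\<^sup>2" using c by (simp add: mult_left_mono)
  then show "vec_nrm (A *\<^sub>v x) \<le> c * vec_nrm x" using c by (auto intro: power2_le_imp_le)
qed

lemma frob2_adj: "frob2 (mat_adjoint X) = frob2 X"
  unfolding frob2_def by (subst sum.swap) auto

lemma frob2_add_le:
  assumes "X \<in> carrier_mat n m" "Y \<in> carrier_mat n m"
  shows "frob2 (X + Y) \<le> 2 * frob2 X + 2 * frob2 Y"
proof -
  have "(cmod (x + y))\<^sup>2 \<le> 2 * (cmod x)\<^sup>2 + 2 * (cmod y)\<^sup>2" for x y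
  proof -
    have "(cmod (x + y))\<^sup>2 \<le> (cmod x + cmod y)\<^sup>2" by (intro power_mono norm_triangle_ineq) auto
    also have "\<dots> \<le> 2 * (cmod x)\<^sup>2 + 2 * (cmod y)\<^sup>2"
      using zero_le_power2[of "cmod x - cmod y"] by (simp add: power2_eq_square algebra_simps)
    finally show ?thesis .
  qed
  note * = this
  have "frob2 (X + Y) = (\<Sum>i<n. \<Sum>j<m. (cmod (X $$ (i, j) + Y $$ (i, j)))\<^sup>2)"
    using assms unfolding frob2_def by auto
  also have "\<dots> \<le> (\<Sum>i<n. \<Sum>j<m. 2 * (cmod (X $$ (i, j)))\<^sup>2 + 2 * (cmod (Y $$ (i, j)))\<^sup>2)"
    by (intro sum_mono *)
  also have "\<dots> = 2 * frob2 X + 2 * frob2 Y"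
    using assms unfolding frob2_def by (simp add: sum.distrib sum_distrib_left)
  finally show ?thesis .
qed

text \<open>\<open>frob2\<close> is the sum of the squared norms of the columns, and
  \<open>Y\<close> acts on each column separately.\<close>

lemma frob2_mult_left:
  assumes Y: "Y \<in> carrier_mat d d" and X: "X \<in> carrier_mat d d" and c: "nb Y c"
  shows "frob2 (Y * X) \<le> c\<^sup>2 * frob2 X"
proof -
  have sw: "frob2 Z = (\<Sum>j<d. (vec_nrm (col Z j))\<^sup>2)" if "Z \<in> carrier_mat d d" for Z
  proof -
    have "frob2 Z = (\<Sum>j<d. \<Sum>i<d. (cmod (Z $$ (i, j)))\<^sup>2)" unfolding frob2_def using that by (subst sum.swap) auto
    also have "\<dots> = (\<Sum>j<d. (vec_nrm (col Z j))\<^sup>2)"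
      using that by (intro sum.cong refl, subst vec_nrm_sq[of _ d]) auto
    finally show ?thesis .
  qed
  have "frob2 (Y * X) = (\<Sum>j<d. (vec_nrm (Y *\<^sub>v col X j))\<^sup>2)"
    unfolding sw[OF mult_carrier_mat[OF Y X]] using col_mult2[OF Y X] by (intro sum.cong) auto
  also have "\<dots> \<le> (\<Sum>j<d. (c * vec_nrm (col X j))\<^sup>2)"
    using X by (intro sum_mono power_mono nbD[OF c Y]) auto
  also have "\<dots> = c\<^sup>2 * frob2 X" unfolding sw[OF X] by (simp add: power_mult_distrib sum_distrib_left)
  finally show ?thesis .
qed

lemma frob2_mult_right:
  assumes X: "X \<in> carrier_mat d d" and Y: "Y \<in> carrier_mat d d" and c: "nb Y c" "0 \<le> c"
  shows "frob2 (X * Y) \<le> c\<^sup>2 * frob2 X"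
proof -
  have "frob2 (mat_adjoint Y * mat_adjoint X) \<le> c\<^sup>2 * frob2 (mat_adjoint X)"
    using assms by (intro frob2_mult_left[of _ d] nb_adj[of _ d d]) auto
  then show ?thesis unfolding adj_mult[OF X Y, symmetric] frob2_adj .
qed

text \<open>Cauchy-Schwarz on the diagonal against the constant vector 1.\<close>

lemma mtrace_bound:
  assumes X: "X \<in> carrier_mat d d"
  shows "(cmod (mtrace X))\<^sup>2 \<le> real d * frob2 X"
proof -
  have "cmod (mtrace X) \<le> (\<Sum>i<d. \<bar>1\<bar> * \<bar>cmod (X $$ (i, i))\<bar>)"
    using X by (auto simp: mtrace_def intro: norm_sum)
  also have "\<dots> \<le> L2_set (\<lambda>_. 1) {..<d} * L2_set (\<lambda>i. cmod (X $$ (i, i))) {..<d}"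
    by (rule L2_set_mult_ineq)
  finally have "(cmod (mtrace X))\<^sup>2 \<le> (L2_set (\<lambda>_. 1) {..<d} * L2_set (\<lambda>i. cmod (X $$ (i, i))) {..<d})\<^sup>2"
    by (intro power_mono) auto
  also have "\<dots> = real d * (\<Sum>i<d. (cmod (X $$ (i, i)))\<^sup>2)"
    by (simp add: power_mult_distrib L2_set_def sum_nonneg)
  also have "\<dots> \<le> real d * frob2 X"
  proof (intro mult_left_mono)
    show "(\<Sum>i<d. (cmod (X $$ (i, i)))\<^sup>2) \<le> frob2 X" unfolding frob2_def using X
      by (auto intro!: sum_mono member_le_sum[of _ _ "\<lambda>j. (cmod (X $$ (_, j)))\<^sup>2"])
  qed simp
  finally show ?thesis .
qed

lemma mtrace_minus: "X \<in> carrier_mat d d \<Longrightarrow> Y \<in> carrier_mat d d \<Longrightarrow> mtrace (X - Y) = mtrace X - mtrace Y"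
  by (auto simp: mtrace_def sum_subtractf)

lemma mtrace_add: "X \<in> carrier_mat d d \<Longrightarrow> Y \<in> carrier_mat d d \<Longrightarrow> mtrace (X + Y) = mtrace X + mtrace Y"
  by (auto simp: mtrace_def sum.distrib)

lemma mi_range_iff: "i \<in> mi_range n \<longleftrightarrow> (\<forall>j. 1 \<le> i j \<and> i j \<le> n j)"
  by (auto simp: mi_range_def le_fun_def)

lemma mi_range_PiE: "mi_range n = PiE UNIV (\<lambda>j. {1..n j})"
  by (auto simp: mi_range_iff PiE_def Pi_def extensional_def)

lemma finite_mi_range [simp]: "finite (mi_range n)"
  unfolding mi_range_PiE by (rule finite_PiE) auto

lemma card_mi_range: "card (mi_range n) = mi_size n"
  unfolding mi_range_PiE mi_size_def by (subst card_PiE) auto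

text \<open>Counting predecessors is strictly increasing, hence injective, into a set of the same
  finite size.\<close>

lemma bij_betw_rank:
  assumes fin: "finite S" and irr: "\<And>x. \<not> r x x" and tr: "\<And>x y z. r x y \<Longrightarrow> r y z \<Longrightarrow> r x z"
    and tot: "\<And>x y. x \<in> S \<Longrightarrow> y \<in> S \<Longrightarrow> r x y \<or> x = y \<or> r y x"
  shows "bij_betw (\<lambda>i. card {j \<in> S. r j i}) S {..<card S}"
proof -
  have less: "card {j \<in> S. r j x} < card {j \<in> S. r j y}" if "x \<in> S" "r x y" for x y
  proof (rule psubset_card_mono)
    have "{j \<in> S. r j x} \<subseteq> {j \<in> S. r j y}" using tr[OF _ that(2)] by blast
    moreover have "x \<in> {j \<in> S. r j y}" "x \<notin> {j \<in> S. r j x}" using that irr by auto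
    ultimately show "{j \<in> S. r j x} \<subset> {j \<in> S. r j y}" by blast
  qed (use fin in simp)
  have inj: "inj_on (\<lambda>i. card {j \<in> S. r j i}) S"
  proof (rule inj_onI, rule ccontr)
    fix x y assume xy: "x \<in> S" "y \<in> S" "card {j \<in> S. r j x} = card {j \<in> S. r j y}" "x \<noteq> y"
    then have "r x y \<or> r y x" using tot by blast
    then show False using less[of x y] less[of y x] xy by auto
  qed
  have "(\<lambda>i. card {j \<in> S. r j i}) ` S \<subseteq> {..<card S}"
  proof clarsimp
    fix i assume "i \<in> S"
    then have "{j \<in> S. r j i} \<subset> S" using irr by blast
    then show "card {j \<in> S. r j i} < card S" by (rule psubset_card_mono[OF fin])
  qed
  moreover have "card ((\<lambda>i. card {j \<in> S. r j i}) ` S) = card {..<card S}" using inj by (simp add: card_image)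
  ultimately have "(\<lambda>i. card {j \<in> S. r j i}) ` S = {..<card S}" by (intro card_subset_eq) auto
  then show ?thesis using inj by (simp add: bij_betw_def)
qed

text \<open>\<open>mi_nth\<close> inverts the map that counts lexicographic predecessors. After this
  the particular order is irrelevant: sums over matrix indices become sums over
  multi-indices.\<close>

lemma mi_nth_bij: "bij_betw (mi_nth n) {..<mi_size n} (mi_range n)"
  for n :: "'d::{finite,linorder} \<Rightarrow> nat"
proof -
  let ?f = "\<lambda>i. card {j \<in> mi_range n. less_fun j i}"
  have b: "bij_betw ?f (mi_range n) {..<mi_size n}"
    unfolding card_mi_range[symmetric]
    by (rule bij_betw_rank[OF finite_mi_range less_fun_irrefl less_fun_trans])
      (use less_fun_trichotomy[OF finite] in blast)+
  have "mi_nth n k = inv_into (mi_range n) ?f k" if "k \<in> {..<mi_size n}" for k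
    unfolding mi_nth_def
  proof (rule the_equality)
    have "inv_into (mi_range n) ?f k \<in> mi_range n"
      using bij_betw_inv_into[OF b] that by (auto simp: bij_betw_def)
    then show "inv_into (mi_range n) ?f k \<in> mi_range n \<and> ?f (inv_into (mi_range n) ?f k) = k"
      using bij_betw_inv_into_right[OF b that] by simp
    fix i assume i: "i \<in> mi_range n \<and> ?f i = k"
    then have "inv_into (mi_range n) ?f (?f i) = i" by (intro bij_betw_inv_into_left[OF b]) simp
    then show "i = inv_into (mi_range n) ?f k" using i by simp
  qed
  then show ?thesis using bij_betw_inv_into[OF b] by (subst bij_betw_cong) auto
qed

lemma mi_nth_in: "k < mi_size n \<Longrightarrow> mi_nth n k \<in> mi_range n"
  using mi_nth_bij[of n] by (auto simp: bij_betw_def)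

lemma mi_nth_eq_iff: "k < mi_size n \<Longrightarrow> l < mi_size n \<Longrightarrow> mi_nth n k = mi_nth n l \<longleftrightarrow> k = l"
  using mi_nth_bij[of n] by (auto simp: bij_betw_def inj_on_def)

lemma sum_mi_nth: "(\<Sum>k<mi_size n. g (mi_nth n k)) = (\<Sum>i\<in>mi_range n. g i)"
  by (rule sum.reindex_bij_betw[OF mi_nth_bij])

lemma mi_mat_carrier [simp]: "mi_mat n a \<in> carrier_mat (mi_size n) (mi_size n)"
  "dim_row (mi_mat n a) = mi_size n" "dim_col (mi_mat n a) = mi_size n"
  by (auto simp: mi_mat_def)

lemma mi_mat_index: "k < mi_size n \<Longrightarrow> l < mi_size n \<Longrightarrow> mi_mat n a $$ (k, l) = a (mi_nth n k) (mi_nth n l)"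
  by (simp add: mi_mat_def)

lemma mi_mat_cong: "(\<And>i j. i \<in> mi_range n \<Longrightarrow> j \<in> mi_range n \<Longrightarrow> a i j = b i j) \<Longrightarrow> mi_mat n a = mi_mat n b"
  by (rule eq_matI) (auto simp: mi_mat_index mi_nth_in)

lemma mi_mat_add: "mi_mat n a + mi_mat n b = mi_mat n (\<lambda>i j. a i j + b i j)"
  by (rule eq_matI) (auto simp: mi_mat_index)

lemma mi_mat_minus: "mi_mat n a - mi_mat n b = mi_mat n (\<lambda>i j. a i j - b i j)"
  by (rule eq_matI) (auto simp: mi_mat_index)

lemma mi_mat_smult: "c \<cdot>\<^sub>m mi_mat n a = mi_mat n (\<lambda>i j. c * a i j)"
  by (rule eq_matI) (auto simp: mi_mat_index)

lemma mi_mat_zero: "mi_mat n (\<lambda>_ _. 0) = 0\<^sub>m (mi_size n) (mi_size n)"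
  by (rule eq_matI) (auto simp: mi_mat_index)

lemma mi_mat_one: "mi_mat n (\<lambda>i j. if i = j then 1 else 0) = 1\<^sub>m (mi_size n)"
  by (rule eq_matI) (auto simp: mi_mat_index mi_nth_eq_iff)

lemma mi_mat_adj: "mat_adjoint (mi_mat n a) = mi_mat n (\<lambda>i j. cnj (a j i))"
  by (rule eq_matI) (auto simp: mi_mat_index)

lemma mi_mat_mult: "mi_mat n a * mi_mat n b = mi_mat n (\<lambda>i j. \<Sum>l\<in>mi_range n. a i l * b l j)"
proof (rule eq_matI)
  fix k l assume "k < dim_row (mi_mat n (\<lambda>i j. \<Sum>l\<in>mi_range n. a i l * b l j))"
    "l < dim_col (mi_mat n (\<lambda>i j. \<Sum>l\<in>mi_range n. a i l * b l j))"
  then have kl: "k < mi_size n" "l < mi_size n" by auto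
  have "(mi_mat n a * mi_mat n b) $$ (k, l) = (\<Sum>p<mi_size n. a (mi_nth n k) (mi_nth n p) * b (mi_nth n p) (mi_nth n l))"
    using kl by (subst index_mult_sum[of _ "mi_size n" "mi_size n" _ "mi_size n"]) (auto simp: mi_mat_index)
  also have "\<dots> = (\<Sum>p\<in>mi_range n. a (mi_nth n k) p * b p (mi_nth n l))" by (rule sum_mi_nth)
  finally show "(mi_mat n a * mi_mat n b) $$ (k, l) = mi_mat n (\<lambda>i j. \<Sum>l\<in>mi_range n. a i l * b l j) $$ (k, l)"
    using kl by (simp add: mi_mat_index)
qed auto

lemma mtrace_mi_mat: "mtrace (mi_mat n a) = (\<Sum>i\<in>mi_range n. a i i)"
proof -
  have "mtrace (mi_mat n a) = (\<Sum>k<mi_size n. a (mi_nth n k) (mi_nth n k))"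
    unfolding mtrace_def by (auto simp: mi_mat_index intro!: sum.cong)
  then show ?thesis using sum_mi_nth[of "\<lambda>i. a i i" n] by simp
qed

lemma frob2_mi_mat: "frob2 (mi_mat n a) = (\<Sum>i\<in>mi_range n. \<Sum>j\<in>mi_range n. (cmod (a i j))\<^sup>2)"
proof -
  have "frob2 (mi_mat n a) = (\<Sum>k<mi_size n. \<Sum>l<mi_size n. (cmod (a (mi_nth n k) (mi_nth n l)))\<^sup>2)"
    unfolding frob2_def by (auto simp: mi_mat_index intro!: sum.cong)
  also have "\<dots> = (\<Sum>k<mi_size n. \<Sum>j\<in>mi_range n. (cmod (a (mi_nth n k) j))\<^sup>2)"
    using sum_mi_nth[of "\<lambda>j. (cmod (a (mi_nth n _) j))\<^sup>2" n] by (intro sum.cong refl)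
  also have "\<dots> = (\<Sum>i\<in>mi_range n. \<Sum>j\<in>mi_range n. (cmod (a i j))\<^sup>2)" by (rule sum_mi_nth)
  finally show ?thesis .
qed

lemma nb_mi_mat:
  assumes "0 \<le> c" and row: "\<And>i. i \<in> mi_range n \<Longrightarrow> (\<Sum>j\<in>mi_range n. cmod (a i j)) \<le> c"
    and col: "\<And>j. j \<in> mi_range n \<Longrightarrow> (\<Sum>i\<in>mi_range n. cmod (a i j)) \<le> c"
  shows "nb (mi_mat n a) c"
proof (rule schur_test[OF mi_mat_carrier(1) assms(1)])
  fix i assume i: "i < mi_size n"
  have "(\<Sum>j<mi_size n. cmod (mi_mat n a $$ (i, j))) = (\<Sum>j<mi_size n. cmod (a (mi_nth n i) (mi_nth n j)))"
    using i by (intro sum.cong) (auto simp: mi_mat_index)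
  also have "\<dots> = (\<Sum>j\<in>mi_range n. cmod (a (mi_nth n i) j))" by (rule sum_mi_nth)
  finally show "(\<Sum>j<mi_size n. cmod (mi_mat n a $$ (i, j))) \<le> c" using row[OF mi_nth_in[OF i]] by simp
  have "(\<Sum>j<mi_size n. cmod (mi_mat n a $$ (j, i))) = (\<Sum>j<mi_size n. cmod (a (mi_nth n j) (mi_nth n i)))"
    using i by (intro sum.cong) (auto simp: mi_mat_index)
  also have "\<dots> = (\<Sum>j\<in>mi_range n. cmod (a j (mi_nth n i)))" by (rule sum_mi_nth)
  finally show "(\<Sum>j<mi_size n. cmod (mi_mat n a $$ (j, i))) \<le> c" using col[OF mi_nth_in[OF i]] by simp
qed

text \<open>The vector is carried over to multi-indices, where the block structure of the entries is
  visible; used for positivity in \<open>LT_psd\<close>.\<close>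

lemma quad_mi_mat:
  assumes x: "x \<in> carrier_vec (mi_size n)"
  shows "\<exists>\<xi>. (mi_mat n a *\<^sub>v x) \<bullet>c x = (\<Sum>i\<in>mi_range n. \<Sum>j\<in>mi_range n. a i j * \<xi> j * cnj (\<xi> i))"
proof -
  define \<xi> where "\<xi> i = x $ (inv_into {..<mi_size n} (mi_nth n) i)" for i
  have \<xi>: "\<xi> (mi_nth n k) = x $ k" if "k < mi_size n" for k
    using bij_betw_inv_into_left[OF mi_nth_bij[of n], of k] that by (simp add: \<xi>_def)
  have "(mi_mat n a *\<^sub>v x) \<bullet>c x = (\<Sum>k<mi_size n. \<Sum>l<mi_size n. a (mi_nth n k) (mi_nth n l) * \<xi> (mi_nth n l) * cnj (\<xi> (mi_nth n k)))"
    by (subst cscalar_sum[OF mult_mat_vec_carrier[OF mi_mat_carrier(1) x] x])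
      (auto simp: index_mult_vec_sum[OF mi_mat_carrier(1) x] mi_mat_index \<xi> sum_distrib_right simp del: index_mult_mat_vec intro!: sum.cong)
  also have "\<dots> = (\<Sum>k<mi_size n. \<Sum>j\<in>mi_range n. a (mi_nth n k) j * \<xi> j * cnj (\<xi> (mi_nth n k)))"
    by (intro sum.cong refl) (rule sum_mi_nth)
  also have "\<dots> = (\<Sum>i\<in>mi_range n. \<Sum>j\<in>mi_range n. a i j * \<xi> j * cnj (\<xi> i))" by (rule sum_mi_nth)
  finally show ?thesis by blast
qed

text \<open>Union bound over the coordinate that is responsible: each one contributes a product set
  in which only that coordinate is restricted.\<close>

lemma card_mi_bad:
  "card {i \<in> mi_range n. \<exists>j. P j (i j)} \<le> (\<Sum>j\<in>UNIV. card {t \<in> {1..n j}. P j t} * (\<Prod>l\<in>UNIV - {j}. n l))"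
  for n :: "'d::finite \<Rightarrow> nat"
proof -
  let ?B = "\<lambda>j. PiE UNIV (\<lambda>l. if l = j then {t \<in> {1..n j}. P j t} else {1..n l})"
  have "{i \<in> mi_range n. \<exists>j. P j (i j)} \<subseteq> (\<Union>j. ?B j)"
    unfolding mi_range_PiE by (auto simp: PiE_iff)
  then have "card {i \<in> mi_range n. \<exists>j. P j (i j)} \<le> card (\<Union>j. ?B j)"
    by (intro card_mono finite_UN_I finite_PiE) auto
  also have "\<dots> \<le> (\<Sum>j\<in>UNIV. card (?B j))" by (rule card_UN_le) simp
  also have "\<dots> = (\<Sum>j\<in>UNIV. card {t \<in> {1..n j}. P j t} * (\<Prod>l\<in>UNIV - {j}. n l))"
  proof (intro sum.cong refl)
    fix j
    have "card (?B j) = (\<Prod>l\<in>UNIV. card (if l = j then {t \<in> {1..n j}. P j t} else {1..n l}))" by (simp add: card_PiE)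
    also have "\<dots> = card {t \<in> {1..n j}. P j t} * (\<Prod>l\<in>UNIV - {j}. card (if l = j then {t \<in> {1..n j}. P j t} else {1..n l}))"
      by (subst prod.remove[of _ j]) auto
    also have "(\<Prod>l\<in>UNIV - {j}. card (if l = j then {t \<in> {1..n j}. P j t} else {1..n l})) = (\<Prod>l\<in>UNIV - {j}. n l)"
      by (intro prod.cong) auto
    finally show "card (?B j) = card {t \<in> {1..n j}. P j t} * (\<Prod>l\<in>UNIV - {j}. n l)" .
  qed
  finally show ?thesis .
qed

lemma card_mi_bad_frac:
  fixes n :: "'d::finite \<Rightarrow> nat"
  assumes b: "\<And>j. real (card {t \<in> {1..n j}. P j t}) \<le> c j * real (n j)"
  shows "real (card {i \<in> mi_range n. \<exists>j. P j (i j)}) \<le> (\<Sum>j\<in>UNIV. c j) * real (mi_size n)"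
proof -
  have "real (card {i \<in> mi_range n. \<exists>j. P j (i j)}) \<le> (\<Sum>j\<in>UNIV. real (card {t \<in> {1..n j}. P j t}) * real (\<Prod>l\<in>UNIV - {j}. n l))"
    using of_nat_mono[OF card_mi_bad[of n P], where 'a = real] by simp
  also have "\<dots> \<le> (\<Sum>j\<in>UNIV. c j * real (n j) * real (\<Prod>l\<in>UNIV - {j}. n l))"
    by (intro sum_mono mult_right_mono b) (auto intro: prod_nonneg)
  also have "\<dots> = (\<Sum>j\<in>UNIV. c j * real (mi_size n))"
  proof (intro sum.cong refl)
    fix j
    have "mi_size n = n j * (\<Prod>l\<in>UNIV - {j}. n l)" unfolding mi_size_def by (subst prod.remove[of _ j]) auto
    then show "c j * real (n j) * real (\<Prod>l\<in>UNIV - {j}. n l) = c j * real (mi_size n)"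
      by (simp add: mult.assoc)
  qed
  finally show ?thesis by (simp add: sum_distrib_right)
qed

section \<open>Riemann sums over cells\<close>

lemma mi_pos: "\<forall>j. 1 \<le> m j \<Longrightarrow> 0 < real (m j)"
proof -
  assume "\<forall>j. 1 \<le> m j"
  then have "1 \<le> m j" by blast
  then show "0 < real (m j)" by linarith
qed

text \<open>The cells with \<open>a\<close> in \<open>mi_range m\<close> tile the unit cube; the
  upper corner \<open>a / m\<close> is the sampling point of LT operators.\<close>

definition cell :: "('d::finite \<Rightarrow> nat) \<Rightarrow> ('d \<Rightarrow> nat) \<Rightarrow> (real ^ 'd) set" where
  "cell m a = cbox (\<chi> j. (real (a j) - 1) / real (m j)) (\<chi> j. real (a j) / real (m j))"

lemma mem_cell: "x \<in> cell m a \<longleftrightarrow> (\<forall>j. (real (a j) - 1) / real (m j) \<le> vec_nth x j \<and> vec_nth x j \<le> real (a j) / real (m j))"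
  by (auto simp: cell_def mem_box_cart)

lemma mem_unit_cube: "x \<in> unit_cube \<longleftrightarrow> (\<forall>j. 0 \<le> vec_nth x j \<and> vec_nth x j \<le> 1)"
  by (auto simp: unit_cube_def mem_box_cart)

lemma interior_cell: "interior (cell m a) = {x. \<forall>j. (real (a j) - 1) / real (m j) < vec_nth x j \<and> vec_nth x j < real (a j) / real (m j)}"
  by (auto simp: cell_def interior_cbox mem_box_cart)

lemma cell_interiors_disjoint:
  assumes m: "\<forall>j. 1 \<le> m j" and ab: "a \<noteq> b"
  shows "interior (cell m a) \<inter> interior (cell m b) = {}"
proof (rule ccontr)
  assume "interior (cell m a) \<inter> interior (cell m b) \<noteq> {}"
  then obtain x where x: "x \<in> interior (cell m a)" "x \<in> interior (cell m b)" by blast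
  obtain j where j: "a j \<noteq> b j" using ab by blast
  have mj: "0 < real (m j)" using mi_pos[OF m] by blast
  have "real (a j) - 1 < vec_nth x j * real (m j)" "vec_nth x j * real (m j) < real (a j)"
    "real (b j) - 1 < vec_nth x j * real (m j)" "vec_nth x j * real (m j) < real (b j)"
  proof -
    have "(real (a j) - 1) / real (m j) < vec_nth x j" "vec_nth x j < real (a j) / real (m j)"
      "(real (b j) - 1) / real (m j) < vec_nth x j" "vec_nth x j < real (b j) / real (m j)"
      using x unfolding interior_cell by blast+
    then show "real (a j) - 1 < vec_nth x j * real (m j)" "vec_nth x j * real (m j) < real (a j)"
    "real (b j) - 1 < vec_nth x j * real (m j)" "vec_nth x j * real (m j) < real (b j)"
      using mj by (simp_all add: pos_divide_less_eq pos_less_divide_eq)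
  qed
  then have "real (a j) - 1 < real (b j)" "real (b j) - 1 < real (a j)" by linarith+
  then have "a j = b j" by linarith
  with j show False by blast
qed

text \<open>An explicit interior point: it makes the volume formula applicable and, with
  disjointness of the interiors, \<open>cell m\<close> injective.\<close>

lemma center_in_cell:
  assumes m: "\<forall>j. 1 \<le> m j"
  shows "(\<chi> j. (real (a j) - 1/2) / real (m j)) \<in> interior (cell m a)"
proof -
  have "0 < real (m j)" for j using mi_pos[OF m] by blast
  then show ?thesis by (auto simp: interior_cell divide_strict_right_mono)
qed

lemma cell_inj: "\<forall>j. 1 \<le> m j \<Longrightarrow> inj (cell m)"
  using center_in_cell[of m] cell_interiors_disjoint[of m] by (intro injI) (metis disjoint_iff)

lemma measure_cell:
  assumes m: "\<forall>j. 1 \<le> m j"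
  shows "measure lborel (cell m a) = 1 / real (mi_size m)"
proof -
  have mj: "0 < real (m j)" for j using mi_pos[OF m] by blast
  have ne: "cell m a \<noteq> {}" using center_in_cell[OF m] interior_subset by blast
  have "measure lborel (cell m a) = (\<Prod>j\<in>UNIV. real (a j) / real (m j) - (real (a j) - 1) / real (m j))"
    using content_cbox_cart[OF ne[unfolded cell_def]] by (simp add: cell_def)
  also have "\<dots> = (\<Prod>j\<in>UNIV. 1 / real (m j))"
    by (intro prod.cong refl) (simp add: diff_divide_distrib[symmetric])
  also have "\<dots> = 1 / real (mi_size m)" by (simp add: mi_size_def prod_dividef)
  finally show ?thesis .
qed

lemma cell_subset: "a \<in> mi_range m \<Longrightarrow> cell m a \<subseteq> unit_cube"
proof
  fix x assume a: "a \<in> mi_range m" and x: "x \<in> cell m a"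
  show "x \<in> unit_cube" unfolding mem_unit_cube
  proof (intro allI conjI)
    fix j
    have aj: "1 \<le> a j" "a j \<le> m j" using a by (auto simp: mi_range_iff)
    have "0 \<le> (real (a j) - 1) / real (m j)" using aj by simp
    then show "0 \<le> vec_nth x j" using x unfolding mem_cell by (meson order_trans)
    have "real (a j) / real (m j) \<le> 1" using aj by (simp add: divide_le_eq_1)
    then show "vec_nth x j \<le> 1" using x unfolding mem_cell by (meson order_trans)
  qed
qed

lemma unit_cube_cells:
  assumes m: "\<forall>j. 1 \<le> m j" and x: "x \<in> unit_cube"
  shows "\<exists>a\<in>mi_range m. x \<in> cell m a"
proof -
  \<comment> \<open>On a face of the cube where a coordinate vanishes the ceiling is 0, outside the
    index range, so the first cell is taken instead.\<close>
  define a where "a j = (if vec_nth x j = 0 then 1 else nat \<lceil>real (m j) * vec_nth x j\<rceil>)" for j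
  have *: "1 \<le> a j \<and> a j \<le> m j \<and> (real (a j) - 1) / real (m j) \<le> vec_nth x j \<and> vec_nth x j \<le> real (a j) / real (m j)" for j
  proof -
    have mj: "0 < real (m j)" "1 \<le> m j" using mi_pos[OF m] m by auto
    have xj: "0 \<le> vec_nth x j" "vec_nth x j \<le> 1" using x by (auto simp: mem_unit_cube)
    show ?thesis
    proof (cases "vec_nth x j = 0")
      case True then show ?thesis using mj by (simp add: a_def)
    next
      case False
      then have p: "0 < real (m j) * vec_nth x j" using xj mj by simp
      have ra: "real (a j) = of_int \<lceil>real (m j) * vec_nth x j\<rceil>" using False p by (simp add: a_def)
      have c: "real (m j) * vec_nth x j \<le> real (a j)" "real (a j) < real (m j) * vec_nth x j + 1"
        unfolding ra by linarith+
      have "0 < real (a j)" using p c by linarith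
      moreover have "real (m j) * vec_nth x j \<le> real (m j)" using xj mj by (simp add: mult_left_le)
      then have "real (a j) < real (m j) + 1" using c by linarith
      ultimately show ?thesis using c mj by (auto simp: field_simps)
    qed
  qed
  then show ?thesis by (intro bexI[of _ a]) (auto simp: mem_cell mi_range_iff)
qed

lemma cells_tagged_division:
  assumes m: "\<forall>j. 1 \<le> m j" and t: "\<And>a. a \<in> mi_range m \<Longrightarrow> t a \<in> cell m a"
  shows "(\<lambda>a. (t a, cell m a)) ` mi_range m tagged_division_of unit_cube"
proof (rule tagged_division_ofI)
  show "finite ((\<lambda>a. (t a, cell m a)) ` mi_range m)" by simp
  show "\<And>x K. (x, K) \<in> (\<lambda>a. (t a, cell m a)) ` mi_range m \<Longrightarrow> x \<in> K" using t by auto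
  show "\<And>x K. (x, K) \<in> (\<lambda>a. (t a, cell m a)) ` mi_range m \<Longrightarrow> K \<subseteq> unit_cube" using cell_subset by blast
  show "\<And>x K. (x, K) \<in> (\<lambda>a. (t a, cell m a)) ` mi_range m \<Longrightarrow> \<exists>a b. K = cbox a b" unfolding cell_def by blast
  {
    fix x1 K1 x2 K2 assume *: "(x1, K1) \<in> (\<lambda>a. (t a, cell m a)) ` mi_range m"
     "(x2, K2) \<in> (\<lambda>a. (t a, cell m a)) ` mi_range m" "(x1, K1) \<noteq> (x2, K2)"
    then obtain a b where ab: "x1 = t a" "K1 = cell m a" "x2 = t b" "K2 = cell m b" by blast
    then have "a \<noteq> b" using *(3) by blast
    then show "interior K1 \<inter> interior K2 = {}" unfolding ab by (rule cell_interiors_disjoint[OF m])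
  }
  show "\<Union>{K. \<exists>x. (x, K) \<in> (\<lambda>a. (t a, cell m a)) ` mi_range m} = unit_cube"
  proof -
    have "{K. \<exists>x. (x, K) \<in> (\<lambda>a. (t a, cell m a)) ` mi_range m} = cell m ` mi_range m" by auto
    moreover have "(\<Union>a\<in>mi_range m. cell m a) \<subseteq> unit_cube" using cell_subset by (intro UN_least)
    moreover have "unit_cube \<subseteq> (\<Union>a\<in>mi_range m. cell m a)" using unit_cube_cells[OF m] by (intro subsetI UN_iff[THEN iffD2])
    ultimately show ?thesis by simp
  qed
qed

lemma cells_sum:
  fixes v :: "real ^ 'd::finite \<Rightarrow> complex"
  assumes m: "\<forall>j. 1 \<le> m j"
  shows "(\<Sum>(x, K)\<in>(\<lambda>a. (t a, cell m a)) ` mi_range m. measure lborel K *\<^sub>R v x) = (1 / real (mi_size m)) *\<^sub>R (\<Sum>a\<in>mi_range m. v (t a))"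
proof -
  have "inj_on (\<lambda>a. (t a, cell m a)) (mi_range m)" using cell_inj[OF m] by (auto intro!: inj_onI dest: injD)
  then have "(\<Sum>(x, K)\<in>(\<lambda>a. (t a, cell m a)) ` mi_range m. measure lborel K *\<^sub>R v x)
      = (\<Sum>a\<in>mi_range m. (1 / real (mi_size m)) *\<^sub>R v (t a))"
    by (simp add: sum.reindex measure_cell[OF m])
  then show ?thesis by (simp only: scaleR_right.sum)
qed

lemma diameter_cell:
  assumes m: "\<forall>j. 1 \<le> m j"
  shows "diameter (cell m a) \<le> (\<Sum>j\<in>UNIV. 1 / real (m j))"
proof (rule diameter_le)
  show "cell m a \<noteq> {} \<or> 0 \<le> (\<Sum>j\<in>UNIV. 1 / real (m j))" by (auto intro: sum_nonneg)
  fix x y assume x: "x \<in> cell m a" and y: "y \<in> cell m a"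
  have "norm (x - y) \<le> (\<Sum>j\<in>UNIV. \<bar>vec_nth (x - y) j\<bar>)" by (rule norm_le_l1_cart)
  also have "\<dots> \<le> (\<Sum>j\<in>UNIV. 1 / real (m j))"
  proof (rule sum_mono)
    fix j
    have "(real (a j) - 1) / real (m j) \<le> vec_nth x j" "vec_nth x j \<le> real (a j) / real (m j)"
      "(real (a j) - 1) / real (m j) \<le> vec_nth y j" "vec_nth y j \<le> real (a j) / real (m j)"
      using x y by (auto simp: mem_cell)
    moreover have "real (a j) / real (m j) = (real (a j) - 1) / real (m j) + 1 / real (m j)"
      by (simp add: diff_divide_distrib)
    ultimately show "\<bar>vec_nth (x - y) j\<bar> \<le> 1 / real (m j)" by (simp add: abs_le_iff)
  qed
  finally show "norm (x - y) \<le> (\<Sum>j\<in>UNIV. 1 / real (m j))" .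
qed

text \<open>The mesh condition for the uniform grid, with tags left free; freedom in the tags is
  what \<open>riemann_bad_cells\<close> exploits.\<close>

lemma riemann_cells:
  fixes v :: "real ^ 'd::finite \<Rightarrow> complex"
  assumes R: "\<forall>p. p tagged_division_of unit_cube \<and> (\<forall>(x, K)\<in>p. diameter K < \<delta>) \<longrightarrow>
      norm ((\<Sum>(x, K)\<in>p. measure lborel K *\<^sub>R v x) - y) < e"
    and m: "\<forall>j. 1 \<le> m j" and t: "\<And>a. a \<in> mi_range m \<Longrightarrow> t a \<in> cell m a" and \<delta>: "(\<Sum>j\<in>UNIV. 1 / real (m j)) < \<delta>"
  shows "norm ((1 / real (mi_size m)) *\<^sub>R (\<Sum>a\<in>mi_range m. v (t a)) - y) < e"
  unfolding cells_sum[OF m, where t = t and v = v, symmetric]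
proof (rule R[THEN spec, THEN mp], rule conjI)
  show "(\<lambda>a. (t a, cell m a)) ` mi_range m tagged_division_of unit_cube"
    by (rule cells_tagged_division[OF m t])
  show "\<forall>(x, K)\<in>(\<lambda>a. (t a, cell m a)) ` mi_range m. diameter K < \<delta>"
  proof clarify
    fix a
    show "diameter (cell m a) < \<delta>" using diameter_cell[OF m, of a] \<delta> by linarith
  qed
qed

lemma measure_cbox_const:
  "a \<le> b \<Longrightarrow> measure lborel (cbox (\<chi> j. a) (\<chi> j. b) :: (real ^ 'd::finite) set) = (b - a) ^ CARD('d)"
  by (subst content_cbox_cart) (auto simp: interval_ne_empty_cart)

lemma emeasure_cbox_const:
  assumes "a \<le> b"
  shows "emeasure lebesgue (cbox (\<chi> j. a) (\<chi> j. b) :: (real ^ 'd::finite) set) = ennreal ((b - a) ^ CARD('d))"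
  using emeasure_eq_ennreal_measure[of lborel "cbox (\<chi> j. a) (\<chi> j. b) :: (real ^ 'd) set"]
  by (simp add: measure_cbox_const[OF assms] emeasure_lborel_cbox_eq)

lemma emeasure_angle_cube: "emeasure lebesgue (angle_cube :: (real ^ 'd::finite) set) = ennreal ((2 * pi) ^ CARD('d))"
  unfolding angle_cube_def by (subst emeasure_cbox_const) auto

lemma emeasure_unit_cube: "emeasure lebesgue (unit_cube :: (real ^ 'd::finite) set) = 1"
  unfolding unit_cube_def by (subst emeasure_cbox_const) auto

text \<open>By uniform continuity \<open>v\<close> varies by at most \<open>e / 2\<close> on each
  piece, and the volumes of the pieces sum to 1.\<close>

lemma continuous_riemann:
  fixes v :: "real ^ 'd::finite \<Rightarrow> complex"
  assumes v: "continuous_on unit_cube v" and e: "0 < e"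
  shows "\<exists>\<delta>>0. \<forall>p. p tagged_division_of unit_cube \<and> (\<forall>(x, K)\<in>p. diameter K < \<delta>) \<longrightarrow>
      norm ((\<Sum>(x, K)\<in>p. measure lborel K *\<^sub>R v x) - integral unit_cube v) < e"
proof -
  have comp: "compact (unit_cube :: (real ^ 'd) set)" by (simp add: unit_cube_def)
  have "uniformly_continuous_on unit_cube v" by (rule compact_uniformly_continuous[OF v comp])
  then obtain \<delta> where \<delta>: "0 < \<delta>" "\<And>x x'. x \<in> unit_cube \<Longrightarrow> x' \<in> unit_cube \<Longrightarrow> dist x' x < \<delta> \<Longrightarrow> dist (v x') (v x) < e / 2"
    unfolding uniformly_continuous_on_def using half_gt_zero[OF e] by blast
  show ?thesis
  proof (intro exI[of _ \<delta>] conjI allI impI \<delta>(1))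
    fix p :: "((real ^ 'd) \<times> (real ^ 'd) set) set"
    assume *: "p tagged_division_of unit_cube \<and> (\<forall>(x, K)\<in>p. diameter K < \<delta>)"
    then have p: "p tagged_division_of unit_cube" and d: "\<And>x K. (x, K) \<in> p \<Longrightarrow> diameter K < \<delta>" by auto
    have int: "v integrable_on unit_cube" using v unfolding unit_cube_def by (rule integrable_continuous)
    have "integral unit_cube v = (\<Sum>(x, K)\<in>p. integral K v)"
      using integral_combine_tagged_division_topdown[OF int[unfolded unit_cube_def] p[unfolded unit_cube_def]]
      by (simp add: unit_cube_def)
    then have "norm ((\<Sum>(x, K)\<in>p. measure lborel K *\<^sub>R v x) - integral unit_cube v)
       = norm (\<Sum>(x, K)\<in>p. measure lborel K *\<^sub>R v x - integral K v)" by (simp add: sum_subtractf case_prod_unfold)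
    also have "\<dots> \<le> (\<Sum>(x, K)\<in>p. (e / 2) * measure lborel K)"
    proof (rule sum_norm_le, clarify)
      fix x K assume xK: "(x, K) \<in> p"
      obtain a b where K: "K = cbox a b" "x \<in> K" "K \<subseteq> unit_cube" using tagged_division_ofD[OF p] xK by metis
      have hi: "((\<lambda>y. v x - v y) has_integral (measure lborel K *\<^sub>R v x - integral K v)) (cbox a b)"
        unfolding K(1)
        by (intro has_integral_diff has_integral_const integrable_integral integrable_continuous continuous_on_subset[OF v])
          (use K in auto)
      have bd: "norm (v x - v y) \<le> e / 2" if "y \<in> cbox a b" for y
      proof -
        have "dist y x \<le> diameter K" unfolding dist_commute[of y]
          using K that by (intro diameter_bounded_bound) auto
        then have "dist y x < \<delta>" using d[OF xK] by linarith
        moreover have "x \<in> unit_cube" "y \<in> unit_cube" using K that by auto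
        ultimately show ?thesis using \<delta>(2)[of x y] by (simp add: dist_norm norm_minus_commute)
      qed
      show "norm (measure lborel K *\<^sub>R v x - integral K v) \<le> e / 2 * measure lborel K"
        using has_integral_bound[OF _ hi bd] e unfolding K(1) by simp
    qed
    also have "\<dots> = (e / 2) * (\<Sum>(x, K)\<in>p. measure lborel K)" by (simp add: sum_distrib_left case_prod_unfold)
    also have "(\<Sum>(x, K)\<in>p. measure lborel K) = 1"
      using additive_content_tagged_division[OF p[unfolded unit_cube_def]] by (simp add: measure_cbox_const)
    also have "e / 2 * 1 < e" using e by simp
    finally show "norm ((\<Sum>(x, K)\<in>p. measure lborel K *\<^sub>R v x) - integral unit_cube v) < e" .
  qed
qed

lemma continuous_riemann_integrable: "continuous_on unit_cube v \<Longrightarrow> riemann_integrable_on v unit_cube"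
  for v :: "real ^ 'd::finite \<Rightarrow> complex"
  unfolding riemann_integrable_on_def
  by (intro exI[of _ "integral unit_cube v"] allI impI continuous_riemann)

text \<open>Convergence along the mesh is convergence along constant gauges, and gauge-integrable
  functions are Lebesgue measurable.\<close>

lemma riemann_integrable_measurable:
  fixes v :: "real ^ 'd::finite \<Rightarrow> complex"
  assumes "riemann_integrable_on v unit_cube"
  shows "v \<in> borel_measurable (lebesgue_on unit_cube)"
proof -
  obtain y where y: "\<forall>e>0. \<exists>\<delta>>0. \<forall>p. p tagged_division_of unit_cube \<and> (\<forall>(x, K)\<in>p. diameter K < \<delta>) \<longrightarrow>
        norm ((\<Sum>(x, K)\<in>p. measure lborel K *\<^sub>R v x) - y) < e"
    using assms unfolding riemann_integrable_on_def by (rule exE)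
  have "(v has_integral y) unit_cube"
    unfolding unit_cube_def has_integral
  proof (intro allI impI)
    fix e :: real assume "0 < e"
    obtain \<delta> where \<delta>: "\<delta> > 0" "\<forall>p. p tagged_division_of unit_cube \<and> (\<forall>(x, K)\<in>p. diameter K < \<delta>) \<longrightarrow>
        norm ((\<Sum>(x, K)\<in>p. measure lborel K *\<^sub>R v x) - y) < e"
      using y[rule_format, OF \<open>0 < e\<close>] by (elim exE conjE)
    show "\<exists>\<gamma>. gauge \<gamma> \<and> (\<forall>\<D>. \<D> tagged_division_of cbox (\<chi> j. 0) (\<chi> j. 1) \<and> \<gamma> fine \<D> \<longrightarrow>
       norm ((\<Sum>(x, k)\<in>\<D>. measure lborel k *\<^sub>R v x) - y) < e)"
    \<comment> \<open>A set inside a ball of radius \<open>\<delta> / 4\<close> has diameter at most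
      \<open>\<delta> / 2\<close>.\<close>
    proof (intro exI[of _ "\<lambda>x. ball x (\<delta> / 4)"] conjI allI impI)
      show "gauge (\<lambda>x :: real ^ 'd. ball x (\<delta> / 4))" using \<delta>(1) by (simp add: gauge_ball_dependent)
      fix \<D> :: "((real ^ 'd) \<times> (real ^ 'd) set) set"
      assume *: "\<D> tagged_division_of cbox (\<chi> j. 0) (\<chi> j. 1) \<and> (\<lambda>x. ball x (\<delta> / 4)) fine \<D>"
      have "diameter K < \<delta>" if "(x, K) \<in> \<D>" for x K
      proof -
        have "K \<subseteq> ball x (\<delta> / 4)" using * that by (auto simp: fine_def)
        then have "diameter K \<le> diameter (ball x (\<delta> / 4))" by (intro diameter_subset) auto
        also have "\<dots> < \<delta>" using \<delta>(1) by (simp add: diameter_ball)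
        finally show ?thesis .
      qed
      then show "norm ((\<Sum>(x, k)\<in>\<D>. measure lborel k *\<^sub>R v x) - y) < e"
        using \<delta>(2)[rule_format, of \<D>] * by (auto simp: unit_cube_def)
    qed
  qed
  then have "(\<lambda>x. indicator unit_cube x *\<^sub>R v x) \<in> lebesgue \<rightarrow>\<^sub>M borel"
    by (rule has_integral_implies_lebesgue_measurable)
  then show ?thesis by (subst borel_measurable_restrict_space_iff) (auto simp: unit_cube_def)
qed

section \<open>Sums of diagonal matrices times shifts\<close>

lemma eventually_at_top_in: "eventually P (at_top_in I) \<longleftrightarrow> (\<exists>N. \<forall>n\<in>I. N \<le> n \<longrightarrow> P n)"
  unfolding at_top_in_def eventually_inf_principal eventually_at_top_linorder by blast

definition mi_diff :: "('d \<Rightarrow> nat) \<Rightarrow> ('d \<Rightarrow> nat) \<Rightarrow> 'd \<Rightarrow> int" where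
  "mi_diff i j = (\<lambda>l. int (i l) - int (j l))"

text \<open>The index \<open>i - k\<close>; \<open>nat\<close> cuts off negative components, so it
  is the true difference exactly under the bounds recorded by \<open>inb\<close>.\<close>

definition shift :: "('d \<Rightarrow> nat) \<Rightarrow> ('d \<Rightarrow> int) \<Rightarrow> 'd \<Rightarrow> nat" where
  "shift i k = (\<lambda>l. nat (int (i l) - k l))"

definition inb :: "('d \<Rightarrow> nat) \<Rightarrow> ('d \<Rightarrow> nat) \<Rightarrow> ('d \<Rightarrow> int) \<Rightarrow> bool" where
  "inb n i k \<longleftrightarrow> (\<forall>l. 1 \<le> int (i l) - k l \<and> int (i l) - k l \<le> int (n l))"

lemma mi_diff_eq_iff: "j \<in> mi_range n \<Longrightarrow> mi_diff i j = k \<longleftrightarrow> inb n i k \<and> j = shift i k"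
proof -
  assume j: "j \<in> mi_range n"
  have "int (i l) - int (j l) = k l \<longleftrightarrow> (1 \<le> int (i l) - k l \<and> int (i l) - k l \<le> int (n l)) \<and> j l = nat (int (i l) - k l)" for l
    using j[unfolded mi_range_iff, rule_format, of l] by auto
  then show ?thesis unfolding mi_diff_def inb_def shift_def fun_eq_iff by blast
qed

lemma inb_shift: "inb n i k \<Longrightarrow> shift i k \<in> mi_range n"
  unfolding inb_def shift_def mi_range_iff
proof (intro allI)
  fix l assume "\<forall>l. 1 \<le> int (i l) - k l \<and> int (i l) - k l \<le> int (n l)"
  then have "1 \<le> int (i l) - k l \<and> int (i l) - k l \<le> int (n l)" by blast
  then show "1 \<le> nat (int (i l) - k l) \<and> nat (int (i l) - k l) \<le> n l" by linarith
qed

text \<open>A row has at most one column at difference \<open>k\<close>, and none if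
  \<open>i - k\<close> leaves the index range.\<close>

lemma sum_diff_eq:
  "(\<Sum>j\<in>mi_range n. if mi_diff i j = k then g j else 0) = (if inb n i k then g (shift i k) else (0 :: 'a :: comm_monoid_add))"
proof -
  have "(\<Sum>j\<in>mi_range n. if mi_diff i j = k then g j else 0) = (\<Sum>j\<in>mi_range n. if shift i k = j then (if inb n i k then g j else 0) else 0)"
    by (intro sum.cong) (auto simp: mi_diff_eq_iff)
  also have "\<dots> = (if inb n i k then g (shift i k) else 0)"
    using inb_shift[of n i k] by (simp add: sum.delta)
  finally show ?thesis .
qed

lemma mi_diff_sym: "mi_diff j i = k \<longleftrightarrow> mi_diff i j = (\<lambda>l. - k l)"
  unfolding mi_diff_def fun_eq_iff by (metis minus_diff_eq minus_minus)

text \<open>The diagonal matrix of \<open>h\<close> times the shift by \<open>k\<close>;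
  \<open>h\<close> is evaluated at the row index.\<close>

definition single :: "('d::{finite,linorder} \<Rightarrow> nat) \<Rightarrow> ('d \<Rightarrow> int) \<Rightarrow> (('d \<Rightarrow> nat) \<Rightarrow> complex) \<Rightarrow> complex Matrix.mat" where
  "single n k h = mi_mat n (\<lambda>i j. if mi_diff i j = k then h i else 0)"

lemma single_carrier [simp]: "single n k h \<in> carrier_mat (mi_size n) (mi_size n)"
  "dim_row (single n k h) = mi_size n" "dim_col (single n k h) = mi_size n"
  by (auto simp: single_def)

lemma single_minus: "single n k h - single n k h' = single n k (\<lambda>i. h i - h' i)"
  unfolding single_def mi_mat_minus by (rule mi_mat_cong) auto

lemma frob2_single: "frob2 (single n k h) \<le> (\<Sum>i\<in>mi_range n. (cmod (h i))\<^sup>2)"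
  unfolding single_def frob2_mi_mat
proof (rule sum_mono)
  fix i
  have "(\<Sum>j\<in>mi_range n. (cmod (if mi_diff i j = k then h i else 0))\<^sup>2) = (\<Sum>j\<in>mi_range n. if mi_diff i j = k then (cmod (h i))\<^sup>2 else 0)"
    by (intro sum.cong) auto
  also have "\<dots> \<le> (cmod (h i))\<^sup>2" unfolding sum_diff_eq by simp
  finally show "(\<Sum>j\<in>mi_range n. (cmod (if mi_diff i j = k then h i else 0))\<^sup>2) \<le> (cmod (h i))\<^sup>2" .
qed

text \<open>Transposition turns the row index of an entry into its column index, so \<open>h\<close>
  is read off at the shifted index.\<close>

lemma single_adj: "mat_adjoint (single n k h) = single n (\<lambda>l. - k l) (\<lambda>i. cnj (h (shift i (\<lambda>l. - k l))))"
  unfolding single_def mi_mat_adj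
proof (rule mi_mat_cong)
  fix i j assume "i \<in> mi_range n" "j \<in> mi_range n"
  then show "cnj (if mi_diff j i = k then h j else 0) = (if mi_diff i j = (\<lambda>l. - k l) then cnj (h (shift i (\<lambda>l. - k l))) else 0)"
    unfolding mi_diff_sym[of j i k] using mi_diff_eq_iff[of j n i "\<lambda>l. - k l"] by auto
qed

text \<open>Two deviations from the product of the symbols appear: \<open>g\<close> is taken at the
  shifted index, and rows whose intermediate index leaves the range are lost.\<close>

lemma single_mult:
  "single n k h * single n m g = single n (\<lambda>l. k l + m l) (\<lambda>i. if inb n i k then h i * g (shift i k) else 0)"
  unfolding single_def mi_mat_mult
proof (rule mi_mat_cong)
  fix i j assume i: "i \<in> mi_range n" and j: "j \<in> mi_range n"
  have "(\<Sum>l\<in>mi_range n. (if mi_diff i l = k then h i else 0) * (if mi_diff l j = m then g l else 0))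
     = (\<Sum>l\<in>mi_range n. if mi_diff i l = k then h i * (if mi_diff l j = m then g l else 0) else 0)"
    by (intro sum.cong) auto
  also have "\<dots> = (if inb n i k then h i * (if mi_diff (shift i k) j = m then g (shift i k) else 0) else 0)"
    by (rule sum_diff_eq)
  also have "\<dots> = (if mi_diff i j = (\<lambda>l. k l + m l) then (if inb n i k then h i * g (shift i k) else 0) else 0)"
  proof (cases "inb n i k")
    case True
    then have "int (shift i k l) = int (i l) - k l" for l
      unfolding inb_def shift_def by (metis (no_types) int_nat_eq not_one_le_zero order_trans zero_le_one)
    then have "mi_diff (shift i k) j = m \<longleftrightarrow> mi_diff i j = (\<lambda>l. k l + m l)"
      unfolding mi_diff_def fun_eq_iff by (auto simp: algebra_simps)
    then show ?thesis using True by auto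
  qed auto
  finally show "(\<Sum>l\<in>mi_range n. (if mi_diff i l = k then h i else 0) * (if mi_diff l j = m then g l else 0))
     = (if mi_diff i j = (\<lambda>l. k l + m l) then (if inb n i k then h i * g (shift i k) else 0) else 0)" .
qed

lemma nb_single:
  assumes "\<And>i. i \<in> mi_range n \<Longrightarrow> cmod (h i) \<le> c" and "0 \<le> c"
  shows "nb (single n k h) c"
  unfolding single_def
proof (rule nb_mi_mat[OF assms(2)])
  fix i assume i: "i \<in> mi_range n"
  have "(\<Sum>j\<in>mi_range n. cmod (if mi_diff i j = k then h i else 0)) = (\<Sum>j\<in>mi_range n. if mi_diff i j = k then cmod (h i) else 0)"
    by (intro sum.cong) auto
  also have "\<dots> \<le> c" unfolding sum_diff_eq using assms i by auto
  finally show "(\<Sum>j\<in>mi_range n. cmod (if mi_diff i j = k then h i else 0)) \<le> c" .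
  have "(\<Sum>j\<in>mi_range n. cmod (if mi_diff j i = k then h j else 0)) \<le> (\<Sum>j\<in>mi_range n. if mi_diff i j = (\<lambda>l. - k l) then c else 0)"
    unfolding mi_diff_sym[of _ i k] using assms by (intro sum_mono) auto
  also have "\<dots> \<le> c" unfolding sum_diff_eq using assms(2) by auto
  finally show "(\<Sum>j\<in>mi_range n. cmod (if mi_diff j i = k then h j else 0)) \<le> c" .
qed

lemma mtrace_single: "mtrace (single n k h) = (if k = (\<lambda>_. 0) then (\<Sum>i\<in>mi_range n. h i) else 0)"
proof -
  have "mi_diff i i = (\<lambda>_. 0)" for i :: "'a \<Rightarrow> nat" by (simp add: mi_diff_def)
  then show ?thesis unfolding single_def mtrace_mi_mat by auto
qed

definition pt :: "('d::finite \<Rightarrow> nat) \<Rightarrow> ('d \<Rightarrow> nat) \<Rightarrow> real ^ 'd" where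
  "pt n i = (\<chi> l. real (i l) / real (n l))"

lemma pt_in: "i \<in> mi_range n \<Longrightarrow> pt n i \<in> unit_cube"
proof -
  assume i: "i \<in> mi_range n"
  have "0 \<le> real (i l) / real (n l) \<and> real (i l) / real (n l) \<le> 1" for l
    using i[unfolded mi_range_iff, rule_format, of l] by (simp add: divide_le_eq_1)
  then show ?thesis by (simp add: pt_def mem_unit_cube)
qed

lemma pt_in_cell: "i \<in> mi_range n \<Longrightarrow> pt n i \<in> cell n i"
  by (auto simp: pt_def mem_cell divide_right_mono)

text \<open>In coordinate \<open>j\<close> the difference leaves the range for at most
  \<open>|k j|\<close> indices, all at one end.\<close>

lemma card_not_inb:
  fixes n :: "'d::finite \<Rightarrow> nat"
  assumes n: "\<forall>j. 1 \<le> n j"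
  shows "real (card {i \<in> mi_range n. \<not> inb n i k}) \<le> (\<Sum>j\<in>UNIV. \<bar>real_of_int (k j)\<bar> / real (n j)) * real (mi_size n)"
proof -
  have "{i \<in> mi_range n. \<not> inb n i k} = {i \<in> mi_range n. \<exists>j. \<not> (1 \<le> int (i j) - k j \<and> int (i j) - k j \<le> int (n j))}"
    by (auto simp: inb_def)
  moreover have "real (card {t \<in> {1..n j}. \<not> (1 \<le> int t - k j \<and> int t - k j \<le> int (n j))}) \<le> \<bar>real_of_int (k j)\<bar> / real (n j) * real (n j)" for j
  proof -
    have "card {t \<in> {1..n j}. \<not> (1 \<le> int t - k j \<and> int t - k j \<le> int (n j))} \<le> nat \<bar>k j\<bar>"
    proof (cases "0 \<le> k j")
      case True
      have "card {t \<in> {1..n j}. \<not> (1 \<le> int t - k j \<and> int t - k j \<le> int (n j))} \<le> card {1..nat (k j)}"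
        using True by (intro card_mono) auto
      then show ?thesis using True by simp
    next
      case False
      have "card {t \<in> {1..n j}. \<not> (1 \<le> int t - k j \<and> int t - k j \<le> int (n j))} \<le> card {n j - nat (- k j)<..n j}"
        using False by (intro card_mono) auto
      then show ?thesis using False by simp
    qed
    then have "real (card {t \<in> {1..n j}. \<not> (1 \<le> int t - k j \<and> int t - k j \<le> int (n j))}) \<le> real (nat \<bar>k j\<bar>)" by (rule of_nat_mono)
    then show ?thesis using mi_pos[OF n, of j] by simp
  qed
  ultimately show ?thesis by (simp only:) (rule card_mi_bad_frac)
qed

lemma norm_pt_shift:
  assumes "inb n i k"
  shows "norm (pt n (shift i k) - pt n i) \<le> (\<Sum>j\<in>UNIV. \<bar>real_of_int (k j)\<bar> / real (n j))"
proof -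
  have "norm (pt n (shift i k) - pt n i) \<le> (\<Sum>j\<in>UNIV. \<bar>vec_nth (pt n (shift i k) - pt n i) j\<bar>)" by (rule norm_le_l1_cart)
  also have "\<dots> \<le> (\<Sum>j\<in>UNIV. \<bar>real_of_int (k j)\<bar> / real (n j))"
  proof (rule sum_mono)
    fix j
    have "1 \<le> int (i j) - k j" using assms by (simp add: inb_def)
    then have "real (shift i k j) = real (i j) - real_of_int (k j)" by (simp add: shift_def)
    then have "vec_nth (pt n (shift i k) - pt n i) j = - real_of_int (k j) / real (n j)"
      by (simp add: pt_def diff_divide_distrib)
    then show "\<bar>vec_nth (pt n (shift i k) - pt n i) j\<bar> \<le> \<bar>real_of_int (k j)\<bar> / real (n j)" by simp
  qed
  finally show ?thesis .
qed

definition fexp :: "('d::finite \<Rightarrow> int) \<Rightarrow> real ^ 'd \<Rightarrow> complex" where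
  "fexp k \<theta> = exp (\<i> * complex_of_real (\<Sum>j\<in>UNIV. real_of_int (k j) * vec_nth \<theta> j))"

lemma fexp_add: "fexp (\<lambda>l. k l + m l) \<theta> = fexp k \<theta> * fexp m \<theta>"
  by (simp add: fexp_def exp_add[symmetric] algebra_simps sum.distrib)

lemma fexp_uminus: "fexp (\<lambda>l. - k l) \<theta> = cnj (fexp k \<theta>)"
  by (simp add: fexp_def exp_cnj sum_negf)

lemma fexp_zero: "fexp (\<lambda>_. 0) \<theta> = 1"
  by (simp add: fexp_def)

lemma norm_fexp [simp]: "cmod (fexp k \<theta>) = 1"
  by (simp add: fexp_def)

lemma continuous_fexp: "continuous_on S (fexp k)"
  unfolding fexp_def by (intro continuous_intros)

text \<open>A list of pairs \<open>(v, k)\<close> stands for the symbol \<open>\<Sum> v(x) e\<^sup>i\<^sup>\<langle>\<^sup>k\<^sup>,\<^sup>\<theta>\<^sup>\<rangle>\<close> and for the matrices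
  whose entry at \<open>(i, j)\<close> is the sum of the \<open>v(i/n)\<close> with \<open>k = i - j\<close>.\<close>

type_synonym 'd nice = "((real ^ 'd \<Rightarrow> complex) \<times> ('d \<Rightarrow> int)) list"

fun nmat :: "('d::{finite,linorder} \<Rightarrow> nat) \<Rightarrow> 'd nice \<Rightarrow> complex Matrix.mat" where
  "nmat n [] = 0\<^sub>m (mi_size n) (mi_size n)"
| "nmat n ((v, k) # c) = single n k (\<lambda>i. v (pt n i)) + nmat n c"

fun nsym :: "'d::finite nice \<Rightarrow> 'd sdom \<Rightarrow> complex" where
  "nsym [] z = 0"
| "nsym ((v, k) # c) z = v (fst z) * fexp k (snd z) + nsym c z"

fun nvalid :: "'d::finite nice \<Rightarrow> bool" where
  "nvalid [] = True"
| "nvalid ((v, k) # c) \<longleftrightarrow> continuous_on unit_cube v \<and> nvalid c"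

text \<open>On symbols both functions are evaluated at the same point \<open>x\<close>; the matrix
  product evaluates the second one a few grid steps away, which \<open>single_mult_negl\<close>
  shows to be negligible.\<close>

fun nmul1 :: "(real ^ 'd \<Rightarrow> complex) \<times> ('d \<Rightarrow> int) \<Rightarrow> 'd::finite nice \<Rightarrow> 'd nice" where
  "nmul1 _ [] = []"
| "nmul1 (v, k) ((w, m) # c) = (\<lambda>x. v x * w x, \<lambda>l. k l + m l) # nmul1 (v, k) c"

fun nmul :: "'d::finite nice \<Rightarrow> 'd nice \<Rightarrow> 'd nice" where
  "nmul [] c = []"
| "nmul (a # b) c = nmul1 a c @ nmul b c"

fun nadj :: "'d::finite nice \<Rightarrow> 'd nice" where
  "nadj [] = []"
| "nadj ((v, k) # c) = (\<lambda>x. cnj (v x), \<lambda>l. - k l) # nadj c"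

lemma nmat_carrier [simp]: "nmat n c \<in> carrier_mat (mi_size n) (mi_size n)"
  "dim_row (nmat n c) = mi_size n" "dim_col (nmat n c) = mi_size n"
proof -
  show "nmat n c \<in> carrier_mat (mi_size n) (mi_size n)" by (induction n c rule: nmat.induct) auto
  then show "dim_row (nmat n c) = mi_size n" "dim_col (nmat n c) = mi_size n" by auto
qed

lemma nmat_append: "nmat n (b @ c) = nmat n b + nmat n c"
proof (induction b)
  case (Cons a b)
  obtain v k where a: "a = (v, k)" by (cases a)
  show ?case unfolding a using Cons by (simp add: assoc_add_mat[of _ "mi_size n" "mi_size n"])
qed simp

lemma nsym_append: "nsym (b @ c) z = nsym b z + nsym c z"
  by (induction b z rule: nsym.induct) auto

lemma nvalid_append: "nvalid (b @ c) \<longleftrightarrow> nvalid b \<and> nvalid c"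
  by (induction b rule: nvalid.induct) auto

lemma nsym_nmul1: "nsym (nmul1 (v, k) c) z = v (fst z) * fexp k (snd z) * nsym c z"
  by (induction "(v, k)" c rule: nmul1.induct) (auto simp: fexp_add algebra_simps)

lemma nsym_nmul: "nsym (nmul b c) z = nsym b z * nsym c z"
  by (induction b c rule: nmul.induct) (auto simp: nsym_append nsym_nmul1 algebra_simps)

lemma nsym_nadj: "nsym (nadj c) z = cnj (nsym c z)"
  by (induction c rule: nadj.induct) (auto simp: fexp_uminus)

lemma nvalid_nmul1: "continuous_on unit_cube v \<Longrightarrow> nvalid c \<Longrightarrow> nvalid (nmul1 (v, k) c)"
  by (induction "(v, k)" c rule: nmul1.induct) (auto intro: continuous_intros)

lemma nvalid_nmul: "nvalid b \<Longrightarrow> nvalid c \<Longrightarrow> nvalid (nmul b c)"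
  by (induction b c rule: nmul.induct) (auto simp: nvalid_append nvalid_nmul1)

lemma nvalid_nadj: "nvalid c \<Longrightarrow> nvalid (nadj c)"
  by (induction c rule: nadj.induct) (auto intro: continuous_intros)

lemma unit_cube_bounded:
  assumes "continuous_on unit_cube v"
  obtains K where "0 < K" "\<And>x. x \<in> unit_cube \<Longrightarrow> cmod (v x) \<le> K"
proof -
  have "compact (v ` unit_cube)" using assms by (intro compact_continuous_image) (auto simp: unit_cube_def)
  then obtain K where "0 < K" "\<forall>y\<in>v ` unit_cube. norm y \<le> K" using compact_imp_bounded bounded_pos by metis
  then show ?thesis using that[of K] by blast
qed

lemma nmat_nb:
  assumes "nvalid c" shows "\<exists>K\<ge>0. \<forall>n. nb (nmat n c) K"
  using assms
proof (induction c)
  case Nil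
  then show ?case using nb_zero by auto
next
  case (Cons a c)
  obtain v k where a: "a = (v, k)" by (cases a)
  obtain K where K: "0 \<le> K" "\<And>n. nb (nmat n c) K" using Cons a by auto
  obtain L where L: "0 < L" "\<And>x. x \<in> unit_cube \<Longrightarrow> cmod (v x) \<le> L"
    using unit_cube_bounded[of v] Cons.prems a by auto
  have "nb (nmat n (a # c)) (L + K)" for n
    unfolding a nmat.simps
    by (rule nb_add[OF single_carrier(1) nmat_carrier(1) nb_single K(2)]) (use L pt_in in auto)
  then show ?case using K L by (intro exI[of _ "L + K"]) auto
qed

locale mlseq =
  fixes I :: "nat set" and nn :: "nat \<Rightarrow> 'd::{finite,linorder} \<Rightarrow> nat"
  assumes inf: "infinite I" and pos: "\<And>n. n \<in> I \<Longrightarrow> \<forall>j. 1 \<le> nn n j"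
    and lim: "filterlim nn mi_at_top (at_top_in I)"
begin

abbreviation "F \<equiv> at_top_in I"
abbreviation "N n \<equiv> mi_size (nn n)"

lemma F_nontrivial: "F \<noteq> bot"
proof
  assume "F = bot"
  then have "eventually (\<lambda>_. False) F" by simp
  then obtain M where "\<forall>n\<in>I. \<not> M \<le> n" unfolding eventually_at_top_in by blast
  then have "I \<subseteq> {..<M}" by auto
  then show False using inf finite_subset by blast
qed

lemma ev_I: "eventually (\<lambda>n. n \<in> I) F"
  unfolding eventually_at_top_in by blast

lemma N_pos: "n \<in> I \<Longrightarrow> 0 < real (N n)"
  unfolding mi_size_def using mi_pos[OF pos] by (simp add: prod_pos)

lemma lim_comp: "filterlim (\<lambda>n. nn n j) at_top F"
proof -
  have "filterlim (\<lambda>n. Min (range (nn n))) at_top F"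
    using lim unfolding mi_at_top_def filterlim_filtercomap_iff by (simp add: o_def)
  then show ?thesis
    by (rule filterlim_at_top_mono) (auto intro!: always_eventually)
qed

lemma lim_inv: "((\<lambda>n. c / real (nn n j)) \<longlongrightarrow> 0) F"
  by (rule real_tendsto_divide_at_top[OF tendsto_const]) (rule filterlim_compose[OF filterlim_real_sequentially lim_comp])

lemma lim_sum_inv: "((\<lambda>n. \<Sum>j\<in>UNIV. c j / real (nn n j)) \<longlongrightarrow> 0) F"
proof -
  have "((\<lambda>n. \<Sum>j\<in>UNIV. c j / real (nn n j)) \<longlongrightarrow> (\<Sum>j\<in>(UNIV :: 'd set). 0)) F"
    by (intro tendsto_sum lim_inv)
  then show ?thesis by simp
qed

text \<open>Squared Frobenius norm \<open>o(N n)\<close>. This implies both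
  \<open>small_pert\<close> with every error (\<open>negl_small_pert\<close>) and vanishing
  normalized trace (\<open>negl_mtrace\<close>), and it survives multiplication by bounded
  matrices.\<close>

definition negl :: "(nat \<Rightarrow> complex Matrix.mat) \<Rightarrow> bool" where
  "negl X \<longleftrightarrow> (\<forall>n\<in>I. X n \<in> carrier_mat (N n) (N n)) \<and>
     (\<forall>e>0. eventually (\<lambda>n. frob2 (X n) \<le> e * real (N n)) F)"

lemma neglD: "negl X \<Longrightarrow> n \<in> I \<Longrightarrow> X n \<in> carrier_mat (N n) (N n)"
  "negl X \<Longrightarrow> 0 < e \<Longrightarrow> eventually (\<lambda>n. frob2 (X n) \<le> e * real (N n)) F"
  by (auto simp: negl_def)

lemma neglI: "(\<And>n. n \<in> I \<Longrightarrow> X n \<in> carrier_mat (N n) (N n)) \<Longrightarrow>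
   (\<And>e. 0 < e \<Longrightarrow> eventually (\<lambda>n. frob2 (X n) \<le> e * real (N n)) F) \<Longrightarrow> negl X"
  by (auto simp: negl_def)

lemma negl_cong: "negl X \<Longrightarrow> (\<And>n. n \<in> I \<Longrightarrow> X n = Y n) \<Longrightarrow> negl Y"
proof (rule neglI)
  fix e :: real assume X: "negl X" "\<And>n. n \<in> I \<Longrightarrow> X n = Y n" and e: "0 < e"
  show "eventually (\<lambda>n. frob2 (Y n) \<le> e * real (N n)) F"
    using neglD(2)[OF X(1) e] ev_I by eventually_elim (simp add: X(2)[symmetric])
qed (auto dest: neglD)

lemma negl_zero: "negl (\<lambda>n. 0\<^sub>m (N n) (N n))"
  by (rule neglI) (auto simp: frob2_def intro!: always_eventually)

lemma negl_add: assumes X: "negl X" and Y: "negl Y" shows "negl (\<lambda>n. X n + Y n)"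
proof (rule neglI)
  fix e :: real assume "0 < e"
  then have "eventually (\<lambda>n. frob2 (X n) \<le> e / 4 * real (N n)) F" "eventually (\<lambda>n. frob2 (Y n) \<le> e / 4 * real (N n)) F"
    using neglD(2)[OF X, of "e / 4"] neglD(2)[OF Y, of "e / 4"] by auto
  then show "eventually (\<lambda>n. frob2 (X n + Y n) \<le> e * real (N n)) F"
    using ev_I
  proof eventually_elim
    case (elim n)
    then show ?case using frob2_add_le[OF neglD(1)[OF X elim(3)] neglD(1)[OF Y elim(3)]] by simp
  qed
qed (use neglD(1)[OF X] neglD(1)[OF Y] in auto)

lemma negl_scale:
  assumes X: "negl X" and Y: "\<And>n. n \<in> I \<Longrightarrow> Y n \<in> carrier_mat (N n) (N n)"
    and b: "\<And>n. n \<in> I \<Longrightarrow> frob2 (Y n) \<le> c * frob2 (X n)"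
  shows "negl Y"
proof (rule neglI[OF Y])
  fix e :: real assume "0 < e"
  then have "eventually (\<lambda>n. frob2 (X n) \<le> e / (\<bar>c\<bar> + 1) * real (N n)) F" by (intro neglD(2)[OF X]) auto
  then show "eventually (\<lambda>n. frob2 (Y n) \<le> e * real (N n)) F" using ev_I
  proof eventually_elim
    case (elim n)
    have "frob2 (Y n) \<le> c * frob2 (X n)" by (rule b[OF elim(2)])
    also have "\<dots> \<le> (\<bar>c\<bar> + 1) * frob2 (X n)" by (intro mult_right_mono) auto
    also have "\<dots> \<le> (\<bar>c\<bar> + 1) * (e / (\<bar>c\<bar> + 1) * real (N n))" using elim(1) by (intro mult_left_mono) auto
    also have "\<dots> = e * real (N n)" by (simp add: field_simps)
    finally show ?case .
  qed
qed

lemma negl_mult_left: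
  assumes X: "negl X" and Y: "\<And>n. n \<in> I \<Longrightarrow> Y n \<in> carrier_mat (N n) (N n)"
    and c: "\<And>n. n \<in> I \<Longrightarrow> nb (Y n) c"
  shows "negl (\<lambda>n. Y n * X n)"
  by (rule negl_scale[OF X, of _ "c\<^sup>2"])
    (use frob2_mult_left[OF Y neglD(1)[OF X] c] mult_carrier_mat[OF Y neglD(1)[OF X]] in auto)

lemma negl_mult_right:
  assumes X: "negl X" and Y: "\<And>n. n \<in> I \<Longrightarrow> Y n \<in> carrier_mat (N n) (N n)"
    and c: "\<And>n. n \<in> I \<Longrightarrow> nb (Y n) c" "0 \<le> c"
  shows "negl (\<lambda>n. X n * Y n)"
  by (rule negl_scale[OF X, of _ "c\<^sup>2"])
    (use frob2_mult_right[OF neglD(1)[OF X] Y c(1) c(2)] mult_carrier_mat[OF neglD(1)[OF X] Y] in auto)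

lemma negl_small_pert:
  assumes X: "negl X" and e: "0 < e" shows "eventually (\<lambda>n. small_pert e (X n)) F"
proof -
  have "eventually (\<lambda>n. frob2 (X n) \<le> e ^ 3 * real (N n)) F" using e by (intro neglD(2)[OF X]) auto
  then show ?thesis using ev_I
  proof eventually_elim
    case (elim n)
    then show ?case using frob2_small_pert[OF neglD(1)[OF X elim(2)] elim(1) e] by simp
  qed
qed

text \<open>By \<open>mtrace_bound\<close> the squared trace is at most \<open>N n\<close> times
  \<open>frob2\<close>, which is \<open>o((N n)^2)\<close>.\<close>

lemma negl_mtrace:
  assumes X: "negl X" shows "((\<lambda>n. mtrace (X n) / of_nat (N n)) \<longlongrightarrow> 0) F"
proof (rule tendstoI)
  fix e :: real assume e: "0 < e"
  have "eventually (\<lambda>n. frob2 (X n) \<le> (e / 2)\<^sup>2 * real (N n)) F" using e by (intro neglD(2)[OF X]) auto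
  then show "eventually (\<lambda>n. dist (mtrace (X n) / of_nat (N n)) 0 < e) F" using ev_I
  proof eventually_elim
    case (elim n)
    have "(cmod (mtrace (X n)))\<^sup>2 \<le> real (N n) * frob2 (X n)" by (rule mtrace_bound[OF neglD(1)[OF X elim(2)]])
    also have "\<dots> \<le> real (N n) * ((e / 2)\<^sup>2 * real (N n))" using elim(1) by (intro mult_left_mono) auto
    also have "\<dots> = (e / 2 * real (N n))\<^sup>2" by (simp add: power2_eq_square)
    finally have "cmod (mtrace (X n)) \<le> e / 2 * real (N n)" using e by (auto intro: power2_le_imp_le)
    then have "cmod (mtrace (X n)) < e * real (N n)" using mult_pos_pos[OF e N_pos[OF elim(2)]] by linarith
    then show ?case using N_pos[OF elim(2)] by (simp add: norm_divide pos_divide_less_eq)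
  qed
qed

text \<open>Interior rows are small by uniform continuity of \<open>w\<close>, since a shift moves
  the sampling point by \<open>O(1/n)\<close>; boundary rows are merely bounded by \<open>C\<close>,
  but their proportion tends to 0.\<close>

lemma negl_single:
  assumes w: "continuous_on unit_cube w" and C: "0 \<le> C"
    and h: "\<And>n i. n \<in> I \<Longrightarrow> i \<in> mi_range (nn n) \<Longrightarrow>
       cmod (h n i) \<le> (if inb (nn n) i k then C * cmod (w (pt (nn n) (shift i k)) - w (pt (nn n) i)) else C)"
  shows "negl (\<lambda>n. single (nn n) m (h n))"
proof (rule neglI)
  fix e :: real assume e: "0 < e"
  \<comment> \<open>Chosen for \<open>(C * \<eta>)\<^sup>2 \<le> e / 2\<close>; the 1 in
    \<open>C + 1\<close> guards against \<open>C = 0\<close>.\<close>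
  define \<eta> where "\<eta> = sqrt (e / 2) / (C + 1)"
  have \<eta>: "0 < \<eta>" using e C by (simp add: \<eta>_def)
  have C\<eta>: "(C * \<eta>)\<^sup>2 \<le> e / 2"
  proof -
    have "C * \<eta> \<le> sqrt (e / 2)" unfolding \<eta>_def using C e by (simp add: field_simps)
    then have "(C * \<eta>)\<^sup>2 \<le> (sqrt (e / 2))\<^sup>2" using C \<eta> by (intro power_mono) auto
    then show ?thesis using e by simp
  qed
  have "uniformly_continuous_on unit_cube w" by (rule compact_uniformly_continuous[OF w]) (simp add: unit_cube_def)
  then obtain \<delta> where \<delta>: "0 < \<delta>" "\<And>x x'. x \<in> unit_cube \<Longrightarrow> x' \<in> unit_cube \<Longrightarrow> dist x' x < \<delta> \<Longrightarrow> dist (w x') (w x) < \<eta>"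
    unfolding uniformly_continuous_on_def using \<eta> by blast
  have "eventually (\<lambda>n. (\<Sum>j\<in>UNIV. \<bar>real_of_int (k j)\<bar> / real (nn n j)) < min \<delta> (e / (2 * (C\<^sup>2 + 1)))) F"
    using \<delta>(1) e by (intro order_tendstoD(2)[OF lim_sum_inv]) (auto simp: add_nonneg_pos)
  then show "eventually (\<lambda>n. frob2 (single (nn n) m (h n)) \<le> e * real (N n)) F" using ev_I
  proof eventually_elim
    case (elim n)
    let ?s = "\<Sum>j\<in>UNIV. \<bar>real_of_int (k j)\<bar> / real (nn n j)"
    have s1: "?s < \<delta>" and s2: "?s < e / (2 * (C\<^sup>2 + 1))" using elim(1) by auto
    let ?B = "{i \<in> mi_range (nn n). \<not> inb (nn n) i k}"
    have "frob2 (single (nn n) m (h n)) \<le> (\<Sum>i\<in>mi_range (nn n). (cmod (h n i))\<^sup>2)" by (rule frob2_single)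
    also have "\<dots> \<le> (\<Sum>i\<in>mi_range (nn n). e / 2 + (if i \<in> ?B then C\<^sup>2 else 0))"
    proof (rule sum_mono)
      fix i assume i: "i \<in> mi_range (nn n)"
      show "(cmod (h n i))\<^sup>2 \<le> e / 2 + (if i \<in> ?B then C\<^sup>2 else 0)"
      proof (cases "inb (nn n) i k")
        case True
        have "dist (pt (nn n) (shift i k)) (pt (nn n) i) < \<delta>"
          using norm_pt_shift[OF True] s1 by (simp add: dist_norm)
        then have "dist (w (pt (nn n) (shift i k))) (w (pt (nn n) i)) < \<eta>"
          by (intro \<delta>(2) pt_in i inb_shift True)
        then have "cmod (h n i) \<le> C * \<eta>" using h[OF elim(2) i] True C
          by (simp add: dist_norm) (meson less_imp_le mult_left_mono order_trans)
        then have "(cmod (h n i))\<^sup>2 \<le> (C * \<eta>)\<^sup>2" by (intro power_mono) auto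
        then show ?thesis using C\<eta> True by simp
      next
        case False
        then have "(cmod (h n i))\<^sup>2 \<le> C\<^sup>2" using h[OF elim(2) i] by (intro power_mono) auto
        then show ?thesis using False i e by simp
      qed
    qed
    also have "\<dots> = real (N n) * (e / 2) + C\<^sup>2 * real (card ?B)"
      by (simp add: sum.distrib sum.If_cases card_mi_range Int_def)
    also have "\<dots> \<le> real (N n) * (e / 2) + C\<^sup>2 * (?s * real (N n))"
      using card_not_inb[OF pos[OF elim(2)], of k] by (intro add_left_mono mult_left_mono) auto
    also have "\<dots> \<le> real (N n) * (e / 2) + (e / 2) * real (N n)"
    proof -
      have s0: "0 \<le> ?s" by (intro sum_nonneg) auto
      have "C\<^sup>2 * ?s \<le> (C\<^sup>2 + 1) * ?s" using s0 by (intro mult_right_mono) auto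
      also have "\<dots> \<le> (C\<^sup>2 + 1) * (e / (2 * (C\<^sup>2 + 1)))" using s2 by (intro mult_left_mono) auto
      also have "\<dots> = e / 2"
      proof -
        have "0 < C\<^sup>2 + 1" by (rule add_nonneg_pos) auto
        then show ?thesis by (simp add: field_simps)
      qed
      finally have "C\<^sup>2 * ?s * real (N n) \<le> e / 2 * real (N n)" by (intro mult_right_mono) auto
      then have "C\<^sup>2 * (?s * real (N n)) \<le> e / 2 * real (N n)" by (simp only: mult.assoc)
      then show ?thesis by (rule add_left_mono)
    qed
    finally show ?case by (simp add: algebra_simps)
  qed
qed simp

lemma single_mult_negl:
  assumes v: "continuous_on unit_cube v" and w: "continuous_on unit_cube w"
  shows "negl (\<lambda>n. single (nn n) k (\<lambda>i. v (pt (nn n) i)) * single (nn n) m (\<lambda>i. w (pt (nn n) i))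
     - single (nn n) (\<lambda>l. k l + m l) (\<lambda>i. v (pt (nn n) i) * w (pt (nn n) i)))"
proof -
  obtain K where K: "0 < K" "\<And>x. x \<in> unit_cube \<Longrightarrow> cmod (v x) \<le> K" using unit_cube_bounded[OF v] by metis
  obtain L where L: "0 < L" "\<And>x. x \<in> unit_cube \<Longrightarrow> cmod (w x) \<le> L" using unit_cube_bounded[OF w] by metis
  show ?thesis unfolding single_mult single_minus
  proof (rule negl_single[OF w, where C = "K * max 1 L" and k = k])
    fix n i assume n: "n \<in> I" and i: "i \<in> mi_range (nn n)"
    \<comment> \<open>The constant must exceed \<open>K * L\<close> for lost rows and
      \<open>K\<close> alone for the difference of the values of \<open>w\<close>;
      \<open>K * max 1 L\<close> does both.\<close>
    have "1 \<le> max 1 L" by simp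
    then have KL: "K \<le> K * max 1 L" using K(1) by simp
    have v: "cmod (v (pt (nn n) i)) \<le> K" and w: "cmod (w (pt (nn n) i)) \<le> max 1 L"
      using K(2)[OF pt_in[OF i]] L(2)[OF pt_in[OF i]] by auto
    show "cmod ((if inb (nn n) i k then v (pt (nn n) i) * w (pt (nn n) (shift i k)) else 0) - v (pt (nn n) i) * w (pt (nn n) i))
       \<le> (if inb (nn n) i k then K * max 1 L * cmod (w (pt (nn n) (shift i k)) - w (pt (nn n) i)) else K * max 1 L)"
    proof (cases "inb (nn n) i k")
      case True
      then show ?thesis using v KL by (auto simp: right_diff_distrib[symmetric] norm_mult intro!: mult_right_mono)
    next
      case False
      then show ?thesis using mult_mono[OF v w] K(1) by (simp add: norm_mult)
    qed
  qed (use K in simp)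
qed

lemma single_adj_negl:
  assumes v: "continuous_on unit_cube v"
  shows "negl (\<lambda>n. mat_adjoint (single (nn n) k (\<lambda>i. v (pt (nn n) i))) - single (nn n) (\<lambda>l. - k l) (\<lambda>i. cnj (v (pt (nn n) i))))"
proof -
  obtain K where K: "0 < K" "\<And>x. x \<in> unit_cube \<Longrightarrow> cmod (v x) \<le> K" using unit_cube_bounded[OF v] by metis
  have eq: "mat_adjoint (single (nn n) k (\<lambda>i. v (pt (nn n) i))) - single (nn n) (\<lambda>l. - k l) (\<lambda>i. cnj (v (pt (nn n) i)))
     = single (nn n) (\<lambda>l. - k l) (\<lambda>i. (if inb (nn n) i (\<lambda>l. - k l) then cnj (v (pt (nn n) (shift i (\<lambda>l. - k l)))) else 0) - cnj (v (pt (nn n) i)))" for n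
    unfolding single_adj single_minus unfolding single_def
    by (rule mi_mat_cong) (auto simp: mi_diff_eq_iff)
  show ?thesis unfolding eq
  proof (rule negl_single[OF v, where C = "max 1 K" and k = "\<lambda>l. - k l"])
    fix n i assume n: "n \<in> I" and i: "i \<in> mi_range (nn n)"
    have "cmod (v (pt (nn n) i)) \<le> max 1 K" using K(2)[OF pt_in[OF i]] by auto
    moreover have "cmod (cnj a - cnj b) \<le> max 1 K * cmod (a - b)" for a b
      using mult_right_mono[of 1 "max 1 K" "cmod (a - b)"] by (simp flip: complex_cnj_diff)
    ultimately show "cmod ((if inb (nn n) i (\<lambda>l. - k l) then cnj (v (pt (nn n) (shift i (\<lambda>l. - k l)))) else 0) - cnj (v (pt (nn n) i)))
      \<le> (if inb (nn n) i (\<lambda>l. - k l) then max 1 K * cmod (v (pt (nn n) (shift i (\<lambda>l. - k l))) - v (pt (nn n) i)) else max 1 K)"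
      by simp
  qed simp
qed

lemma nmul1_negl:
  assumes v: "continuous_on unit_cube v" and c: "nvalid c"
  shows "negl (\<lambda>n. single (nn n) k (\<lambda>i. v (pt (nn n) i)) * nmat (nn n) c - nmat (nn n) (nmul1 (v, k) c))"
  using c
proof (induction c)
  case Nil
  show ?case by (rule negl_cong[OF negl_zero]) auto
next
  case (Cons a c)
  obtain w m where a: "a = (w, m)" by (cases a)
  let ?S = "\<lambda>n. single (nn n) k (\<lambda>i. v (pt (nn n) i))" and ?T = "\<lambda>n. single (nn n) m (\<lambda>i. w (pt (nn n) i))"
  let ?P = "\<lambda>n. single (nn n) (\<lambda>l. k l + m l) (\<lambda>i. v (pt (nn n) i) * w (pt (nn n) i))"
  have "negl (\<lambda>n. (?S n * ?T n - ?P n) + (?S n * nmat (nn n) c - nmat (nn n) (nmul1 (v, k) c)))"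
    using Cons a by (intro negl_add single_mult_negl v) auto
  then show ?case
  proof (rule negl_cong)
    fix n assume "n \<in> I"
    have "?S n * (?T n + nmat (nn n) c) = ?S n * ?T n + ?S n * nmat (nn n) c"
      by (intro mult_add_distrib_mat[of _ "N n" "N n" _ "N n"]) auto
    then show "(?S n * ?T n - ?P n) + (?S n * nmat (nn n) c - nmat (nn n) (nmul1 (v, k) c))
      = ?S n * nmat (nn n) (a # c) - nmat (nn n) (nmul1 (v, k) (a # c))"
      unfolding a by (simp del: index_mult_mat) (intro eq_matI, auto simp del: index_mult_mat(1))
  qed
qed

lemma nmul_negl:
  assumes "nvalid b" "nvalid c"
  shows "negl (\<lambda>n. nmat (nn n) b * nmat (nn n) c - nmat (nn n) (nmul b c))"
  using assms(1)
proof (induction b)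
  case Nil
  show ?case by (rule negl_cong[OF negl_zero]) auto
next
  case (Cons a b)
  obtain v k where a: "a = (v, k)" by (cases a)
  let ?S = "\<lambda>n. single (nn n) k (\<lambda>i. v (pt (nn n) i))" and ?C = "\<lambda>n. nmat (nn n) c"
  have "negl (\<lambda>n. (?S n * ?C n - nmat (nn n) (nmul1 (v, k) c)) + (nmat (nn n) b * ?C n - nmat (nn n) (nmul b c)))"
    using Cons a assms(2) by (intro negl_add nmul1_negl) auto
  then show ?case
  proof (rule negl_cong)
    fix n assume "n \<in> I"
    have "(?S n + nmat (nn n) b) * ?C n = ?S n * ?C n + nmat (nn n) b * ?C n"
      by (intro add_mult_distrib_mat[of _ "N n" "N n" _ _ "N n"]) auto
    then show "(?S n * ?C n - nmat (nn n) (nmul1 (v, k) c)) + (nmat (nn n) b * ?C n - nmat (nn n) (nmul b c))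
      = nmat (nn n) (a # b) * ?C n - nmat (nn n) (nmul (a # b) c)"
      unfolding a by (simp add: nmat_append del: index_mult_mat) (intro eq_matI, auto simp del: index_mult_mat(1))
  qed
qed

lemma nadj_negl:
  assumes "nvalid c"
  shows "negl (\<lambda>n. mat_adjoint (nmat (nn n) c) - nmat (nn n) (nadj c))"
  using assms
proof (induction c)
  case Nil
  show ?case by (rule negl_cong[OF negl_zero]) (auto intro!: eq_matI)
next
  case (Cons a c)
  obtain v k where a: "a = (v, k)" by (cases a)
  let ?S = "\<lambda>n. single (nn n) k (\<lambda>i. v (pt (nn n) i))"
  let ?T = "\<lambda>n. single (nn n) (\<lambda>l. - k l) (\<lambda>i. cnj (v (pt (nn n) i)))"
  have "negl (\<lambda>n. (mat_adjoint (?S n) - ?T n) + (mat_adjoint (nmat (nn n) c) - nmat (nn n) (nadj c)))"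
    using Cons a by (intro negl_add single_adj_negl) auto
  then show ?case
  proof (rule negl_cong)
    fix n assume "n \<in> I"
    have "mat_adjoint (?S n + nmat (nn n) c) = mat_adjoint (?S n) + mat_adjoint (nmat (nn n) c)"
      by (intro adj_add[of _ "N n" "N n"]) auto
    then show "(mat_adjoint (?S n) - ?T n) + (mat_adjoint (nmat (nn n) c) - nmat (nn n) (nadj c))
      = mat_adjoint (nmat (nn n) (a # c)) - nmat (nn n) (nadj (a # c))"
      unfolding a by (simp del: adj_index) (intro eq_matI, auto simp del: adj_index)
  qed
qed

end

section \<open>Locally Toeplitz operators with trigonometric symbol\<close>

text \<open>Together with \<open>blk_rem\<close>, the \<open>a\<close> and \<open>r\<close> of the
  representation \<open>i = (a - 1) q + r\<close>, both counted from 1; they have this meaning when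
  \<open>i\<close> is not in the zero padding, which is \<open>blk_ok\<close>.\<close>

definition blk :: "('d \<Rightarrow> nat) \<Rightarrow> ('d \<Rightarrow> nat) \<Rightarrow> ('d \<Rightarrow> nat) \<Rightarrow> 'd \<Rightarrow> nat" where
  "blk n m i = (\<lambda>l. (i l - 1) div (n l div m l) + 1)"

definition blk_rem :: "('d \<Rightarrow> nat) \<Rightarrow> ('d \<Rightarrow> nat) \<Rightarrow> ('d \<Rightarrow> nat) \<Rightarrow> 'd \<Rightarrow> nat" where
  "blk_rem n m i = (\<lambda>l. (i l - 1) mod (n l div m l) + 1)"

definition blk_ok :: "('d \<Rightarrow> nat) \<Rightarrow> ('d \<Rightarrow> nat) \<Rightarrow> ('d \<Rightarrow> nat) \<Rightarrow> bool" where
  "blk_ok n m i \<longleftrightarrow> (\<forall>l. i l \<le> m l * (n l div m l))"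

lemma block_decomp_nat:
  fixes t a r q m :: nat
  assumes "1 \<le> t" and ar: "1 \<le> a" "a \<le> m" "1 \<le> r" "r \<le> q"
  shows "t = (a - 1) * q + r \<longleftrightarrow> t \<le> m * q \<and> a = (t - 1) div q + 1 \<and> r = (t - 1) mod q + 1"
proof
  assume t: "t = (a - 1) * q + r"
  obtain a' r' where a': "a = Suc a'" and r': "r = Suc r'" using ar by (cases a; cases r) auto
  have t1: "t - 1 = a' * q + r'" using t a' r' by simp
  have "(t - 1) div q = a - 1" "(t - 1) mod q = r - 1" unfolding t1 using ar a' r' by auto
  moreover have "t \<le> (a - 1) * q + q" using t ar by simp
  moreover have "(a - 1) * q + q = a * q" using ar by (cases a) auto
  moreover have "a * q \<le> m * q" using ar by simp
  ultimately have "t \<le> m * q" "(t - 1) div q = a - 1" "(t - 1) mod q = r - 1" by linarith+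
  then show "t \<le> m * q \<and> a = (t - 1) div q + 1 \<and> r = (t - 1) mod q + 1" using ar by auto
next
  assume *: "t \<le> m * q \<and> a = (t - 1) div q + 1 \<and> r = (t - 1) mod q + 1"
  then have "(a - 1) * q + r = (t - 1) div q * q + (t - 1) mod q + 1" by simp
  also have "\<dots> = t" unfolding div_mult_mod_eq using assms(1) by simp
  finally show "t = (a - 1) * q + r" by simp
qed

lemma block_range_nat:
  fixes t q m :: nat
  assumes "1 \<le> t" "t \<le> m * q"
  shows "(t - 1) div q + 1 \<le> m" "(t - 1) mod q + 1 \<le> q" "0 < q"
proof -
  show q: "0 < q" using assms by (cases q) auto
  have "t - 1 < m * q" using assms by simp
  then have "(t - 1) div q < m" by (simp add: less_mult_imp_div_less)
  then show "(t - 1) div q + 1 \<le> m" by simp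
  have "(t - 1) mod q < q" using q by simp
  then show "(t - 1) mod q + 1 \<le> q" by simp
qed

lemma block_decomp:
  assumes i: "i \<in> mi_range n" and a: "a \<in> mi_range m" and r: "r \<in> mi_range (\<lambda>l. n l div m l)"
  shows "i = (\<lambda>l. (a l - 1) * (n l div m l) + r l) \<longleftrightarrow> blk_ok n m i \<and> a = blk n m i \<and> r = blk_rem n m i"
proof -
  have "i l = (a l - 1) * (n l div m l) + r l \<longleftrightarrow> i l \<le> m l * (n l div m l) \<and> a l = (i l - 1) div (n l div m l) + 1
     \<and> r l = (i l - 1) mod (n l div m l) + 1" for l
    using i[unfolded mi_range_iff, rule_format, of l] a[unfolded mi_range_iff, rule_format, of l] r[unfolded mi_range_iff, rule_format, of l]
    by (intro block_decomp_nat) auto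
  then show ?thesis unfolding fun_eq_iff blk_ok_def blk_def blk_rem_def by blast
qed

lemma blk_range:
  assumes i: "i \<in> mi_range n" and ok: "blk_ok n m i"
  shows "blk n m i \<in> mi_range m" "blk_rem n m i \<in> mi_range (\<lambda>l. n l div m l)"
proof -
  have "(i l - 1) div (n l div m l) + 1 \<le> m l \<and> (i l - 1) mod (n l div m l) + 1 \<le> n l div m l" for l
    using i[unfolded mi_range_iff, rule_format, of l] ok[unfolded blk_ok_def, rule_format, of l]
      block_range_nat[of "i l" "m l" "n l div m l"] by auto
  then show "blk n m i \<in> mi_range m" "blk_rem n m i \<in> mi_range (\<lambda>l. n l div m l)"
    unfolding mi_range_iff blk_def blk_rem_def by auto
qed

lemma blk_eq: "blk_ok n m i \<Longrightarrow> i \<in> mi_range n \<Longrightarrow> i = (\<lambda>l. (blk n m i l - 1) * (n l div m l) + blk_rem n m i l)"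
  using block_decomp[of i n "blk n m i" m "blk_rem n m i"] blk_range[of i n m] by blast

text \<open>Since an index determines its block and remainder, the triple sum has at most one term;
  within a block \<open>r - s\<close> equals \<open>i - j\<close>, so the Fourier coefficient
  depends on \<open>mi_diff i j\<close> alone.\<close>

lemma LT_op_eq:
  "LT_op n m v f = mi_mat n (\<lambda>i j. if blk_ok n m i \<and> blk_ok n m j \<and> blk n m i = blk n m j
      then v (pt m (blk n m i)) * fourier_coeff f (mi_diff i j) else 0)"
  unfolding LT_op_def Let_def
proof (rule mi_mat_cong)
  fix i j assume i: "i \<in> mi_range n" and j: "j \<in> mi_range n"
  let ?q = "\<lambda>l. n l div m l"
  let ?X = "\<lambda>a r s. v (\<chi> l. real (a l) / real (m l)) * fourier_coeff f (\<lambda>l. int (r l) - int (s l))"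
  let ?o = "blk_ok n m i \<and> blk_ok n m j \<and> blk n m i = blk n m j"
  have "(\<Sum>a\<in>mi_range m. \<Sum>r\<in>mi_range ?q. \<Sum>s\<in>mi_range ?q.
          if i = (\<lambda>l. (a l - 1) * ?q l + r l) \<and> j = (\<lambda>l. (a l - 1) * ?q l + s l) then ?X a r s else 0)
     = (\<Sum>a\<in>mi_range m. \<Sum>r\<in>mi_range ?q. \<Sum>s\<in>mi_range ?q.
          if blk_rem n m j = s then (if blk_rem n m i = r then (if blk n m i = a then (if ?o then ?X a r s else 0) else 0) else 0) else 0)"
    by (intro sum.cong refl) (use block_decomp[OF i] block_decomp[OF j] in auto)
  also have "\<dots> = (if ?o then ?X (blk n m i) (blk_rem n m i) (blk_rem n m j) else 0)"
    using blk_range[OF i, of m] blk_range[OF j, of m] by (simp add: sum.delta)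
  also have "\<dots> = (if ?o then v (pt m (blk n m i)) * fourier_coeff f (mi_diff i j) else 0)"
  proof (cases ?o)
    case True
    have "(\<lambda>l. int (blk_rem n m i l) - int (blk_rem n m j l)) = mi_diff i j"
    proof
      fix l
      have "i l = (blk n m i l - 1) * ?q l + blk_rem n m i l" "j l = (blk n m i l - 1) * ?q l + blk_rem n m j l"
        using fun_cong[OF blk_eq[of n m i], of l] fun_cong[OF blk_eq[of n m j], of l] True i j by auto
      then show "int (blk_rem n m i l) - int (blk_rem n m j l) = mi_diff i j l" unfolding mi_diff_def by linarith
    qed
    then show ?thesis using True by (simp add: pt_def)
  next
    case False
    then show ?thesis by (simp only: if_False)
  qed
  finally show "(\<Sum>a\<in>mi_range m. \<Sum>r\<in>mi_range ?q. \<Sum>s\<in>mi_range ?q.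
          if i = (\<lambda>l. (a l - 1) * ?q l + r l) \<and> j = (\<lambda>l. (a l - 1) * ?q l + s l) then ?X a r s else 0)
     = (if ?o then v (pt m (blk n m i)) * fourier_coeff f (mi_diff i j) else 0)" .
qed

lemma LT_op_carrier [simp]: "LT_op n m v f \<in> carrier_mat (mi_size n) (mi_size n)"
  "dim_row (LT_op n m v f) = mi_size n" "dim_col (LT_op n m v f) = mi_size n"
  unfolding LT_op_eq by simp_all

lemma LT_op_single:
  assumes f: "\<And>r. fourier_coeff f r = (if r = k then c else 0)"
  shows "LT_op n m v f = single n k (\<lambda>i. if blk_ok n m i \<and> blk_ok n m (shift i k) \<and> blk n m i = blk n m (shift i k)
     then c * v (pt m (blk n m i)) else 0)"
  unfolding LT_op_eq single_def
proof (rule mi_mat_cong)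
  fix i j assume "i \<in> mi_range n" and j: "j \<in> mi_range n"
  show "(if blk_ok n m i \<and> blk_ok n m j \<and> blk n m i = blk n m j then v (pt m (blk n m i)) * fourier_coeff f (mi_diff i j) else 0) =
     (if mi_diff i j = k then if blk_ok n m i \<and> blk_ok n m (shift i k) \<and> blk n m i = blk n m (shift i k)
       then c * v (pt m (blk n m i)) else 0 else 0)"
  proof (cases "mi_diff i j = k")
    case True
    then have "shift i k = j" using mi_diff_eq_iff[OF j] by metis
    then show ?thesis using True by (simp only: f refl if_True mult.commute)
  next
    case False
    then show ?thesis by (simp add: f)
  qed
qed

text \<open>In one coordinate: \<open>t\<close> is in the zero padding or so close to an end of its
  block that a shift by up to \<open>b\<close> may leave it.\<close>

definition bad1 :: "nat \<Rightarrow> nat \<Rightarrow> nat \<Rightarrow> nat \<Rightarrow> bool" where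
  "bad1 n m b t \<longleftrightarrow> m * (n div m) < t \<or> (t - 1) mod (n div m) < b \<or> n div m \<le> (t - 1) mod (n div m) + b"

text \<open>Each of the \<open>m\<close> blocks has at most \<open>2 * b\<close> indices near its
  ends, and the padding has \<open>n mod m < m\<close> indices.\<close>

lemma card_bad1:
  assumes "1 \<le> m"
  shows "card {t \<in> {1..n}. bad1 n m b t} \<le> m * (2 * b + 1)"
proof -
  let ?q = "n div m"
  let ?A = "{m * ?q<..n}"
  let ?B = "(\<lambda>(a, r). a * ?q + r + 1) ` ({..<m} \<times> ({..<b} \<union> {?q - b..<?q}))"
  have "{t \<in> {1..n}. bad1 n m b t} \<subseteq> ?A \<union> ?B"
  proof
    fix t assume t: "t \<in> {t \<in> {1..n}. bad1 n m b t}"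
    show "t \<in> ?A \<union> ?B"
    proof (cases "m * ?q < t")
      case False
      then have le: "t \<le> m * ?q" and t1: "1 \<le> t" using t by auto
      note q = block_range_nat[OF t1 le]
      have "(t - 1) mod ?q \<in> {..<b} \<union> {?q - b..<?q}" using t False q(3) by (auto simp: bad1_def)
      moreover have "(t - 1) div ?q \<in> {..<m}" using q(1) by simp
      moreover have "t = (t - 1) div ?q * ?q + (t - 1) mod ?q + 1" unfolding div_mult_mod_eq using t1 by simp
      ultimately show ?thesis by (intro UnI2) (rule image_eqI[of _ _ "((t - 1) div ?q, (t - 1) mod ?q)"], auto)
    qed (use t in auto)
  qed
  then have "card {t \<in> {1..n}. bad1 n m b t} \<le> card (?A \<union> ?B)" by (intro card_mono) auto
  also have "\<dots> \<le> card ?A + card ?B" by (rule card_Un_le)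
  also have "card ?A \<le> m"
  proof -
    have "n = m * ?q + n mod m" by simp
    then have "card ?A = n mod m" by (metis add_diff_cancel_left' card_greaterThanAtMost)
    then show ?thesis using mod_less_divisor[of m n] assms by linarith
  qed
  also have "card ?B \<le> card ({..<m} \<times> ({..<b} \<union> {?q - b..<?q}))" by (rule card_image_le) simp
  also have "\<dots> = m * card ({..<b} \<union> {?q - b..<?q})" by (simp add: card_cartesian_product)
  also have "card ({..<b} \<union> {?q - b..<?q}) \<le> card {..<b} + card {?q - b..<?q}" by (rule card_Un_le)
  also have "card {..<b} + card {?q - b..<?q} \<le> 2 * b" by simp
  finally show ?thesis by simp
qed

text \<open>The remainder keeps distance \<open>b\<close> from both ends of the block, so
  subtracting \<open>k\<close> does not carry into a neighbouring block.\<close>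

lemma good_block:
  fixes t n m b :: nat and k :: int
  assumes g: "\<not> bad1 n m b t" and t: "1 \<le> t" and k: "\<bar>k\<bar> \<le> int b"
  shows "t \<le> m * (n div m)" "nat (int t - k) \<le> m * (n div m)"
    "(nat (int t - k) - 1) div (n div m) = (t - 1) div (n div m)" "1 \<le> int t - k"
proof -
  let ?q = "n div m"
  show le: "t \<le> m * ?q" using g by (simp add: bad1_def)
  note q = block_range_nat[OF t le]
  define a r where "a = (t - 1) div ?q" and "r = (t - 1) mod ?q"
  have t1: "t - 1 = a * ?q + r" unfolding a_def r_def by (rule div_mult_mod_eq[symmetric])
  have r: "b \<le> r" "r + b < ?q" using g by (auto simp: bad1_def r_def)
  define r' where "r' = nat (int r - k)"
  have r': "int r' = int r - k" "r' < ?q" using r k by (auto simp: r'_def)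
  have "int t - k = int (a * ?q + r' + 1)" using t1 t r' by linarith
  then have nt: "nat (int t - k) = a * ?q + r' + 1" by (simp only: nat_int)
  show "1 \<le> int t - k" using \<open>int t - k = int (a * ?q + r' + 1)\<close> by linarith
  show "(nat (int t - k) - 1) div ?q = (t - 1) div ?q" unfolding nt t1 using r'(2) r(2) by simp
  have "a + 1 \<le> m" using q(1) by (simp add: a_def)
  then have "(a + 1) * ?q \<le> m * ?q" by (rule mult_le_mono1)
  then show "nat (int t - k) \<le> m * ?q" unfolding nt using r'(2) by simp
qed

text \<open>Good rows contribute \<open>\<eta>\<^sup>2\<close> each, bad ones at most
  \<open>(2 * C)\<^sup>2\<close>. The margin \<open>b\<close> is free: \<open>LT_continuous\<close>
  takes just the size of the shift, \<open>LT_wtrap\<close> adds the distance from the cell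
  walls.\<close>

lemma LT_single_diff:
  fixes n m b :: "'d::{finite,linorder} \<Rightarrow> nat"
  assumes f: "\<And>r. fourier_coeff f r = (if r = k then 1 else 0)"
    and n: "\<forall>l. 1 \<le> n l" and m: "\<forall>l. 1 \<le> m l" and b: "\<forall>l. \<bar>k l\<bar> \<le> int (b l)" and C: "0 \<le> C" and \<eta>: "0 \<le> \<eta>"
    and v: "\<And>a. a \<in> mi_range m \<Longrightarrow> cmod (v (pt m a)) \<le> C"
    and w: "\<And>i. i \<in> mi_range n \<Longrightarrow> cmod (w (pt n i)) \<le> C"
    and good: "\<And>i. i \<in> mi_range n \<Longrightarrow> (\<And>l. \<not> bad1 (n l) (m l) (b l) (i l)) \<Longrightarrow> cmod (v (pt m (blk n m i)) - w (pt n i)) \<le> \<eta>"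
  shows "frob2 (LT_op n m v f - single n k (\<lambda>i. w (pt n i)))
     \<le> (\<eta>\<^sup>2 + (2 * C)\<^sup>2 * (\<Sum>l\<in>UNIV. real (m l * (2 * b l + 1)) / real (n l))) * real (mi_size n)"
proof -
  let ?h = "\<lambda>i. (if blk_ok n m i \<and> blk_ok n m (shift i k) \<and> blk n m i = blk n m (shift i k)
     then 1 * v (pt m (blk n m i)) else 0) - w (pt n i)"
  let ?B = "{i \<in> mi_range n. \<exists>l. bad1 (n l) (m l) (b l) (i l)}"
  have eq: "LT_op n m v f - single n k (\<lambda>i. w (pt n i)) = single n k ?h"
    unfolding LT_op_single[OF f] single_minus ..
  have "frob2 (single n k ?h) \<le> (\<Sum>i\<in>mi_range n. (cmod (?h i))\<^sup>2)" by (rule frob2_single)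
  also have "\<dots> \<le> (\<Sum>i\<in>mi_range n. \<eta>\<^sup>2 + (if i \<in> ?B then (2 * C)\<^sup>2 else 0))"
  proof (rule sum_mono)
    fix i assume i: "i \<in> mi_range n"
    show "(cmod (?h i))\<^sup>2 \<le> \<eta>\<^sup>2 + (if i \<in> ?B then (2 * C)\<^sup>2 else 0)"
    proof (cases "i \<in> ?B")
      case False
      then have g: "\<not> bad1 (n l) (m l) (b l) (i l)" for l using i by auto
      have i1: "1 \<le> i l" for l using i by (simp add: mi_range_iff)
      note gb = good_block[OF g i1 b[rule_format]]
      have "blk_ok n m i" unfolding blk_ok_def using gb(1) by blast
      moreover have "blk_ok n m (shift i k)" unfolding blk_ok_def shift_def using gb(2) by blast
      moreover have "blk n m i = blk n m (shift i k)" unfolding blk_def shift_def using gb(3) by auto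
      ultimately have "cmod (?h i) \<le> \<eta>" using good[OF i g] by simp
      then have "(cmod (?h i))\<^sup>2 \<le> \<eta>\<^sup>2" by (intro power_mono) auto
      then show ?thesis by (simp only: False if_False add_0_right)
    next
      case True
      have "cmod (?h i) \<le> cmod (if blk_ok n m i \<and> blk_ok n m (shift i k) \<and> blk n m i = blk n m (shift i k)
     then 1 * v (pt m (blk n m i)) else 0) + cmod (w (pt n i))" by (rule norm_triangle_ineq4)
      also have "\<dots> \<le> C + C" using w[OF i] v[OF blk_range(1)[OF i]] C by (intro add_mono) auto
      finally have "(cmod (?h i))\<^sup>2 \<le> (2 * C)\<^sup>2" by (intro power_mono) auto
      then have "(cmod (?h i))\<^sup>2 \<le> \<eta>\<^sup>2 + (2 * C)\<^sup>2" using zero_le_power2[of \<eta>] by linarith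
      then show ?thesis by (simp only: True if_True)
    qed
  qed
  also have "\<dots> = \<eta>\<^sup>2 * real (mi_size n) + (2 * C)\<^sup>2 * real (card ?B)"
    by (simp add: sum.distrib sum.If_cases card_mi_range Int_def)
  also have "\<dots> \<le> \<eta>\<^sup>2 * real (mi_size n) + (2 * C)\<^sup>2 * ((\<Sum>l\<in>UNIV. real (m l * (2 * b l + 1)) / real (n l)) * real (mi_size n))"
  proof (intro add_left_mono mult_left_mono card_mi_bad_frac)
    fix l
    have "real (card {t \<in> {1..n l}. bad1 (n l) (m l) (b l) t}) \<le> real (m l * (2 * b l + 1))"
      using card_bad1[OF m[rule_format]] by (rule of_nat_mono)
    then show "real (card {t \<in> {1..n l}. bad1 (n l) (m l) (b l) t}) \<le> real (m l * (2 * b l + 1)) / real (n l) * real (n l)"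
      using mi_pos[OF n, of l] by simp
  qed auto
  finally show ?thesis unfolding eq by (simp add: algebra_simps)
qed

text \<open>The term \<open>1 / m\<close> is the width of a block in the unit interval;
  \<open>m / n\<close> accounts for blocks of length \<open>n div m\<close>, whose total falls short
  of \<open>n\<close> by less than \<open>m\<close>.\<close>

lemma blk_pt_close:
  fixes t n m :: nat
  assumes t: "1 \<le> t" "t \<le> m * (n div m)" and n: "1 \<le> n" and m: "1 \<le> m"
  shows "\<bar>real ((t - 1) div (n div m) + 1) / real m - real t / real n\<bar> \<le> 1 / real m + real m / real n"
proof -
  let ?q = "n div m"
  define a r where "a = (t - 1) div ?q" and "r = (t - 1) mod ?q"
  note q = block_range_nat[OF t]
  have t1: "t = a * ?q + r + 1" unfolding a_def r_def div_mult_mod_eq using t(1) by simp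
  have rq: "r + 1 \<le> ?q" unfolding r_def by (rule q(2))
  have am: "a + 1 \<le> m" unfolding a_def by (rule q(1))
  have n1: "n = m * ?q + n mod m" by (rule mult_div_mod_eq[symmetric])
  have nm: "n mod m < m" using m by simp
  have pos: "0 < real n" "0 < real m" using n m by auto
  have "t * m \<le> (a + 1) * n"
  proof -
    have "t * m \<le> ((a + 1) * ?q) * m" using t1 rq by (intro mult_le_mono1) simp
    also have "\<dots> = (a + 1) * (m * ?q)" by (simp add: algebra_simps)
    also have "\<dots> \<le> (a + 1) * n" by (intro mult_le_mono2) (simp add: times_div_less_eq_dividend)
    finally show ?thesis .
  qed
  then have "real t * real m \<le> real (a + 1) * real n" by (metis of_nat_le_iff of_nat_mult)
  then have up: "real t / real n \<le> real (a + 1) / real m" using pos by (simp add: field_simps)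
  have "(a + 1) * n \<le> t * m + n + m * m"
  proof -
    have "a * n = a * (m * ?q) + a * (n mod m)" using n1 by (metis distrib_left)
    also have "a * (m * ?q) \<le> t * m" using t1 by (simp add: algebra_simps)
    also have "a * (n mod m) \<le> m * m" using am nm by (intro mult_le_mono) auto
    finally show ?thesis by simp
  qed
  then have "real ((a + 1) * n) \<le> real (t * m + n + m * m)" by (rule of_nat_mono)
  then have "real (a + 1) * real n \<le> real t * real m + real n + real m * real m" by (simp add: algebra_simps)
  then have "real (a + 1) * real n / (real m * real n) \<le> (real t * real m + real n + real m * real m) / (real m * real n)"
    using pos by (intro divide_right_mono) auto
  moreover have "real (a + 1) * real n / (real m * real n) = real (a + 1) / real m" using pos by simp
  moreover have "(real t * real m + real n + real m * real m) / (real m * real n) = real t / real n + (1 / real m + real m / real n)"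
    using pos by (simp add: field_simps)
  ultimately have "real (a + 1) / real m \<le> real t / real n + (1 / real m + real m / real n)" by simp
  then show ?thesis using up by (simp add: a_def abs_le_iff)
qed

lemma norm_blk_pt:
  assumes i: "i \<in> mi_range n" and ok: "blk_ok n m i" and n: "\<forall>l. 1 \<le> n l" and m: "\<forall>l. 1 \<le> m l"
  shows "norm (pt m (blk n m i) - pt n i) \<le> (\<Sum>l\<in>UNIV. 1 / real (m l) + real (m l) / real (n l))"
proof -
  have "norm (pt m (blk n m i) - pt n i) \<le> (\<Sum>l\<in>UNIV. \<bar>vec_nth (pt m (blk n m i) - pt n i) l\<bar>)" by (rule norm_le_l1_cart)
  also have "\<dots> \<le> (\<Sum>l\<in>UNIV. 1 / real (m l) + real (m l) / real (n l))"
  proof (rule sum_mono)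
    fix l
    show "\<bar>vec_nth (pt m (blk n m i) - pt n i) l\<bar> \<le> 1 / real (m l) + real (m l) / real (n l)"
      using blk_pt_close[of "i l" "m l" "n l"] i ok n m by (simp add: pt_def blk_def mi_range_iff blk_ok_def)
  qed
  finally show ?thesis .
qed

text \<open>\<open>y\<close> is the position of \<open>t / n\<close> within its cell, scaled to
  [0, 1]. In the bound on \<open>b\<close>, \<open>\<eta> * n / m\<close> is the wanted margin and
  the extra \<open>m\<close> absorbs the drift between blocks of length \<open>n div m\<close> and
  cells of width \<open>n / m\<close>.\<close>

lemma good_cell:
  fixes t n m b :: nat and \<eta> :: real
  assumes g: "\<not> bad1 n m b t" and t: "1 \<le> t" and n: "1 \<le> n" and m: "1 \<le> m" and \<eta>: "0 \<le> \<eta>"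
    and b: "\<eta> * real n / real m + real m \<le> real b"
  defines "y \<equiv> real m * (real t / real n) - real ((t - 1) div (n div m) + 1) + 1"
  shows "\<eta> \<le> y" "y \<le> 1 - \<eta>"
proof -
  let ?q = "n div m"
  define a r where "a = (t - 1) div ?q" and "r = (t - 1) mod ?q"
  have le: "t \<le> m * ?q" using g by (simp add: bad1_def)
  note q = block_range_nat[OF t le]
  have r: "b \<le> r" "r + b < ?q" using g by (auto simp: bad1_def r_def)
  have t1: "t = a * ?q + r + 1" unfolding a_def r_def div_mult_mod_eq using t(1) by simp
  have am: "a + 1 \<le> m" unfolding a_def by (rule q(1))
  have n1: "n = m * ?q + n mod m" by (rule mult_div_mod_eq[symmetric])
  have nm: "n mod m < m" using m by simp
  have pos: "0 < real n" "0 < real m" using n m by auto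
  have bm: "\<eta> * real n + real m * real m \<le> real m * real b"
    using mult_left_mono[OF b, of "real m"] pos by (simp add: algebra_simps)
  have y: "y = (real m * real t - real a * real n) / real n" using pos by (simp add: y_def a_def field_simps)
  have tq: "real m * real t = real a * (real m * real ?q) + real m * (real r + 1)"
    by (subst t1) (simp add: algebra_simps)
  have nr: "real n = real m * real ?q + real (n mod m)" by (metis n1 of_nat_add of_nat_mult)
  have "real a * real (n mod m) \<le> real m * real m" using am nm by (intro mult_mono) auto
  moreover have "real m * real b \<le> real m * real r" by (rule mult_left_mono) (use r in auto)
  moreover have "real m * real t - real a * real n = real m * (real r + 1) - real a * real (n mod m)"
    unfolding tq by (subst nr) (simp add: algebra_simps)
  moreover have "real m * (real r + 1) = real m * real r + real m" by (simp add: algebra_simps)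
  ultimately have "\<eta> * real n \<le> real m * real t - real a * real n" using bm pos by linarith
  then show "\<eta> \<le> y" unfolding y using pos by (simp add: pos_le_divide_eq)
  have "real m * (real r + 1 + real b) \<le> real m * real ?q" using r by (intro mult_left_mono) auto
  then have "real m * (real r + 1) \<le> real n - real m * real b" using nr by (simp add: algebra_simps)
  moreover have "0 \<le> real a * real (n mod m)" "0 \<le> real m * real m" by auto
  moreover have "real m * real t - real a * real n = real m * (real r + 1) - real a * real (n mod m)" by fact
  moreover have "(1 - \<eta>) * real n = real n - \<eta> * real n" by (simp add: algebra_simps)
  ultimately have "real m * real t - real a * real n \<le> (1 - \<eta>) * real n" using bm by linarith
  then show "y \<le> 1 - \<eta>" unfolding y using pos by (simp add: pos_divide_le_eq)
qed

text \<open>A trapezoid: 1 on \<open>[\<eta>, 1 - \<eta>]\<close>, 0 outside the unit interval and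
  linear in between.\<close>

definition trap :: "real \<Rightarrow> real \<Rightarrow> real" where
  "trap \<eta> t = max 0 (min 1 (min (t / \<eta>) ((1 - t) / \<eta>)))"

lemma trap_one: "0 < \<eta> \<Longrightarrow> \<eta> \<le> t \<Longrightarrow> t \<le> 1 - \<eta> \<Longrightarrow> trap \<eta> t = 1"
  by (auto simp: trap_def min_def max_def field_simps)

lemma trap_zero: "0 < \<eta> \<Longrightarrow> t \<le> 0 \<or> 1 \<le> t \<Longrightarrow> trap \<eta> t = 0"
  by (auto simp: trap_def min_def max_def field_simps)

lemma trap_bound: "0 \<le> trap \<eta> t" "trap \<eta> t \<le> 1"
  by (auto simp: trap_def)

text \<open>A continuous version of the function that equals \<open>v(a/m)\<close> on the cell with upper corner
  \<open>a/m\<close>: it agrees with it except near the walls of the cells.\<close>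

definition wtrap :: "real \<Rightarrow> ('d::finite \<Rightarrow> nat) \<Rightarrow> (real ^ 'd \<Rightarrow> complex) \<Rightarrow> real ^ 'd \<Rightarrow> complex" where
  "wtrap \<eta> m v x = (\<Sum>a\<in>mi_range m. v (pt m a) * complex_of_real (\<Prod>l\<in>UNIV. trap \<eta> (real (m l) * vec_nth x l - real (a l) + 1)))"

lemma continuous_wtrap: "0 < \<eta> \<Longrightarrow> continuous_on S (wtrap \<eta> m v)"
  unfolding wtrap_def trap_def
  by (intro continuous_intros continuous_on_max continuous_on_min) auto

lemma wtrap_bound: "cmod (wtrap \<eta> m v x) \<le> (\<Sum>a\<in>mi_range m. cmod (v (pt m a)))"
  unfolding wtrap_def
proof (rule sum_norm_le)
  fix a assume "a \<in> mi_range m"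
  let ?p = "\<Prod>l\<in>UNIV. trap \<eta> (real (m l) * vec_nth x l - real (a l) + 1)"
  have "0 \<le> ?p" "?p \<le> 1" by (auto intro!: prod_nonneg prod_le_1 simp: trap_bound)
  then show "cmod (v (pt m a) * complex_of_real ?p) \<le> cmod (v (pt m a))"
    by (simp add: norm_mult mult_left_le del: of_real_prod)
qed

lemma wtrap_eq:
  assumes \<eta>: "0 < \<eta>" and a: "a \<in> mi_range m"
    and x: "\<And>l. \<eta> \<le> real (m l) * vec_nth x l - real (a l) + 1 \<and> real (m l) * vec_nth x l - real (a l) + 1 \<le> 1 - \<eta>"
  shows "wtrap \<eta> m v x = v (pt m a)"
proof -
  have "wtrap \<eta> m v x = (\<Sum>a'\<in>mi_range m. if a' = a then v (pt m a) else 0)"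
    unfolding wtrap_def
  proof (rule sum.cong[OF refl])
    fix a' assume "a' \<in> mi_range m"
    show "v (pt m a') * complex_of_real (\<Prod>l\<in>UNIV. trap \<eta> (real (m l) * vec_nth x l - real (a' l) + 1)) = (if a' = a then v (pt m a) else 0)"
    proof (cases "a' = a")
      case True
      then have "(\<Prod>l\<in>UNIV. trap \<eta> (real (m l) * vec_nth x l - real (a' l) + 1)) = 1"
        using x by (intro prod.neutral ballI) (auto intro!: trap_one \<eta>)
      then show ?thesis using True by (simp del: of_real_prod)
    next
      case False
      then obtain l where l: "a' l \<noteq> a l" by blast
      have "trap \<eta> (real (m l) * vec_nth x l - real (a' l) + 1) = 0"
      proof (rule trap_zero[OF \<eta>])
        have "real (a' l) + 1 \<le> real (a l) \<or> real (a l) + 1 \<le> real (a' l)" using l by linarith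
        then show "real (m l) * vec_nth x l - real (a' l) + 1 \<le> 0 \<or> 1 \<le> real (m l) * vec_nth x l - real (a' l) + 1"
          using x[of l] \<eta> by linarith
      qed
      then have "(\<Prod>l\<in>UNIV. trap \<eta> (real (m l) * vec_nth x l - real (a' l) + 1)) = 0" by (intro prod_zero) auto
      then show ?thesis using False by (simp del: of_real_prod)
    qed
  qed
  also have "\<dots> = v (pt m a)" using a by simp
  finally show ?thesis .
qed

context mlseq
begin

text \<open>Away from the walls \<open>wtrap\<close> reproduces the block value exactly, so only bad
  indices count. Their proportion is at most \<open>2 * \<eta>\<close> per coordinate plus a
  vanishing part, for which the additional \<open>\<eta>\<close> makes room.\<close>

lemma LT_wtrap:
  assumes f: "\<And>r. fourier_coeff f r = (if r = k then 1 else 0)"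
    and m: "\<forall>l. 1 \<le> m l" and \<eta>: "0 < \<eta>"
  shows "eventually (\<lambda>n. frob2 (LT_op (nn n) m v f - single (nn n) k (\<lambda>i. wtrap \<eta> m v (pt (nn n) i)))
     \<le> (2 * (\<Sum>a\<in>mi_range m. cmod (v (pt m a))))\<^sup>2 * ((2 * real CARD('d) + 1) * \<eta>) * real (N n)) F"
proof -
  define C where "C = (\<Sum>a\<in>mi_range m. cmod (v (pt m a)))"
  have C: "0 \<le> C" unfolding C_def by (intro sum_nonneg) auto
  \<comment> \<open>The wall margin, the drift allowance required by \<open>good_cell\<close>, and
    the size of the shift.\<close>
  define b where "b n l = nat \<lceil>\<eta> * real (nn n l) / real (m l)\<rceil> + m l + nat \<bar>k l\<bar>" for n l
  \<comment> \<open>The part of \<open>m * (2 * b + 1)\<close> that does not grow with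
    \<open>n\<close>; the 3 is 1 plus twice the rounding of the ceiling.\<close>
  define cc where "cc l = real (m l) * (2 * real (m l) + 2 * \<bar>real_of_int (k l)\<bar> + 3)" for l
  have "eventually (\<lambda>n. (\<Sum>l\<in>UNIV. cc l / real (nn n l)) < \<eta>) F"
    by (rule order_tendstoD(2)[OF lim_sum_inv \<eta>])
  then show ?thesis using ev_I
  proof eventually_elim
    case (elim n)
    note n = pos[OF elim(2)]
    have "frob2 (LT_op (nn n) m v f - single (nn n) k (\<lambda>i. wtrap \<eta> m v (pt (nn n) i)))
      \<le> (0\<^sup>2 + (2 * C)\<^sup>2 * (\<Sum>l\<in>UNIV. real (m l * (2 * b n l + 1)) / real (nn n l))) * real (N n)"
    proof (rule LT_single_diff[OF f n m])
      show "\<forall>l. \<bar>k l\<bar> \<le> int (b n l)" by (auto simp: b_def)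
      show "cmod (v (pt m a)) \<le> C" if "a \<in> mi_range m" for a
        unfolding C_def by (rule member_le_sum[OF that]) auto
      show "cmod (wtrap \<eta> m v (pt (nn n) i)) \<le> C" for i unfolding C_def by (rule wtrap_bound)
      fix i assume i: "i \<in> mi_range (nn n)" and g: "\<And>l. \<not> bad1 (nn n l) (m l) (b n l) (i l)"
      have i1: "1 \<le> i l" for l using i by (simp add: mi_range_iff)
      have ok: "blk_ok (nn n) m i" using g by (auto simp: blk_ok_def bad1_def not_less)
      have "wtrap \<eta> m v (pt (nn n) i) = v (pt m (blk (nn n) m i))"
      proof (rule wtrap_eq[OF \<eta> blk_range(1)[OF i ok]])
        fix l
        have "\<eta> * real (nn n l) / real (m l) + real (m l) \<le> real (b n l)"
          unfolding b_def using real_nat_ceiling_ge[of "\<eta> * real (nn n l) / real (m l)"] by simp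
        from good_cell[OF g i1 n[rule_format] m[rule_format] less_imp_le[OF \<eta>] this]
        show "\<eta> \<le> real (m l) * vec_nth (pt (nn n) i) l - real (blk (nn n) m i l) + 1 \<and>
           real (m l) * vec_nth (pt (nn n) i) l - real (blk (nn n) m i l) + 1 \<le> 1 - \<eta>"
          by (simp add: pt_def blk_def)
      qed
      then show "cmod (v (pt m (blk (nn n) m i)) - wtrap \<eta> m v (pt (nn n) i)) \<le> 0" by simp
    qed (use C in auto)
    also have "\<dots> = (2 * C)\<^sup>2 * (\<Sum>l\<in>UNIV. real (m l * (2 * b n l + 1)) / real (nn n l)) * real (N n)" by simp
    also have "\<dots> \<le> (2 * C)\<^sup>2 * ((2 * real CARD('d) + 1) * \<eta>) * real (N n)"
    proof (intro mult_right_mono mult_left_mono)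
      have "(\<Sum>l\<in>UNIV. real (m l * (2 * b n l + 1)) / real (nn n l)) \<le> (\<Sum>l\<in>UNIV. 2 * \<eta> + cc l / real (nn n l))"
      proof (rule sum_mono)
        fix l
        have p: "0 < real (nn n l)" "0 < real (m l)" using mi_pos[OF n] mi_pos[OF m] by auto
        have "0 \<le> \<eta> * real (nn n l) / real (m l)" using \<eta> by simp
        then have "real (nat \<lceil>\<eta> * real (nn n l) / real (m l)\<rceil>) \<le> \<eta> * real (nn n l) / real (m l) + 1" by linarith
        then have "real (b n l) \<le> \<eta> * real (nn n l) / real (m l) + 1 + real (m l) + \<bar>real_of_int (k l)\<bar>" by (simp add: b_def)
        then have "real (m l) * (2 * real (b n l) + 1) \<le> real (m l) * (2 * (\<eta> * real (nn n l) / real (m l) + 1 + real (m l) + \<bar>real_of_int (k l)\<bar>) + 1)"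
          using p by (intro mult_left_mono) auto
        also have "\<dots> = 2 * \<eta> * real (nn n l) + cc l" using p by (simp add: cc_def field_simps)
        finally have "real (m l * (2 * b n l + 1)) \<le> 2 * \<eta> * real (nn n l) + cc l"
          by (simp only: of_nat_mult of_nat_add of_nat_numeral of_nat_1)
        then have "real (m l * (2 * b n l + 1)) / real (nn n l) \<le> (2 * \<eta> * real (nn n l) + cc l) / real (nn n l)"
          using p by (intro divide_right_mono) auto
        also have "\<dots> = 2 * \<eta> + cc l / real (nn n l)" using p by (simp add: add_divide_distrib)
        finally show "real (m l * (2 * b n l + 1)) / real (nn n l) \<le> 2 * \<eta> + cc l / real (nn n l)" .
      qed
      also have "\<dots> = 2 * real CARD('d) * \<eta> + (\<Sum>l\<in>UNIV. cc l / real (nn n l))" by (simp add: sum.distrib)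
      also have "\<dots> \<le> 2 * real CARD('d) * \<eta> + \<eta>" using elim(1) by simp
      finally show "(\<Sum>l\<in>UNIV. real (m l * (2 * b n l + 1)) / real (nn n l)) \<le> (2 * real CARD('d) + 1) * \<eta>"
        by (simp add: algebra_simps)
    qed auto
    finally show ?case unfolding C_def .
  qed
qed

text \<open>For continuous \<open>v\<close> no cut-off is needed: the block point and the grid point
  differ by about \<open>1 / m + m / n\<close>, small once \<open>m\<close> is large and then
  \<open>n\<close> is large compared with \<open>m\<close>. This is the approximation that makes
  \<open>single\<close> matrices LT sequences.\<close>

lemma LT_continuous:
  assumes f: "\<And>r. fourier_coeff f r = (if r = k then 1 else 0)"
    and v: "continuous_on unit_cube v" and e: "0 < e"
  shows "eventually (\<lambda>m. (\<forall>l. 1 \<le> m l) \<longrightarrow>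
     eventually (\<lambda>n. frob2 (single (nn n) k (\<lambda>i. v (pt (nn n) i)) - LT_op (nn n) m v f) \<le> e * real (N n)) F) mi_at_top"
proof -
  obtain K where K: "0 < K" "\<And>x. x \<in> unit_cube \<Longrightarrow> cmod (v x) \<le> K" using unit_cube_bounded[OF v] by metis
  define \<eta> where "\<eta> = sqrt (e / 2)"
  have \<eta>: "0 < \<eta>" "\<eta>\<^sup>2 = e / 2" using e by (auto simp: \<eta>_def)
  have "uniformly_continuous_on unit_cube v" by (rule compact_uniformly_continuous[OF v]) (simp add: unit_cube_def)
  then obtain \<delta> where \<delta>: "0 < \<delta>" "\<And>x x'. x \<in> unit_cube \<Longrightarrow> x' \<in> unit_cube \<Longrightarrow> dist x' x < \<delta> \<Longrightarrow> dist (v x') (v x) < \<eta>"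
    unfolding uniformly_continuous_on_def using \<eta>(1) by blast
  obtain M :: nat where M: "2 * real CARD('d) / \<delta> < real M" using reals_Archimedean2 by blast
  have "eventually (\<lambda>m :: 'd \<Rightarrow> nat. M \<le> Min (range m)) mi_at_top"
    unfolding mi_at_top_def eventually_filtercomap by (intro exI[of _ "\<lambda>x. M \<le> x"]) (auto simp: eventually_at_top_linorder)
  then show ?thesis
  proof (rule eventually_mono, intro impI)
    fix m :: "'d \<Rightarrow> nat" assume Mm: "M \<le> Min (range m)" and m: "\<forall>l. 1 \<le> m l"
    have ml: "M \<le> m l" for l using Mm Min_le[of "range m" "m l"] by simp
    have M0: "0 < real M" using M \<delta>(1) by (meson divide_nonneg_pos le_less_trans mult_nonneg_nonneg of_nat_0_le_iff zero_le_numeral)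
    have s1: "(\<Sum>l\<in>UNIV. 1 / real (m l)) < \<delta> / 2"
    proof -
      have "(\<Sum>l\<in>UNIV. 1 / real (m l)) \<le> (\<Sum>l\<in>(UNIV :: 'd set). 1 / real M)"
        using ml M0 by (intro sum_mono divide_left_mono) (auto intro!: mult_pos_pos mi_pos[OF m])
      also have "\<dots> = real CARD('d) / real M" by simp
      also have "\<dots> < \<delta> / 2" using M M0 \<delta>(1) by (simp add: field_simps)
      finally show ?thesis .
    qed
    have "eventually (\<lambda>n. (\<Sum>l\<in>UNIV. real (m l) / real (nn n l)) < \<delta> / 2) F"
      using \<delta>(1) by (intro order_tendstoD(2)[OF lim_sum_inv]) auto
    moreover have "eventually (\<lambda>n. (\<Sum>l\<in>UNIV. real (m l * (2 * nat \<bar>k l\<bar> + 1)) / real (nn n l)) < e / (2 * (2 * K)\<^sup>2)) F"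
      using e K(1) by (intro order_tendstoD(2)[OF lim_sum_inv]) auto
    ultimately show "eventually (\<lambda>n. frob2 (single (nn n) k (\<lambda>i. v (pt (nn n) i)) - LT_op (nn n) m v f) \<le> e * real (N n)) F"
      using ev_I
    proof eventually_elim
      case (elim n)
      note n = pos[OF elim(3)]
      let ?S = "single (nn n) k (\<lambda>i. v (pt (nn n) i))" and ?L = "LT_op (nn n) m v f"
      have "?S - ?L = (-1) \<cdot>\<^sub>m (?L - ?S)"
        by (intro eq_matI) auto
      then have "frob2 (?S - ?L) = frob2 (?L - ?S)" by (simp add: frob2_def norm_minus_commute)
      also have "frob2 (?L - ?S) \<le> (\<eta>\<^sup>2 + (2 * K)\<^sup>2 * (\<Sum>l\<in>UNIV. real (m l * (2 * nat \<bar>k l\<bar> + 1)) / real (nn n l))) * real (N n)"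
      proof (rule LT_single_diff[OF f n m])
        fix i assume i: "i \<in> mi_range (nn n)" and g: "\<And>l. \<not> bad1 (nn n l) (m l) (nat \<bar>k l\<bar>) (i l)"
        have ok: "blk_ok (nn n) m i" using g by (auto simp: blk_ok_def bad1_def not_less)
        have "norm (pt m (blk (nn n) m i) - pt (nn n) i) < \<delta>"
          using norm_blk_pt[OF i ok n m] s1 elim(1) by (simp add: sum.distrib)
        then have "dist (v (pt m (blk (nn n) m i))) (v (pt (nn n) i)) < \<eta>"
          by (intro \<delta>(2) pt_in i blk_range(1)[OF i ok]) (simp add: dist_norm)
        then show "cmod (v (pt m (blk (nn n) m i)) - v (pt (nn n) i)) \<le> \<eta>" by (simp add: dist_norm)
      qed (use K \<eta> pt_in in \<open>auto simp: less_imp_le\<close>)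
      also have "\<dots> \<le> (e / 2 + e / 2) * real (N n)"
      proof (intro mult_right_mono add_mono)
        have "(2 * K)\<^sup>2 * (\<Sum>l\<in>UNIV. real (m l * (2 * nat \<bar>k l\<bar> + 1)) / real (nn n l)) \<le> (2 * K)\<^sup>2 * (e / (2 * (2 * K)\<^sup>2))"
          using elim(2) by (intro mult_left_mono) auto
        also have "\<dots> = e / 2" using K(1) by simp
        finally show "(2 * K)\<^sup>2 * (\<Sum>l\<in>UNIV. real (m l * (2 * nat \<bar>k l\<bar> + 1)) / real (nn n l)) \<le> e / 2" .
      qed (use \<eta> in auto)
      finally show ?case by simp
    qed
  qed
qed

end

section \<open>Density of trigonometric polynomials\<close>

lemma mem_angle_cube: "\<theta> \<in> angle_cube \<longleftrightarrow> (\<forall>j. - pi \<le> vec_nth \<theta> j \<and> vec_nth \<theta> j \<le> pi)"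
  by (auto simp: angle_cube_def mem_box_cart)

lemma angle_cube_sets [simp]: "angle_cube \<in> sets lebesgue" "angle_cube \<in> sets borel" "unit_cube \<in> sets lebesgue" "unit_cube \<in> sets borel"
  by (auto simp: angle_cube_def unit_cube_def)

lemma finite_angle_cube: "finite_measure (lebesgue_on (angle_cube :: (real ^ 'd::finite) set))"
  by (rule finite_measure_lebesgue_on) (simp add: angle_cube_def)

lemma integral_exp_period:
  "(LBINT t. indicat_real {- pi..pi} t *\<^sub>R exp (\<i> * complex_of_real (real_of_int m * t))) = (if m = 0 then 2 * complex_of_real pi else 0)"
proof (cases "m = 0")
  case True
  have "(LBINT t. indicat_real {- pi..pi} t *\<^sub>R (1 :: complex)) = complex_of_real pi - complex_of_real (- pi)"
  proof (rule integral_FTC_Icc)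
    show "(complex_of_real has_vector_derivative 1) (at x within {- pi..pi})" for x
      using has_vector_derivative_of_real[OF DERIV_ident] by (simp add: has_vector_derivative_at_within)
  qed auto
  then show ?thesis using True by simp
next
  case False
  let ?G = "\<lambda>t. exp (\<i> * complex_of_real (real_of_int m * t)) / (\<i> * complex_of_int m)"
  have "(LBINT t. indicat_real {- pi..pi} t *\<^sub>R exp (\<i> * complex_of_real (real_of_int m * t))) = ?G pi - ?G (- pi)"
  proof (rule integral_FTC_Icc)
    fix x :: real
    have "((\<lambda>z. exp (\<i> * (of_int m * z)) / (\<i> * of_int m)) has_field_derivative exp (\<i> * (of_int m * complex_of_real x))) (at (complex_of_real x))"
      using False by (auto intro!: derivative_eq_intros simp: mult_ac)
    from has_vector_derivative_real_field[OF this]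
    show "(?G has_vector_derivative exp (\<i> * complex_of_real (real_of_int m * x))) (at x within {- pi..pi})"
      by simp
  qed (auto intro!: continuous_intros)
  also have "?G pi - ?G (- pi) = 0"
  proof -
    have "exp (\<i> * complex_of_real (real_of_int m * pi)) = exp (\<i> * complex_of_real (real_of_int m * (- pi)))"
      unfolding exp_eq by (intro exI[of _ m]) (simp add: algebra_simps)
    then show ?thesis by simp
  qed
  finally show ?thesis using False by simp
qed

lemma sum_Basis_axis: "(\<Sum>b\<in>Basis. (f b :: real) *\<^sub>R (b :: real ^ 'd::finite)) = (\<chi> j. f (axis j 1))"
proof -
  have B: "(Basis :: (real ^ 'd) set) = range (\<lambda>j. axis j 1)" by (auto simp: Basis_vec_def)
  have inj: "inj (\<lambda>j :: 'd. axis j (1 :: real))" by (auto intro!: injI simp: axis_eq_axis)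
  show ?thesis
  proof (rule Finite_Cartesian_Product.vec_eq_iff[THEN iffD2], rule allI)
    fix i
    have "vec_nth (\<Sum>b\<in>Basis. f b *\<^sub>R (b :: real ^ 'd)) i = (\<Sum>j\<in>UNIV. f (axis j 1) * vec_nth (axis j 1) i)"
      unfolding B by (subst sum.reindex[OF inj]) simp
    also have "\<dots> = (\<Sum>j\<in>UNIV. if j = i then f (axis j 1) else 0)" by (intro sum.cong) (auto simp: axis_def)
    finally show "vec_nth (\<Sum>b\<in>Basis. f b *\<^sub>R (b :: real ^ 'd)) i = vec_nth (\<chi> j. f (axis j 1)) i" by simp
  qed
qed

lemma prod_Basis_axis: "(\<Prod>b\<in>Basis. g (b :: real ^ 'd::finite)) = (\<Prod>j\<in>UNIV. g (axis j 1) :: complex)"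
proof -
  have B: "(Basis :: (real ^ 'd) set) = range (\<lambda>j. axis j 1)" by (auto simp: Basis_vec_def)
  have inj: "inj (\<lambda>j :: 'd. axis j (1 :: real))" by (auto intro!: injI simp: axis_eq_axis)
  show ?thesis unfolding B by (subst prod.reindex[OF inj]) simp
qed

lemma fexp_borel [measurable]: "fexp k \<in> borel_measurable borel"
  using continuous_fexp[of UNIV k] by (rule borel_measurable_continuous_onI)

text \<open>Lebesgue measure on \<open>real ^ 'd\<close> is a product over \<open>Basis\<close>, and
  both the exponential and the indicator of the cube factor, so the integral is a product of
  integrals over one period.\<close>

lemma integral_fexp:
  fixes k :: "'d::finite \<Rightarrow> int"
  shows "(LINT \<theta>|angM. fexp k \<theta>) = (if k = (\<lambda>_. 0) then complex_of_real ((2 * pi) ^ CARD('d)) else 0)"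
proof -
  let ?A = "angle_cube :: (real ^ 'd) set"
  \<comment> \<open>The product measure is indexed by basis vectors rather than by coordinates;
    \<open>\<kappa>\<close> transports the frequencies accordingly.\<close>
  define \<kappa> where "\<kappa> b = (\<Sum>j\<in>UNIV. k j * (if vec_nth b j = (1::real) then 1 else 0))" for b :: "real ^ 'd"
  have \<kappa>: "\<kappa> (axis j 1) = k j" for j
  proof -
    have "vec_nth (axis j (1 :: real)) l = 1 \<longleftrightarrow> l = j" for l by (simp add: axis_def)
    then show ?thesis by (simp add: \<kappa>_def if_distrib[of "\<lambda>x. _ * x"] cong: if_cong)
  qed
  define h where "h b t = indicat_real {- pi..pi} t *\<^sub>R exp (\<i> * complex_of_real (real_of_int (\<kappa> b) * t))" for b :: "real ^ 'd" and t
  have bm: "(\<lambda>\<theta>. indicat_real ?A \<theta> *\<^sub>R fexp k \<theta>) \<in> borel_measurable borel"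
    by (intro borel_measurable_scaleR borel_measurable_indicator fexp_borel) simp
  have "(LINT \<theta>|lebesgue_on ?A. fexp k \<theta>) = (LINT \<theta>|lebesgue. indicat_real ?A \<theta> *\<^sub>R fexp k \<theta>)"
    by (rule integral_restrict_space) simp
  also have "\<dots> = (LBINT \<theta>. indicat_real ?A \<theta> *\<^sub>R fexp k \<theta>)"
    by (rule integral_completion) (use bm in simp)
  also have "\<dots> = (LINT f|Pi\<^sub>M Basis (\<lambda>b. lborel). indicat_real ?A (\<Sum>b\<in>Basis. f b *\<^sub>R b) *\<^sub>R fexp k (\<Sum>b\<in>Basis. f b *\<^sub>R b))"
    by (subst lborel_eq, subst integral_distr) (use bm in auto)
  also have "\<dots> = (LINT f|Pi\<^sub>M Basis (\<lambda>b. lborel). (\<Prod>b\<in>Basis. h b (f b)))"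
  proof (rule Bochner_Integration.integral_cong[OF refl])
    fix f :: "real ^ 'd \<Rightarrow> real"
    have "indicat_real ?A (\<chi> j. f (axis j 1)) = (\<Prod>j\<in>UNIV. indicat_real {- pi..pi} (f (axis j 1)))"
    proof (cases "(\<chi> j. f (axis j 1)) \<in> ?A")
      case True
      then have "indicat_real {- pi..pi} (f (axis j 1)) = 1" for j by (auto simp: mem_angle_cube)
      then show ?thesis using True by simp
    next
      case False
      then obtain j where "f (axis j 1) \<notin> {- pi..pi}" by (auto simp: mem_angle_cube)
      then have "indicat_real {- pi..pi} (f (axis j 1)) = 0" by simp
      then have "(\<Prod>j\<in>UNIV. indicat_real {- pi..pi} (f (axis j 1))) = 0" by (intro prod_zero) auto
      then show ?thesis using False by simp
    qed
    moreover have "fexp k (\<chi> j. f (axis j 1)) = (\<Prod>j\<in>UNIV. exp (\<i> * complex_of_real (real_of_int (k j) * f (axis j 1))))"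
      unfolding fexp_def by (simp add: exp_sum[symmetric] sum_distrib_left)
    ultimately show "indicat_real ?A (\<Sum>b\<in>Basis. f b *\<^sub>R b) *\<^sub>R fexp k (\<Sum>b\<in>Basis. f b *\<^sub>R b) = (\<Prod>b\<in>Basis. h b (f b))"
      unfolding sum_Basis_axis prod_Basis_axis by (simp add: h_def \<kappa> scaleR_conv_of_real prod.distrib)
  qed
  also have "\<dots> = (\<Prod>b\<in>Basis. LBINT t. h b t)"
  proof (rule product_sigma_finite.product_integral_prod)
    show "product_sigma_finite (\<lambda>b :: real ^ 'd. lborel :: real measure)" by (simp add: product_sigma_finite_def lborel.sigma_finite_measure_axioms)
    fix b :: "real ^ 'd"
    have "set_integrable lborel {- pi..pi} (\<lambda>t. exp (\<i> * complex_of_real (real_of_int (\<kappa> b) * t)))"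
      by (rule borel_integrable_atLeastAtMost') (auto intro!: continuous_intros)
    then show "integrable lborel (h b)" unfolding h_def set_integrable_def .
  qed simp
  also have "\<dots> = (\<Prod>j\<in>(UNIV :: 'd set). if k j = 0 then 2 * complex_of_real pi else 0)"
    unfolding prod_Basis_axis h_def integral_exp_period \<kappa> ..
  also have "\<dots> = (if k = (\<lambda>_. 0) then complex_of_real ((2 * pi) ^ CARD('d)) else 0)"
  proof (cases "k = (\<lambda>_. 0)")
    case False
    then obtain j where "k j \<noteq> 0" by auto
    then have "(\<Prod>j\<in>(UNIV :: 'd set). if k j = 0 then 2 * complex_of_real pi else 0) = 0" by (intro prod_zero) auto
    then show ?thesis using False by simp
  qed simp
  finally show ?thesis .
qed

lemma fourier_coeff_eq:
  "fourier_coeff f k = complex_of_real (1 / (2 * pi) ^ CARD('d)) * (LINT \<theta>|angM. f \<theta> * fexp (\<lambda>l. - k l) \<theta>)"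
  for f :: "real ^ 'd::finite \<Rightarrow> complex"
  unfolding fourier_coeff_def fexp_def by (simp add: sum_negf)

lemma fourier_coeff_fexp: "fourier_coeff (fexp k) r = (if r = k then 1 else 0)"
proof -
  have "fourier_coeff (fexp k) r = complex_of_real (1 / (2 * pi) ^ CARD('a)) * (LINT \<theta>|angM. fexp (\<lambda>l. k l + - r l) \<theta>)"
    unfolding fourier_coeff_eq fexp_add ..
  also have "\<dots> = (if r = k then 1 else 0)"
    unfolding integral_fexp by (auto simp: fun_eq_iff)
  finally show ?thesis .
qed

lemma fexp_lebesgue_on [measurable]: "fexp k \<in> borel_measurable (lebesgue_on S)"
  by (rule measurable_restrict_space1) (simp add: measurable_completion)

lemma integrable_mult_fexp:
  "integrable (lebesgue_on S) f \<Longrightarrow> integrable (lebesgue_on S) (\<lambda>\<theta>. f \<theta> * fexp k \<theta>)"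
  by (rule Bochner_Integration.integrable_bound[of _ f]) (auto simp: norm_mult)

lemma integrable_fexp: "integrable angM (fexp k)"
proof -
  have "integrable angM (\<lambda>_ :: real ^ 'a. 1 :: complex)"
    by (rule finite_measure.integrable_const[OF finite_angle_cube])
  then show ?thesis using integrable_mult_fexp[of angle_cube "\<lambda>_. 1" k] by simp
qed

lemma fourier_coeff_add:
  "integrable angM f \<Longrightarrow> integrable angM g \<Longrightarrow>
   fourier_coeff (\<lambda>\<theta>. f \<theta> + g \<theta>) k = fourier_coeff f k + fourier_coeff g k"
  unfolding fourier_coeff_eq by (simp add: distrib_right integrable_mult_fexp distrib_left)

lemma fourier_coeff_cmult: "fourier_coeff (\<lambda>\<theta>. c * f \<theta>) k = c * fourier_coeff f k"
  unfolding fourier_coeff_eq by (simp add: mult.assoc)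

fun teval :: "(complex \<times> ('d::finite \<Rightarrow> int)) list \<Rightarrow> real ^ 'd \<Rightarrow> complex" where
  "teval [] \<theta> = 0"
| "teval ((c, k) # p) \<theta> = c * fexp k \<theta> + teval p \<theta>"

lemma teval_append: "teval (p @ q) \<theta> = teval p \<theta> + teval q \<theta>"
  by (induction p \<theta> rule: teval.induct) auto

lemma integrable_teval: "integrable angM (teval p)"
proof (induction p)
  case (Cons a p)
  obtain c k where a: "a = (c, k)" by (cases a)
  have "integrable angM (\<lambda>\<theta>. c * fexp k \<theta> + teval p \<theta>)"
    using Cons integrable_fexp by (intro Bochner_Integration.integrable_add integrable_mult_right)
  then show ?case unfolding a by (simp add: teval.simps[abs_def])
qed simp

definition trigpoly :: "(real ^ 'd::finite \<Rightarrow> complex) \<Rightarrow> bool" where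
  "trigpoly f \<longleftrightarrow> (\<exists>p. \<forall>\<theta>. f \<theta> = teval p \<theta>)"

lemma trigpoly_fexp: "trigpoly (\<lambda>\<theta>. c * fexp k \<theta>)"
  unfolding trigpoly_def by (rule exI[of _ "[(c, k)]"]) simp

lemma trigpoly_const: "trigpoly (\<lambda>\<theta>. c)"
  using trigpoly_fexp[of c "\<lambda>_. 0"] by (simp add: fexp_zero)

lemma trigpoly_add: "trigpoly f \<Longrightarrow> trigpoly g \<Longrightarrow> trigpoly (\<lambda>\<theta>. f \<theta> + g \<theta>)"
  unfolding trigpoly_def by (metis teval_append)

lemma trigpoly_sum: "finite S \<Longrightarrow> (\<And>b. b \<in> S \<Longrightarrow> trigpoly (f b)) \<Longrightarrow> trigpoly (\<lambda>\<theta>. \<Sum>b\<in>S. f b \<theta>)"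
  by (induction S rule: finite_induct) (auto intro: trigpoly_const trigpoly_add)

lemma trigpoly_mult:
  assumes "trigpoly f" "trigpoly g" shows "trigpoly (\<lambda>\<theta>. f \<theta> * g \<theta>)"
proof -
  obtain p q where p: "\<And>\<theta>. f \<theta> = teval p \<theta>" and q: "\<And>\<theta>. g \<theta> = teval q \<theta>"
    using assms unfolding trigpoly_def by auto
  have 1: "trigpoly (\<lambda>\<theta>. c * fexp k \<theta> * teval q \<theta>)" for c k q
  proof (induction q)
    case Nil show ?case using trigpoly_const[of 0] by simp
  next
    case (Cons a q)
    obtain c' m where a: "a = (c', m)" by (cases a)
    have "trigpoly (\<lambda>\<theta>. (c * c') * fexp (\<lambda>l. k l + m l) \<theta> + c * fexp k \<theta> * teval q \<theta>)"
      by (intro trigpoly_add trigpoly_fexp Cons)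
    then show ?case unfolding a by (simp add: fexp_add algebra_simps)
  qed
  have "trigpoly (\<lambda>\<theta>. teval p \<theta> * teval q \<theta>)"
  proof (induction p)
    case Nil show ?case using trigpoly_const[of 0] by simp
  next
    case (Cons a p)
    obtain c k where a: "a = (c, k)" by (cases a)
    have "trigpoly (\<lambda>\<theta>. c * fexp k \<theta> * teval q \<theta> + teval p \<theta> * teval q \<theta>)"
      by (intro trigpoly_add 1 Cons)
    then show ?case unfolding a by (simp add: algebra_simps)
  qed
  then show ?thesis unfolding p q .
qed

text \<open>Wraps the cube onto the torus in complex space. Real polynomials in the coordinates of
  \<open>tor \<theta>\<close> are trigonometric polynomials in \<open>\<theta>\<close>, so
  Stone-Weierstrass becomes applicable.\<close>

definition tor :: "real ^ 'd::finite \<Rightarrow> complex ^ 'd" where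
  "tor \<theta> = (\<chi> j. cis (vec_nth \<theta> j))"

lemma trigpoly_tor_inner:
  assumes b: "b \<in> Basis" shows "trigpoly (\<lambda>\<theta>. complex_of_real (tor \<theta> \<bullet> b))"
proof -
  obtain j u where b: "b = axis j u" "u \<in> Basis" using b by (auto simp: Basis_vec_def)
  define k :: "'a \<Rightarrow> int" where "k = (\<lambda>l. if l = j then 1 else 0)"
  have s: "(\<Sum>l\<in>UNIV. real_of_int (k l) * vec_nth \<theta> l) = vec_nth \<theta> j" for \<theta> :: "real ^ 'a"
    by (simp add: k_def if_distrib[of "\<lambda>x. real_of_int x * _"] cong: if_cong)
  have e: "fexp k \<theta> = cis (vec_nth \<theta> j)" "fexp (\<lambda>l. - k l) \<theta> = cnj (cis (vec_nth \<theta> j))" for \<theta>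
    unfolding fexp_uminus unfolding fexp_def s by (simp_all add: cis_conv_exp)
  have i: "tor \<theta> \<bullet> b = cis (vec_nth \<theta> j) \<bullet> u" for \<theta>
    unfolding b(1) by (simp add: inner_axis tor_def)
  consider "u = 1" | "u = \<i>" using b(2) by (auto simp: Basis_complex_def)
  then show ?thesis
  proof cases
    case 1
    have "complex_of_real (tor \<theta> \<bullet> b) = 1/2 * fexp k \<theta> + 1/2 * fexp (\<lambda>l. - k l) \<theta>" for \<theta>
      unfolding e i 1 by (simp add: complex_eq_iff)
    then show ?thesis by (simp only:) (intro trigpoly_add trigpoly_fexp)
  next
    case 2
    have "complex_of_real (tor \<theta> \<bullet> b) = (- \<i>/2) * fexp k \<theta> + (\<i>/2) * fexp (\<lambda>l. - k l) \<theta>" for \<theta>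
      unfolding e i 2 by (simp add: complex_eq_iff inner_complex_def)
    then show ?thesis by (simp only:) (intro trigpoly_add trigpoly_fexp)
  qed
qed

lemma trigpoly_real_polynomial:
  assumes "real_polynomial_function g"
  shows "trigpoly (\<lambda>\<theta>. complex_of_real (g (tor \<theta>)))"
  using assms
proof (induction g rule: real_polynomial_function.induct)
  case (linear f)
  have "f (tor \<theta>) = (\<Sum>b\<in>Basis. (tor \<theta> \<bullet> b) * f b)" for \<theta>
  proof -
    have "f (tor \<theta>) = f (\<Sum>b\<in>Basis. (tor \<theta> \<bullet> b) *\<^sub>R b)" by (simp add: euclidean_representation)
    also have "\<dots> = (\<Sum>b\<in>Basis. (tor \<theta> \<bullet> b) *\<^sub>R f b)"
      using bounded_linear.linear[OF linear] by (simp add: linear_sum linear_cmul)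
    finally show ?thesis by simp
  qed
  then show ?case
    by (simp only: of_real_sum of_real_mult) (intro trigpoly_sum trigpoly_mult trigpoly_const trigpoly_tor_inner finite_Basis)
qed (auto intro: trigpoly_const trigpoly_add trigpoly_mult)

lemma trigpoly_polynomial:
  assumes "polynomial_function (g :: complex ^ 'd::finite \<Rightarrow> complex)"
  shows "trigpoly (\<lambda>\<theta>. g (tor \<theta>))"
proof -
  have "real_polynomial_function (Re \<circ> g)" "real_polynomial_function (Im \<circ> g)"
    using assms bounded_linear_Re bounded_linear_Im unfolding polynomial_function_def by auto
  then have "trigpoly (\<lambda>\<theta>. complex_of_real ((Re \<circ> g) (tor \<theta>)) + \<i> * complex_of_real ((Im \<circ> g) (tor \<theta>)))"
    by (intro trigpoly_add trigpoly_mult trigpoly_const trigpoly_real_polynomial)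
  then show ?thesis by (simp add: complex_eq[symmetric])
qed

text \<open>Coordinates with the same point on the circle differ by a multiple of
  \<open>2 * pi\<close>; if one lies strictly inside the interval, the difference is less than
  \<open>2 * pi\<close>.\<close>

lemma tor_fibres:
  assumes "\<theta> \<in> angle_cube" "\<theta>' \<in> angle_cube" "tor \<theta> = tor \<theta>'" "\<theta> \<noteq> \<theta>'"
  shows "\<theta> \<notin> interior angle_cube"
proof
  assume int: "\<theta> \<in> interior angle_cube"
  obtain j where j: "vec_nth \<theta> j \<noteq> vec_nth \<theta>' j" using assms(4) by (auto simp: Finite_Cartesian_Product.vec_eq_iff)
  have "cis (vec_nth \<theta> j) = cis (vec_nth \<theta>' j)" using assms(3) by (simp add: tor_def Finite_Cartesian_Product.vec_eq_iff)
  then have "sin (vec_nth \<theta> j) = sin (vec_nth \<theta>' j) \<and> cos (vec_nth \<theta> j) = cos (vec_nth \<theta>' j)" by (simp add: complex_eq_iff)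
  then obtain n :: int where n: "vec_nth \<theta> j = vec_nth \<theta>' j + 2 * pi * n" using sin_cos_eq_iff by blast
  have "- pi < vec_nth \<theta> j" "vec_nth \<theta> j < pi"
    using int by (auto simp: angle_cube_def interior_cbox mem_box_cart)
  moreover have "- pi \<le> vec_nth \<theta>' j" "vec_nth \<theta>' j \<le> pi" using assms(2) by (auto simp: mem_angle_cube)
  ultimately have "2 * pi * real_of_int n < 2 * pi * 1" "2 * pi * (- 1) < 2 * pi * real_of_int n" using n by linarith+
  then have "real_of_int n < 1" "-1 < real_of_int n" by (simp_all only: mult_less_cancel_left_pos[of "2 * pi"] pi_gt_zero mult_pos_pos zero_less_numeral)
  then have "n = 0" by linarith
  then show False using n j by simp
qed

text \<open>Vanishing on the boundary makes \<open>g\<close> constant on the fibres of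
  \<open>tor\<close>, so it descends to a function \<open>G\<close> on the torus.\<close>

lemma continuous_trig_approx:
  fixes g :: "real ^ 'd::finite \<Rightarrow> complex"
  assumes g: "continuous_on angle_cube g" and z: "\<And>\<theta>. \<theta> \<in> angle_cube \<Longrightarrow> \<theta> \<notin> interior angle_cube \<Longrightarrow> g \<theta> = 0" and e: "0 < e"
  shows "\<exists>p. \<forall>\<theta>\<in>angle_cube. cmod (g \<theta> - teval p \<theta>) < e"
proof -
  let ?T = "tor ` angle_cube :: (complex ^ 'd) set"
  have ct: "continuous_on angle_cube (tor :: real ^ 'd \<Rightarrow> _)" unfolding tor_def cis_conv_exp by (intro continuous_intros)
  have T: "compact ?T" using ct by (intro compact_continuous_image) (auto simp: angle_cube_def)
  define G where "G z = g (SOME \<theta>. \<theta> \<in> angle_cube \<and> tor \<theta> = z)" for z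
  have G: "G (tor \<theta>) = g \<theta>" if \<theta>: "\<theta> \<in> angle_cube" for \<theta>
  proof -
    define \<theta>' where "\<theta>' = (SOME \<theta>'. \<theta>' \<in> angle_cube \<and> tor \<theta>' = tor \<theta>)"
    have \<theta>': "\<theta>' \<in> angle_cube" "tor \<theta>' = tor \<theta>"
      using someI[of "\<lambda>\<theta>'. \<theta>' \<in> angle_cube \<and> tor \<theta>' = tor \<theta>" \<theta>] \<theta> unfolding \<theta>'_def by auto
    show ?thesis
    proof (cases "\<theta>' = \<theta>")
      case True then show ?thesis unfolding G_def \<theta>'_def by simp
    next
      case False
      have "g \<theta> = 0" using tor_fibres[OF \<theta> \<theta>'(1)] \<theta>'(2) False z[OF \<theta>] by metis
      moreover have "g \<theta>' = 0" using tor_fibres[OF \<theta>'(1) \<theta> \<theta>'(2) False] z[OF \<theta>'(1)] by blast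
      ultimately show ?thesis unfolding G_def \<theta>'_def by simp
    qed
  qed
  \<comment> \<open>The cube is compact, so \<open>tor\<close> maps its closed subsets to closed
    sets, and closed preimages under \<open>G\<close> are such images.\<close>
  have "continuous_on ?T G"
    unfolding continuous_on_closed_vimage[OF compact_imp_closed[OF T]]
  proof (intro allI impI)
    fix B :: "complex set" assume B: "closed B"
    have cl: "closed (angle_cube :: (real ^ 'd) set)" unfolding angle_cube_def by (rule closed_cbox)
    have "G -` B \<inter> ?T = tor ` (g -` B \<inter> angle_cube)" using G by auto
    moreover have "compact (g -` B \<inter> angle_cube)"
    proof -
      have "closed (g -` B \<inter> angle_cube)" using g B unfolding continuous_on_closed_vimage[OF cl] by blast
      moreover have "compact (angle_cube :: (real ^ 'd) set)" by (simp add: angle_cube_def)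
      ultimately have "compact ((g -` B \<inter> angle_cube) \<inter> angle_cube)" by (rule closed_Int_compact)
      then show ?thesis by simp
    qed
    then have "compact (tor ` (g -` B \<inter> angle_cube))"
      by (intro compact_continuous_image continuous_on_subset[OF ct]) auto
    ultimately show "closed (G -` B \<inter> ?T)" by (simp add: compact_imp_closed)
  qed
  from Stone_Weierstrass_polynomial_function[OF T this e]
  obtain q where q: "polynomial_function q" "\<forall>x\<in>?T. norm (G x - q x) < e" by blast
  obtain p where "\<forall>\<theta>. q (tor \<theta>) = teval p \<theta>" using trigpoly_polynomial[OF q(1)] unfolding trigpoly_def by blast
  then show ?thesis using q(2) G by (intro exI[of _ p]) auto
qed

lemma negligible_angle_boundary: "negligible (angle_cube - interior angle_cube :: (real ^ 'd::finite) set)"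
proof -
  show ?thesis unfolding angle_cube_def interior_cbox by (rule negligible_frontier_interval)
qed

abbreviation l1d :: "(real ^ 'd::finite \<Rightarrow> complex) \<Rightarrow> (real ^ 'd \<Rightarrow> complex) \<Rightarrow> real" where
  "l1d f g \<equiv> LINT \<theta>|angM. cmod (f \<theta> - g \<theta>)"

definition l1_approx :: "(real ^ 'd::finite \<Rightarrow> complex) \<Rightarrow> bool" where
  "l1_approx f \<longleftrightarrow> (\<forall>e>0. \<exists>p. l1d f (teval p) < e)"

lemma l1_approx_triangle:
  assumes "integrable angM f" "integrable angM g"
    "integrable angM h"
  shows "l1d f h \<le> l1d f g + l1d g h"
proof -
  have i: "integrable angM (\<lambda>\<theta>. cmod (f \<theta> - g \<theta>))"
    "integrable angM (\<lambda>\<theta>. cmod (g \<theta> - h \<theta>))"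
    "integrable angM (\<lambda>\<theta>. cmod (f \<theta> - h \<theta>))"
    using assms by (auto intro: Bochner_Integration.integrable_diff)
  have "l1d f h \<le> (LINT \<theta>|angM. cmod (f \<theta> - g \<theta>) + cmod (g \<theta> - h \<theta>))"
  proof (rule integral_mono[OF i(3) Bochner_Integration.integrable_add[OF i(1,2)]])
    fix \<theta> show "cmod (f \<theta> - h \<theta>) \<le> cmod (f \<theta> - g \<theta>) + cmod (g \<theta> - h \<theta>)"
      using norm_triangle_ineq[of "f \<theta> - g \<theta>" "g \<theta> - h \<theta>"] by simp
  qed
  then show ?thesis using i by simp
qed

lemma l1_approx_add:
  assumes "integrable angM f" "integrable angM g" "l1_approx f" "l1_approx g"
  shows "l1_approx (\<lambda>\<theta>. f \<theta> + g \<theta>)"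
  unfolding l1_approx_def
proof (intro allI impI)
  fix e :: real assume "0 < e"
  then have "0 < e / 2" by simp
  obtain p where p: "l1d f (teval p) < e / 2"
    using assms(3) \<open>0 < e / 2\<close> unfolding l1_approx_def by blast
  obtain q where q: "l1d g (teval q) < e / 2"
    using assms(4) \<open>0 < e / 2\<close> unfolding l1_approx_def by blast
  have "l1d (\<lambda>\<theta>. f \<theta> + g \<theta>) (\<lambda>\<theta>. teval p \<theta> + teval q \<theta>)
     \<le> l1d (\<lambda>\<theta>. f \<theta> + g \<theta>) (\<lambda>\<theta>. teval p \<theta> + g \<theta>)
      + l1d (\<lambda>\<theta>. teval p \<theta> + g \<theta>) (\<lambda>\<theta>. teval p \<theta> + teval q \<theta>)"
    using assms(1,2) integrable_teval by (intro l1_approx_triangle) auto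
  also have "\<dots> < e" using p q by simp
  finally show "\<exists>p. l1d (\<lambda>\<theta>. f \<theta> + g \<theta>) (teval p) < e"
    by (intro exI[of _ "p @ q"]) (simp add: teval_append)
qed

lemma l1_approx_lim:
  assumes s: "\<And>i. integrable angM (s i)" "\<And>i. l1_approx (s i)"
    and lim: "\<And>x. x \<in> angle_cube \<Longrightarrow> (\<lambda>i. s i x) \<longlonglongrightarrow> f x"
    and b: "\<And>i x. x \<in> angle_cube \<Longrightarrow> norm (s i x) \<le> 2 * norm (f x)"
    and f: "integrable angM f"
  shows "l1_approx f"
  unfolding l1_approx_def
proof (intro allI impI)
  fix e :: real assume e: "0 < e"
  have "(\<lambda>i. LINT \<theta>|angM. cmod (f \<theta> - s i \<theta>)) \<longlonglongrightarrow> (LINT \<theta>|lebesgue_on (angle_cube :: (real ^ 'a) set). 0 :: real)"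
  proof (rule integral_dominated_convergence[where w = "\<lambda>\<theta>. 3 * cmod (f \<theta>)"])
    show "AE x in angM. (\<lambda>i. cmod (f x - s i x)) \<longlonglongrightarrow> 0"
    proof (rule AE_I2)
      fix x :: "real ^ 'a" assume "x \<in> space angM"
      then have "(\<lambda>i. f x - s i x) \<longlonglongrightarrow> f x - f x" by (intro tendsto_intros lim) simp
      then show "(\<lambda>i. cmod (f x - s i x)) \<longlonglongrightarrow> 0" by (simp add: tendsto_norm_zero)
    qed
    show "AE x in angM. norm (cmod (f x - s i x)) \<le> 3 * cmod (f x)" for i
    proof (rule AE_I2)
      fix x :: "real ^ 'a" assume "x \<in> space angM"
      then have "norm (s i x) \<le> 2 * norm (f x)" by (intro b) simp
      then show "norm (cmod (f x - s i x)) \<le> 3 * cmod (f x)" using norm_triangle_ineq4[of "f x" "s i x"] by simp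
    qed
  qed (use f s borel_measurable_integrable[OF f] borel_measurable_integrable[OF s(1)] in \<open>auto intro: borel_measurable_diff\<close>)
  then have "(\<lambda>i. LINT \<theta>|angM. cmod (f \<theta> - s i \<theta>)) \<longlonglongrightarrow> 0" by simp
  then have "eventually (\<lambda>i. l1d f (s i) < e / 2) sequentially"
    using e by (intro order_tendstoD) auto
  then obtain i where i: "l1d f (s i) < e / 2"
    by (auto simp: eventually_sequentially)
  have "0 < e / 2" using e by simp
  then obtain p where p: "l1d (s i) (teval p) < e / 2"
    using s(2)[of i] unfolding l1_approx_def by blast
  have "l1d f (teval p) < e"
    using l1_approx_triangle[OF f s(1)[of i] integrable_teval[of p]] i p by linarith
  then show "\<exists>p. l1d f (teval p) < e" by blast
qed

text \<open>Regularity of Lebesgue measure encloses the set between a closed and an open one, and a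
  Urysohn function between them is continuous. Its support is forced into the open cube so that
  \<open>continuous_trig_approx\<close> applies.\<close>

lemma l1_approx_indicator:
  assumes A: "A \<in> sets (lebesgue_on (angle_cube :: (real ^ 'd::finite) set))"
  shows "l1_approx (\<lambda>x. indicat_real A x *\<^sub>R c)"
  unfolding l1_approx_def
proof (intro allI impI)
  fix e :: real assume e: "0 < e"
  let ?Q = "angle_cube :: (real ^ 'd) set"
  have AQ: "A \<in> sets lebesgue" "A \<subseteq> ?Q" using A by (auto simp: sets_restrict_space_iff)
  define M where "M = (2 * pi) ^ CARD('d)"
  have M: "0 < M" by (simp add: M_def)
  define \<eta> where "\<eta> = e / (2 * (cmod c + 1))"
  have \<eta>: "0 < \<eta>" using e by (simp add: \<eta>_def add_nonneg_pos)
  \<comment> \<open>Dropping the boundary of the cube costs a null set, which reappears in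
    \<open>E\<close> below.\<close>
  let ?A' = "A \<inter> interior ?Q"
  have A': "?A' \<in> sets lebesgue" using AQ(1) by auto
  have h: "0 < \<eta> / 2" using \<eta> by simp
  obtain K where K: "closed K" "K \<subseteq> ?A'" "?A' - K \<in> lmeasurable" "emeasure lebesgue (?A' - K) < ennreal (\<eta> / 2)"
    using sets_lebesgue_inner_closed[OF A' h] by blast
  obtain W where W: "open W" "?A' \<subseteq> W" "W - ?A' \<in> lmeasurable" "emeasure lebesgue (W - ?A') < ennreal (\<eta> / 2)"
    using sets_lebesgue_outer_open[OF A' h] by blast
  let ?U = "W \<inter> interior ?Q"
  have "K \<inter> - ?U = {}" using K(2) W(2) by blast
  moreover have "closedin (top_of_set UNIV) K" "closedin (top_of_set UNIV) (- ?U)" using K(1) W(1) by auto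
  ultimately obtain g :: "real ^ 'd \<Rightarrow> real" where g: "continuous_on UNIV g" "\<And>x. g x \<in> closed_segment 1 0"
    "\<And>x. x \<in> K \<Longrightarrow> g x = 1" "\<And>x. x \<in> - ?U \<Longrightarrow> g x = 0"
    using Urysohn_local[of UNIV K "- ?U" 1 0] by (metis UNIV_I)
  have g01: "0 \<le> g x" "g x \<le> 1" for x using g(2)[of x] by (auto simp: closed_segment_eq_real_ivl split: if_splits)
  define G where "G x = complex_of_real (g x) * c" for x
  have "continuous_on ?Q G" unfolding G_def by (intro continuous_intros continuous_on_subset[OF g(1)]) auto
  moreover have "G \<theta> = 0" if "\<theta> \<in> ?Q" "\<theta> \<notin> interior ?Q" for \<theta> using g(4)[of \<theta>] that by (auto simp: G_def)
  \<comment> \<open>A uniform error of this size integrates to less than \<open>e / 2\<close> over a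
    cube of volume \<open>M\<close>.\<close>
  moreover have "0 < e / (2 * M + 2)" using e M by (simp add: add_pos_pos)
  ultimately obtain p where p: "\<forall>\<theta>\<in>?Q. cmod (G \<theta> - teval p \<theta>) < e / (2 * M + 2)"
    using continuous_trig_approx[of G] by blast
  interpret fin: finite_measure "lebesgue_on ?Q" by (rule finite_angle_cube)
  have Gm: "G \<in> borel_measurable (lebesgue_on ?Q)"
    using \<open>continuous_on ?Q G\<close> by (intro continuous_imp_measurable_on_sets_lebesgue) auto
  have Gi: "integrable (lebesgue_on ?Q) G"
    by (rule fin.integrable_const_bound[of _ "cmod c", OF AE_I2 Gm]) (use g01 in \<open>auto simp: G_def norm_mult mult_left_le_one_le\<close>)
  have fA: "emeasure (lebesgue_on ?Q) B < \<infinity>" for B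
    using fin.emeasure_finite[of B] by (simp only: less_top infinity_ennreal_def not_False_eq_True)
  have Ai: "integrable (lebesgue_on ?Q) (\<lambda>x. indicat_real A x *\<^sub>R c)"
    by (intro integrable_scaleR_left integrable_real_indicator A fA)
  have mQ: "measure (lebesgue_on ?Q) ?Q = M"
  proof -
    have "measure lebesgue ?Q = M" unfolding measure_def emeasure_angle_cube M_def by simp
    then show ?thesis by (simp add: measure_restrict_space)
  qed
  have 1: "l1d G (teval p) < e / 2"
  proof -
    have "l1d G (teval p) \<le> (LINT \<theta>|lebesgue_on ?Q. e / (2 * M + 2))"
      using p Gi integrable_teval[of p] by (intro integral_mono) (auto simp: less_imp_le)
    also have "\<dots> = M * (e / (2 * M + 2))" using mQ by simp
    also have "\<dots> < e / 2" using M e by (simp add: field_simps add_pos_pos)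
    finally show ?thesis .
  qed
  define E where "E = (?A' - K) \<union> (W - ?A') \<union> (?Q - interior ?Q)"
  have null: "?Q - interior ?Q \<in> null_sets lebesgue" using negligible_angle_boundary negligible_iff_null_sets by blast
  have Em: "E \<in> sets lebesgue" unfolding E_def using K(3) W(3) null by auto
  have Ee: "emeasure lebesgue E \<le> ennreal \<eta>"
  proof -
    have "emeasure lebesgue E \<le> emeasure lebesgue ((?A' - K) \<union> (W - ?A')) + emeasure lebesgue (?Q - interior ?Q)"
      unfolding E_def using K(3) W(3) null by (intro emeasure_subadditive) auto
    also have "emeasure lebesgue (?Q - interior ?Q) = 0" using null by auto
    also have "emeasure lebesgue ((?A' - K) \<union> (W - ?A')) \<le> emeasure lebesgue (?A' - K) + emeasure lebesgue (W - ?A')"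
      using K(3) W(3) by (intro emeasure_subadditive) auto
    also have "\<dots> \<le> ennreal (\<eta> / 2) + ennreal (\<eta> / 2)" using K(4) W(4) by (intro add_mono) auto
    also have "\<dots> = ennreal \<eta>" using \<eta> by (simp flip: ennreal_plus)
    finally show ?thesis by (simp add: add_mono)
  qed
  have EQ: "E \<inter> ?Q \<in> sets (lebesgue_on ?Q)" using Em by (auto simp: sets_restrict_space_iff)
  have mE: "measure (lebesgue_on ?Q) (E \<inter> ?Q) \<le> \<eta>"
  proof -
    have "emeasure (lebesgue_on ?Q) (E \<inter> ?Q) = emeasure lebesgue (E \<inter> ?Q)"
      using Em by (intro emeasure_restrict_space) auto
    also have "\<dots> \<le> emeasure lebesgue E" using Em by (intro emeasure_mono) auto
    finally have "emeasure (lebesgue_on ?Q) (E \<inter> ?Q) \<le> ennreal \<eta>" using Ee by (rule order_trans)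
    then show ?thesis using \<eta> by (simp add: fin.emeasure_eq_measure)
  qed
  have 2: "l1d (\<lambda>\<theta>. indicat_real A \<theta> *\<^sub>R c) G \<le> cmod c * \<eta>"
  proof -
    have "l1d (\<lambda>\<theta>. indicat_real A \<theta> *\<^sub>R c) G \<le> (LINT \<theta>|lebesgue_on ?Q. cmod c * indicat_real (E \<inter> ?Q) \<theta>)"
    proof (rule integral_mono)
      show "integrable (lebesgue_on ?Q) (\<lambda>\<theta>. cmod c * indicat_real (E \<inter> ?Q) \<theta>)"
        by (intro integrable_mult_right integrable_real_indicator EQ fA)
      show "integrable (lebesgue_on ?Q) (\<lambda>\<theta>. cmod (indicat_real A \<theta> *\<^sub>R c - G \<theta>))" using Ai Gi by auto
      fix \<theta> assume "\<theta> \<in> space (lebesgue_on ?Q)"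
      then have \<theta>: "\<theta> \<in> ?Q" by simp
      have eq: "indicat_real A \<theta> *\<^sub>R c - G \<theta> = complex_of_real (indicat_real A \<theta> - g \<theta>) * c"
        by (simp add: G_def scaleR_conv_of_real left_diff_distrib)
      show "cmod (indicat_real A \<theta> *\<^sub>R c - G \<theta>) \<le> cmod c * indicat_real (E \<inter> ?Q) \<theta>"
      proof (cases "\<theta> \<in> E")
        case True
        have "\<bar>indicat_real A \<theta> - g \<theta>\<bar> \<le> 1" using g01[of \<theta>] by (auto simp: indicator_def)
        then show ?thesis unfolding eq norm_mult norm_of_real using True \<theta> by (simp add: mult_left_le_one_le)
      next
        case False
        then have "\<theta> \<in> interior ?Q" using \<theta> by (auto simp: E_def)
        then have "\<theta> \<in> A \<Longrightarrow> \<theta> \<in> K" "\<theta> \<notin> A \<Longrightarrow> \<theta> \<notin> W" using False by (auto simp: E_def)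
        then have "indicat_real A \<theta> = g \<theta>" using g(3)[of \<theta>] g(4)[of \<theta>] by (cases "\<theta> \<in> A") auto
        then show ?thesis unfolding eq by simp
      qed
    qed
    also have "\<dots> = cmod c * measure (lebesgue_on ?Q) (E \<inter> ?Q)" using EQ by simp
    also have "\<dots> \<le> cmod c * \<eta>" using mE by (intro mult_left_mono) auto
    finally show ?thesis .
  qed
  have 3: "cmod c * \<eta> \<le> e / 2"
  proof -
    have "cmod c * \<eta> \<le> (cmod c + 1) * \<eta>" using \<eta> by (intro mult_right_mono) auto
    also have "\<dots> = e / 2"
    proof -
      have "0 < cmod c + 1" by (rule add_nonneg_pos) auto
      then show ?thesis by (simp add: \<eta>_def field_simps)
    qed
    finally show ?thesis .
  qed
  have "l1d (\<lambda>\<theta>. indicat_real A \<theta> *\<^sub>R c) (teval p) < e"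
    using l1_approx_triangle[OF Ai Gi integrable_teval[of p]] 1 2 3 by linarith
  then show "\<exists>p. l1d (\<lambda>\<theta>. indicat_real A \<theta> *\<^sub>R c) (teval p) < e" by blast
qed

theorem trig_dense_L1:
  assumes "integrable (lebesgue_on (angle_cube :: (real ^ 'd::finite) set)) f"
  shows "l1_approx f"
  using assms
proof (rule integrable_induct)
  show "l1_approx (\<lambda>x. indicat_real A x *\<^sub>R c)" if "A \<in> sets angM" for A and c :: complex
    by (rule l1_approx_indicator[OF that])
  show "l1_approx (\<lambda>x. f x + g x)" if "integrable angM f" "l1_approx f"
     "integrable angM g" "l1_approx g" for f g :: "real ^ 'd \<Rightarrow> complex"
    by (rule l1_approx_add[OF that(1,3,2,4)])
  show "l1_approx f" if "\<And>i. integrable angM (s i)" "\<And>i. l1_approx (s i)"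
    "\<And>x. x \<in> space angM \<Longrightarrow> (\<lambda>i. s i x) \<longlonglongrightarrow> f x"
    "\<And>i x. x \<in> space angM \<Longrightarrow> norm (s i x) \<le> 2 * norm (f x)"
    "integrable angM f" for f :: "real ^ 'd \<Rightarrow> complex" and s
    by (rule l1_approx_lim[OF that(1,2) that(3) that(4) that(5)]) auto
qed

section \<open>Locally Toeplitz operators with integrable symbol\<close>

lemma LT_op_add:
  assumes "integrable angM f" "integrable angM g"
  shows "LT_op n m v (\<lambda>\<theta>. f \<theta> + g \<theta>) = LT_op n m v f + LT_op n m v g"
  unfolding LT_op_eq mi_mat_add fourier_coeff_add[OF assms] by (rule mi_mat_cong) (auto simp: distrib_left)

lemma LT_op_cmult: "LT_op n m v (\<lambda>\<theta>. c * f \<theta>) = c \<cdot>\<^sub>m LT_op n m v f"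
  unfolding LT_op_eq mi_mat_smult fourier_coeff_cmult by (rule mi_mat_cong) auto

text \<open>Splits off the weight \<open>v\<close> as a bounded diagonal factor, so small
  perturbations have to be shown only for the weight 1.\<close>

lemma LT_op_diag:
  "LT_op n m v f = single n (\<lambda>_. 0) (\<lambda>i. if blk_ok n m i then v (pt m (blk n m i)) else 0) * LT_op n m (\<lambda>_. 1) f"
  unfolding LT_op_eq single_def mi_mat_mult
proof (rule mi_mat_cong)
  fix i j assume i: "i \<in> mi_range n" and j: "j \<in> mi_range n"
  let ?h = "\<lambda>i. if blk_ok n m i then v (pt m (blk n m i)) else 0"
  let ?b = "\<lambda>l. if blk_ok n m l \<and> blk_ok n m j \<and> blk n m l = blk n m j then 1 * fourier_coeff f (mi_diff l j) else 0"
  have 0: "inb n i (\<lambda>_. 0)" "shift i (\<lambda>_. 0) = i" using i by (auto simp: inb_def shift_def mi_range_iff)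
  have "(\<Sum>l\<in>mi_range n. (if mi_diff i l = (\<lambda>_. 0) then ?h i else 0) * ?b l)
     = (\<Sum>l\<in>mi_range n. if mi_diff i l = (\<lambda>_. 0) then ?h i * ?b l else 0)" by (intro sum.cong) auto
  also have "\<dots> = ?h i * ?b i" unfolding sum_diff_eq using 0 by simp
  finally show "(if blk_ok n m i \<and> blk_ok n m j \<and> blk n m i = blk n m j then v (pt m (blk n m i)) * fourier_coeff f (mi_diff i j) else 0)
     = (\<Sum>l\<in>mi_range n. (if mi_diff i l = (\<lambda>_. 0) then ?h i else 0) * ?b l)" by auto
qed

lemma fourier_coeff_real:
  "fourier_coeff (\<lambda>\<theta>. complex_of_real (g \<theta>)) (\<lambda>l. - k l) = cnj (fourier_coeff (\<lambda>\<theta>. complex_of_real (g \<theta>)) k)"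
proof -
  have "(LINT \<theta>|angM. cnj (complex_of_real (g \<theta>) * fexp (\<lambda>l. - k l) \<theta>))
    = cnj (LINT \<theta>|angM. complex_of_real (g \<theta>) * fexp (\<lambda>l. - k l) \<theta>)"
    by (rule Bochner_Integration.integral_cnj)
  then show ?thesis unfolding fourier_coeff_eq by (simp add: fexp_uminus)
qed

text \<open>The quadratic form of a block Toeplitz matrix with symbol \<open>g \<ge> 0\<close> is the integral of \<open>g\<close>
  against a sum of squares, one for each block.\<close>

lemma LT_psd:
  fixes g :: "real ^ 'd::{finite,linorder} \<Rightarrow> real"
  assumes g: "integrable angM g" "\<And>\<theta>. 0 \<le> g \<theta>" and x: "x \<in> carrier_vec (mi_size n)"
  shows "0 \<le> Re ((LT_op n m (\<lambda>_. 1) (\<lambda>\<theta>. complex_of_real (g \<theta>)) *\<^sub>v x) \<bullet>c x)"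
proof -
  let ?G = "\<lambda>\<theta>. complex_of_real (g \<theta>)"
  let ?M = "lebesgue_on (angle_cube :: (real ^ 'd::{finite,linorder}) set)"
  let ?c = "1 / (2 * pi) ^ CARD('d)"
  have Gi: "integrable ?M ?G" using g(1) by (rule integrable_of_real)
  \<comment> \<open>Indicator of membership in block \<open>b\<close>; summing
    \<open>u b i * u b j\<close> over \<open>b\<close> expresses that \<open>i\<close> and
    \<open>j\<close> share a block.\<close>
  define u where "u b i = (if blk_ok n m i \<and> blk n m i = b then 1 else 0 :: complex)" for b i
  let ?a = "\<lambda>i j. if blk_ok n m i \<and> blk_ok n m j \<and> blk n m i = blk n m j then 1 * fourier_coeff ?G (mi_diff i j) else 0"
  obtain \<xi> where \<xi>: "(mi_mat n ?a *\<^sub>v x) \<bullet>c x = (\<Sum>i\<in>mi_range n. \<Sum>j\<in>mi_range n. ?a i j * \<xi> j * cnj (\<xi> i))"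
    using quad_mi_mat[OF x, of ?a] by blast
  define e where "e i \<theta> = fexp (\<lambda>l. int (i l)) \<theta>" for i :: "'d \<Rightarrow> nat" and \<theta>
  define s where "s \<theta> = (\<Sum>b\<in>mi_range m. (cmod (\<Sum>j\<in>mi_range n. u b j * \<xi> j * e j \<theta>))\<^sup>2)" for \<theta>
  have uu: "?a i j = (\<Sum>b\<in>mi_range m. u b i * u b j) * fourier_coeff ?G (mi_diff i j)" if "i \<in> mi_range n" "j \<in> mi_range n" for i j
  proof -
    have "(\<Sum>b\<in>mi_range m. u b i * u b j) = (\<Sum>b\<in>mi_range m. if blk n m i = b then (if blk_ok n m i \<and> blk_ok n m j \<and> blk n m j = b then 1 else 0) else 0)"
      by (intro sum.cong) (auto simp: u_def)
    also have "\<dots> = (if blk_ok n m i \<and> blk_ok n m j \<and> blk n m i = blk n m j then 1 else 0)"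
      using blk_range(1)[OF that(1), of m] by (auto simp: sum.delta)
    finally show ?thesis by auto
  qed
  have fe: "fexp (\<lambda>l. - mi_diff i j l) \<theta> = e j \<theta> * cnj (e i \<theta>)" for i j \<theta>
    unfolding e_def fexp_uminus[symmetric] fexp_add[symmetric] by (simp add: mi_diff_def)
  have gi: "integrable ?M (\<lambda>\<theta>. ?G \<theta> * (e j \<theta> * cnj (e i \<theta>)))" for i j
    unfolding fe[symmetric] by (rule integrable_mult_fexp[OF Gi])
  \<comment> \<open>Pointwise in \<open>\<theta>\<close>, the double sum is
    \<open>g \<theta>\<close> times the sum over blocks of the squared modulus of a trigonometric
    sum; integrating it gives the quadratic form.\<close>
  have S: "(\<Sum>i\<in>mi_range n. \<Sum>j\<in>mi_range n. (\<Sum>b\<in>mi_range m. u b i * u b j) * (?G \<theta> * (e j \<theta> * cnj (e i \<theta>))) * \<xi> j * cnj (\<xi> i))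
     = complex_of_real (g \<theta> * s \<theta>)" for \<theta>
  proof -
    have cu: "cnj (u b i) = u b i" for b i by (simp add: u_def)
    have "complex_of_real (g \<theta> * s \<theta>) = ?G \<theta> * (\<Sum>b\<in>mi_range m. (\<Sum>j\<in>mi_range n. u b j * \<xi> j * e j \<theta>) * cnj (\<Sum>i\<in>mi_range n. u b i * \<xi> i * e i \<theta>))"
      unfolding s_def of_real_mult of_real_sum complex_norm_square ..
    also have "\<dots> = (\<Sum>b\<in>mi_range m. \<Sum>j\<in>mi_range n. \<Sum>i\<in>mi_range n. ?G \<theta> * ((u b j * \<xi> j * e j \<theta>) * (u b i * cnj (\<xi> i) * cnj (e i \<theta>))))"
      by (simp only: cnj_sum complex_cnj_mult cu sum_product) (simp only: sum_distrib_left)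
    also have "\<dots> = (\<Sum>b\<in>mi_range m. \<Sum>i\<in>mi_range n. \<Sum>j\<in>mi_range n. ?G \<theta> * ((u b j * \<xi> j * e j \<theta>) * (u b i * cnj (\<xi> i) * cnj (e i \<theta>))))"
      by (rule sum.cong[OF refl], rule sum.swap)
    also have "\<dots> = (\<Sum>i\<in>mi_range n. \<Sum>b\<in>mi_range m. \<Sum>j\<in>mi_range n. ?G \<theta> * ((u b j * \<xi> j * e j \<theta>) * (u b i * cnj (\<xi> i) * cnj (e i \<theta>))))"
      by (rule sum.swap)
    also have "\<dots> = (\<Sum>i\<in>mi_range n. \<Sum>j\<in>mi_range n. \<Sum>b\<in>mi_range m. ?G \<theta> * ((u b j * \<xi> j * e j \<theta>) * (u b i * cnj (\<xi> i) * cnj (e i \<theta>))))"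
      by (rule sum.cong[OF refl], rule sum.swap)
    also have "\<dots> = (\<Sum>i\<in>mi_range n. \<Sum>j\<in>mi_range n. (\<Sum>b\<in>mi_range m. u b i * u b j) * (?G \<theta> * (e j \<theta> * cnj (e i \<theta>))) * \<xi> j * cnj (\<xi> i))"
      by (intro sum.cong refl) (simp add: sum_distrib_right sum_distrib_left mult_ac)
    finally show ?thesis by simp
  qed
  have "(\<Sum>i\<in>mi_range n. \<Sum>j\<in>mi_range n. ?a i j * \<xi> j * cnj (\<xi> i))
     = (\<Sum>i\<in>mi_range n. \<Sum>j\<in>mi_range n. (\<Sum>b\<in>mi_range m. u b i * u b j) * fourier_coeff ?G (mi_diff i j) * \<xi> j * cnj (\<xi> i))"
    by (intro sum.cong refl arg_cong2[of _ _ _ _ "(*)"] uu)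
  also have "\<dots> = complex_of_real ?c * (\<Sum>i\<in>mi_range n. \<Sum>j\<in>mi_range n. (LINT \<theta>|?M. (\<Sum>b\<in>mi_range m. u b i * u b j) * (?G \<theta> * (e j \<theta> * cnj (e i \<theta>))) * \<xi> j * cnj (\<xi> i)))"
  proof -
    have *: "(LINT \<theta>|?M. A * f \<theta> * x * y) = A * (LINT \<theta>|?M. f \<theta>) * x * y" for A x y :: complex and f
      by (simp only: integral_mult_left_zero integral_mult_right_zero)
    have **: "A * (c * t) * x * y = c * (A * t * x * y)" for A c t x y :: complex by (simp only: mult_ac)
    show ?thesis unfolding fourier_coeff_eq fe sum_distrib_left[of "complex_of_real ?c"]
      by (intro sum.cong refl) (subst *, rule **)
  qed
  also have "\<dots> = complex_of_real ?c * (LINT \<theta>|?M. (\<Sum>i\<in>mi_range n. \<Sum>j\<in>mi_range n. (\<Sum>b\<in>mi_range m. u b i * u b j) * (?G \<theta> * (e j \<theta> * cnj (e i \<theta>))) * \<xi> j * cnj (\<xi> i)))"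
    using gi by (subst Bochner_Integration.integral_sum) (auto intro!: Bochner_Integration.integrable_sum integrable_mult_right integrable_mult_left simp: Bochner_Integration.integral_sum)
  also have "\<dots> = complex_of_real (?c * (LINT \<theta>|?M. g \<theta> * s \<theta>))"
    unfolding S integral_complex_of_real of_real_mult[of ?c] ..
  finally have eq: "(mi_mat n ?a *\<^sub>v x) \<bullet>c x = complex_of_real (?c * (LINT \<theta>|?M. g \<theta> * s \<theta>))" using \<xi> by simp
  have "0 \<le> (LINT \<theta>|?M. g \<theta> * s \<theta>)"
    using g(2) by (intro integral_nonneg_AE AE_I2 mult_nonneg_nonneg) (auto simp: s_def intro: sum_nonneg)
  then show ?thesis unfolding LT_op_eq eq by simp
qed

text \<open>The matrix is positive semidefinite, and its diagonal entries are 0 or the zeroth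
  Fourier coefficient, that is, the mean of \<open>g\<close>. So the L1 norm of \<open>g\<close>
  controls the trace, for all \<open>n\<close> and \<open>m\<close>.\<close>

lemma LT_pos_small:
  fixes g :: "real ^ 'd::{finite,linorder} \<Rightarrow> real"
  assumes g: "integrable angM g" "\<And>\<theta>. 0 \<le> g \<theta>" and e: "0 < e"
    and s: "(LINT \<theta>|angM. g \<theta>) \<le> e\<^sup>2 * (2 * pi) ^ CARD('d)"
  shows "small_pert e (LT_op n m (\<lambda>_. 1) (\<lambda>\<theta>. complex_of_real (g \<theta>)))"
proof (rule psd_trace_small_pert[OF LT_op_carrier(1) _ LT_psd[OF g] _ e])
  let ?G = "\<lambda>\<theta>. complex_of_real (g \<theta>)"
  let ?X = "LT_op n m (\<lambda>_. 1) ?G"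
  show "mat_adjoint ?X = ?X"
    unfolding LT_op_eq mi_mat_adj
  proof (rule mi_mat_cong)
    fix i j :: "'d \<Rightarrow> nat"
    have d: "mi_diff j i = (\<lambda>l. - mi_diff i j l)" by (simp add: mi_diff_def)
    have "cnj (fourier_coeff ?G (mi_diff j i)) = fourier_coeff ?G (mi_diff i j)"
      unfolding d fourier_coeff_real by simp
    then show "cnj (if blk_ok n m j \<and> blk_ok n m i \<and> blk n m j = blk n m i then 1 * fourier_coeff ?G (mi_diff j i) else 0)
      = (if blk_ok n m i \<and> blk_ok n m j \<and> blk n m i = blk n m j then 1 * fourier_coeff ?G (mi_diff i j) else 0)" by auto
  qed
  have z: "fourier_coeff ?G (\<lambda>_. 0) = complex_of_real (1 / (2 * pi) ^ CARD('d) * (LINT \<theta>|angM. g \<theta>))"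
    unfolding fourier_coeff_eq by (simp add: fexp_zero)
  define t where "t = 1 / (2 * pi) ^ CARD('d) * (LINT \<theta>|lebesgue_on (angle_cube :: (real ^ 'd::{finite,linorder}) set). g \<theta>)"
  have t0: "0 \<le> t" unfolding t_def using g(2) by (intro mult_nonneg_nonneg integral_nonneg_AE AE_I2) auto
  have te: "t \<le> e\<^sup>2" unfolding t_def using s by (simp add: field_simps)
  have "Re (mtrace ?X) = (\<Sum>i\<in>mi_range n. if blk_ok n m i then t else 0)"
    unfolding LT_op_eq mtrace_mi_mat Re_sum by (intro sum.cong refl) (simp add: mi_diff_def z t_def)
  also have "\<dots> \<le> (\<Sum>i\<in>mi_range n. e\<^sup>2)" using t0 te by (intro sum_mono) auto
  finally show "Re (mtrace ?X) \<le> e\<^sup>2 * real (mi_size n)" by (simp add: card_mi_range mult.commute)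
qed

text \<open>Splits \<open>h\<close> into the positive and negative parts of its real and imaginary
  parts. Four summands, each with a unimodular coefficient costing the factor 2 of
  \<open>small_pert_smult\<close>, make the 8; the weight \<open>v\<close> brings
  \<open>1 + C\<close>.\<close>

lemma LT_L1_small:
  fixes h :: "real ^ 'd::{finite,linorder} \<Rightarrow> complex"
  assumes h: "integrable angM h" and e: "0 < e"
    and s: "(LINT \<theta>|angM. cmod (h \<theta>)) \<le> e\<^sup>2 * (2 * pi) ^ CARD('d)"
    and C: "0 \<le> C" "\<And>a. a \<in> mi_range m \<Longrightarrow> cmod (v (pt m a)) \<le> C"
  shows "small_pert ((1 + C) * (8 * e)) (LT_op n m v h)"
proof -
  let ?M = "lebesgue_on (angle_cube :: (real ^ 'd::{finite,linorder}) set)"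
  define h1 h2 h3 h4 where "h1 \<theta> = max (Re (h \<theta>)) 0" and "h2 \<theta> = max (- Re (h \<theta>)) 0"
    and "h3 \<theta> = max (Im (h \<theta>)) 0" and "h4 \<theta> = max (- Im (h \<theta>)) 0" for \<theta>
  have R: "integrable ?M (\<lambda>\<theta>. Re (h \<theta>))" "integrable ?M (\<lambda>\<theta>. Im (h \<theta>))"
    using h by (auto intro: integrable_Re integrable_Im)
  have int: "integrable ?M h1" "integrable ?M h2" "integrable ?M h3" "integrable ?M h4"
    unfolding h1_def h2_def h3_def h4_def using R by (auto intro!: integrable_max)
  let ?L = "\<lambda>g. LT_op n m (\<lambda>_. 1) (\<lambda>\<theta>. complex_of_real (g \<theta>))"
  have sm: "small_pert e (?L g)" if "g \<in> {h1, h2, h3, h4}" for g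
  proof (rule LT_pos_small[OF _ _ e])
    show gi: "integrable ?M g" using that int by auto
    show "0 \<le> g \<theta>" for \<theta> using that by (auto simp: h1_def h2_def h3_def h4_def)
    have "(LINT \<theta>|?M. g \<theta>) \<le> (LINT \<theta>|?M. cmod (h \<theta>))"
    proof (rule integral_mono[OF gi])
      show "integrable ?M (\<lambda>\<theta>. cmod (h \<theta>))" using h by (rule integrable_norm)
      show "g \<theta> \<le> cmod (h \<theta>)" for \<theta>
        using that abs_Re_le_cmod[of "h \<theta>"] abs_Im_le_cmod[of "h \<theta>"] by (auto simp: h1_def h2_def h3_def h4_def)
    qed
    then show "(LINT \<theta>|?M. g \<theta>) \<le> e\<^sup>2 * (2 * pi) ^ CARD('d)" using s by linarith
  qed
  have oi: "integrable ?M (\<lambda>\<theta>. c * complex_of_real (g \<theta>))" if "g \<in> {h1, h2, h3, h4}" for g and c :: complex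
    using that int by (intro integrable_mult_right integrable_of_real) auto
  have hd: "h = (\<lambda>\<theta>. (1 * complex_of_real (h1 \<theta>) + (-1) * complex_of_real (h2 \<theta>)) + (\<i> * complex_of_real (h3 \<theta>) + (-\<i>) * complex_of_real (h4 \<theta>)))"
    by (auto simp: h1_def h2_def h3_def h4_def complex_eq_iff max_def)
  have "LT_op n m (\<lambda>_. 1) h = (1 \<cdot>\<^sub>m ?L h1 + (-1) \<cdot>\<^sub>m ?L h2) + (\<i> \<cdot>\<^sub>m ?L h3 + (-\<i>) \<cdot>\<^sub>m ?L h4)"
    by (subst hd, subst LT_op_add, (intro Bochner_Integration.integrable_add oi; simp), (intro Bochner_Integration.integrable_add oi; simp),
        subst LT_op_add, (intro oi; simp), (intro oi; simp), subst LT_op_add, (intro oi; simp), (intro oi; simp))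
      (simp only: LT_op_cmult)
  moreover have sc: "small_pert ((1 + cmod c) * e) (c \<cdot>\<^sub>m ?L g)" if "g \<in> {h1, h2, h3, h4}" for c g
    using sm[OF that] e by (intro small_pert_smult[of _ _ "mi_size n"]) auto
  have "small_pert (((1 + cmod 1) * e + (1 + cmod (-1)) * e) + ((1 + cmod \<i>) * e + (1 + cmod (-\<i>)) * e))
     ((1 \<cdot>\<^sub>m ?L h1 + (-1) \<cdot>\<^sub>m ?L h2) + (\<i> \<cdot>\<^sub>m ?L h3 + (-\<i>) \<cdot>\<^sub>m ?L h4))"
    by (intro small_pert_add[of _ _ _ _ "mi_size n"] sc) auto
  ultimately have "small_pert (8 * e) (LT_op n m (\<lambda>_. 1) h)" by simp
  then show ?thesis unfolding LT_op_diag[of n m v h] using e C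
    by (intro small_pert_mult_left[of _ _ "mi_size n"] nb_single) (auto simp: blk_range(1))
qed

section \<open>Lebesgue sets in products and closeness in measure\<close>

text \<open>A Lebesgue set is a Borel set together with part of a Borel null set; the cylinder over
  the latter is again null, hence measurable in the completion.\<close>

lemma vimage_fst_lebesgue:
  fixes A :: "'a::euclidean_space set"
  assumes "A \<in> sets lebesgue"
  shows "A \<times> (UNIV :: 'b::euclidean_space set) \<in> sets lebesgue"
proof -
  obtain S N N' where A: "A = S \<union> N" "N \<subseteq> N'" "N' \<in> null_sets lborel" "S \<in> sets lborel"
    using assms by (auto elim: sets_completionE)
  have "S \<times> (UNIV :: 'b set) \<in> sets (lborel \<Otimes>\<^sub>M lborel)" using A(4) by auto
  then have 1: "S \<times> (UNIV :: 'b set) \<in> sets lebesgue" unfolding lborel_prod by auto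
  have "emeasure (lborel \<Otimes>\<^sub>M lborel) (N' \<times> (UNIV :: 'b set)) = emeasure lborel N' * emeasure lborel (UNIV :: 'b set)"
    using A(3) by (intro lborel.emeasure_pair_measure_Times) auto
  also have "\<dots> = 0" using A(3) by auto
  finally have "N' \<times> (UNIV :: 'b set) \<in> null_sets (lborel \<Otimes>\<^sub>M lborel)" using A(3) by (intro null_setsI) auto
  then have "N' \<times> (UNIV :: 'b set) \<in> null_sets lborel" unfolding lborel_prod .
  then have "N \<times> (UNIV :: 'b set) \<in> sets lebesgue" using A(2) by (rule null_sets_completion[OF _ Sigma_mono]) simp
  then have "(S \<times> (UNIV :: 'b set)) \<union> (N \<times> UNIV) \<in> sets lebesgue" using 1 by auto
  moreover have "A \<times> (UNIV :: 'b set) = (S \<times> UNIV) \<union> (N \<times> UNIV)" unfolding A(1) by auto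
  ultimately show ?thesis by simp
qed

lemma vimage_snd_lebesgue:
  fixes A :: "'a::euclidean_space set"
  assumes "A \<in> sets lebesgue"
  shows "(UNIV :: 'b::euclidean_space set) \<times> A \<in> sets lebesgue"
proof -
  obtain S N N' where A: "A = S \<union> N" "N \<subseteq> N'" "N' \<in> null_sets lborel" "S \<in> sets lborel"
    using assms by (auto elim: sets_completionE)
  have "(UNIV :: 'b set) \<times> S \<in> sets (lborel \<Otimes>\<^sub>M lborel)" using A(4) by auto
  then have 1: "(UNIV :: 'b set) \<times> S \<in> sets lebesgue" unfolding lborel_prod by auto
  have "emeasure (lborel \<Otimes>\<^sub>M lborel) ((UNIV :: 'b set) \<times> N') = emeasure lborel (UNIV :: 'b set) * emeasure lborel N'"
    using A(3) by (intro lborel.emeasure_pair_measure_Times) auto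
  also have "\<dots> = 0" using A(3) by auto
  finally have "(UNIV :: 'b set) \<times> N' \<in> null_sets (lborel \<Otimes>\<^sub>M lborel)" using A(3) by (intro null_setsI) auto
  then have "(UNIV :: 'b set) \<times> N' \<in> null_sets lborel" unfolding lborel_prod .
  then have "(UNIV :: 'b set) \<times> N \<in> sets lebesgue" by (rule null_sets_completion[OF _ Sigma_mono]) (use A(2) in auto)
  then have "((UNIV :: 'b set) \<times> S) \<union> (UNIV \<times> N) \<in> sets lebesgue" using 1 by auto
  moreover have "(UNIV :: 'b set) \<times> A = (UNIV \<times> S) \<union> (UNIV \<times> N)" unfolding A(1) by auto
  ultimately show ?thesis by simp
qed

lemma measurable_fst_lebesgue:
  fixes S :: "'a::euclidean_space set" and T :: "'b::euclidean_space set"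
  assumes f: "f \<in> borel_measurable (lebesgue_on S)"
  shows "(\<lambda>z. f (fst z)) \<in> borel_measurable (lebesgue_on (S \<times> T))"
proof -
  have "(fst :: 'a \<times> 'b \<Rightarrow> 'a) \<in> measurable lebesgue lebesgue"
  proof (rule measurableI)
    fix A :: "'a set" assume "A \<in> sets lebesgue"
    moreover have "fst -` A \<inter> space lebesgue = A \<times> (UNIV :: 'b set)" by auto
    ultimately show "fst -` A \<inter> space lebesgue \<in> sets (lebesgue :: ('a \<times> 'b) measure)"
      using vimage_fst_lebesgue by metis
  qed simp
  then have "fst \<in> measurable (lebesgue_on (S \<times> T)) (lebesgue_on S)"
    by (rule measurable_restrict_space3) auto
  from measurable_compose[OF this f] show ?thesis .
qed

lemma measurable_snd_lebesgue:
  fixes S :: "'a::euclidean_space set" and T :: "'b::euclidean_space set"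
  assumes f: "f \<in> borel_measurable (lebesgue_on T)"
  shows "(\<lambda>z. f (snd z)) \<in> borel_measurable (lebesgue_on (S \<times> T))"
proof -
  have "(snd :: 'a \<times> 'b \<Rightarrow> 'b) \<in> measurable lebesgue lebesgue"
  proof (rule measurableI)
    fix A :: "'b set" assume "A \<in> sets lebesgue"
    moreover have "snd -` A \<inter> space lebesgue = (UNIV :: 'a set) \<times> A" by auto
    ultimately show "snd -` A \<inter> space lebesgue \<in> sets (lebesgue :: ('a \<times> 'b) measure)"
      using vimage_snd_lebesgue by metis
  qed simp
  then have "snd \<in> measurable (lebesgue_on (S \<times> T)) (lebesgue_on T)"
    by (rule measurable_restrict_space3) auto
  from measurable_compose[OF this f] show ?thesis .
qed

lemma symbol_domain_cbox: "symbol_domain = cbox ((\<chi> j. 0), (\<chi> j. - pi)) ((\<chi> j. 1), (\<chi> j. pi))"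
  by (simp add: symbol_domain_def unit_cube_def angle_cube_def cbox_Pair_eq)

lemma symbol_domain_sets [simp]: "symbol_domain \<in> sets lebesgue" "symbol_domain \<in> sets borel"
  by (auto simp: symbol_domain_cbox)

lemma emeasure_times_lebesgue:
  fixes A :: "'a::euclidean_space set" and B :: "'b::euclidean_space set"
  assumes "A \<in> sets borel" "B \<in> sets borel"
  shows "emeasure lebesgue (A \<times> B) = emeasure lebesgue A * emeasure lebesgue B"
proof -
  have "emeasure (lborel \<Otimes>\<^sub>M lborel) (A \<times> B) = emeasure lborel A * emeasure lborel B"
    using assms by (intro lborel.emeasure_pair_measure_Times) auto
  moreover have "A \<times> B \<in> sets borel" using assms by (rule borel_Times)
  ultimately show ?thesis using assms unfolding lborel_prod by simp
qed

text \<open>The counterpart of \<open>small_pert\<close> for symbols: one number bounds the measure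
  of the exceptional set and the deviation off it. The exceptional set is only covered by a
  measurable \<open>E\<close>, so sums and limits can be treated without measurability of the
  functions.\<close>

definition closeM :: "real \<Rightarrow> ('d::finite sdom \<Rightarrow> complex) \<Rightarrow> ('d sdom \<Rightarrow> complex) \<Rightarrow> bool" where
  "closeM \<epsilon> g h \<longleftrightarrow> (\<exists>E\<in>sets lebesgue. emeasure lebesgue E \<le> ennreal \<epsilon> \<and> (\<forall>z\<in>symbol_domain - E. cmod (g z - h z) \<le> \<epsilon>))"

lemma closeM_mono: "closeM \<epsilon> g h \<Longrightarrow> \<epsilon> \<le> \<epsilon>' \<Longrightarrow> closeM \<epsilon>' g h"
  unfolding closeM_def by (meson ennreal_leI order_trans)

lemma closeM_sets:
  assumes "E \<in> sets lebesgue" "emeasure lebesgue E \<le> ennreal \<epsilon>" "E' \<in> sets lebesgue" "emeasure lebesgue E' \<le> ennreal \<epsilon>'" "0 \<le> \<epsilon>" "0 \<le> \<epsilon>'"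
  shows "E \<union> E' \<in> sets lebesgue" "emeasure lebesgue (E \<union> E') \<le> ennreal (\<epsilon> + \<epsilon>')"
proof -
  show "E \<union> E' \<in> sets lebesgue" using assms by auto
  have "emeasure lebesgue (E \<union> E') \<le> emeasure lebesgue E + emeasure lebesgue E'" using assms by (intro emeasure_subadditive)
  also have "\<dots> \<le> ennreal \<epsilon> + ennreal \<epsilon>'" using assms by (intro add_mono)
  finally show "emeasure lebesgue (E \<union> E') \<le> ennreal (\<epsilon> + \<epsilon>')" using assms by simp
qed

lemma closeM_comb:
  assumes "closeM \<epsilon> g h" "closeM \<epsilon>' g' h'" "0 \<le> \<epsilon>" "0 \<le> \<epsilon>'"
    and "\<And>z. z \<in> symbol_domain \<Longrightarrow> cmod (g z - h z) \<le> \<epsilon> \<Longrightarrow> cmod (g' z - h' z) \<le> \<epsilon>' \<Longrightarrow> cmod (p z - q z) \<le> \<epsilon> + \<epsilon>'"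
  shows "closeM (\<epsilon> + \<epsilon>') p q"
proof -
  obtain E where E: "E \<in> sets lebesgue" "emeasure lebesgue E \<le> ennreal \<epsilon>" "\<forall>z\<in>symbol_domain - E. cmod (g z - h z) \<le> \<epsilon>"
    using assms(1) unfolding closeM_def by blast
  obtain E' where E': "E' \<in> sets lebesgue" "emeasure lebesgue E' \<le> ennreal \<epsilon>'" "\<forall>z\<in>symbol_domain - E'. cmod (g' z - h' z) \<le> \<epsilon>'"
    using assms(2) unfolding closeM_def by blast
  show ?thesis unfolding closeM_def
    using closeM_sets[OF E(1,2) E'(1,2) assms(3,4)] E(3) E'(3) assms(5) by (intro bexI[of _ "E \<union> E'"]) auto
qed

lemma closeM_add: "closeM \<epsilon> g h \<Longrightarrow> closeM \<epsilon>' g' h' \<Longrightarrow> 0 \<le> \<epsilon> \<Longrightarrow> 0 \<le> \<epsilon>' \<Longrightarrow> closeM (\<epsilon> + \<epsilon>') (\<lambda>z. g z + g' z) (\<lambda>z. h z + h' z)"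
  by (rule closeM_comb) (auto simp: add_diff_add intro: norm_triangle_mono)

lemma closeM_trans: "closeM \<epsilon> g h \<Longrightarrow> closeM \<epsilon>' h k \<Longrightarrow> 0 \<le> \<epsilon> \<Longrightarrow> 0 \<le> \<epsilon>' \<Longrightarrow> closeM (\<epsilon> + \<epsilon>') g k"
proof (rule closeM_comb)
  fix z assume "cmod (g z - h z) \<le> \<epsilon>" "cmod (h z - k z) \<le> \<epsilon>'"
  then show "cmod (g z - k z) \<le> \<epsilon> + \<epsilon>'" using norm_triangle_ineq[of "g z - h z" "h z - k z"] by simp
qed

lemma closeM_imp: "closeM \<epsilon> g h \<Longrightarrow> (\<And>z. z \<in> symbol_domain \<Longrightarrow> cmod (g z - h z) \<le> \<epsilon> \<Longrightarrow> cmod (g' z - h' z) \<le> \<epsilon>) \<Longrightarrow> closeM \<epsilon> g' h'"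
  unfolding closeM_def by blast

lemma finite_symbol_domain: "emeasure lebesgue (symbol_domain :: ('d::finite sdom) set) < \<infinity>"
  unfolding symbol_domain_cbox using fmeasurableD2[OF lmeasurable_cbox] by (simp only: less_top infinity_ennreal_def)

text \<open>The sets where the modulus exceeds a natural number decrease to the empty set, and in a
  space of finite measure their measures tend to 0.\<close>

lemma measurable_bounded_outside:
  fixes \<kappa> :: "'a::euclidean_space \<Rightarrow> complex"
  assumes S: "S \<in> sets lebesgue" "emeasure lebesgue S < \<infinity>" and \<kappa>: "\<kappa> \<in> borel_measurable (lebesgue_on S)" and e: "0 < e"
  obtains K E where "0 < K" "E \<in> sets lebesgue" "emeasure lebesgue E \<le> ennreal e" "\<And>z. z \<in> S - E \<Longrightarrow> cmod (\<kappa> z) \<le> K"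
proof -
  define B where "B n = {z \<in> S. real n < cmod (\<kappa> z)}" for n :: nat
  have B: "B n \<in> sets lebesgue" for n
  proof -
    have "{z \<in> space (lebesgue_on S). real n < cmod (\<kappa> z)} \<in> sets (lebesgue_on S)" using \<kappa> by measurable
    then show ?thesis using S(1) by (auto simp: B_def sets_restrict_space_iff)
  qed
  have "(\<lambda>n. emeasure lebesgue (B n)) \<longlonglongrightarrow> emeasure lebesgue (\<Inter>n. B n)"
  proof (rule Lim_emeasure_decseq)
    show "range B \<subseteq> sets lebesgue" using B by auto
    show "decseq B" unfolding B_def decseq_def by (auto intro: le_less_trans)
    fix n
    have "emeasure lebesgue (B n) \<le> emeasure lebesgue S" using S by (intro emeasure_mono) (auto simp: B_def)
    then show "emeasure lebesgue (B n) \<noteq> \<infinity>" using S(2) by auto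
  qed
  moreover have "(\<Inter>n. B n) = {}"
  proof -
    have "\<exists>n :: nat. cmod (\<kappa> z) \<le> real n" for z by (rule real_arch_simple)
    then have "\<not> (\<forall>n. real n < cmod (\<kappa> z))" for z by (meson not_less)
    then show ?thesis by (auto simp: B_def)
  qed
  ultimately have "(\<lambda>n. emeasure lebesgue (B n)) \<longlonglongrightarrow> 0" by simp
  then have "eventually (\<lambda>n. emeasure lebesgue (B n) < ennreal e) sequentially" using e by (intro order_tendstoD) auto
  then obtain n where "emeasure lebesgue (B n) < ennreal e" by (auto simp: eventually_sequentially)
  then show ?thesis using B by (intro that[of "real n + 1" "B n"]) (auto simp: B_def)
qed

lemma ex_pos_le: "0 < a \<Longrightarrow> 0 < b \<Longrightarrow> \<exists>e>0. e \<le> a \<and> e \<le> b" for a b :: real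
  by (intro exI[of _ "min a b"]) auto

text \<open>The factor may be unbounded; it is bounded by some \<open>K\<close> off a set of measure
  \<open>e / 2\<close>, and \<open>\<delta>\<close> is fitted to that \<open>K\<close>. Hence
  \<open>\<delta>\<close> depends on \<open>\<kappa>\<close>.\<close>

lemma closeM_mult:
  fixes \<kappa> :: "'d::finite sdom \<Rightarrow> complex"
  assumes \<kappa>: "\<kappa> \<in> borel_measurable symM" and e: "0 < e"
  obtains \<delta> where "0 < \<delta>" "\<And>g h. closeM \<delta> g h \<Longrightarrow> closeM e (\<lambda>z. \<kappa> z * g z) (\<lambda>z. \<kappa> z * h z)"
proof -
  have "0 < e / 2" using e by simp
  then obtain K E where K: "0 < K" "E \<in> sets lebesgue" "emeasure lebesgue E \<le> ennreal (e / 2)" "\<And>z. z \<in> symbol_domain - E \<Longrightarrow> cmod (\<kappa> z) \<le> K"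
    using measurable_bounded_outside[OF symbol_domain_sets(1) finite_symbol_domain \<kappa>] by metis
  obtain \<delta> where \<delta>: "0 < \<delta>" "\<delta> \<le> e / 2" "\<delta> \<le> e / K"
    using ex_pos_le[of "e / 2" "e / K"] e K(1) by auto
  show ?thesis
  proof (rule that[OF \<delta>(1)])
    fix g h :: "'d sdom \<Rightarrow> complex" assume "closeM \<delta> g h"
    then obtain E' where E': "E' \<in> sets lebesgue" "emeasure lebesgue E' \<le> ennreal \<delta>" "\<forall>z\<in>symbol_domain - E'. cmod (g z - h z) \<le> \<delta>"
      unfolding closeM_def by blast
    have "emeasure lebesgue E' \<le> ennreal (e / 2)" using E'(2) \<delta>(2) by (meson ennreal_leI order_trans)
    note U = closeM_sets[OF K(2,3) E'(1) this]
    have "cmod (\<kappa> z * g z - \<kappa> z * h z) \<le> e" if "z \<in> symbol_domain - (E \<union> E')" for z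
    proof -
      have "cmod (\<kappa> z * g z - \<kappa> z * h z) = cmod (\<kappa> z) * cmod (g z - h z)" by (simp add: right_diff_distrib[symmetric] norm_mult)
      also have "\<dots> \<le> K * (e / K)" using K(4)[of z] E'(3) \<delta>(3) that K(1) by (intro mult_mono) force+
      finally show ?thesis using K(1) by simp
    qed
    then show "closeM e (\<lambda>z. \<kappa> z * g z) (\<lambda>z. \<kappa> z * h z)"
      unfolding closeM_def using U e by (intro bexI[of _ "E \<union> E'"]) auto
  qed
qed

text \<open>Two tagged divisions into the same cells have nearby Riemann sums. Choosing the tags so that a
  given real-linear functional \<open>\<phi>\<close> of the values differs by at least \<open>\<eta>\<close> on the bad cells bounds
  their number.\<close>

lemma riemann_bad_cells:
  fixes v :: "real ^ 'd::finite \<Rightarrow> complex" and \<phi> :: "complex \<Rightarrow> real" and m :: "'d \<Rightarrow> nat"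
  assumes R: "\<forall>p. p tagged_division_of unit_cube \<and> (\<forall>(x, K)\<in>p. diameter K < \<delta>) \<longrightarrow>
      norm ((\<Sum>(x, K)\<in>p. measure lborel K *\<^sub>R v x) - y) < e"
    and m: "\<forall>j. 1 \<le> m j" and \<delta>: "(\<Sum>j\<in>UNIV. 1 / real (m j)) < \<delta>"
    and \<phi>: "linear \<phi>" "\<And>z. \<bar>\<phi> z\<bar> \<le> cmod z"
  shows "\<eta> * real (card {a \<in> mi_range m. \<exists>x\<in>cell m a. \<eta> \<le> \<phi> (v x) - \<phi> (v (pt m a))}) \<le> 2 * e * real (mi_size m)"
proof -
  let ?B = "{a \<in> mi_range m. \<exists>x\<in>cell m a. \<eta> \<le> \<phi> (v x) - \<phi> (v (pt m a))}"
  define t where "t a = (if a \<in> ?B then SOME x. x \<in> cell m a \<and> \<eta> \<le> \<phi> (v x) - \<phi> (v (pt m a)) else pt m a)" for a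
  have tB: "t a \<in> cell m a \<and> \<eta> \<le> \<phi> (v (t a)) - \<phi> (v (pt m a))" if "a \<in> ?B" for a
  proof -
    have "\<exists>x. x \<in> cell m a \<and> \<eta> \<le> \<phi> (v x) - \<phi> (v (pt m a))" using that by blast
    from someI_ex[OF this] show ?thesis using that by (simp add: t_def)
  qed
  have tc: "t a \<in> cell m a" if "a \<in> mi_range m" for a
    using tB[of a] pt_in_cell[OF that] by (cases "a \<in> ?B") (auto simp: t_def)
  let ?N = "real (mi_size m)"
  have N: "0 < ?N" unfolding mi_size_def using mi_pos[OF m] by (simp add: prod_pos)
  let ?S = "\<lambda>t. (1 / ?N) *\<^sub>R (\<Sum>a\<in>mi_range m. v (t a))"
  have "norm (?S t - y) < e" "norm (?S (pt m) - y) < e"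
    by (rule riemann_cells[OF R m _ \<delta>], use tc pt_in_cell in blast)+
  then have "norm (?S t - ?S (pt m)) < 2 * e"
    using norm_triangle_ineq4[of "?S t - y" "?S (pt m) - y"] by simp
  then have "\<phi> (?S t - ?S (pt m)) < 2 * e" using \<phi>(2)[of "?S t - ?S (pt m)"] by linarith
  moreover have "\<phi> (?S t - ?S (pt m)) = (1 / ?N) * (\<Sum>a\<in>mi_range m. \<phi> (v (t a)) - \<phi> (v (pt m a)))"
    using \<phi>(1) by (simp add: linear_diff linear_cmul linear_sum sum_subtractf right_diff_distrib sum_divide_distrib)
  ultimately have *: "(\<Sum>a\<in>mi_range m. \<phi> (v (t a)) - \<phi> (v (pt m a))) < 2 * e * ?N" using N by (simp add: field_simps)
  have "\<eta> * real (card ?B) = (\<Sum>a\<in>mi_range m. if a \<in> ?B then \<eta> else 0)"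
    by (simp add: sum.If_cases Int_def)
  also have "\<dots> \<le> (\<Sum>a\<in>mi_range m. \<phi> (v (t a)) - \<phi> (v (pt m a)))"
    using tB by (intro sum_mono) (auto simp: t_def)
  finally show ?thesis using * by linarith
qed

lemma cell_borel [simp]: "cell m a \<in> sets borel" "cell m a \<in> sets lebesgue"
  by (auto simp: cell_def)

lemma emeasure_cell:
  assumes "\<forall>j. 1 \<le> m j" shows "emeasure lebesgue (cell m a) = ennreal (1 / real (mi_size m))"
proof -
  have "emeasure lborel (cell m a) < \<infinity>" unfolding cell_def by (simp add: emeasure_lborel_cbox_eq)
  then have "emeasure lborel (cell m a) = ennreal (measure lborel (cell m a))"
    by (intro emeasure_eq_ennreal_measure) auto
  then show ?thesis using measure_cell[OF assms, of a] by simp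
qed

text \<open>Says that the step function with values \<open>v (pt m a)\<close> is close to
  \<open>v\<close> in measure. A deviation in modulus is detected by one of the functionals Re, Im,
  -Re, -Im, and \<open>riemann_bad_cells\<close> bounds the bad cells of each.\<close>

lemma riemann_step_close:
  fixes v :: "real ^ 'd::finite \<Rightarrow> complex"
  assumes v: "riemann_integrable_on v unit_cube" and \<epsilon>: "0 < \<epsilon>"
  shows "\<exists>M. \<forall>m. (\<forall>j. M \<le> m j) \<and> (\<forall>j. 1 \<le> m j) \<longrightarrow> (\<exists>E\<in>sets borel. emeasure lebesgue E \<le> ennreal \<epsilon> \<and>
     (\<forall>a\<in>mi_range m. \<forall>x\<in>cell m a. x \<notin> E \<longrightarrow> cmod (v x - v (pt m a)) \<le> \<epsilon>))"
proof -
  obtain y where y: "\<forall>e>0. \<exists>\<delta>>0. \<forall>p. p tagged_division_of unit_cube \<and> (\<forall>(x, K)\<in>p. diameter K < \<delta>) \<longrightarrow>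
        norm ((\<Sum>(x, K)\<in>p. measure lborel K *\<^sub>R v x) - y) < e"
    using v unfolding riemann_integrable_on_def by (rule exE)
  define \<eta> where "\<eta> = \<epsilon> / 2"
  have \<eta>: "0 < \<eta>" using \<epsilon> by (simp add: \<eta>_def)
  \<comment> \<open>Makes the bound \<open>2 * e / \<eta>\<close> on the proportion of bad cells
    equal to \<open>\<epsilon> / 4\<close> for each of the four functionals.\<close>
  define e where "e = \<epsilon> * \<eta> / 8"
  have e: "0 < e" using \<epsilon> \<eta> by (simp add: e_def)
  obtain \<delta> where \<delta>: "\<delta> > 0" and R: "\<forall>p. p tagged_division_of unit_cube \<and> (\<forall>(x, K)\<in>p. diameter K < \<delta>) \<longrightarrow>
        norm ((\<Sum>(x, K)\<in>p. measure lborel K *\<^sub>R v x) - y) < e"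
    using y[rule_format, OF e] by (elim exE conjE)
  obtain M :: nat where M: "real CARD('d) / \<delta> < real M" using reals_Archimedean2 by blast
  have M0: "0 < real M" using M \<delta> by (meson divide_nonneg_pos le_less_trans of_nat_0_le_iff)
  show ?thesis
  proof (intro exI[of _ M] allI impI)
    fix m :: "'d \<Rightarrow> nat" assume mm: "(\<forall>j. M \<le> m j) \<and> (\<forall>j. 1 \<le> m j)"
    then have m: "\<forall>j. 1 \<le> m j" and mM: "\<And>j. real M \<le> real (m j)" by auto
    have "(\<Sum>j\<in>UNIV. 1 / real (m j)) \<le> (\<Sum>j\<in>(UNIV :: 'd set). 1 / real M)"
      using mM M0 by (intro sum_mono divide_left_mono) (auto intro!: mult_pos_pos mi_pos[OF m])
    also have "\<dots> = real CARD('d) / real M" by simp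
    also have "\<dots> < \<delta>" using M M0 \<delta> by (simp add: field_simps)
    finally have md: "(\<Sum>j\<in>UNIV. 1 / real (m j)) < \<delta>" .
    let ?N = "real (mi_size m)"
    have N: "0 < ?N" unfolding mi_size_def using mi_pos[OF m] by (simp add: prod_pos)
    define B where "B \<phi> = {a \<in> mi_range m. \<exists>x\<in>cell m a. \<eta> \<le> \<phi> (v x) - \<phi> (v (pt m a))}" for \<phi> :: "complex \<Rightarrow> real"
    have B: "real (card (B \<phi>)) \<le> \<epsilon> / 4 * ?N" if "linear \<phi>" "\<And>z. \<bar>\<phi> z\<bar> \<le> cmod z" for \<phi>
    proof -
      have "\<eta> * real (card (B \<phi>)) \<le> \<eta> * (\<epsilon> / 4 * ?N)"
        using riemann_bad_cells[OF R m md that, of \<eta>] unfolding B_def e_def by (simp add: algebra_simps)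
      then show ?thesis using \<eta> by simp
    qed
    let ?\<Phi> = "{Re, Im, \<lambda>z. - Re z, \<lambda>z. - Im z}"
    define BB where "BB = B Re \<union> B Im \<union> (B (\<lambda>z. - Re z) \<union> B (\<lambda>z. - Im z))"
    have lin: "linear Re" "linear Im" "linear (\<lambda>z. - Re z)" "linear (\<lambda>z. - Im z)"
      by (auto intro!: linearI)
    have "card BB \<le> (card (B Re) + card (B Im)) + (card (B (\<lambda>z. - Re z)) + card (B (\<lambda>z. - Im z)))"
      unfolding BB_def by (intro order_trans[OF card_Un_le] add_mono card_Un_le)
    then have "real (card BB) \<le> real ((card (B Re) + card (B Im)) + (card (B (\<lambda>z. - Re z)) + card (B (\<lambda>z. - Im z))))"
      by (rule of_nat_mono)
    also have "\<dots> \<le> (\<epsilon> / 4 * ?N + \<epsilon> / 4 * ?N) + (\<epsilon> / 4 * ?N + \<epsilon> / 4 * ?N)"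
      unfolding of_nat_add using B[OF lin(1)] B[OF lin(2)] B[OF lin(3)] B[OF lin(4)]
      by (intro add_mono) (auto simp: abs_Re_le_cmod abs_Im_le_cmod)
    finally have cB: "real (card BB) \<le> \<epsilon> * ?N" by simp
    define E where "E = (\<Union>a\<in>BB. cell m a)"
    have fin: "finite BB" unfolding BB_def B_def by auto
    show "\<exists>E\<in>sets borel. emeasure lebesgue E \<le> ennreal \<epsilon> \<and>
       (\<forall>a\<in>mi_range m. \<forall>x\<in>cell m a. x \<notin> E \<longrightarrow> cmod (v x - v (pt m a)) \<le> \<epsilon>)"
    proof (intro bexI[of _ E] conjI ballI impI)
      show "E \<in> sets borel" unfolding E_def using fin by (intro sets.finite_UN) auto
      have "emeasure lebesgue E \<le> (\<Sum>a\<in>BB. emeasure lebesgue (cell m a))"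
        unfolding E_def using fin by (intro emeasure_subadditive_finite) auto
      also have "\<dots> = ennreal (real (card BB) * (1 / ?N))"
        unfolding emeasure_cell[OF m] using N by (simp add: ennreal_mult[symmetric] ennreal_of_nat_eq_real_of_nat)
      also have "\<dots> \<le> ennreal \<epsilon>" using cB N by (intro ennreal_leI) (simp add: field_simps)
      finally show "emeasure lebesgue E \<le> ennreal \<epsilon>" .
      fix a x assume a: "a \<in> mi_range m" and x: "x \<in> cell m a" and xE: "x \<notin> E"
      have "a \<notin> BB" using x xE by (auto simp: E_def)
      then have "\<not> \<eta> \<le> \<phi> (v x) - \<phi> (v (pt m a))" if "\<phi> \<in> ?\<Phi>" for \<phi>
        using a x that unfolding BB_def B_def by blast
      from this[of Re] this[of Im] this[of "\<lambda>z. - Re z"] this[of "\<lambda>z. - Im z"]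
      have "\<bar>Re (v x - v (pt m a))\<bar> \<le> \<eta>" "\<bar>Im (v x - v (pt m a))\<bar> \<le> \<eta>" by auto
      then show "cmod (v x - v (pt m a)) \<le> \<epsilon>"
        using cmod_le[of "v x - v (pt m a)"] by (simp add: \<eta>_def)
    qed
  qed
qed

text \<open>The exceptional set is the cube minus the cells shrunk by \<open>\<eta>\<close> relative
  to their width; its measure is independent of \<open>m\<close>, which allows \<open>\<eta>\<close>
  to be chosen after \<open>m\<close>.\<close>

lemma wtrap_close:
  fixes v :: "real ^ 'd::finite \<Rightarrow> complex"
  assumes m: "\<forall>j. 1 \<le> m j" and \<eta>: "0 < \<eta>" "\<eta> < 1 / 2"
  shows "\<exists>E\<in>sets borel. emeasure lebesgue E \<le> ennreal (2 * real CARD('d) * \<eta>) \<and>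
     (\<forall>x\<in>unit_cube - E. \<exists>a\<in>mi_range m. x \<in> cell m a \<and> wtrap \<eta> m v x = v (pt m a))"
proof -
  \<comment> \<open>The shrunken cells lie in the interiors of the cells, so they are disjoint and
    their volumes add up.\<close>
  define sc where "sc a = cbox (\<chi> j. (real (a j) - 1 + \<eta>) / real (m j)) (\<chi> j. (real (a j) - \<eta>) / real (m j))" for a :: "'d \<Rightarrow> nat"
  have p: "0 < real (m j)" for j by (rule mi_pos[OF m])
  have sub: "sc a \<subseteq> interior (cell m a)" for a
  proof
    fix x assume x: "x \<in> sc a"
    have "(real (a j) - 1) / real (m j) < vec_nth x j \<and> vec_nth x j < real (a j) / real (m j)" for j
    proof -
      have "(real (a j) - 1 + \<eta>) / real (m j) \<le> vec_nth x j" "vec_nth x j \<le> (real (a j) - \<eta>) / real (m j)"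
        using x by (auto simp: sc_def mem_box_cart)
      moreover have "(real (a j) - 1) / real (m j) < (real (a j) - 1 + \<eta>) / real (m j)" "(real (a j) - \<eta>) / real (m j) < real (a j) / real (m j)"
        using \<eta> p[of j] by (auto intro: divide_strict_right_mono)
      ultimately show ?thesis by linarith
    qed
    then show "x \<in> interior (cell m a)" by (simp add: interior_cell)
  qed
  have ne: "sc a \<noteq> {}" for a
  proof -
    have "(\<chi> j. (real (a j) - 1/2) / real (m j)) \<in> sc a"
      using \<eta> p by (auto simp: sc_def mem_box_cart intro!: divide_right_mono)
    then show ?thesis by blast
  qed
  have ms: "measure lborel (sc a) = (1 - 2 * \<eta>) ^ CARD('d) / real (mi_size m)" for a
  proof -
    have "measure lborel (sc a) = (\<Prod>j\<in>UNIV. (real (a j) - \<eta>) / real (m j) - (real (a j) - 1 + \<eta>) / real (m j))"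
      using content_cbox_cart[OF ne[unfolded sc_def]] by (simp add: sc_def)
    also have "\<dots> = (\<Prod>j\<in>UNIV. (1 - 2 * \<eta>) / real (m j))"
      by (intro prod.cong refl) (simp add: diff_divide_distrib[symmetric] algebra_simps)
    finally show ?thesis by (simp add: mi_size_def prod_dividef)
  qed
  have bs: "sc a \<in> sets borel" "sc a \<in> lmeasurable" for a by (auto simp: sc_def)
  have fs: "emeasure lborel (sc a) \<noteq> \<infinity>" for a unfolding sc_def by (simp add: emeasure_lborel_cbox_eq)
  let ?U = "\<Union>a\<in>mi_range m. sc a"
  have N: "0 < real (mi_size m)" unfolding mi_size_def using p by (simp add: prod_pos)
  have disj: "disjoint_family_on sc (mi_range m)"
    unfolding disjoint_family_on_def
  proof (intro ballI impI)
    fix a b :: "'d \<Rightarrow> nat" assume "a \<noteq> b"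
    then show "sc a \<inter> sc b = {}" using sub[of a] sub[of b] cell_interiors_disjoint[OF m, of a b] by blast
  qed
  have mU: "measure lebesgue ?U = (1 - 2 * \<eta>) ^ CARD('d)"
  proof -
    have "measure lebesgue ?U = (\<Sum>a\<in>mi_range m. measure lebesgue (sc a))"
      using bs disj fs by (intro measure_finite_Union) auto
    also have "\<dots> = (\<Sum>a\<in>mi_range m. (1 - 2 * \<eta>) ^ CARD('d) / real (mi_size m))"
      using ms bs(1) by (intro sum.cong) auto
    also have "\<dots> = (1 - 2 * \<eta>) ^ CARD('d)" using N by (simp add: card_mi_range)
    finally show ?thesis .
  qed
  have Us: "?U \<subseteq> unit_cube" using sub interior_subset cell_subset by blast
  have Ub: "?U \<in> sets borel" using bs by (intro sets.finite_UN) auto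
  define E where "E = unit_cube - ?U"
  have E: "E \<in> sets borel" unfolding E_def using Ub by auto
  have mc: "measure lebesgue (unit_cube :: (real ^ 'd) set) = 1" by (simp add: unit_cube_def measure_cbox_const)
  have lm: "(unit_cube :: (real ^ 'd) set) \<in> lmeasurable" by (simp add: unit_cube_def)
  have "E \<in> lmeasurable" unfolding E_def using lm bs(2) by (intro fmeasurable.Diff fmeasurable.finite_UN) auto
  then have "emeasure lebesgue E = ennreal (measure lebesgue E)" by (intro emeasure_eq_measure2) auto
  also have "measure lebesgue E = 1 - (1 - 2 * \<eta>) ^ CARD('d)"
    unfolding E_def using lm Us Ub mU mc by (subst measure_Diff) (auto dest: fmeasurableD2)
  \<comment> \<open>Bernoulli's inequality for the \<open>d\<close>-th power of
    \<open>1 - 2 * \<eta>\<close>.\<close>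
  also have "\<dots> \<le> 2 * real CARD('d) * \<eta>"
    using Bernoulli_inequality[of "- 2 * \<eta>" "CARD('d)"] \<eta> by (simp add: algebra_simps)
  finally have Ee: "emeasure lebesgue E \<le> ennreal (2 * real CARD('d) * \<eta>)" by (simp add: ennreal_leI)
  have "\<exists>a\<in>mi_range m. x \<in> cell m a \<and> wtrap \<eta> m v x = v (pt m a)" if x: "x \<in> unit_cube - E" for x
  proof -
    obtain a where a: "a \<in> mi_range m" "x \<in> sc a" using x by (auto simp: E_def)
    have "wtrap \<eta> m v x = v (pt m a)"
    proof (rule wtrap_eq[OF \<eta>(1) a(1)])
      fix j
      have "(real (a j) - 1 + \<eta>) / real (m j) \<le> vec_nth x j" "vec_nth x j \<le> (real (a j) - \<eta>) / real (m j)"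
        using a(2) by (auto simp: sc_def mem_box_cart)
      then show "\<eta> \<le> real (m j) * vec_nth x j - real (a j) + 1 \<and> real (m j) * vec_nth x j - real (a j) + 1 \<le> 1 - \<eta>"
        using p[of j] by (simp add: field_simps)
    qed
    moreover have "x \<in> cell m a" using sub[of a] a(2) interior_subset by blast
    ultimately show ?thesis using a(1) by blast
  qed
  then show ?thesis using E Ee by blast
qed

definition tnice :: "real \<Rightarrow> ('d::{finite,linorder} \<Rightarrow> nat) \<Rightarrow> (real ^ 'd::{finite,linorder} \<Rightarrow> complex) \<Rightarrow> (complex \<times> ('d \<Rightarrow> int)) list \<Rightarrow> 'd nice" where
  "tnice \<eta> m v p = map (\<lambda>(c, k). (\<lambda>x. c * wtrap \<eta> m v x, k)) p"

lemma nsym_tnice: "nsym (tnice \<eta> m v p) z = wtrap \<eta> m v (fst z) * teval p (snd z)"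
  by (induction p "snd z" rule: teval.induct) (auto simp: tnice_def algebra_simps)

lemma nvalid_tnice: "0 < \<eta> \<Longrightarrow> nvalid (tnice \<eta> m v p)"
proof (induction p)
  case (Cons a p)
  then show ?case by (cases a) (auto simp: tnice_def intro!: continuous_intros continuous_wtrap)
qed (simp add: tnice_def)

lemma single_smult: "c \<cdot>\<^sub>m single n k h = single n k (\<lambda>i. c * h i)"
  unfolding single_def mi_mat_smult by (rule mi_mat_cong) auto

lemma frob2_smult: "frob2 (c \<cdot>\<^sub>m X) = (cmod c)\<^sup>2 * frob2 X"
  by (simp add: frob2_def norm_mult power_mult_distrib sum_distrib_left)

lemma nsym_measurable: "nvalid c \<Longrightarrow> nsym c \<in> borel_measurable symM"
proof (induction c)
  case (Cons a c)
  obtain v k where a: "a = (v, k)" by (cases a)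
  have "v \<in> borel_measurable (lebesgue_on unit_cube)" using Cons.prems a
    by (intro continuous_imp_measurable_on_sets_lebesgue) auto
  then have "(\<lambda>z. v (fst z)) \<in> borel_measurable symM"
    unfolding symbol_domain_def by (rule measurable_fst_lebesgue)
  moreover have "(\<lambda>z. fexp k (snd z)) \<in> borel_measurable symM"
    unfolding symbol_domain_def by (rule measurable_snd_lebesgue[OF fexp_lebesgue_on])
  ultimately have "(\<lambda>z. v (fst z) * fexp k (snd z) + nsym c z) \<in> borel_measurable symM"
    using Cons a by (intro borel_measurable_add borel_measurable_times) auto
  then show ?case unfolding a by (simp add: nsym.simps[abs_def])
qed (simp add: nsym.simps[abs_def])

section \<open>Locally Toeplitz sequences as GLT sequences in the working sense\<close>

context mlseq
begin

text \<open>Linear in the polynomial, hence \<open>LT_wtrap\<close> term by term. As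
  \<open>frob2\<close> is subadditive only up to the factor 2, each half of a sum gets a quarter of
  \<open>e\<close>.\<close>

lemma LT_tnice:
  assumes m: "\<forall>j. 1 \<le> m j" and e: "0 < e"
  shows "\<exists>\<eta>0>0. \<forall>\<eta>. 0 < \<eta> \<and> \<eta> < \<eta>0 \<longrightarrow>
    eventually (\<lambda>n. frob2 (LT_op (nn n) m v (teval p) - nmat (nn n) (tnice \<eta> m v p)) \<le> e * real (N n)) F"
  using e
proof (induction p arbitrary: e)
  case Nil
  have fc: "fourier_coeff (teval [] :: real ^ 'd::{finite,linorder} \<Rightarrow> complex) r = 0" for r
    unfolding fourier_coeff_eq by (simp add: teval.simps[abs_def])
  have "LT_op (nn n) m v (teval []) = 0\<^sub>m (N n) (N n)" for n
    unfolding LT_op_eq fc mi_mat_zero[symmetric] by (rule mi_mat_cong) auto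
  then have "frob2 (LT_op (nn n) m v (teval []) - nmat (nn n) (tnice \<eta> m v [])) = 0" for n \<eta>
    by (simp add: tnice_def frob2_def)
  then show ?case using Nil by (intro exI[of _ 1]) (simp only:, simp)
next
  case (Cons a p)
  obtain c k where a: "a = (c, k)" by (cases a)
  have e4: "0 < e / 4" using Cons.prems by simp
  obtain \<eta>1 where \<eta>1: "\<eta>1 > 0" "\<And>\<eta>. 0 < \<eta> \<and> \<eta> < \<eta>1 \<Longrightarrow>
    eventually (\<lambda>n. frob2 (LT_op (nn n) m v (teval p) - nmat (nn n) (tnice \<eta> m v p)) \<le> e / 4 * real (N n)) F"
    using Cons.IH[OF e4] by blast
  define C where "C = (2 * (\<Sum>a\<in>mi_range m. cmod (v (pt m a))))\<^sup>2 * (2 * real CARD('d) + 1)"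
  have C: "0 \<le> C" unfolding C_def by (intro mult_nonneg_nonneg) auto
  \<comment> \<open>\<open>LT_wtrap\<close> has error \<open>C * \<eta>\<close>, scaled by the
    squared coefficient; the 1 keeps the denominator positive.\<close>
  define \<eta>2 where "\<eta>2 = e / (4 * ((cmod c)\<^sup>2 * C + 1))"
  have pos: "0 < (cmod c)\<^sup>2 * C + 1" using C by (intro add_nonneg_pos mult_nonneg_nonneg) auto
  have \<eta>2: "0 < \<eta>2" unfolding \<eta>2_def using pos Cons.prems by simp
  show ?case
  proof (intro exI[of _ "min \<eta>1 \<eta>2"] conjI allI impI)
    fix \<eta> assume \<eta>: "0 < \<eta> \<and> \<eta> < min \<eta>1 \<eta>2"
    then have \<eta>0: "0 < \<eta>" by blast
    have "eventually (\<lambda>n. frob2 (LT_op (nn n) m v (teval p) - nmat (nn n) (tnice \<eta> m v p)) \<le> e / 4 * real (N n)) F"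
      using \<eta> by (intro \<eta>1(2)) auto
    with LT_wtrap[OF fourier_coeff_fexp m \<eta>0, of v k]
    show "eventually (\<lambda>n. frob2 (LT_op (nn n) m v (teval (a # p)) - nmat (nn n) (tnice \<eta> m v (a # p))) \<le> e * real (N n)) F"
    proof eventually_elim
      case (elim n)
      let ?X = "LT_op (nn n) m v (fexp k) - single (nn n) k (\<lambda>i. wtrap \<eta> m v (pt (nn n) i))"
      let ?Y = "LT_op (nn n) m v (teval p) - nmat (nn n) (tnice \<eta> m v p)"
      have te: "teval (a # p) = (\<lambda>\<theta>. c * fexp k \<theta> + teval p \<theta>)" unfolding a by (auto simp: fun_eq_iff)
      have "LT_op (nn n) m v (teval (a # p)) = c \<cdot>\<^sub>m LT_op (nn n) m v (fexp k) + LT_op (nn n) m v (teval p)"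
        unfolding te by (subst LT_op_add) (auto intro: integrable_mult_right integrable_fexp integrable_teval simp: LT_op_cmult)
      moreover have "nmat (nn n) (tnice \<eta> m v (a # p)) = c \<cdot>\<^sub>m single (nn n) k (\<lambda>i. wtrap \<eta> m v (pt (nn n) i)) + nmat (nn n) (tnice \<eta> m v p)"
        unfolding a by (simp add: tnice_def single_smult)
      ultimately have eq: "LT_op (nn n) m v (teval (a # p)) - nmat (nn n) (tnice \<eta> m v (a # p)) = c \<cdot>\<^sub>m ?X + ?Y"
        by (simp only:) (intro eq_matI, auto simp: algebra_simps)
      have "frob2 (c \<cdot>\<^sub>m ?X + ?Y) \<le> 2 * frob2 (c \<cdot>\<^sub>m ?X) + 2 * frob2 ?Y"
        by (rule frob2_add_le[of _ "N n" "N n"]) auto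
      also have "frob2 (c \<cdot>\<^sub>m ?X) \<le> e / 4 * real (N n)"
      proof -
        have "frob2 (c \<cdot>\<^sub>m ?X) = (cmod c)\<^sup>2 * frob2 ?X" by (rule frob2_smult)
        also have "\<dots> \<le> (cmod c)\<^sup>2 * (C * \<eta> * real (N n))" using elim(1) unfolding C_def by (intro mult_left_mono) (auto simp: mult.assoc)
        also have "\<dots> = ((cmod c)\<^sup>2 * C) * \<eta> * real (N n)" by simp
        also have "\<dots> \<le> ((cmod c)\<^sup>2 * C + 1) * \<eta>2 * real (N n)" using \<eta> C pos by (intro mult_right_mono mult_mono) auto
        also have "\<dots> = e / 4 * real (N n)"
        proof -
          have "X * (e / (4 * X)) = e / 4" if "0 < X" for X using that by simp
          from this[OF pos] show ?thesis unfolding \<eta>2_def by (simp only:)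
        qed
        finally show ?thesis .
      qed
      finally show ?case unfolding eq using elim(2) by simp
    qed
  qed (use \<eta>1 \<eta>2 in auto)
qed

text \<open>Equivalent to \<^const>\<open>GLT_seq\<close>: see \<open>GLT_imp_glt\<close> and \<open>glt_imp_GLT\<close>.\<close>

definition glt :: "(nat \<Rightarrow> complex Matrix.mat) \<Rightarrow> ('d::{finite,linorder} sdom \<Rightarrow> complex) \<Rightarrow> bool" where
  "glt A \<kappa> \<longleftrightarrow> (\<forall>n\<in>I. A n \<in> carrier_mat (N n) (N n)) \<and> \<kappa> \<in> borel_measurable symM \<and>
     (\<forall>\<epsilon>>0. \<exists>c. nvalid c \<and> closeM \<epsilon> (nsym c) \<kappa> \<and> eventually (\<lambda>n. small_pert \<epsilon> (A n - nmat (nn n) c)) F)"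

lemma gltD: "glt A \<kappa> \<Longrightarrow> n \<in> I \<Longrightarrow> A n \<in> carrier_mat (N n) (N n)"
  "glt A \<kappa> \<Longrightarrow> \<kappa> \<in> borel_measurable symM"
  by (auto simp: glt_def)

lemma gltE:
  assumes "glt A \<kappa>" "0 < \<epsilon>"
  obtains c where "nvalid c" "closeM \<epsilon> (nsym c) \<kappa>" "eventually (\<lambda>n. small_pert \<epsilon> (A n - nmat (nn n) c)) F"
  using assms unfolding glt_def by metis

lemma gltI:
  assumes "\<And>n. n \<in> I \<Longrightarrow> A n \<in> carrier_mat (N n) (N n)" "\<kappa> \<in> borel_measurable symM"
    "\<And>\<epsilon>. 0 < \<epsilon> \<Longrightarrow> \<exists>c. nvalid c \<and> closeM \<epsilon> (nsym c) \<kappa> \<and> eventually (\<lambda>n. small_pert \<epsilon> (A n - nmat (nn n) c)) F"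
  shows "glt A \<kappa>"
  using assms unfolding glt_def by blast

lemma acs_small_pert:
  assumes acs: "acs I P G B A" and A: "\<And>n. n \<in> I \<Longrightarrow> A n \<in> carrier_mat (N n) (N n)" and e: "0 < e"
  shows "eventually (\<lambda>m. m \<in> P \<longrightarrow> eventually (\<lambda>n. B m n \<in> carrier_mat (N n) (N n) \<and> small_pert e (A n - B m n)) F) G"
proof -
  obtain n0 c \<omega> where c: "(c \<longlongrightarrow> 0) G" and \<omega>: "(\<omega> \<longlongrightarrow> 0) G"
    and d: "\<And>m n. m \<in> P \<Longrightarrow> n \<in> I \<Longrightarrow> n0 m \<le> n \<Longrightarrow>
           (let d = dim_row (A n) in B m n \<in> carrier_mat d d \<and>
             (\<exists>R \<in> carrier_mat d d. \<exists>N \<in> carrier_mat d d. A n = B m n + R + N \<and>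
                real (mat_rank R) \<le> c m * real d \<and> spectral_norm N \<le> \<omega> m))"
    using acs unfolding acs_def by blast
  have "eventually (\<lambda>m. c m < e) G" "eventually (\<lambda>m. \<omega> m < e) G"
    using order_tendstoD(2)[OF c e] order_tendstoD(2)[OF \<omega> e] .
  then show ?thesis
  proof eventually_elim
    case (elim m)
    show ?case unfolding eventually_at_top_in
    proof (intro impI exI[of _ "n0 m"] ballI)
      fix n assume m: "m \<in> P" and n: "n \<in> I" "n0 m \<le> n"
      have dr: "dim_row (A n) = N n" using A[OF n(1)] by auto
      obtain R M where B: "B m n \<in> carrier_mat (N n) (N n)" and R: "R \<in> carrier_mat (N n) (N n)" and M: "M \<in> carrier_mat (N n) (N n)"
        and eq: "A n = B m n + R + M" and rk: "real (mat_rank R) \<le> c m * real (N n)" and sn: "spectral_norm M \<le> \<omega> m"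
        using d[OF m n] unfolding Let_def dr by blast
      have "A n - B m n = R + M" unfolding eq using B R M by (intro eq_matI) auto
      moreover have "real (mat_rank R) \<le> e * real (N n)" using rk mult_right_mono[of "c m" e "real (N n)"] elim by simp
      moreover have "nb M e" using nb_mono[OF nb_spectral_norm[OF sn]] elim e by simp
      ultimately show "B m n \<in> carrier_mat (N n) (N n) \<and> small_pert e (A n - B m n)"
        using B small_pertI[OF R M _ mat_rank_imp_lowrank[OF R]] by blast
    qed
  qed
qed

lemma mi_at_top_ge: "eventually (\<lambda>m :: 'd \<Rightarrow> nat. \<forall>j. M \<le> m j) mi_at_top"
proof -
  have "eventually (\<lambda>m :: 'd \<Rightarrow> nat. M \<le> Min (range m)) mi_at_top"
    unfolding mi_at_top_def eventually_filtercomap by (intro exI[of _ "\<lambda>x. M \<le> x"]) (auto simp: eventually_at_top_linorder)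
  then show ?thesis by (rule eventually_mono) (auto intro: order_trans[OF _ Min_le])
qed

text \<open>Lets a single \<open>m\<close> be extracted from properties that hold
  eventually.\<close>

lemma mi_at_top_nontrivial: "(mi_at_top :: ('d \<Rightarrow> nat) filter) \<noteq> bot"
proof
  assume "(mi_at_top :: ('d \<Rightarrow> nat) filter) = bot"
  then have "eventually (\<lambda>_ :: 'd \<Rightarrow> nat. False) mi_at_top" by simp
  then obtain Q where Q: "eventually Q (at_top :: nat filter)" "\<And>m :: 'd \<Rightarrow> nat. Q (Min (range m)) \<Longrightarrow> False"
    unfolding mi_at_top_def eventually_filtercomap by blast
  then obtain M where "Q M" by (auto simp: eventually_at_top_linorder)
  then show False using Q(2)[of "\<lambda>_. M"] by simp
qed

end

text \<open>\<open>emeasure_times_lebesgue\<close> concerns Borel factors, so exceptional sets are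
  first enlarged to Borel sets of the same measure.\<close>

lemma borel_cover:
  fixes A :: "'a::euclidean_space set"
  assumes "A \<in> sets lebesgue"
  obtains B where "B \<in> sets borel" "A \<subseteq> B" "emeasure lebesgue B = emeasure lebesgue A"
proof -
  obtain S N N' where A: "A = S \<union> N" "N \<subseteq> N'" "N' \<in> null_sets lborel" "S \<in> sets lborel"
    using assms by (auto elim: sets_completionE)
  have N': "N' \<in> sets borel" "emeasure lebesgue N' = 0" using null_setsD2[OF A(3)] null_setsD1[OF A(3)] by simp_all
  have "emeasure lebesgue (S \<union> N') \<le> emeasure lebesgue S + emeasure lebesgue N'"
    using A(4) N' by (intro emeasure_subadditive) auto
  also have "\<dots> \<le> emeasure lebesgue A" unfolding N' add_0_right using A(1) assms by (intro emeasure_mono) auto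
  finally have "emeasure lebesgue (S \<union> N') = emeasure lebesgue A"
  proof (rule antisym)
    show "emeasure lebesgue A \<le> emeasure lebesgue (S \<union> N')" using A N' by (intro emeasure_mono) auto
  qed
  then show ?thesis using A N' by (intro that[of "S \<union> N'"]) auto
qed

text \<open>The exceptional set is the union of two cylinders, with measure at most \<open>a\<close>
  times the volume of the angle cube plus \<open>b\<close> times the volume 1 of the unit
  cube.\<close>

lemma closeM_prod:
  fixes g h :: "'d::finite sdom \<Rightarrow> complex"
  assumes E: "E \<in> sets lebesgue" "emeasure lebesgue E \<le> ennreal a" and B: "B \<in> sets lebesgue" "emeasure lebesgue B \<le> ennreal b"
    and "0 \<le> a" "0 \<le> b" "a * (2 * pi) ^ CARD('d) + b \<le> \<epsilon>"
    and gh: "\<And>x \<theta>. x \<in> unit_cube \<Longrightarrow> \<theta> \<in> angle_cube \<Longrightarrow> x \<notin> E \<Longrightarrow> \<theta> \<notin> B \<Longrightarrow> cmod (g (x, \<theta>) - h (x, \<theta>)) \<le> \<epsilon>"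
  shows "closeM \<epsilon> g h"
proof -
  obtain E' where E': "E' \<in> sets borel" "E \<subseteq> E'" "emeasure lebesgue E' = emeasure lebesgue E" by (rule borel_cover[OF E(1)])
  obtain B' where B': "B' \<in> sets borel" "B \<subseteq> B'" "emeasure lebesgue B' = emeasure lebesgue B" by (rule borel_cover[OF B(1)])
  let ?A = "angle_cube :: (real ^ 'd) set" and ?U = "unit_cube :: (real ^ 'd) set"
  have AU: "?A \<in> sets borel" "?U \<in> sets borel" by (auto simp: angle_cube_def unit_cube_def)
  let ?P = "(2 * pi) ^ CARD('d)"
  let ?Z = "E' \<times> ?A \<union> ?U \<times> B'"
  have "E' \<times> ?A \<in> sets borel" "?U \<times> B' \<in> sets borel" using AU E' B' by (auto intro: borel_Times)
  then have Z: "E' \<times> ?A \<in> sets lebesgue" "?U \<times> B' \<in> sets lebesgue" by auto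
  have "emeasure lebesgue ?Z \<le> emeasure lebesgue (E' \<times> ?A) + emeasure lebesgue (?U \<times> B')"
    using Z by (rule emeasure_subadditive)
  also have "\<dots> = emeasure lebesgue E * ennreal ?P + emeasure lebesgue B"
    unfolding emeasure_times_lebesgue[OF E'(1) AU(1)] emeasure_times_lebesgue[OF AU(2) B'(1)] emeasure_angle_cube emeasure_unit_cube E'(3) B'(3) by simp
  also have "\<dots> \<le> ennreal a * ennreal ?P + ennreal b" using E(2) B(2) by (intro add_mono mult_right_mono) auto
  also have "\<dots> = ennreal (a * ?P + b)" using assms(5,6) by (simp add: ennreal_mult ennreal_plus)
  also have "\<dots> \<le> ennreal \<epsilon>" using assms(7) by (rule ennreal_leI)
  finally show ?thesis unfolding closeM_def using Z gh E'(2) B'(2)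
    by (intro bexI[of _ ?Z]) (auto simp: symbol_domain_def)
qed

context mlseq
begin

text \<open>Three replacements on the matrix side: the sequence by an LT operator with fixed
  \<open>m\<close>, the symbol \<open>f\<close> by a polynomial \<open>p\<close>, the block values
  by \<open>wtrap\<close>. Each costs \<open>\<epsilon> / 4\<close>. On the symbol side
  \<open>E1\<close> and \<open>E2\<close> collect bad points in \<open>x\<close>, \<open>B1\<close>
  and \<open>B2\<close> those in \<open>\<theta>\<close>.\<close>

lemma LT_glt:
  assumes LT: "LT_seq I nn A v f"
  shows "glt A (\<lambda>z. v (fst z) * f (snd z))"
proof (rule gltI)
  have v: "riemann_integrable_on v unit_cube" and f: "integrable angM f"
    and acs: "acs I {m. \<forall>j. 1 \<le> m j} mi_at_top (\<lambda>m n. LT_op (nn n) m v f) A"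
    using LT by (auto simp: LT_seq_def)
  have A: "A n \<in> carrier_mat (N n) (N n)" if "n \<in> I" for n
    using LT that by (auto simp: LT_seq_def multilevel_seq_def)
  then show "A n \<in> carrier_mat (N n) (N n)" if "n \<in> I" for n using that .
  have fm: "f \<in> borel_measurable angM" using f by auto
  show "(\<lambda>z. v (fst z) * f (snd z)) \<in> borel_measurable symM"
    unfolding symbol_domain_def
    by (intro borel_measurable_times measurable_fst_lebesgue measurable_snd_lebesgue riemann_integrable_measurable v fm)
  fix \<epsilon> :: real assume e: "0 < \<epsilon>"
  let ?A = "angle_cube :: (real ^ 'd::{finite,linorder}) set"
  let ?P = "(2 * pi) ^ CARD('d)"
  have P: "0 < ?P" by simp
  have A_s: "?A \<in> sets lebesgue" by simp
  have A_f: "emeasure lebesgue ?A < \<infinity>" by (simp add: emeasure_angle_cube)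
  have e4: "0 < \<epsilon> / 4" using e by simp
  \<comment> \<open>The order of the choices matters: the bound \<open>K\<close> of \<open>f\<close>
    off a small set fixes the accuracy \<open>\<epsilon>1\<close> for \<open>v\<close>, which fixes
    \<open>m\<close>; then come the bound \<open>C\<close> of \<open>v\<close> on the grid, the
    polynomial \<open>p\<close>, and last the wall width \<open>\<eta>\<close>.\<close>
  obtain K B1 where K: "0 < K" "B1 \<in> sets lebesgue" "emeasure lebesgue B1 \<le> ennreal (\<epsilon> / 4)" "\<And>z. z \<in> ?A - B1 \<Longrightarrow> cmod (f z) \<le> K"
    using measurable_bounded_outside[OF A_s A_f fm e4] by metis
  obtain \<epsilon>1 where e1: "0 < \<epsilon>1" "\<epsilon>1 \<le> \<epsilon> / (2 * K)" "\<epsilon>1 \<le> \<epsilon> / (4 * ?P)"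
    using ex_pos_le[of "\<epsilon> / (2 * K)" "\<epsilon> / (4 * ?P)"] e K(1) P by auto
  have e1K: "\<epsilon>1 * K \<le> \<epsilon> / 2" using mult_right_mono[OF e1(2), of K] K(1) by simp
  have e1P: "\<epsilon>1 * ?P \<le> \<epsilon> / 4" using mult_right_mono[OF e1(3), of ?P] P by simp
  obtain M where M: "\<And>m. (\<forall>j. M \<le> m j) \<and> (\<forall>j. 1 \<le> m j) \<Longrightarrow> (\<exists>E\<in>sets borel. emeasure lebesgue E \<le> ennreal \<epsilon>1 \<and>
     (\<forall>a\<in>mi_range m. \<forall>x\<in>cell m a. x \<notin> E \<longrightarrow> cmod (v x - v (pt m a)) \<le> \<epsilon>1))"
    using riemann_step_close[OF v e1(1)] by blast
  have "eventually (\<lambda>m. (m \<in> {m. \<forall>j. 1 \<le> m j} \<longrightarrow> eventually (\<lambda>n. LT_op (nn n) m v f \<in> carrier_mat (N n) (N n) \<and> small_pert (\<epsilon> / 4) (A n - LT_op (nn n) m v f)) F)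
     \<and> (\<forall>j. max 1 M \<le> m j)) mi_at_top"
    by (intro eventually_conj acs_small_pert[OF acs A e4] mi_at_top_ge)
  from eventually_happens'[OF mi_at_top_nontrivial this]
  obtain m where m0: "(\<forall>j. 1 \<le> m j) \<longrightarrow> eventually (\<lambda>n. LT_op (nn n) m v f \<in> carrier_mat (N n) (N n) \<and> small_pert (\<epsilon> / 4) (A n - LT_op (nn n) m v f)) F"
    "\<forall>j. max 1 M \<le> m j" by auto
  have m: "\<forall>j. 1 \<le> m j" "\<forall>j. M \<le> m j" using m0(2) by auto
  have ev1: "eventually (\<lambda>n. small_pert (\<epsilon> / 4) (A n - LT_op (nn n) m v f)) F"
    using m0(1) m(1) by (auto elim: eventually_mono)
  obtain E1 where E1: "E1 \<in> sets borel" "emeasure lebesgue E1 \<le> ennreal \<epsilon>1"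
    "\<And>a x. a \<in> mi_range m \<Longrightarrow> x \<in> cell m a \<Longrightarrow> x \<notin> E1 \<Longrightarrow> cmod (v x - v (pt m a)) \<le> \<epsilon>1"
    using M[of m] m by blast
  define C where "C = (\<Sum>a\<in>mi_range m. cmod (v (pt m a)))"
  have C: "0 \<le> C" "\<And>a. a \<in> mi_range m \<Longrightarrow> cmod (v (pt m a)) \<le> C"
    unfolding C_def by (auto intro: sum_nonneg member_le_sum)
  \<comment> \<open>Off the exceptional sets the symbols differ by at most
    \<open>\<epsilon>1 * K + C * t\<close>, and each term is at most
    \<open>\<epsilon> / 2\<close>.\<close>
  define t where "t = \<epsilon> / (2 * (C + 1))"
  have t: "0 < t" "C * t \<le> \<epsilon> / 2"
  proof -
    show "0 < t" unfolding t_def using e C by simp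
    have "C * t \<le> (C + 1) * t" using \<open>0 < t\<close> by (intro mult_right_mono) auto
    also have "\<dots> = \<epsilon> / 2" unfolding t_def using C(1) by (simp add: field_simps)
    finally show "C * t \<le> \<epsilon> / 2" .
  qed
  \<comment> \<open>Solves \<open>(1 + C) * (8 * e') = \<epsilon> / 4\<close>, the bound of
    \<open>LT_L1_small\<close>.\<close>
  define e' where "e' = \<epsilon> / (32 * (1 + C))"
  have e': "0 < e'" "(1 + C) * (8 * e') = \<epsilon> / 4"
  proof -
    show "0 < e'" unfolding e'_def using e C by simp
    show "(1 + C) * (8 * e') = \<epsilon> / 4" unfolding e'_def using C(1) by (simp add: field_simps)
  qed
  \<comment> \<open>One L1 bound on \<open>f - p\<close> serves twice: for the matrices through
    \<open>LT_L1_small\<close>, for the symbols through Markov's inequality.\<close>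
  have "0 < min (e'\<^sup>2 * ?P) (t * (\<epsilon> / 4))" using e' t e by simp
  then obtain p where p: "l1d f (teval p) < min (e'\<^sup>2 * ?P) (t * (\<epsilon> / 4))"
    using trig_dense_L1[OF f] unfolding l1_approx_def by meson
  have p1: "l1d f (teval p) \<le> e'\<^sup>2 * ?P"
    and p2: "l1d f (teval p) \<le> t * (\<epsilon> / 4)" using p by auto
  have fp: "integrable (lebesgue_on ?A) (\<lambda>\<theta>. f \<theta> - teval p \<theta>)" using f integrable_teval by (rule Bochner_Integration.integrable_diff)
  define B2 where "B2 = {\<theta> \<in> ?A. t \<le> cmod (f \<theta> - teval p \<theta>)}"
  have B2: "B2 \<in> sets lebesgue" "emeasure lebesgue B2 \<le> ennreal (\<epsilon> / 4)"
  proof -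
    have s: "{\<theta> \<in> space (lebesgue_on ?A). t \<le> cmod (f \<theta> - teval p \<theta>)} \<in> sets (lebesgue_on ?A)"
      using fp by measurable
    then show "B2 \<in> sets lebesgue" by (auto simp: B2_def sets_restrict_space_iff)
    have "emeasure (lebesgue_on ?A) {\<theta> \<in> space (lebesgue_on ?A). t \<le> cmod (f \<theta> - teval p \<theta>)}
       \<le> ennreal ((1 / t) * l1d f (teval p))"
      using fp t(1) by (intro integral_Markov_inequality) auto
    also have "\<dots> \<le> ennreal (\<epsilon> / 4)" using p2 t(1) by (intro ennreal_leI) (simp add: field_simps)
    finally show "emeasure lebesgue B2 \<le> ennreal (\<epsilon> / 4)"
      by (simp add: B2_def emeasure_restrict_space)
  qed
  define e3 where "e3 = (\<epsilon> / 4) ^ 3"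
  have e3: "0 < e3" unfolding e3_def using e by simp
  obtain \<eta>0 where \<eta>0: "\<eta>0 > 0" "\<And>\<eta>. 0 < \<eta> \<and> \<eta> < \<eta>0 \<Longrightarrow>
    eventually (\<lambda>n. frob2 (LT_op (nn n) m v (teval p) - nmat (nn n) (tnice \<eta> m v p)) \<le> e3 * real (N n)) F"
    using LT_tnice[OF m(1) e3] by blast
  \<comment> \<open>Keeps the cylinder over \<open>E2\<close> below measure
    \<open>\<epsilon> / 4\<close>.\<close>
  define D where "D = 8 * real CARD('d) * ?P"
  have D: "0 < D" unfolding D_def using P by simp
  define \<eta> where "\<eta> = min (\<eta>0 / 2) (min (1 / 3) (\<epsilon> / D))"
  have \<eta>: "0 < \<eta>" "\<eta> < \<eta>0" "\<eta> < 1 / 2" "\<eta> \<le> \<epsilon> / D"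
  proof -
    show "0 < \<eta>" using \<eta>0(1) e D unfolding \<eta>_def by simp
    show "\<eta> \<le> \<epsilon> / D" unfolding \<eta>_def by simp
    have "\<eta> \<le> \<eta>0 / 2" unfolding \<eta>_def by (rule min.cobounded1)
    moreover have "\<eta> \<le> 1 / 3" unfolding \<eta>_def by (rule order_trans[OF min.cobounded2 min.cobounded1])
    ultimately show "\<eta> < 1 / 2" "\<eta> < \<eta>0" using \<eta>0(1) by simp_all
  qed
  have \<eta>P: "2 * real CARD('d) * \<eta> * ?P \<le> \<epsilon> / 4"
  proof -
    have "\<eta> * D \<le> \<epsilon>" using \<eta>(4) D by (simp add: pos_le_divide_eq)
    then show ?thesis unfolding D_def by (simp add: algebra_simps)
  qed
  obtain E2 where E2: "E2 \<in> sets borel" "emeasure lebesgue E2 \<le> ennreal (2 * real CARD('d) * \<eta>)"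
    "\<And>x. x \<in> unit_cube - E2 \<Longrightarrow> \<exists>a\<in>mi_range m. x \<in> cell m a \<and> wtrap \<eta> m v x = v (pt m a)"
    using wtrap_close[OF m(1) \<eta>(1,3), of v] by blast
  let ?c = "tnice \<eta> m v p"
  show "\<exists>c. nvalid c \<and> closeM \<epsilon> (nsym c) (\<lambda>z. v (fst z) * f (snd z)) \<and> eventually (\<lambda>n. small_pert \<epsilon> (A n - nmat (nn n) c)) F"
  proof (intro exI[of _ ?c] conjI)
    show "nvalid ?c" by (rule nvalid_tnice[OF \<eta>(1)])
    have lE: "E1 \<in> sets lebesgue" "E2 \<in> sets lebesgue" using E1(1) E2(1) by auto
    have nE2: "0 \<le> 2 * real CARD('d) * \<eta>" using \<eta> by simp
    note E = closeM_sets[OF lE(1) E1(2) lE(2) E2(2) less_imp_le[OF e1(1)] nE2]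
    note B = closeM_sets[OF K(2,3) B2 less_imp_le[OF e4] less_imp_le[OF e4]]
    show "closeM \<epsilon> (nsym ?c) (\<lambda>z. v (fst z) * f (snd z))"
    proof (rule closeM_prod[OF E B])
      show "0 \<le> \<epsilon>1 + 2 * real CARD('d) * \<eta>" "0 \<le> \<epsilon> / 4 + \<epsilon> / 4" using e1(1) nE2 e by auto
      show "(\<epsilon>1 + 2 * real CARD('d) * \<eta>) * ?P + (\<epsilon> / 4 + \<epsilon> / 4) \<le> \<epsilon>"
        using e1P \<eta>P by (simp add: distrib_right)
      fix x \<theta> assume x: "x \<in> unit_cube" "x \<notin> E1 \<union> E2" and th: "\<theta> \<in> ?A" "\<theta> \<notin> B1 \<union> B2"
      obtain a where a: "a \<in> mi_range m" "x \<in> cell m a" "wtrap \<eta> m v x = v (pt m a)" using E2(3)[of x] x by auto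
      have 1: "cmod (v x - v (pt m a)) \<le> \<epsilon>1" using E1(3)[OF a(1,2)] x by auto
      have 2: "cmod (f \<theta>) \<le> K" using K(4)[of \<theta>] th by auto
      have 3: "cmod (f \<theta> - teval p \<theta>) \<le> t" using th by (auto simp: B2_def)
      have "nsym ?c (x, \<theta>) - v x * f \<theta> = - ((v x - v (pt m a)) * f \<theta> + v (pt m a) * (f \<theta> - teval p \<theta>))"
        unfolding nsym_tnice using a(3) by (simp add: algebra_simps)
      then have "cmod (nsym ?c (x, \<theta>) - v x * f \<theta>) \<le> cmod (v x - v (pt m a)) * cmod (f \<theta>) + cmod (v (pt m a)) * cmod (f \<theta> - teval p \<theta>)"
        by (simp only: norm_minus_cancel) (metis norm_triangle_ineq norm_mult)
      also have "\<dots> \<le> \<epsilon>1 * K + C * t" using 1 2 3 C(2)[OF a(1)] e1(1) C(1)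
        by (intro add_mono mult_mono) auto
      also have "\<dots> \<le> \<epsilon>" using e1K t(2) by simp
      finally show "cmod (nsym ?c (x, \<theta>) - v (fst (x, \<theta>)) * f (snd (x, \<theta>))) \<le> \<epsilon>" by simp
    qed
    have "eventually (\<lambda>n. frob2 (LT_op (nn n) m v (teval p) - nmat (nn n) ?c) \<le> e3 * real (N n)) F"
      using \<eta> by (intro \<eta>0(2)) auto
    with ev1 ev_I show "eventually (\<lambda>n. small_pert \<epsilon> (A n - nmat (nn n) ?c)) F"
    proof eventually_elim
      case (elim n)
      have c: "LT_op (nn n) m v f \<in> carrier_mat (N n) (N n)" "LT_op (nn n) m v (teval p) \<in> carrier_mat (N n) (N n)" "nmat (nn n) ?c \<in> carrier_mat (N n) (N n)"
        by auto
      have "LT_op (nn n) m v f = LT_op (nn n) m v (\<lambda>\<theta>. (f \<theta> - teval p \<theta>) + teval p \<theta>)" by simp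
      also have "\<dots> = LT_op (nn n) m v (\<lambda>\<theta>. f \<theta> - teval p \<theta>) + LT_op (nn n) m v (teval p)"
        by (rule LT_op_add[OF fp integrable_teval])
      finally have eq: "LT_op (nn n) m v f - LT_op (nn n) m v (teval p) = LT_op (nn n) m v (\<lambda>\<theta>. f \<theta> - teval p \<theta>)"
        by (simp only:) (intro eq_matI, auto)
      have "small_pert (\<epsilon> / 4) (LT_op (nn n) m v (\<lambda>\<theta>. f \<theta> - teval p \<theta>))"
        unfolding e'(2)[symmetric] by (rule LT_L1_small[OF fp e'(1) p1 C(1)]) (rule C(2))
      then have s2: "small_pert (\<epsilon> / 4) (LT_op (nn n) m v f - LT_op (nn n) m v (teval p))" unfolding eq .
      have s3: "small_pert (\<epsilon> / 4) (LT_op (nn n) m v (teval p) - nmat (nn n) ?c)"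
        using elim(3) e4 unfolding e3_def by (intro frob2_small_pert[of _ "N n"]) auto
      have "small_pert (\<epsilon> / 4 + (\<epsilon> / 4 + \<epsilon> / 4)) (A n - nmat (nn n) ?c)"
        by (rule small_pert_trans[OF elim(1) small_pert_trans[OF s2 s3 c] A[OF elim(2)] c(1,3)])
      then show ?case by (rule small_pert_mono[where d = "N n"]) (use e A[OF elim(2)] c in auto)
    qed
  qed
qed

end

section \<open>The algebra of GLT sequences\<close>

context mlseq
begin

lemma glt_add:
  assumes A: "glt A \<kappa>" and B: "glt B \<mu>"
  shows "glt (\<lambda>n. A n + B n) (\<lambda>z. \<kappa> z + \<mu> z)"
proof (rule gltI)
  show "A n + B n \<in> carrier_mat (N n) (N n)" if "n \<in> I" for n using gltD(1)[OF A that] gltD(1)[OF B that] by simp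
  show "(\<lambda>z. \<kappa> z + \<mu> z) \<in> borel_measurable symM"
    using gltD(2)[OF A] gltD(2)[OF B] by (rule borel_measurable_add)
  fix \<epsilon> :: real assume e: "0 < \<epsilon>"
  then have e2: "0 < \<epsilon> / 2" by simp
  obtain a where a: "nvalid a" "closeM (\<epsilon> / 2) (nsym a) \<kappa>" "eventually (\<lambda>n. small_pert (\<epsilon> / 2) (A n - nmat (nn n) a)) F"
    by (rule gltE[OF A e2])
  obtain b where b: "nvalid b" "closeM (\<epsilon> / 2) (nsym b) \<mu>" "eventually (\<lambda>n. small_pert (\<epsilon> / 2) (B n - nmat (nn n) b)) F"
    by (rule gltE[OF B e2])
  show "\<exists>c. nvalid c \<and> closeM \<epsilon> (nsym c) (\<lambda>z. \<kappa> z + \<mu> z) \<and> eventually (\<lambda>n. small_pert \<epsilon> (A n + B n - nmat (nn n) c)) F"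
  proof (intro exI[of _ "a @ b"] conjI)
    show "nvalid (a @ b)" using a b by (simp add: nvalid_append)
    show "closeM \<epsilon> (nsym (a @ b)) (\<lambda>z. \<kappa> z + \<mu> z)"
      using closeM_add[OF a(2) b(2)] e by (simp add: nsym_append[abs_def])
    from a(3) b(3) ev_I show "eventually (\<lambda>n. small_pert \<epsilon> (A n + B n - nmat (nn n) (a @ b))) F"
    proof eventually_elim
      case (elim n)
      note c = gltD(1)[OF A elim(3)] gltD(1)[OF B elim(3)] nmat_carrier(1)[of "nn n" a] nmat_carrier(1)[of "nn n" b]
      have "A n + B n - nmat (nn n) (a @ b) = (A n - nmat (nn n) a) + (B n - nmat (nn n) b)"
        unfolding nmat_append using c by (intro eq_matI) auto
      then show ?case using small_pert_add[OF elim(1,2) minus_carrier_mat[OF c(3)] minus_carrier_mat[OF c(4)]] by simp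
    qed
  qed
qed

text \<open>Closedness of the class: half of \<open>\<epsilon>\<close> goes to \<open>B\<close>,
  half to an approximant of \<open>B\<close>. Both \<open>GLT_imp_glt\<close> and the Neumann series
  end here.\<close>

lemma glt_lim:
  assumes A: "\<And>n. n \<in> I \<Longrightarrow> A n \<in> carrier_mat (N n) (N n)" "\<kappa> \<in> borel_measurable symM"
    and lim: "\<And>\<epsilon>. 0 < \<epsilon> \<Longrightarrow> \<exists>B \<mu>. glt B \<mu> \<and> closeM \<epsilon> \<mu> \<kappa> \<and> eventually (\<lambda>n. small_pert \<epsilon> (A n - B n)) F"
  shows "glt A \<kappa>"
proof (rule gltI[OF A])
  fix \<epsilon> :: real assume e: "0 < \<epsilon>"
  then have e2: "0 < \<epsilon> / 2" by simp
  obtain B \<mu> where B: "glt B \<mu>" "closeM (\<epsilon> / 2) \<mu> \<kappa>" "eventually (\<lambda>n. small_pert (\<epsilon> / 2) (A n - B n)) F"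
    using lim[OF e2] by blast
  obtain b where b: "nvalid b" "closeM (\<epsilon> / 2) (nsym b) \<mu>" "eventually (\<lambda>n. small_pert (\<epsilon> / 2) (B n - nmat (nn n) b)) F"
    by (rule gltE[OF B(1) e2])
  have "closeM (\<epsilon> / 2 + \<epsilon> / 2) (nsym b) \<kappa>" using closeM_trans[OF b(2) B(2)] e by simp
  moreover from B(3) b(3) ev_I have "eventually (\<lambda>n. small_pert \<epsilon> (A n - nmat (nn n) b)) F"
  proof eventually_elim
    case (elim n)
    show ?case using small_pert_trans[OF elim(1,2) A(1)[OF elim(3)] gltD(1)[OF B(1) elim(3)] nmat_carrier(1)] by simp
  qed
  ultimately show "\<exists>c. nvalid c \<and> closeM \<epsilon> (nsym c) \<kappa> \<and> eventually (\<lambda>n. small_pert \<epsilon> (A n - nmat (nn n) c)) F"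
    using b(1) by auto
qed

lemma closeM_refl: "0 \<le> \<epsilon> \<Longrightarrow> (\<And>z. z \<in> symbol_domain \<Longrightarrow> g z = h z) \<Longrightarrow> closeM \<epsilon> g h"
  unfolding closeM_def by (intro bexI[of _ "{}"]) auto

lemma glt_cong:
  assumes A: "glt A \<kappa>" and AB: "\<And>n. n \<in> I \<Longrightarrow> A n = B n" and \<kappa>: "\<And>z. z \<in> symbol_domain \<Longrightarrow> \<kappa> z = \<mu> z"
  shows "glt B \<mu>"
proof (rule glt_lim)
  show "B n \<in> carrier_mat (N n) (N n)" if "n \<in> I" for n using gltD(1)[OF A that] AB[OF that] by simp
  show "\<mu> \<in> borel_measurable symM"
    using gltD(2)[OF A] measurable_cong[of "symM" \<kappa> \<mu> borel] \<kappa> by auto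
  fix \<epsilon> :: real assume e: "0 < \<epsilon>"
  from ev_I have "eventually (\<lambda>n. small_pert \<epsilon> (B n - A n)) F"
  proof eventually_elim
    case (elim n)
    have "B n - A n = 0\<^sub>m (N n) (N n)" using gltD(1)[OF A elim] AB[OF elim] by simp
    then show ?case using e small_pert_zero[of \<epsilon> "N n"] by simp
  qed
  then show "\<exists>B' \<mu>'. glt B' \<mu>' \<and> closeM \<epsilon> \<mu>' \<mu> \<and> eventually (\<lambda>n. small_pert \<epsilon> (B n - B' n)) F"
    using A \<kappa> e closeM_refl[of \<epsilon> \<kappa> \<mu>] by auto
qed

lemma glt_nmat:
  assumes c: "nvalid c" shows "glt (\<lambda>n. nmat (nn n) c) (nsym c)"
proof (rule gltI[OF _ nsym_measurable[OF c]])
  fix \<epsilon> :: real assume e: "0 < \<epsilon>"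
  have "nmat (nn n) c - nmat (nn n) c = 0\<^sub>m (N n) (N n)" for n by auto
  then show "\<exists>b. nvalid b \<and> closeM \<epsilon> (nsym b) (nsym c) \<and> eventually (\<lambda>n. small_pert \<epsilon> (nmat (nn n) c - nmat (nn n) b)) F"
    using c e small_pert_zero[of \<epsilon>] by (intro exI[of _ c]) (simp only:, simp add: closeM_refl)
qed auto

lemma glt_const: "glt (\<lambda>n. c \<cdot>\<^sub>m 1\<^sub>m (N n)) (\<lambda>_. c)"
proof -
  let ?c = "[(\<lambda>_. c, \<lambda>_. 0)] :: 'd nice"
  have "nmat (nn n) ?c = c \<cdot>\<^sub>m 1\<^sub>m (N n)" for n
  proof -
    have "c \<cdot>\<^sub>m 1\<^sub>m (N n) = mi_mat (nn n) (\<lambda>i j. if mi_diff i j = (\<lambda>_. 0) then c else 0)"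
      unfolding mi_mat_one[symmetric] mi_mat_smult by (rule mi_mat_cong) (auto simp: mi_diff_def fun_eq_iff)
    then show ?thesis by (simp add: single_def)
  qed
  then show ?thesis using glt_nmat[of ?c] by (auto intro: glt_cong simp: fexp_zero)
qed

text \<open>For approximants a, b the error is A B - a b = A (B - b) + (A - a) b, with
  \<open>A\<close> and b as the bounded factors; the symbols are split in the same way, with
  \<open>closeM_mult\<close> for \<open>\<kappa>\<close> and for the symbol of b. So b is chosen
  first, and the accuracy of a depends on it.\<close>

lemma glt_mult:
  assumes A: "glt A \<kappa>" and B: "glt B \<mu>" and K: "\<And>n. n \<in> I \<Longrightarrow> nb (A n) K" "0 \<le> K"
  shows "glt (\<lambda>n. A n * B n) (\<lambda>z. \<kappa> z * \<mu> z)"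
proof (rule gltI)
  show "A n * B n \<in> carrier_mat (N n) (N n)" if "n \<in> I" for n using gltD(1)[OF A that] gltD(1)[OF B that] by simp
  show "(\<lambda>z. \<kappa> z * \<mu> z) \<in> borel_measurable symM"
    using gltD(2)[OF A] gltD(2)[OF B] by (rule borel_measurable_times)
  fix \<epsilon> :: real assume e: "0 < \<epsilon>"
  then have e2: "0 < \<epsilon> / 2" "0 < \<epsilon> / 4" by simp_all
  obtain \<delta> where \<delta>: "0 < \<delta>" "\<And>g h. closeM \<delta> g h \<Longrightarrow> closeM (\<epsilon> / 2) (\<lambda>z. \<kappa> z * g z) (\<lambda>z. \<kappa> z * h z)"
    using closeM_mult[OF gltD(2)[OF A] e2(1)] by metis
  obtain \<beta> where \<beta>: "0 < \<beta>" "\<beta> \<le> \<delta>" "\<beta> \<le> \<epsilon> / (4 * (1 + K))"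
    using ex_pos_le[of \<delta> "\<epsilon> / (4 * (1 + K))"] \<delta>(1) e K(2) by auto
  have b0: "0 < \<beta>" "\<beta> \<le> \<delta>" "(1 + K) * \<beta> \<le> \<epsilon> / 4" using \<beta> K(2) by (auto simp: field_simps)
  obtain b where b: "nvalid b" "closeM \<beta> (nsym b) \<mu>" "eventually (\<lambda>n. small_pert \<beta> (B n - nmat (nn n) b)) F"
    by (rule gltE[OF B b0(1)])
  obtain L where L: "0 \<le> L" "\<And>n :: 'd \<Rightarrow> nat. nb (nmat n b) L" using nmat_nb[OF b(1)] by blast
  obtain \<delta>' where \<delta>': "0 < \<delta>'" "\<And>g h. closeM \<delta>' g h \<Longrightarrow> closeM (\<epsilon> / 2) (\<lambda>z. nsym b z * g z) (\<lambda>z. nsym b z * h z)"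
    using closeM_mult[OF nsym_measurable[OF b(1)] e2(1)] by metis
  obtain \<alpha> where \<alpha>: "0 < \<alpha>" "\<alpha> \<le> \<delta>'" "\<alpha> \<le> \<epsilon> / (4 * (1 + L))"
    using ex_pos_le[of \<delta>' "\<epsilon> / (4 * (1 + L))"] \<delta>'(1) e L(1) by auto
  have a0: "0 < \<alpha>" "\<alpha> \<le> \<delta>'" "(1 + L) * \<alpha> \<le> \<epsilon> / 4" using \<alpha> L(1) by (auto simp: field_simps)
  obtain a where a: "nvalid a" "closeM \<alpha> (nsym a) \<kappa>" "eventually (\<lambda>n. small_pert \<alpha> (A n - nmat (nn n) a)) F"
    by (rule gltE[OF A a0(1)])
  have "closeM (\<epsilon> / 2) (\<lambda>z. nsym b z * nsym a z) (\<lambda>z. nsym b z * \<kappa> z)" by (rule \<delta>'(2)[OF closeM_mono[OF a(2) a0(2)]])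
  then have c1: "closeM (\<epsilon> / 2) (nsym (nmul a b)) (\<lambda>z. \<kappa> z * nsym b z)" by (simp add: nsym_nmul[abs_def] mult.commute)
  have c2: "closeM (\<epsilon> / 2) (\<lambda>z. \<kappa> z * nsym b z) (\<lambda>z. \<kappa> z * \<mu> z)" by (rule \<delta>(2)[OF closeM_mono[OF b(2) b0(2)]])
  have cl: "closeM \<epsilon> (nsym (nmul a b)) (\<lambda>z. \<kappa> z * \<mu> z)" using closeM_trans[OF c1 c2] e by simp
  have "eventually (\<lambda>n. small_pert \<epsilon> (A n * B n - nmat (nn n) (nmul a b))) F"
    using a(3) b(3) negl_small_pert[OF nmul_negl[OF a(1) b(1)] e2(2)] ev_I
  proof eventually_elim
    case (elim n)
    let ?a = "nmat (nn n) a" and ?b = "nmat (nn n) b" and ?c = "nmat (nn n) (nmul a b)"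
    note c = gltD(1)[OF A elim(4)] gltD(1)[OF B elim(4)] nmat_carrier(1)[of "nn n" a] nmat_carrier(1)[of "nn n" b] nmat_carrier(1)[of "nn n" "nmul a b"]
    have s1: "small_pert ((1 + K) * \<beta>) (A n * (B n - ?b))"
      using elim(2) c K elim(4) b0(1) by (intro small_pert_mult_left[of _ _ "N n"]) auto
    have s2: "small_pert ((1 + L) * \<alpha>) ((A n - ?a) * ?b)"
      using elim(1) c L a0(1) by (intro small_pert_mult_right[of _ _ "N n"]) auto
    have e1: "A n * B n - A n * ?b = A n * (B n - ?b)" using c by (simp add: mult_minus_distrib_mat[of _ "N n" "N n"])
    have e2: "A n * ?b - ?a * ?b = (A n - ?a) * ?b" by (rule minus_mult_distrib_mat[OF c(1) c(3) c(4), symmetric])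
    have "small_pert (((1 + K) * \<beta> + (1 + L) * \<alpha>) + \<epsilon> / 4) (A n * B n - ?c)"
      using c by (intro small_pert_trans[OF small_pert_trans[OF s1[folded e1] s2[folded e2]] elim(3)]) auto
    then show ?case by (rule small_pert_mono[where d = "N n"]) (use b0(3) a0(3) e c in auto)
  qed
  then show "\<exists>c. nvalid c \<and> closeM \<epsilon> (nsym c) (\<lambda>z. \<kappa> z * \<mu> z) \<and> eventually (\<lambda>n. small_pert \<epsilon> (A n * B n - nmat (nn n) c)) F"
    using cl nvalid_nmul[OF a(1) b(1)] by blast
qed

lemma glt_smult:
  assumes A: "glt A \<kappa>"
  shows "glt (\<lambda>n. c \<cdot>\<^sub>m A n) (\<lambda>z. c * \<kappa> z)"
proof (rule glt_cong[OF glt_mult[OF glt_const[of c] A, of "cmod c"]])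
  show "nb (c \<cdot>\<^sub>m 1\<^sub>m (N n)) (cmod c)" for n using nb_smult[OF one_carrier_mat nb_one, of c "N n"] by simp
  show "c \<cdot>\<^sub>m 1\<^sub>m (N n) * A n = c \<cdot>\<^sub>m A n" if "n \<in> I" for n
    using gltD(1)[OF A that] by (simp add: mult_smult_assoc_mat[of _ "N n" "N n"])
qed auto

lemma glt_adj:
  assumes A: "glt A \<kappa>"
  shows "glt (\<lambda>n. mat_adjoint (A n)) (\<lambda>z. cnj (\<kappa> z))"
proof (rule gltI)
  show "mat_adjoint (A n) \<in> carrier_mat (N n) (N n)" if "n \<in> I" for n using gltD(1)[OF A that] by auto
  show "(\<lambda>z. cnj (\<kappa> z)) \<in> borel_measurable symM"
    using gltD(2)[OF A] by (rule measurable_compose) (intro borel_measurable_continuous_onI continuous_intros)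
  fix \<epsilon> :: real assume e: "0 < \<epsilon>"
  then have e2: "0 < \<epsilon> / 2" by simp
  obtain a where a: "nvalid a" "closeM (\<epsilon> / 2) (nsym a) \<kappa>" "eventually (\<lambda>n. small_pert (\<epsilon> / 2) (A n - nmat (nn n) a)) F"
    by (rule gltE[OF A e2])
  have "closeM (\<epsilon> / 2) (nsym (nadj a)) (\<lambda>z. cnj (\<kappa> z))"
    using a(2) by (rule closeM_imp) (simp add: nsym_nadj complex_cnj_diff[symmetric] del: complex_cnj_diff)
  then have cl: "closeM \<epsilon> (nsym (nadj a)) (\<lambda>z. cnj (\<kappa> z))" using e by (auto elim: closeM_mono)
  have "eventually (\<lambda>n. small_pert \<epsilon> (mat_adjoint (A n) - nmat (nn n) (nadj a))) F"
    using a(3) negl_small_pert[OF nadj_negl[OF a(1)] e2] ev_I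
  proof eventually_elim
    case (elim n)
    note c = gltD(1)[OF A elim(3)] nmat_carrier(1)[of "nn n" a]
    have "mat_adjoint (A n - nmat (nn n) a) = mat_adjoint (A n) - mat_adjoint (nmat (nn n) a)" by (rule adj_minus[OF c])
    moreover have "small_pert (\<epsilon> / 2) (mat_adjoint (A n - nmat (nn n) a))"
      using elim(1) c e by (intro small_pert_adj[of _ _ "N n"]) auto
    ultimately have s: "small_pert (\<epsilon> / 2) (mat_adjoint (A n) - mat_adjoint (nmat (nn n) a))" by simp
    show ?case using small_pert_trans[OF s elim(2), of "N n"] c by auto
  qed
  then show "\<exists>c. nvalid c \<and> closeM \<epsilon> (nsym c) (\<lambda>z. cnj (\<kappa> z)) \<and> eventually (\<lambda>n. small_pert \<epsilon> (mat_adjoint (A n) - nmat (nn n) c)) F"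
    using cl nvalid_nadj[OF a(1)] by blast
qed

lemma glt_sum:
  fixes L :: "nat \<Rightarrow> nat \<Rightarrow> complex Matrix.mat"
  assumes "\<And>i. i \<in> {1..M} \<Longrightarrow> glt (L i) (\<mu> i)"
  shows "glt (\<lambda>n. Matrix.mat (N n) (N n) (\<lambda>(k, l). \<Sum>i\<in>{1..M}. L i n $$ (k, l))) (\<lambda>z. \<Sum>i\<in>{1..M}. \<mu> i z)"
  using assms
proof (induction M)
  case 0
  show ?case by (rule glt_cong[OF glt_const[of 0]]) auto
next
  case (Suc M)
  have "glt (L (Suc M)) (\<mu> (Suc M))" using Suc.prems by simp
  note S = glt_add[OF Suc.IH this]
  show ?case
  proof (rule glt_cong[OF S])
    fix n assume n: "n \<in> I"
    have "L (Suc M) n \<in> carrier_mat (N n) (N n)" using Suc.prems[of "Suc M"] gltD(1)[OF _ n] by auto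
    then show "Matrix.mat (N n) (N n) (\<lambda>(k, l). \<Sum>i = 1..M. L i n $$ (k, l)) + L (Suc M) n =
         Matrix.mat (N n) (N n) (\<lambda>(k, l). \<Sum>i = 1..Suc M. L i n $$ (k, l))" by (intro eq_matI) auto
  qed (use Suc.prems in auto)
qed

text \<open>LT sequences belong to the class by \<open>LT_glt\<close>, finite sums by
  \<open>glt_sum\<close>, and the a.c.s. limit by \<open>glt_lim\<close>, evaluated at one
  sufficiently small parameter.\<close>

lemma GLT_imp_glt:
  assumes G: "GLT_seq I nn A \<kappa>" shows "glt A \<kappa>"
  using G unfolding GLT_seq_def
proof (elim exE conjE)
  fix M :: "real \<Rightarrow> nat" and L :: "real \<Rightarrow> nat \<Rightarrow> nat \<Rightarrow> complex Matrix.mat"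
    and v f :: "real \<Rightarrow> nat \<Rightarrow> real ^ 'd::{finite,linorder} \<Rightarrow> complex"
  assume LT0: "\<forall>\<epsilon>>0. \<forall>i\<in>{1..M \<epsilon>}. LT_seq I nn (L \<epsilon> i) (v \<epsilon> i) (f \<epsilon> i)"
    and cm: "converges_in_measure_on symbol_domain (\<lambda>\<epsilon> (x, \<theta>). \<Sum>i\<in>{1..M \<epsilon>}. v \<epsilon> i x * f \<epsilon> i \<theta>) \<kappa> (at_right (0 :: real))"
    and acs: "acs I {0<..} (at_right (0 :: real)) (\<lambda>\<epsilon> n. Matrix.mat (N n) (N n) (\<lambda>(k, l). \<Sum>i\<in>{1..M \<epsilon>}. L \<epsilon> i n $$ (k, l))) A"
  have LT: "LT_seq I nn (L \<epsilon> i) (v \<epsilon> i) (f \<epsilon> i)" if "0 < \<epsilon>" "i \<in> {1..M \<epsilon>}" for \<epsilon> i using LT0 that by blast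
  have A: "\<And>n. n \<in> I \<Longrightarrow> A n \<in> carrier_mat (N n) (N n)" and \<kappa>: "\<kappa> \<in> borel_measurable symM"
    using G by (auto simp: GLT_seq_def multilevel_seq_def)
  let ?B = "\<lambda>\<epsilon> n. Matrix.mat (N n) (N n) (\<lambda>(k, l). \<Sum>i\<in>{1..M \<epsilon>}. L \<epsilon> i n $$ (k, l))"
  let ?g = "\<lambda>\<epsilon> z. \<Sum>i\<in>{1..M \<epsilon>}. v \<epsilon> i (fst z) * f \<epsilon> i (snd z)"
  have gB: "glt (?B \<epsilon>) (?g \<epsilon>)" if "0 < \<epsilon>" for \<epsilon> using that by (intro glt_sum LT_glt LT)
  show ?thesis
  proof (rule glt_lim[OF A \<kappa>])
    fix e :: real assume e: "0 < e"
    have "((\<lambda>p. emeasure lebesgue {z \<in> symbol_domain. e < norm (?g p z - \<kappa> z)}) \<longlongrightarrow> 0) (at_right 0)"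
      using cm e unfolding converges_in_measure_on_def by (auto simp: split_beta)
    then have "eventually (\<lambda>p. emeasure lebesgue {z \<in> symbol_domain. e < norm (?g p z - \<kappa> z)} < ennreal e) (at_right 0)"
      using e by (intro order_tendstoD) auto
    moreover have "eventually (\<lambda>p. p \<in> {0<..} \<longrightarrow> eventually (\<lambda>n. ?B p n \<in> carrier_mat (N n) (N n) \<and> small_pert e (A n - ?B p n)) F) (at_right 0)"
      by (rule acs_small_pert[OF acs _ e]) (rule A)
    moreover note eventually_at_right_less[of "0 :: real"]
    ultimately have "eventually (\<lambda>p. glt (?B p) (?g p) \<and> closeM e (?g p) \<kappa> \<and> eventually (\<lambda>n. small_pert e (A n - ?B p n)) F) (at_right 0)"
    proof eventually_elim
      case (elim p)
      have g: "glt (?B p) (?g p)" by (rule gB) (use elim in auto)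
      have "{z \<in> space symM. e < norm (?g p z - \<kappa> z)} \<in> sets symM"
        using gltD(2)[OF g] \<kappa> by measurable
      then have "{z \<in> symbol_domain. e < norm (?g p z - \<kappa> z)} \<in> sets lebesgue" by (auto simp: sets_restrict_space_iff)
      then have "closeM e (?g p) \<kappa>" unfolding closeM_def using elim(1)
        by (intro bexI[of _ "{z \<in> symbol_domain. e < norm (?g p z - \<kappa> z)}"]) auto
      then show ?case using g elim(2,3) by (auto elim: eventually_mono)
    qed
    from eventually_happens'[OF trivial_limit_at_right_real this]
    show "\<exists>B \<mu>. glt B \<mu> \<and> closeM e \<mu> \<kappa> \<and> eventually (\<lambda>n. small_pert e (A n - B n)) F" by blast
  qed
qed

end

section \<open>From the working notion back to the definition of GLT sequences\<close>

lemma nsym_sum: "nsym c z = (\<Sum>i\<in>{1..length c}. fst (c ! (i - 1)) (fst z) * fexp (snd (c ! (i - 1))) (snd z))"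
proof -
  have "nsym c z = (\<Sum>i<length c. fst (c ! i) (fst z) * fexp (snd (c ! i)) (snd z))"
  proof (induction c)
    case (Cons a c)
    then show ?case by (cases a) (simp add: sum.lessThan_Suc_shift del: sum.lessThan_Suc)
  qed simp
  then show ?thesis by (simp add: sum.atLeast1_atMost_eq)
qed

lemma nmat_sum:
  "nmat n c = Matrix.mat (mi_size n) (mi_size n)
     (\<lambda>(k, l). \<Sum>i\<in>{1..length c}. single n (snd (c ! (i - 1))) (\<lambda>j. fst (c ! (i - 1)) (pt n j)) $$ (k, l))"
proof -
  have "nmat n c = Matrix.mat (mi_size n) (mi_size n)
     (\<lambda>(k, l). \<Sum>i<length c. single n (snd (c ! i)) (\<lambda>j. fst (c ! i) (pt n j)) $$ (k, l))"
  proof (induction c)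
    case Nil
    then show ?case by (intro eq_matI) auto
  next
    case (Cons a c)
    obtain v k where a: "a = (v, k)" by (cases a)
    have i: "single n k (\<lambda>j. v (pt n j)) \<in> carrier_mat (mi_size n) (mi_size n)" by simp
    show ?case unfolding a nmat.simps Cons using i by (intro eq_matI) (auto simp: sum.lessThan_Suc_shift simp del: sum.lessThan_Suc)
  qed
  then show ?thesis by (simp add: sum.atLeast1_atMost_eq)
qed

lemma nvalid_nth: "nvalid c \<Longrightarrow> i < length c \<Longrightarrow> continuous_on unit_cube (fst (c ! i))"
proof (induction c arbitrary: i)
  case (Cons a c)
  then show ?case by (cases a; cases i) auto
qed simp

context mlseq
begin

lemma multilevel_seqI: "(\<And>n. n \<in> I \<Longrightarrow> A n \<in> carrier_mat (N n) (N n)) \<Longrightarrow> multilevel_seq I nn A"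
  using inf pos lim by (auto simp: multilevel_seq_def)

text \<open>The smallest admissible \<open>c(m) = \<omega>(m)\<close> need not be attained; the term \<open>t m\<close> makes room.\<close>

lemma acsI:
  fixes t :: "'p \<Rightarrow> real"
  assumes A: "\<And>n. n \<in> I \<Longrightarrow> A n \<in> carrier_mat (N n) (N n)"
    and B: "\<And>m n. m \<in> P \<Longrightarrow> n \<in> I \<Longrightarrow> B m n \<in> carrier_mat (N n) (N n)"
    and P: "eventually (\<lambda>m. m \<in> P) G"
    and t: "\<And>m. m \<in> P \<Longrightarrow> 0 < t m" "(t \<longlongrightarrow> 0) G"
    and s: "\<And>e. 0 < e \<Longrightarrow> eventually (\<lambda>m. m \<in> P \<longrightarrow> eventually (\<lambda>n. small_pert e (A n - B m n)) F) G"
  shows "acs I P G B A"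
proof -
  define S where "S m = {x. 0 < x \<and> eventually (\<lambda>n. small_pert x (A n - B m n)) F}" for m
  define c where "c m = Inf (S m) + t m" for m
  \<comment> \<open>The decomposition is demanded for every \<open>m\<close> in \<open>P\<close>,
    not just eventually; the trivial error 1 makes \<open>S m\<close> nonempty, so its infimum is
    meaningful.\<close>
  have S1: "1 \<in> S m" if "m \<in> P" for m
  proof -
    from ev_I have "eventually (\<lambda>n. small_pert 1 (A n - B m n)) F"
    proof eventually_elim
      case (elim n)
      show ?case by (rule small_pert_full[where d = "N n"]) (use A[OF elim] B[OF that elim] in auto)
    qed
    then show ?thesis by (simp add: S_def)
  qed
  have bdd: "bdd_below (S m)" for m by (rule bdd_belowI[of _ 0]) (auto simp: S_def)
  have inf0: "0 \<le> Inf (S m)" if "m \<in> P" for m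
    using S1[OF that] by (intro cInf_greatest) (blast, simp add: S_def)
  have ex: "\<exists>n0. \<forall>n\<in>I. n0 \<le> n \<longrightarrow> small_pert (c m) (A n - B m n)" if m: "m \<in> P" for m
  proof -
    have "Inf (S m) < c m" using t(1)[OF m] by (simp add: c_def)
    then obtain x where x: "x \<in> S m" "x < c m" using S1[OF m] cInf_lessD[of "S m" "c m"] by blast
    then have "eventually (\<lambda>n. small_pert x (A n - B m n)) F" by (simp add: S_def)
    with ev_I have "eventually (\<lambda>n. small_pert (c m) (A n - B m n)) F"
    proof eventually_elim
      case (elim n)
      show ?case by (rule small_pert_mono[OF elim(2) less_imp_le[OF x(2)]]) (use A[OF elim(1)] B[OF m elim(1)] in auto)
    qed
    then show ?thesis by (simp add: eventually_at_top_in)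
  qed
  then obtain n0 where n0: "\<And>m n. m \<in> P \<Longrightarrow> n \<in> I \<Longrightarrow> n0 m \<le> n \<Longrightarrow> small_pert (c m) (A n - B m n)" by metis
  have c0: "(c \<longlongrightarrow> 0) G"
  proof (rule tendstoI)
    fix e :: real assume e: "0 < e"
    then have e2: "0 < e / 2" by simp
    have "eventually (\<lambda>m. t m < e / 2) G" using t(2) e2 by (rule order_tendstoD)
    with P s[OF e2] show "eventually (\<lambda>m. dist (c m) 0 < e) G"
    proof eventually_elim
      case (elim m)
      then have "e / 2 \<in> S m" using e2 by (simp add: S_def)
      then have "Inf (S m) \<le> e / 2" using bdd by (rule cInf_lower)
      moreover have "0 \<le> c m" using inf0[OF elim(1)] t(1)[OF elim(1)] by (simp add: c_def)
      ultimately show ?case using elim(3) by (simp add: c_def)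
    qed
  qed
  show ?thesis unfolding acs_def
  proof (intro exI[of _ n0] exI[of _ c] conjI c0 ballI impI)
    fix m n assume m: "m \<in> P" and n: "n \<in> I" "n0 m \<le> n"
    have d: "dim_row (A n) = N n" using A[OF n(1)] by auto
    have AB: "A n - B m n \<in> carrier_mat (N n) (N n)" using B[OF m n(1)] by auto
    obtain R M r where R: "R \<in> carrier_mat (N n) (N n)" "M \<in> carrier_mat (N n) (N n)" "A n - B m n = R + M" "lowrank r R"
      "real r \<le> c m * real (N n)" "nb M (c m)" by (rule small_pertE[OF n0[OF m n] AB])
    have "A n = B m n + R + M"
    proof (rule eq_matI)
      fix i j assume ij: "i < dim_row (B m n + R + M)" "j < dim_col (B m n + R + M)"
      have "(A n - B m n) $$ (i, j) = (R + M) $$ (i, j)" using R(3) by simp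
      then show "A n $$ (i, j) = (B m n + R + M) $$ (i, j)" using ij R(1,2) A[OF n(1)] B[OF m n(1)] by (auto simp: algebra_simps)
    qed (use R(1,2) A[OF n(1)] in auto)
    moreover have "real (mat_rank R) \<le> c m * real (N n)" using lowrank_imp_mat_rank[OF R(1,4)] R(5) by linarith
    moreover have "0 \<le> c m" using inf0[OF m] t(1)[OF m] by (simp add: c_def)
    then have "spectral_norm M \<le> c m" using spectral_norm_le_iff R(6) by blast
    ultimately show "let d = dim_row (A n) in B m n \<in> carrier_mat d d \<and>
             (\<exists>R \<in> carrier_mat d d. \<exists>N \<in> carrier_mat d d. A n = B m n + R + N \<and>
                real (mat_rank R) \<le> c m * real d \<and> spectral_norm N \<le> c m)"
      unfolding Let_def d using B[OF m n(1)] R(1,2) by blast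
  qed
qed

text \<open>Each summand of \<open>nmat\<close> is itself an LT sequence, so the approximants in
  \<open>glt\<close> are admissible in the definition of GLT sequences.\<close>

lemma LT_seq_single:
  assumes v: "continuous_on unit_cube v"
  shows "LT_seq I nn (\<lambda>n. single (nn n) k (\<lambda>i. v (pt (nn n) i))) v (fexp k)"
  unfolding LT_seq_def
proof (intro conjI)
  show "multilevel_seq I nn (\<lambda>n. single (nn n) k (\<lambda>i. v (pt (nn n) i)))" by (rule multilevel_seqI) simp
  show "riemann_integrable_on v unit_cube" by (rule continuous_riemann_integrable[OF v])
  show "integrable angM (fexp k)" by (rule integrable_fexp)
  show "acs I {m. \<forall>j. 1 \<le> m j} mi_at_top (\<lambda>m n. LT_op (nn n) m v (fexp k)) (\<lambda>n. single (nn n) k (\<lambda>i. v (pt (nn n) i)))"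
  proof (rule acsI[where t = "\<lambda>m. 1 / real (Suc (Min (range m)))"])
    show "eventually (\<lambda>m. m \<in> {m :: 'd \<Rightarrow> nat. \<forall>j. 1 \<le> m j}) mi_at_top" using mi_at_top_ge[of 1] by simp
    have "filterlim (\<lambda>m :: 'd \<Rightarrow> nat. Min (range m)) at_top mi_at_top"
      unfolding mi_at_top_def by (rule filterlim_filtercomap)
    then have "filterlim (\<lambda>m :: 'd \<Rightarrow> nat. Suc (Min (range m))) at_top mi_at_top"
      by (rule filterlim_compose[OF filterlim_Suc])
    then have "filterlim (\<lambda>m :: 'd \<Rightarrow> nat. real (Suc (Min (range m)))) at_top mi_at_top"
      by (rule filterlim_compose[OF filterlim_real_sequentially])
    then show "((\<lambda>m :: 'd \<Rightarrow> nat. 1 / real (Suc (Min (range m)))) \<longlongrightarrow> 0) mi_at_top"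
      by (rule real_tendsto_divide_at_top[OF tendsto_const])
    fix e :: real assume e: "0 < e"
    then have "0 < e ^ 3" by simp
    from LT_continuous[OF fourier_coeff_fexp v this, of k]
    show "eventually (\<lambda>m. m \<in> {m. \<forall>j. 1 \<le> m j} \<longrightarrow>
       eventually (\<lambda>n. small_pert e (single (nn n) k (\<lambda>i. v (pt (nn n) i)) - LT_op (nn n) m v (fexp k))) F) mi_at_top"
    proof (rule eventually_mono)
      fix m :: "'d \<Rightarrow> nat"
      assume *: "(\<forall>l. 1 \<le> m l) \<longrightarrow> eventually (\<lambda>n. frob2 (single (nn n) k (\<lambda>i. v (pt (nn n) i)) - LT_op (nn n) m v (fexp k)) \<le> e ^ 3 * real (N n)) F"
      show "m \<in> {m. \<forall>j. 1 \<le> m j} \<longrightarrow> eventually (\<lambda>n. small_pert e (single (nn n) k (\<lambda>i. v (pt (nn n) i)) - LT_op (nn n) m v (fexp k))) F"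
      proof
        assume "m \<in> {m. \<forall>j. 1 \<le> m j}"
        with * have "eventually (\<lambda>n. frob2 (single (nn n) k (\<lambda>i. v (pt (nn n) i)) - LT_op (nn n) m v (fexp k)) \<le> e ^ 3 * real (N n)) F" by simp
        then show "eventually (\<lambda>n. small_pert e (single (nn n) k (\<lambda>i. v (pt (nn n) i)) - LT_op (nn n) m v (fexp k))) F"
          by (rule eventually_mono) (rule frob2_small_pert, use e in auto)
      qed
    qed
  qed auto
qed

text \<open>The approximant of accuracy \<open>\<epsilon>\<close> is taken as the LT sum for the
  parameter \<open>\<epsilon>\<close>; its accuracy is at once the a.c.s. error and the rate of
  convergence in measure.\<close>

lemma glt_imp_GLT:
  assumes A: "glt A \<kappa>" shows "GLT_seq I nn A \<kappa>"
proof -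
  have "\<exists>c. nvalid c \<and> closeM \<epsilon> (nsym c) \<kappa> \<and> eventually (\<lambda>n. small_pert \<epsilon> (A n - nmat (nn n) c)) F" if "0 < \<epsilon>" for \<epsilon>
    using A that unfolding glt_def by blast
  then obtain c where c: "\<And>\<epsilon>. 0 < \<epsilon> \<Longrightarrow> nvalid (c \<epsilon>)" "\<And>\<epsilon>. 0 < \<epsilon> \<Longrightarrow> closeM \<epsilon> (nsym (c \<epsilon>)) \<kappa>"
    "\<And>\<epsilon>. 0 < \<epsilon> \<Longrightarrow> eventually (\<lambda>n. small_pert \<epsilon> (A n - nmat (nn n) (c \<epsilon>))) F" by metis
  let ?v = "\<lambda>\<epsilon> i. fst (c \<epsilon> ! (i - 1))" and ?k = "\<lambda>\<epsilon> i. snd (c \<epsilon> ! (i - 1))"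
  show ?thesis unfolding GLT_seq_def
  proof (rule conjI[OF multilevel_seqI], rule gltD(1)[OF A], assumption, rule conjI[OF gltD(2)[OF A]],
      rule exI[of _ "\<lambda>\<epsilon>. length (c \<epsilon>)"], rule exI[of _ "\<lambda>\<epsilon> i n. single (nn n) (?k \<epsilon> i) (\<lambda>j. ?v \<epsilon> i (pt (nn n) j))"],
      rule exI[of _ ?v], rule exI[of _ "\<lambda>\<epsilon> i. fexp (?k \<epsilon> i)"], intro conjI allI impI ballI)
    show "LT_seq I nn (\<lambda>n. single (nn n) (?k \<epsilon> i) (\<lambda>j. ?v \<epsilon> i (pt (nn n) j))) (?v \<epsilon> i) (fexp (?k \<epsilon> i))"
      if "0 < \<epsilon>" "i \<in> {1..length (c \<epsilon>)}" for \<epsilon> i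
      using that by (intro LT_seq_single nvalid_nth c(1)) auto
    show "acs I {0<..} (at_right 0) (\<lambda>\<epsilon> n. Matrix.mat (N n) (N n) (\<lambda>(k, l). \<Sum>i\<in>{1..length (c \<epsilon>)}.
        single (nn n) (?k \<epsilon> i) (\<lambda>j. ?v \<epsilon> i (pt (nn n) j)) $$ (k, l))) A"
      unfolding nmat_sum[symmetric]
    proof (rule acsI[where t = "\<lambda>\<epsilon>. \<epsilon>"])
      show "eventually (\<lambda>\<epsilon>. \<epsilon> \<in> {0<..}) (at_right (0 :: real))" by (simp add: eventually_at_right_less)
      show "((\<lambda>\<epsilon>. \<epsilon>) \<longlongrightarrow> 0) (at_right (0 :: real))" by (rule tendsto_ident_at)
      fix e :: real assume e: "0 < e"
      have "eventually (\<lambda>\<epsilon> :: real. \<epsilon> < e) (at_right 0)" using e by (rule order_tendstoD[OF tendsto_ident_at])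
      then show "eventually (\<lambda>\<epsilon>. \<epsilon> \<in> {0<..} \<longrightarrow> eventually (\<lambda>n. small_pert e (A n - nmat (nn n) (c \<epsilon>))) F) (at_right 0)"
      proof eventually_elim
        case le: (elim \<epsilon>)
        show ?case
        proof
          assume "\<epsilon> \<in> {0<..}"
          then have "0 < \<epsilon>" by simp
          from c(3)[OF this] ev_I show "eventually (\<lambda>n. small_pert e (A n - nmat (nn n) (c \<epsilon>))) F"
          proof eventually_elim
            case (elim n)
            show ?case by (rule small_pert_mono[OF elim(1) less_imp_le[OF le], where d = "N n"]) (use gltD(1)[OF A elim(2)] in auto)
          qed
        qed
      qed
    qed (use gltD(1)[OF A] in auto)
    show "converges_in_measure_on symbol_domain (\<lambda>\<epsilon> (x, \<theta>). \<Sum>i\<in>{1..length (c \<epsilon>)}. ?v \<epsilon> i x * fexp (?k \<epsilon> i) \<theta>) \<kappa> (at_right 0)"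
      unfolding converges_in_measure_on_def
    proof (intro allI impI)
      fix \<eta> :: real assume \<eta>: "0 < \<eta>"
      have eq: "(case z of (x, \<theta>) \<Rightarrow> \<Sum>i\<in>{1..length (c \<epsilon>)}. ?v \<epsilon> i x * fexp (?k \<epsilon> i) \<theta>) = nsym (c \<epsilon>) z" for \<epsilon> z
        unfolding nsym_sum by (cases z) simp
      \<comment> \<open>Once \<open>\<epsilon> < \<eta>\<close>, the set where the deviation exceeds
        \<open>\<eta>\<close> is contained in the exceptional set of \<open>closeM\<close>.\<close>
      have ev: "eventually (\<lambda>\<epsilon> :: real. \<epsilon> < \<eta>) (at_right 0)" using \<eta> by (rule order_tendstoD[OF tendsto_ident_at])
      have "((\<lambda>\<epsilon>. ennreal \<epsilon>) \<longlongrightarrow> ennreal 0) (at_right 0)" by (intro tendsto_ennrealI tendsto_ident_at)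
      then have l: "((\<lambda>\<epsilon>. ennreal \<epsilon>) \<longlongrightarrow> 0) (at_right 0)" by simp
      show "((\<lambda>\<epsilon>. emeasure lebesgue {z \<in> symbol_domain. \<eta> < norm ((case z of (x, \<theta>) \<Rightarrow> \<Sum>i\<in>{1..length (c \<epsilon>)}. ?v \<epsilon> i x * fexp (?k \<epsilon> i) \<theta>) - \<kappa> z)}) \<longlongrightarrow> 0) (at_right 0)"
        unfolding eq
      proof (rule tendsto_sandwich[OF _ _ tendsto_const l])
        from ev eventually_at_right_less[of "0 :: real"]
        show "eventually (\<lambda>\<epsilon>. emeasure lebesgue {z \<in> symbol_domain. \<eta> < norm (nsym (c \<epsilon>) z - \<kappa> z)} \<le> ennreal \<epsilon>) (at_right 0)"
        proof eventually_elim
          case (elim \<epsilon>)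
          obtain E where E: "E \<in> sets lebesgue" "emeasure lebesgue E \<le> ennreal \<epsilon>" "\<forall>z\<in>symbol_domain - E. cmod (nsym (c \<epsilon>) z - \<kappa> z) \<le> \<epsilon>"
            using c(2)[OF elim(2)] unfolding closeM_def by blast
          have "{z \<in> symbol_domain. \<eta> < norm (nsym (c \<epsilon>) z - \<kappa> z)} \<subseteq> E"
          proof (rule subsetI, rule ccontr)
            fix z assume z: "z \<in> {z \<in> symbol_domain. \<eta> < norm (nsym (c \<epsilon>) z - \<kappa> z)}" "z \<notin> E"
            then have "cmod (nsym (c \<epsilon>) z - \<kappa> z) \<le> \<epsilon>" using E(3) by auto
            then show False using z elim(1) by simp
          qed
          then show ?case using E(1,2) by (meson emeasure_mono order_trans)
        qed
      qed simp
    qed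
  qed
qed

end

section \<open>Trace limits and eigenvalue distribution\<close>

lemma emeasure_symbol_domain:
  "emeasure lebesgue (symbol_domain :: ('d::finite sdom) set) = ennreal ((2 * pi) ^ CARD('d))"
proof -
  have "(unit_cube :: (real ^ 'd) set) \<in> sets borel" "(angle_cube :: (real ^ 'd) set) \<in> sets borel"
    by (auto simp: unit_cube_def angle_cube_def)
  then show ?thesis unfolding symbol_domain_def
    by (simp only: emeasure_times_lebesgue emeasure_unit_cube emeasure_angle_cube mult_1)
qed

lemma measure_symbol_domain:
  "measure lebesgue (symbol_domain :: ('d::finite sdom) set) = (2 * pi) ^ CARD('d)"
  unfolding measure_def emeasure_symbol_domain by simp

text \<open>The mean over the symbol domain, whose volume is that of the angle cube since the unit
  cube has volume 1.\<close>

definition avg :: "('d::finite sdom \<Rightarrow> 'b::{banach, second_countable_topology}) \<Rightarrow> 'b" where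
  "avg h = (1 / (2 * pi) ^ CARD('d)) *\<^sub>R (LINT z|symM. h z)"

lemma avg_add:
  "integrable symM f \<Longrightarrow> integrable symM g \<Longrightarrow> avg (\<lambda>z. f z + g z) = avg f + avg g"
  by (simp add: avg_def Bochner_Integration.integral_add scaleR_add_right)

lemma avg_of_real: "avg (\<lambda>z. complex_of_real (f z)) = complex_of_real (avg f)"
  by (simp add: avg_def scaleR_conv_of_real)

lemma continuous_nsym: "nvalid c \<Longrightarrow> continuous_on symbol_domain (nsym c)"
proof (induction c)
  case (Cons a c)
  obtain v k where a: "a = (v, k)" by (cases a)
  have "continuous_on symbol_domain (\<lambda>z. v (fst z) * fexp k (snd z) + nsym c z)"
    using Cons a unfolding symbol_domain_def
    by (intro continuous_intros continuous_on_compose2[of unit_cube v _ fst] continuous_on_compose2[OF continuous_fexp]) auto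
  then show ?case unfolding a by (simp add: nsym.simps[abs_def])
qed (simp add: nsym.simps[abs_def])

lemma continuous_integrable_symbol:
  fixes f :: "'d::finite sdom \<Rightarrow> 'b::euclidean_space"
  assumes "continuous_on symbol_domain f" shows "integrable symM f"
  using assms unfolding symbol_domain_cbox by (rule continuous_imp_integrable)

text \<open>The counterpart of \<open>mtrace_single\<close>: in the integral as in the trace only
  the zero frequency survives.\<close>

lemma avg_single:
  fixes v :: "real ^ 'd::finite \<Rightarrow> complex"
  assumes v: "continuous_on unit_cube v"
  shows "avg (\<lambda>z. v (fst z) * fexp k (snd z)) = (if k = (\<lambda>_. 0) then integral unit_cube v else 0)"
proof -
  let ?f = "\<lambda>z. v (fst z) * fexp k (snd z)"
  have "nvalid [(v, k)]" using v by simp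
  from continuous_nsym[OF this] have c: "continuous_on symbol_domain ?f" by (simp add: nsym.simps[abs_def])
  have ia: "integral angle_cube (fexp k) = (if k = (\<lambda>_. 0) then complex_of_real ((2 * pi) ^ CARD('d)) else 0)"
    using lebesgue_integral_eq_integral[OF integrable_fexp, of k] integral_fexp[of k] by simp
  have "(LINT z|symM. ?f z) = integral symbol_domain ?f"
    by (rule lebesgue_integral_eq_integral[OF continuous_integrable_symbol[OF c]]) simp
  also have "\<dots> = integral unit_cube (\<lambda>x. integral angle_cube (\<lambda>\<theta>. ?f (x, \<theta>)))"
    using c unfolding symbol_domain_cbox unit_cube_def angle_cube_def by (rule integral_prod_continuous)
  also have "\<dots> = integral unit_cube v * integral angle_cube (fexp k)" by simp
  finally show ?thesis unfolding avg_def ia by (simp add: scaleR_conv_of_real)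
qed

context mlseq
begin

text \<open>The grid points are tags for the division into cells of \<open>nn n\<close>, whose mesh
  tends to 0.\<close>

lemma riemann_lim:
  fixes v :: "real ^ 'd::{finite,linorder} \<Rightarrow> complex"
  assumes v: "continuous_on unit_cube v"
  shows "((\<lambda>n. (\<Sum>i\<in>mi_range (nn n). v (pt (nn n) i)) / of_nat (N n)) \<longlongrightarrow> integral unit_cube v) F"
proof (rule tendstoI)
  fix e :: real assume e: "0 < e"
  obtain \<delta> where \<delta>: "0 < \<delta>" and R: "\<forall>p. p tagged_division_of unit_cube \<and> (\<forall>(x, K)\<in>p. diameter K < \<delta>) \<longrightarrow>
      norm ((\<Sum>(x, K)\<in>p. measure lborel K *\<^sub>R v x) - integral unit_cube v) < e"
    using continuous_riemann[OF v e] by (elim exE conjE)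
  have "eventually (\<lambda>n. (\<Sum>j\<in>UNIV. 1 / real (nn n j)) < \<delta>) F" using order_tendstoD(2)[OF lim_sum_inv[of "\<lambda>_. 1"] \<delta>] .
  with ev_I show "eventually (\<lambda>n. dist ((\<Sum>i\<in>mi_range (nn n). v (pt (nn n) i)) / of_nat (N n)) (integral unit_cube v) < e) F"
  proof eventually_elim
    case (elim n)
    have "norm ((1 / real (N n)) *\<^sub>R (\<Sum>a\<in>mi_range (nn n). v (pt (nn n) a)) - integral unit_cube v) < e"
      by (rule riemann_cells[OF R pos[OF elim(1)] _ elim(2)]) (rule pt_in_cell)
    then show ?case by (simp add: dist_norm scaleR_conv_of_real field_simps)
  qed
qed

lemma nmat_trace:
  assumes "nvalid c" shows "((\<lambda>n. mtrace (nmat (nn n) c) / of_nat (N n)) \<longlongrightarrow> avg (nsym c)) F"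
  using assms
proof (induction c)
  case Nil
  show ?case by (simp add: mtrace_def avg_def nsym.simps[abs_def])
next
  case (Cons a c)
  obtain v k where a: "a = (v, k)" by (cases a)
  have v: "continuous_on unit_cube v" and c: "nvalid c" using Cons.prems a by auto
  have "((\<lambda>n. mtrace (single (nn n) k (\<lambda>i. v (pt (nn n) i))) / of_nat (N n)) \<longlongrightarrow> avg (\<lambda>z. v (fst z) * fexp k (snd z))) F"
    unfolding avg_single[OF v] mtrace_single using riemann_lim[OF v] by (cases "k = (\<lambda>_. 0)") auto
  from tendsto_add[OF this Cons.IH[OF c]]
  have "((\<lambda>n. mtrace (nmat (nn n) (a # c)) / of_nat (N n)) \<longlongrightarrow> avg (\<lambda>z. v (fst z) * fexp k (snd z)) + avg (nsym c)) F"
    unfolding a nmat.simps mtrace_add[OF single_carrier(1) nmat_carrier(1)] add_divide_distrib .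
  moreover have "avg (\<lambda>z. v (fst z) * fexp k (snd z)) + avg (nsym c) = avg (nsym (a # c))"
  proof -
    have "nvalid [(v, k)]" using v by simp
    from continuous_nsym[OF this] have "continuous_on symbol_domain (\<lambda>z. v (fst z) * fexp k (snd z))" by (simp add: nsym.simps[abs_def])
    then show ?thesis unfolding a nsym.simps[abs_def]
      by (intro avg_add[symmetric] continuous_integrable_symbol continuous_nsym[OF c])
  qed
  ultimately show ?case by simp
qed

end

primrec npow :: "'d::finite nice \<Rightarrow> nat \<Rightarrow> 'd nice" where
  "npow c 0 = [(\<lambda>_. 1, \<lambda>_. 0)]"
| "npow c (Suc k) = nmul c (npow c k)"

lemma nsym_npow: "nsym (npow c k) z = nsym c z ^ k"
  by (induction k) (auto simp: nsym_nmul fexp_zero)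

lemma nvalid_npow: "nvalid c \<Longrightarrow> nvalid (npow c k)"
  by (induction k) (auto intro: nvalid_nmul)

lemma nmat_one: "nmat n [(\<lambda>_. 1, \<lambda>_. 0)] = 1\<^sub>m (mi_size n)"
proof -
  have "(1\<^sub>m (mi_size n) :: complex Matrix.mat) = mi_mat n (\<lambda>i j. if mi_diff i j = (\<lambda>_. 0) then 1 else 0)"
    unfolding mi_mat_one[symmetric] by (rule mi_mat_cong) (auto simp: mi_diff_def fun_eq_iff)
  then show ?thesis by (simp add: single_def)
qed

context mlseq
begin

text \<open>Telescoping: H P - c^(k+1) splits into H (P - Q), (H - M) Q and the product error of M
  Q, all negligible because H and Q are bounded uniformly in \<open>n\<close>.\<close>

lemma npow_negl:
  assumes c: "nvalid c" and U: "\<And>n. n \<in> I \<Longrightarrow> unitary (N n) (U n)" and K: "0 \<le> K" "\<And>n i. n \<in> I \<Longrightarrow> i < N n \<Longrightarrow> \<bar>\<beta> n i\<bar> \<le> K"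
    and H: "negl (\<lambda>n. spec (N n) (U n) (\<lambda>i. of_real (\<beta> n i)) - nmat (nn n) c)"
  shows "negl (\<lambda>n. spec (N n) (U n) (\<lambda>i. of_real (\<beta> n i) ^ k) - nmat (nn n) (npow c k))"
proof (induction k)
  case 0
  have "spec (N n) (U n) (\<lambda>i. of_real (\<beta> n i) ^ 0) - nmat (nn n) (npow c 0) = 0\<^sub>m (N n) (N n)" if "n \<in> I" for n
    unfolding npow.simps nmat_one power_0 spec_one[OF U[OF that]] by simp
  then show ?case by (intro negl_cong[OF negl_zero]) simp
next
  case (Suc k)
  let ?H = "\<lambda>n. spec (N n) (U n) (\<lambda>i. of_real (\<beta> n i))" and ?P = "\<lambda>n. spec (N n) (U n) (\<lambda>i. of_real (\<beta> n i) ^ k)"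
  let ?M = "\<lambda>n. nmat (nn n) c" and ?Q = "\<lambda>n. nmat (nn n) (npow c k)"
  obtain L where L: "0 \<le> L" "\<And>n :: 'd \<Rightarrow> nat. nb (nmat n (npow c k)) L" using nmat_nb[OF nvalid_npow[OF c]] by blast
  have nbH: "nb (?H n) K" if "n \<in> I" for n
    using U[OF that] K that by (intro spec_nb) auto
  have 1: "negl (\<lambda>n. ?H n * (?P n - ?Q n))"
    by (rule negl_mult_left[OF Suc]) (use nbH K in auto)
  have 2: "negl (\<lambda>n. (?H n - ?M n) * ?Q n)"
    by (rule negl_mult_right[OF H]) (use L in auto)
  have 3: "negl (\<lambda>n. ?M n * ?Q n - nmat (nn n) (npow c (Suc k)))"
    using nmul_negl[OF c nvalid_npow[OF c]] by simp
  show ?case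
  proof (rule negl_cong[OF negl_add[OF negl_add[OF 1 2] 3]])
    fix n assume n: "n \<in> I"
    have s: "?H n * ?P n = spec (N n) (U n) (\<lambda>i. of_real (\<beta> n i) ^ Suc k)"
      by (simp add: spec_mult[OF U[OF n]])
    have "?H n * (?P n - ?Q n) = ?H n * ?P n - ?H n * ?Q n" by (rule mult_minus_distrib_mat[of _ "N n" "N n" _ "N n"]) auto
    moreover have "(?H n - ?M n) * ?Q n = ?H n * ?Q n - ?M n * ?Q n" by (rule minus_mult_distrib_mat[of _ "N n" "N n" _ _ "N n"]) auto
    ultimately show "?H n * (?P n - ?Q n) + (?H n - ?M n) * ?Q n + (?M n * ?Q n - nmat (nn n) (npow c (Suc k)))
      = spec (N n) (U n) (\<lambda>i. of_real (\<beta> n i) ^ Suc k) - nmat (nn n) (npow c (Suc k))"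
      unfolding s[symmetric] by (simp only:) (intro eq_matI, auto)
  qed
qed

text \<open>Sums of powers of eigenvalues are traces of powers, and \<open>npow_negl\<close>
  replaces these by traces of \<open>nmat\<close>, whose limits are known.\<close>

lemma moments:
  assumes c: "nvalid c" and U: "\<And>n. n \<in> I \<Longrightarrow> unitary (N n) (U n)" and K: "0 \<le> K" "\<And>n i. n \<in> I \<Longrightarrow> i < N n \<Longrightarrow> \<bar>\<beta> n i\<bar> \<le> K"
    and H: "negl (\<lambda>n. spec (N n) (U n) (\<lambda>i. of_real (\<beta> n i)) - nmat (nn n) c)"
    and h: "\<And>z. nsym c z = complex_of_real (h z)"
  shows "((\<lambda>n. (\<Sum>i<N n. \<beta> n i ^ k) / real (N n)) \<longlongrightarrow> avg (\<lambda>z. h z ^ k)) F"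
proof -
  let ?P = "\<lambda>n. spec (N n) (U n) (\<lambda>i. of_real (\<beta> n i) ^ k)" and ?Q = "\<lambda>n. nmat (nn n) (npow c k)"
  from tendsto_add[OF negl_mtrace[OF npow_negl[OF c U K H, of k]] nmat_trace[OF nvalid_npow[OF c], of k]]
  have "((\<lambda>n. mtrace (?P n - ?Q n) / of_nat (N n) + mtrace (?Q n) / of_nat (N n)) \<longlongrightarrow> avg (nsym (npow c k))) F" by simp
  moreover have "eventually (\<lambda>n. mtrace (?P n - ?Q n) / of_nat (N n) + mtrace (?Q n) / of_nat (N n)
     = complex_of_real ((\<Sum>i<N n. \<beta> n i ^ k) / real (N n))) F"
    using ev_I
  proof eventually_elim
    case (elim n)
    have "mtrace (?P n - ?Q n) / of_nat (N n) + mtrace (?Q n) / of_nat (N n) = mtrace (?P n) / of_nat (N n)"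
      by (subst mtrace_minus[of _ "N n"]) (auto simp: diff_divide_distrib)
    then show ?case by (simp add: spec_trace[OF U[OF elim]])
  qed
  ultimately have "((\<lambda>n. complex_of_real ((\<Sum>i<N n. \<beta> n i ^ k) / real (N n))) \<longlongrightarrow> avg (nsym (npow c k))) F"
    by (rule Lim_transform_eventually)
  moreover have "nsym (npow c k) = (\<lambda>z. complex_of_real (h z ^ k))" by (auto simp: nsym_npow h)
  ultimately show ?thesis by (simp only: avg_of_real tendsto_of_real_iff)
qed

end

lemma spec_eigen_bound:
  assumes U: "unitary d U" and i: "i < d" and c: "nb (spec d U f) c"
  shows "cmod (f i) \<le> c"
proof -
  obtain x where x: "x \<in> carrier_vec d" "vec_nrm x = 1" "(spec d U f *\<^sub>v x) \<bullet>c x = f i"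
    using spec_eigen_quad[OF U i] by blast
  have s: "spec d U f \<in> carrier_mat d d" by simp
  have Xx: "spec d U f *\<^sub>v x \<in> carrier_vec d" using s x(1) by (rule mult_mat_vec_carrier)
  have "cmod (f i) \<le> vec_nrm (spec d U f *\<^sub>v x) * vec_nrm x"
    using cscalar_cauchy[OF Xx x(1)] x(3) by simp
  also have "\<dots> \<le> c" using nbD[OF c s x(1)] x(2) by simp
  finally show ?thesis .
qed

lemma finite_measure_symbol_domain: "finite_measure (lebesgue_on (symbol_domain :: ('d::finite sdom) set))"
  by (rule finite_measureI) (simp add: emeasure_restrict_space emeasure_symbol_domain)

lemma integrable_bounded_symbol:
  fixes f :: "'d::finite sdom \<Rightarrow> 'b::{banach, second_countable_topology}"
  assumes "f \<in> borel_measurable symM" "AE z in symM. norm (f z) \<le> B"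
  shows "integrable symM f"
  using finite_measure.integrable_const_bound[OF finite_measure_symbol_domain assms(2,1)] .

lemma avg_close:
  fixes f g :: "'d::finite sdom \<Rightarrow> real"
  assumes f: "integrable symM f" and g: "integrable symM g"
    and E: "E \<in> sets lebesgue" "emeasure lebesgue E \<le> ennreal \<epsilon>" and "0 \<le> \<epsilon>" "0 \<le> b"
    and le: "\<And>z. z \<in> symbol_domain \<Longrightarrow> \<bar>f z - g z\<bar> \<le> a + b * indicator E z"
  shows "\<bar>avg f - avg g\<bar> \<le> a + b * \<epsilon>"
proof -
  let ?M = "lebesgue_on (symbol_domain :: 'd sdom set)"
  let ?P = "(2 * pi) ^ CARD('d)"
  \<comment> \<open>Division by a volume of at least 1 cannot enlarge the contribution
    \<open>b * \<epsilon>\<close> of the exceptional set.\<close>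
  have P: "1 \<le> ?P" using pi_ge_two by (intro one_le_power) simp
  interpret finite_measure ?M by (rule finite_measure_symbol_domain)
  have sp: "measure ?M (space ?M) = ?P"
    by (simp add: measure_restrict_space measure_symbol_domain)
  have EL: "E \<inter> symbol_domain \<in> sets lebesgue" using E(1) symbol_domain_sets(1) by (rule sets.Int)
  then have EM: "E \<inter> symbol_domain \<in> sets ?M" by (simp add: sets_restrict_space_iff)
  have iE: "integrable ?M (indicator (E \<inter> symbol_domain) :: _ \<Rightarrow> real)"
    by (rule integrable_real_indicator[OF EM]) (metis emeasure_finite infinity_ennreal_def less_top)
  have mE: "measure ?M (E \<inter> symbol_domain) \<le> \<epsilon>"
  proof -
    have "emeasure ?M (E \<inter> symbol_domain) = emeasure lebesgue (E \<inter> symbol_domain)"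
      using EL by (subst emeasure_restrict_space) auto
    also have "\<dots> \<le> emeasure lebesgue E" using E(1) by (intro emeasure_mono) auto
    also have "\<dots> \<le> ennreal \<epsilon>" by (rule E(2))
    finally show ?thesis unfolding measure_def using assms(5) by (intro enn2real_leI)
  qed
  have "\<bar>(LINT z|?M. f z) - (LINT z|?M. g z)\<bar> = \<bar>LINT z|?M. f z - g z\<bar>"
    using f g by (simp add: Bochner_Integration.integral_diff)
  also have "\<dots> \<le> (LINT z|?M. \<bar>f z - g z\<bar>)" by (rule integral_abs_bound)
  also have "\<dots> \<le> (LINT z|?M. a + b * indicator (E \<inter> symbol_domain) z)"
  proof (rule integral_mono)
    show "integrable ?M (\<lambda>z. \<bar>f z - g z\<bar>)" using f g by auto
    show "integrable ?M (\<lambda>z. a + b * indicator (E \<inter> symbol_domain) z)"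
      using iE by (intro Bochner_Integration.integrable_add integrable_mult_right) auto
    show "\<bar>f z - g z\<bar> \<le> a + b * indicator (E \<inter> symbol_domain) z" if "z \<in> space ?M" for z
      using le[of z] that by (auto simp: indicator_def)
  qed
  also have "\<dots> = a * ?P + b * measure ?M (E \<inter> symbol_domain)"
    using iE sp by (subst Bochner_Integration.integral_add) (auto intro: integrable_mult_right)
  also have "\<dots> \<le> a * ?P + b * \<epsilon>" using mE assms(6) by (intro add_left_mono mult_left_mono)
  finally have 1: "\<bar>(LINT z|?M. f z) - (LINT z|?M. g z)\<bar> \<le> a * ?P + b * \<epsilon>" .
  have "\<bar>avg f - avg g\<bar> = \<bar>(LINT z|?M. f z) - (LINT z|?M. g z)\<bar> / ?P"
    unfolding avg_def by (simp add: abs_mult right_diff_distrib[symmetric] diff_divide_distrib[symmetric])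
  also have "\<dots> \<le> (a * ?P + b * \<epsilon>) / ?P" using 1 P by (intro divide_right_mono) auto
  also have "\<dots> = a + b * \<epsilon> / ?P" using P by (simp add: add_divide_distrib)
  also have "\<dots> \<le> a + b * \<epsilon>"
  proof -
    have "b * \<epsilon> / ?P \<le> b * \<epsilon> / 1" using P assms(5,6) by (intro divide_left_mono) auto
    then show ?thesis by simp
  qed
  finally show ?thesis .
qed

context mlseq
begin

text \<open>Moments determine the limit distribution on a compact interval, by Weierstrass approximation.\<close>

lemma weierstrass_mean:
  fixes x :: "nat \<Rightarrow> nat \<Rightarrow> real" and y :: "'d::{finite,linorder} sdom \<Rightarrow> real"
  assumes y: "y \<in> borel_measurable symM"
    and x_in: "\<And>n i. n \<in> I \<Longrightarrow> i < N n \<Longrightarrow> a \<le> x n i \<and> x n i \<le> b"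
    and y_in: "\<And>z. z \<in> symbol_domain \<Longrightarrow> a \<le> y z \<and> y z \<le> b"
    and mom: "\<And>k. ((\<lambda>n. (\<Sum>i<N n. x n i ^ k) / real (N n)) \<longlongrightarrow> avg (\<lambda>z. y z ^ k)) F"
    and g: "continuous_on UNIV (g :: real \<Rightarrow> real)"
  shows "((\<lambda>n. (\<Sum>i<N n. g (x n i)) / real (N n)) \<longlongrightarrow> avg (\<lambda>z. g (y z))) F"
proof (rule tendstoI)
  fix e :: real assume e: "0 < e"
  have comp: "compact {a..b}" by simp
  have int: "integrable symM (\<lambda>z. h (y z))" if h: "continuous_on UNIV (h :: real \<Rightarrow> real)" for h
  proof -
    have "bounded (h ` {a..b})"
      by (rule compact_imp_bounded[OF compact_continuous_image[OF continuous_on_subset[OF h subset_UNIV] comp]])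
    then have "\<exists>B. \<forall>t\<in>{a..b}. norm (h t) \<le> B" by (simp add: bounded_iff)
    then obtain B where B: "\<forall>t\<in>{a..b}. norm (h t) \<le> B" by (rule exE)
    show ?thesis
    proof (rule integrable_bounded_symbol)
      show "(\<lambda>z. h (y z)) \<in> borel_measurable symM"
        using y borel_measurable_continuous_onI[OF h] by (rule measurable_compose)
      show "AE z in symM. norm (h (y z)) \<le> B" using y_in B by (intro AE_I2) auto
    qed
  qed
  have "0 < e / 3" using e by simp
  then obtain p where p: "real_polynomial_function p" "\<And>t. t \<in> {a..b} \<Longrightarrow> \<bar>g t - p t\<bar> < e / 3"
    using Stone_Weierstrass_real_polynomial_function[OF comp continuous_on_subset[OF g subset_UNIV]] by metis
  then obtain c m where c: "p = (\<lambda>t. \<Sum>k\<le>m. c k * t ^ k)" unfolding real_polynomial_function_iff_sum by blast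
  have pc: "continuous_on UNIV p" unfolding c by (intro continuous_intros)
  have "((\<lambda>n. \<Sum>k\<le>m. c k * ((\<Sum>i<N n. x n i ^ k) / real (N n))) \<longlongrightarrow> (\<Sum>k\<le>m. c k * avg (\<lambda>z. y z ^ k))) F"
    by (intro tendsto_sum tendsto_mult_left mom)
  moreover have "(\<Sum>k\<le>m. c k * ((\<Sum>i<N n. x n i ^ k) / real (N n))) = (\<Sum>i<N n. p (x n i)) / real (N n)" for n
  proof -
    have "(\<Sum>i<N n. p (x n i)) = (\<Sum>k\<le>m. \<Sum>i<N n. c k * x n i ^ k)" unfolding c by (rule sum.swap)
    then show ?thesis by (simp add: sum_divide_distrib sum_distrib_left)
  qed
  moreover have "(\<Sum>k\<le>m. c k * avg (\<lambda>z. y z ^ k)) = avg (\<lambda>z. p (y z))"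
  proof -
    have ik: "integrable symM (\<lambda>z. c k * y z ^ k)" for k by (intro int continuous_intros)
    show ?thesis unfolding c avg_def using ik by (simp add: Bochner_Integration.integral_sum sum_distrib_left mult_ac)
  qed
  ultimately have lim: "((\<lambda>n. (\<Sum>i<N n. p (x n i)) / real (N n)) \<longlongrightarrow> avg (\<lambda>z. p (y z))) F" by simp
  have "\<bar>avg (\<lambda>z. g (y z)) - avg (\<lambda>z. p (y z))\<bar> \<le> e / 3 + 0 * 0"
    using p(2) y_in by (intro avg_close[of _ _ "{}"] int g pc) (auto intro: less_imp_le)
  then have 1: "\<bar>avg (\<lambda>z. g (y z)) - avg (\<lambda>z. p (y z))\<bar> \<le> e / 3" by simp
  have "eventually (\<lambda>n. dist ((\<Sum>i<N n. p (x n i)) / real (N n)) (avg (\<lambda>z. p (y z))) < e / 3) F"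
    using lim e by (intro tendstoD) auto
  with ev_I show "eventually (\<lambda>n. dist ((\<Sum>i<N n. g (x n i)) / real (N n)) (avg (\<lambda>z. g (y z))) < e) F"
  proof eventually_elim
    case (elim n)
    have "\<bar>(\<Sum>i<N n. g (x n i)) - (\<Sum>i<N n. p (x n i))\<bar> = \<bar>\<Sum>i<N n. g (x n i) - p (x n i)\<bar>"
      by (simp add: sum_subtractf)
    also have "\<dots> \<le> (\<Sum>i<N n. e / 3)"
      using p(2) x_in[OF elim(1)] by (intro order_trans[OF sum_abs] sum_mono) (auto intro: less_imp_le)
    also have "\<dots> = e / 3 * real (N n)" by simp
    finally have "\<bar>(\<Sum>i<N n. g (x n i)) - (\<Sum>i<N n. p (x n i))\<bar> / real (N n) \<le> e / 3"
      using N_pos[OF elim(1)] by (simp add: field_simps)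
    then have "\<bar>(\<Sum>i<N n. g (x n i)) / real (N n) - (\<Sum>i<N n. p (x n i)) / real (N n)\<bar> \<le> e / 3"
      by (simp add: diff_divide_distrib[symmetric])
    then show ?case using elim(2) 1 unfolding dist_real_def by linarith
  qed
qed

text \<open>The sequence is compared with a bounded Hermitian approximant \<open>H\<close>, whose
  distribution follows from its moments. The rank part changes the sum of \<open>g\<close> by at
  most the rank because \<open>g\<close> is monotone with values in [0, 1], the norm part is
  controlled by the Lipschitz constant, and neither uses a bound on \<open>A\<close>.\<close>

lemma mono_dist:
  assumes A: "glt A (\<lambda>z. of_real (\<tau> z))" and U: "\<And>n. n \<in> I \<Longrightarrow> unitary (N n) (U n)"
    and AU: "\<And>n. n \<in> I \<Longrightarrow> A n = spec (N n) (U n) (\<lambda>i. of_real (\<alpha> n i))"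
    and g: "mono g" "\<And>t. 0 \<le> g t" "\<And>t. g t \<le> 1" and L: "0 \<le> L" "\<And>s t. \<bar>g s - g t\<bar> \<le> L * \<bar>s - t\<bar>"
  shows "((\<lambda>n. (\<Sum>i<N n. g (\<alpha> n i)) / real (N n)) \<longlongrightarrow> avg (\<lambda>z. g (\<tau> z))) F"
proof (rule tendstoI)
  fix e :: real assume e: "0 < e"
  \<comment> \<open>Total error: \<open>3 * \<epsilon>\<close> for rank and
    \<open>3 * L * \<epsilon>\<close> for norm between \<open>A\<close> and \<open>H\<close>,
    \<open>L * \<epsilon> + \<epsilon>\<close> between the symbols, and \<open>e / 2\<close> for the
    limit along \<open>H\<close>.\<close>
  define \<epsilon> where "\<epsilon> = e / (2 * (4 + 4 * L))"
  have \<epsilon>: "0 < \<epsilon>" "(4 + 4 * L) * \<epsilon> = e / 2" using e L(1) by (auto simp: \<epsilon>_def field_simps)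
  obtain c where c: "nvalid c" "closeM \<epsilon> (nsym c) (\<lambda>z. complex_of_real (\<tau> z))" "eventually (\<lambda>n. small_pert \<epsilon> (A n - nmat (nn n) c)) F"
    by (rule gltE[OF A \<epsilon>(1)])
  have gc: "continuous_on UNIV g"
  proof (rule continuous_onI)
    fix s d :: real assume d: "0 < d"
    show "\<exists>d'>0. \<forall>t\<in>UNIV. dist t s < d' \<longrightarrow> dist (g t) (g s) \<le> d"
    proof (intro exI[of _ "d / (L + 1)"] conjI ballI impI)
      show "0 < d / (L + 1)" using d L(1) by simp
      fix t assume "dist t s < d / (L + 1)"
      then have "(L + 1) * \<bar>t - s\<bar> \<le> d" using L(1) by (simp add: dist_real_def field_simps)
      moreover have "L * \<bar>t - s\<bar> \<le> (L + 1) * \<bar>t - s\<bar>" by (rule mult_right_mono) auto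
      ultimately show "dist (g t) (g s) \<le> d" using L(2)[of t s] by (simp add: dist_real_def)
    qed
  qed
  \<comment> \<open>The approximant of a Hermitian matrix need not be Hermitian. Its Hermitian part
    is half of it plus the adjoint of that half; \<open>hc\<close> is the halved list.\<close>
  define hc where "hc = map (\<lambda>(v, k). (\<lambda>x. v x / 2, k)) c"
  have hc1: "nvalid hc" using c(1) unfolding hc_def
    by (induction c) (auto intro!: continuous_intros)
  have hc2: "nsym hc z = nsym c z / 2" for z unfolding hc_def by (induction c) (auto simp: add_divide_distrib)
  have hc3: "nmat n hc = (1 / 2) \<cdot>\<^sub>m nmat n c" for n
    unfolding hc_def
  proof (induction c)
    case Nil
    then show ?case by auto
  next
    case (Cons a c)
    obtain v k where a: "a = (v, k)" by (cases a)
    have "(1 / 2) \<cdot>\<^sub>m (single n k (\<lambda>i. v (pt n i)) + nmat n c) = (1 / 2) \<cdot>\<^sub>m single n k (\<lambda>i. v (pt n i)) + (1 / 2) \<cdot>\<^sub>m nmat n c"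
      by (rule add_smult_distrib_left_mat[of _ "mi_size n" "mi_size n"]) auto
    then show ?case unfolding a using Cons by (simp add: single_smult)
  qed
  define H where "H n = nmat (nn n) hc + mat_adjoint (nmat (nn n) hc)" for n
  have Hc: "H n \<in> carrier_mat (N n) (N n)" for n by (simp add: H_def)
  have Ha: "mat_adjoint (H n) = H n" for n
    unfolding H_def by (subst adj_add[of _ "N n" "N n"]) (auto intro: comm_add_mat[of _ "N n" "N n"])
  obtain K0 where K0: "0 \<le> K0" "\<And>n :: 'd \<Rightarrow> nat. nb (nmat n hc) K0" using nmat_nb[OF hc1] by blast
  have Hn: "nb (H n) (K0 + K0)" for n unfolding H_def
    using K0 by (intro nb_add[of _ "N n" "N n"] nb_adj[of _ "N n" "N n"]) auto
  define h where "h z = Re (nsym c z)" for z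
  define cc where "cc = hc @ nadj hc"
  have cc: "nvalid cc" using hc1 by (simp add: cc_def nvalid_append nvalid_nadj)
  have nh: "nsym cc z = complex_of_real (h z)" for z
    by (simp add: cc_def nsym_append nsym_nadj hc2 h_def complex_eq_iff)
  have hcont: "continuous_on symbol_domain h" unfolding h_def by (intro continuous_intros continuous_nsym c(1))
  have "compact (symbol_domain :: ('d::{finite,linorder} sdom) set)" unfolding symbol_domain_cbox by simp
  from compact_imp_bounded[OF compact_continuous_image[OF hcont this]]
  obtain K1 where K1: "\<And>z. z \<in> symbol_domain \<Longrightarrow> \<bar>h z\<bar> \<le> K1" unfolding bounded_iff by auto
  define K where "K = max (K0 + K0) K1"
  have K: "K0 + K0 \<le> K" "K1 \<le> K" "0 \<le> K" using K0(1) by (auto simp: K_def)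
  have "\<forall>n. \<exists>V \<beta>. unitary (N n) V \<and> H n = spec (N n) V (\<lambda>i. of_real (\<beta> i))"
    using spectral_theorem[OF Hc Ha] by blast
  then obtain V \<beta> where V: "\<And>n. unitary (N n) (V n)" and HV: "\<And>n. H n = spec (N n) (V n) (\<lambda>i. of_real (\<beta> n i))" by metis
  have bK: "\<bar>\<beta> n i\<bar> \<le> K" if "i < N n" for n i
    using spec_eigen_bound[OF V that, of "\<lambda>i. complex_of_real (\<beta> n i)"] Hn[of n] K(1) unfolding HV[symmetric] by fastforce
  \<comment> \<open>\<open>H\<close> contains the exact adjoint while \<open>cc\<close> contains the
    list \<open>nadj hc\<close>; their difference is the boundary error of
    \<open>nadj_negl\<close>.\<close>
  have neg: "negl (\<lambda>n. spec (N n) (V n) (\<lambda>i. of_real (\<beta> n i)) - nmat (nn n) cc)"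
  proof (rule negl_cong[OF nadj_negl[OF hc1]])
    fix n
    show "mat_adjoint (nmat (nn n) hc) - nmat (nn n) (nadj hc) = spec (N n) (V n) (\<lambda>i. of_real (\<beta> n i)) - nmat (nn n) cc"
      unfolding HV[symmetric] H_def cc_def nmat_append by (intro eq_matI) auto
  qed
  have hm: "h \<in> borel_measurable symM" using continuous_integrable_symbol[OF hcont] by auto
  have "((\<lambda>n. (\<Sum>i<N n. g (\<beta> n i)) / real (N n)) \<longlongrightarrow> avg (\<lambda>z. g (h z))) F"
  proof (rule weierstrass_mean[OF hm _ _ moments[OF cc V K(3) _ neg nh] gc, of "- K" K])
    show "- K \<le> \<beta> n i \<and> \<beta> n i \<le> K" if "i < N n" for n i using bK[OF that] by auto
    show "- K \<le> h z \<and> h z \<le> K" if "z \<in> symbol_domain" for z using K1[OF that] K(2) by auto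
  qed (rule bK)
  then have 1: "eventually (\<lambda>n. dist ((\<Sum>i<N n. g (\<beta> n i)) / real (N n)) (avg (\<lambda>z. g (h z))) < e / 2) F"
    using e by (intro tendstoD) auto
  have 2: "\<bar>avg (\<lambda>z. g (h z)) - avg (\<lambda>z. g (\<tau> z))\<bar> \<le> L * \<epsilon> + 1 * \<epsilon>"
  proof -
    obtain E where E: "E \<in> sets lebesgue" "emeasure lebesgue E \<le> ennreal \<epsilon>" "\<forall>z\<in>symbol_domain - E. cmod (nsym c z - complex_of_real (\<tau> z)) \<le> \<epsilon>"
      using c(2) unfolding closeM_def by blast
    have tm: "\<tau> \<in> borel_measurable symM"
      using measurable_compose[OF gltD(2)[OF A] borel_measurable_Re] by simp
    have gi: "integrable symM (\<lambda>z. g (t z))" if "t \<in> borel_measurable symM" for t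
      using measurable_compose[OF that borel_measurable_continuous_onI[OF gc]] g(2,3)
      by (intro integrable_bounded_symbol[where B = 1]) auto
    show ?thesis
    proof (rule avg_close[OF gi[OF hm] gi[OF tm] E(1,2)])
      fix z :: "'d::{finite,linorder} sdom" assume z: "z \<in> symbol_domain"
      show "\<bar>g (h z) - g (\<tau> z)\<bar> \<le> L * \<epsilon> + 1 * indicator E z"
      proof (cases "z \<in> E")
        case True
        have "0 \<le> L * \<epsilon>" using L(1) \<epsilon>(1) by simp
        then show ?thesis using g(2,3)[of "h z"] g(2,3)[of "\<tau> z"] True by (simp add: abs_if)
      next
        case False
        have "\<bar>h z - \<tau> z\<bar> \<le> cmod (nsym c z - complex_of_real (\<tau> z))"
          using abs_Re_le_cmod[of "nsym c z - complex_of_real (\<tau> z)"] by (simp add: h_def)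
        also have "\<dots> \<le> \<epsilon>" using E(3) z False by auto
        finally have "L * \<bar>h z - \<tau> z\<bar> \<le> L * \<epsilon>" using L(1) by (rule mult_left_mono)
        then show ?thesis using L(2)[of "h z" "\<tau> z"] False by simp
      qed
    qed (use \<epsilon> in auto)
  qed
  from 1 c(3) ev_I show "eventually (\<lambda>n. dist ((\<Sum>i<N n. g (\<alpha> n i)) / real (N n)) (avg (\<lambda>z. g (\<tau> z))) < e) F"
  proof eventually_elim
    case (elim n)
    note Ac = gltD(1)[OF A elim(3)]
    have Aa: "mat_adjoint (A n) = A n" unfolding AU[OF elim(3)] spec_adj by simp
    let ?D = "A n - nmat (nn n) c"
    have Dc: "?D \<in> carrier_mat (N n) (N n)" by (rule minus_carrier_mat[OF nmat_carrier(1)])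
    \<comment> \<open>\<open>A n\<close> equals its own Hermitian part, so the difference is the
      Hermitian part of \<open>?D\<close>. Each half costs \<open>(1 + 1/2) * \<epsilon>\<close>,
      whence \<open>3 * \<epsilon>\<close>.\<close>
    have AH: "A n - H n = (1 / 2) \<cdot>\<^sub>m ?D + (1 / 2) \<cdot>\<^sub>m mat_adjoint ?D"
    proof (rule eq_matI)
      fix i j assume ij: "i < dim_row ((1 / 2) \<cdot>\<^sub>m ?D + (1 / 2) \<cdot>\<^sub>m mat_adjoint ?D)" "j < dim_col ((1 / 2) \<cdot>\<^sub>m ?D + (1 / 2) \<cdot>\<^sub>m mat_adjoint ?D)"
      then have ij': "i < N n" "j < N n" using Ac by auto
      have "cnj (A n $$ (j, i)) = A n $$ (i, j)" using arg_cong[OF Aa, of "\<lambda>X. X $$ (i, j)"] ij' Ac by simp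
      then show "(A n - H n) $$ (i, j) = ((1 / 2) \<cdot>\<^sub>m ?D + (1 / 2) \<cdot>\<^sub>m mat_adjoint ?D) $$ (i, j)"
        using ij' Ac unfolding H_def hc3 by (simp add: field_simps)
    qed (use Ac Hc[of n] in auto)
    have sp: "small_pert (3 * \<epsilon>) (A n - H n)"
    proof -
      have "small_pert ((1 + cmod (1 / 2)) * \<epsilon> + (1 + cmod (1 / 2)) * \<epsilon>) (A n - H n)"
        unfolding AH using elim(2) Dc \<epsilon>(1)
        by (intro small_pert_add[of _ _ _ _ "N n"] small_pert_smult[of _ _ "N n"] small_pert_adj[of _ _ "N n"]) auto
      then show ?thesis by (simp add: norm_divide)
    qed
    have AHc: "A n - H n \<in> carrier_mat (N n) (N n)" by (rule minus_carrier_mat[OF Hc])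
    obtain R M r where R: "R \<in> carrier_mat (N n) (N n)" "M \<in> carrier_mat (N n) (N n)" "A n - H n = R + M" "lowrank r R"
      "real r \<le> 3 * \<epsilon> * real (N n)" "nb M (3 * \<epsilon>)" by (rule small_pertE[OF sp AHc])
    have entry: "A n $$ (i, j) = H n $$ (i, j) + R $$ (i, j) + M $$ (i, j)" if "i < N n" "j < N n" for i j
      using arg_cong[OF R(3), of "\<lambda>X. X $$ (i, j)"] that Ac Hc[of n] R(1,2) by (simp add: algebra_simps)
    have eq1: "A n = H n + R + M" using entry Ac Hc[of n] R(1,2) by (intro eq_matI) auto
    \<comment> \<open>\<open>eigen_sum_compare\<close> is one-sided; exchanging the two matrices
      gives the reverse inequality.\<close>
    have eq2: "H n = A n + (-1) \<cdot>\<^sub>m R + (-1) \<cdot>\<^sub>m M" using entry Ac Hc[of n] R(1,2) by (intro eq_matI) auto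
    have \<eta>: "g t - g (t - 3 * \<epsilon>) \<le> L * (3 * \<epsilon>)" for t using L(2)[of t "t - 3 * \<epsilon>"] \<epsilon>(1) by simp
    have c1: "(\<Sum>i<N n. g (\<beta> n i)) \<le> (\<Sum>i<N n. g (\<alpha> n i)) + real r + real (N n) * (L * (3 * \<epsilon>))"
      by (rule eigen_sum_compare[OF U[OF elim(3)] V R(1,2) eq1[unfolded AU[OF elim(3)] HV] R(4,6) g \<eta>])
    have nR: "(-1) \<cdot>\<^sub>m R \<in> carrier_mat (N n) (N n)" "(-1) \<cdot>\<^sub>m M \<in> carrier_mat (N n) (N n)" "lowrank r ((-1) \<cdot>\<^sub>m R)" "nb ((-1) \<cdot>\<^sub>m M) (3 * \<epsilon>)"
      using R nb_smult[OF R(2,6), of "-1"] by (auto intro: lowrank_smult)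
    have c2: "(\<Sum>i<N n. g (\<alpha> n i)) \<le> (\<Sum>i<N n. g (\<beta> n i)) + real r + real (N n) * (L * (3 * \<epsilon>))"
      by (rule eigen_sum_compare[OF V U[OF elim(3)] nR(1,2) eq2[unfolded AU[OF elim(3)] HV] nR(3,4) g \<eta>])
    have Np: "0 < real (N n)" by (rule N_pos[OF elim(3)])
    have "\<bar>(\<Sum>i<N n. g (\<alpha> n i)) - (\<Sum>i<N n. g (\<beta> n i))\<bar> \<le> (3 * \<epsilon> + L * (3 * \<epsilon>)) * real (N n)"
      using c1 c2 R(5) by (simp add: algebra_simps abs_le_iff)
    then have "\<bar>(\<Sum>i<N n. g (\<alpha> n i)) / real (N n) - (\<Sum>i<N n. g (\<beta> n i)) / real (N n)\<bar> \<le> 3 * \<epsilon> + L * (3 * \<epsilon>)"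
      using Np by (simp add: diff_divide_distrib[symmetric] pos_divide_le_eq)
    then have "\<bar>(\<Sum>i<N n. g (\<alpha> n i)) / real (N n) - avg (\<lambda>z. g (\<tau> z))\<bar> < (3 * \<epsilon> + L * (3 * \<epsilon>)) + e / 2 + (L * \<epsilon> + 1 * \<epsilon>)"
      using elim(1) 2 unfolding dist_real_def by linarith
    also have "\<dots> = e" using \<epsilon>(2) by (simp add: algebra_simps)
    finally show ?case by (simp add: dist_real_def)
  qed
qed

end

section \<open>From monotone test functions to the eigenvalue distribution\<close>

text \<open>The affine map of \<open>[-C, C]\<close> onto [0, 1], clamped outside. Its powers
  satisfy the hypotheses of \<open>mono_dist\<close>.\<close>

definition ramp :: "real \<Rightarrow> real \<Rightarrow> real" where
  "ramp C x = min 1 (max 0 ((x + C) / (2 * C)))"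

lemma ramp_bounds: "0 \<le> ramp C x" "ramp C x \<le> 1"
  by (auto simp: ramp_def)

lemma ramp_mono: "0 < C \<Longrightarrow> mono (ramp C)"
  unfolding ramp_def by (intro monoI min.mono max.mono order_refl divide_right_mono) auto

lemma ramp_lipschitz: "0 < C \<Longrightarrow> \<bar>ramp C s - ramp C t\<bar> \<le> (1 / (2 * C)) * \<bar>s - t\<bar>"
proof -
  assume C: "0 < C"
  have "\<bar>min 1 (max 0 a) - min 1 (max 0 b)\<bar> \<le> \<bar>a - b\<bar>" for a b :: real by linarith
  then have "\<bar>ramp C s - ramp C t\<bar> \<le> \<bar>(s + C) / (2 * C) - (t + C) / (2 * C)\<bar>" unfolding ramp_def .
  also have "(s + C) / (2 * C) - (t + C) / (2 * C) = (1 / (2 * C)) * (s - t)" by (simp add: diff_divide_distrib[symmetric])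
  finally show ?thesis using C by (simp add: abs_mult)
qed

lemma ramp_inside: "0 < C \<Longrightarrow> \<bar>x\<bar> \<le> C \<Longrightarrow> ramp C x = (x + C) / (2 * C)"
  by (auto simp: ramp_def min_def max_def field_simps)

lemma continuous_ramp: "0 < C \<Longrightarrow> continuous_on UNIV (ramp C)"
  unfolding ramp_def by (intro continuous_intros) auto

lemma spec_minus: "spec d U f - spec d U g = spec d U (\<lambda>i. f i - g i)"
  unfolding spec_def by (rule eq_matI) (auto simp: sum_subtractf[symmetric] algebra_simps)

context mlseq
begin

context
  fixes A :: "nat \<Rightarrow> complex Matrix.mat" and \<tau> :: "'d::{finite,linorder} sdom \<Rightarrow> real"
    and U :: "nat \<Rightarrow> complex Matrix.mat" and \<alpha> :: "nat \<Rightarrow> nat \<Rightarrow> real"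
  assumes A: "glt A (\<lambda>z. of_real (\<tau> z))" and U: "\<And>n. n \<in> I \<Longrightarrow> unitary (N n) (U n)"
    and AU: "\<And>n. n \<in> I \<Longrightarrow> A n = spec (N n) (U n) (\<lambda>i. of_real (\<alpha> n i))"
begin

lemma symbol_measurable: "\<tau> \<in> borel_measurable symM"
  using measurable_compose[OF gltD(2)[OF A] borel_measurable_Re] by simp

text \<open>\<open>mono_dist\<close> for the powers of \<open>ramp C\<close> supplies all moments of
  the clamped eigenvalues; \<open>weierstrass_mean\<close> on [0, 1] then gives every continuous
  test function.\<close>

lemma ramp_dist:
  assumes C: "0 < C" and q: "continuous_on UNIV (q :: real \<Rightarrow> real)"
  shows "((\<lambda>n. (\<Sum>i<N n. q (ramp C (\<alpha> n i))) / real (N n)) \<longlongrightarrow> avg (\<lambda>z. q (ramp C (\<tau> z)))) F"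
proof (rule weierstrass_mean[where a = 0 and b = 1, OF _ _ _ _ q])
  show "(\<lambda>z. ramp C (\<tau> z)) \<in> borel_measurable symM"
    using symbol_measurable borel_measurable_continuous_onI[OF continuous_ramp[OF C]] by (rule measurable_compose)
  fix k :: nat
  show "((\<lambda>n. (\<Sum>i<N n. ramp C (\<alpha> n i) ^ k) / real (N n)) \<longlongrightarrow> avg (\<lambda>z. ramp C (\<tau> z) ^ k)) F"
  proof (rule mono_dist[OF A U AU])
    show "mono (\<lambda>t. ramp C t ^ k)" using ramp_mono[OF C] by (auto simp: mono_def intro!: power_mono ramp_bounds)
    show "0 \<le> ramp C t ^ k" "ramp C t ^ k \<le> 1" for t using ramp_bounds[of C t] by (auto intro: power_le_one)
    show "0 \<le> real k * (1 / (2 * C))" using C by simp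
    show "\<bar>ramp C s ^ k - ramp C t ^ k\<bar> \<le> (real k * (1 / (2 * C))) * \<bar>s - t\<bar>" for s t
    proof -
      have "norm (ramp C s ^ k - ramp C t ^ k) \<le> real k * norm (ramp C s - ramp C t)"
        using ramp_bounds[of C s] ramp_bounds[of C t] by (intro norm_power_diff) auto
      also have "\<dots> \<le> real k * ((1 / (2 * C)) * \<bar>s - t\<bar>)"
        using ramp_lipschitz[OF C, of s t] by (intro mult_left_mono) auto
      finally show ?thesis by (simp add: mult.assoc)
    qed
  qed
qed (use ramp_bounds in auto)

context
  fixes C :: real
  assumes C: "0 < C" and \<alpha>C: "\<And>n i. n \<in> I \<Longrightarrow> i < N n \<Longrightarrow> \<bar>\<alpha> n i\<bar> \<le> C"
begin

text \<open>A test function that vanishes on all eigenvalues has mean 0 on the symbol as well; being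
  nonnegative, it vanishes there almost everywhere.\<close>

lemma symbol_bounded: "AE z in symM. \<bar>\<tau> z\<bar> \<le> C"
proof -
  \<comment> \<open>\<open>ramp (2 * C)\<close> maps \<open>[-C, C]\<close> onto [1/4, 3/4], which
    is where \<open>?q\<close> vanishes within [0, 1]. Doubling \<open>C\<close> keeps values
    slightly beyond \<open>C\<close> visible, and values far beyond are clamped to 0 or 1, where
    \<open>?q\<close> is positive.\<close>
  let ?q = "\<lambda>y :: real. max 0 (\<bar>y - 1 / 2\<bar> - 1 / 4)"
  let ?f = "\<lambda>z. ?q (ramp (2 * C) (\<tau> z))"
  have C2: "0 < 2 * C" using C by simp
  have q: "continuous_on UNIV ?q" by (intro continuous_intros)
  have lim: "((\<lambda>n. (\<Sum>i<N n. ?q (ramp (2 * C) (\<alpha> n i))) / real (N n)) \<longlongrightarrow> avg ?f) F" by (rule ramp_dist[OF C2 q])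
  have "eventually (\<lambda>n. (\<Sum>i<N n. ?q (ramp (2 * C) (\<alpha> n i))) / real (N n) = 0) F"
    using ev_I
  proof eventually_elim
    case (elim n)
    have "?q (ramp (2 * C) (\<alpha> n i)) = 0" if "i < N n" for i
    proof -
      have a: "\<bar>\<alpha> n i\<bar> \<le> C" by (rule \<alpha>C[OF elim that])
      have "ramp (2 * C) (\<alpha> n i) = (\<alpha> n i + 2 * C) / (2 * (2 * C))" using a C by (intro ramp_inside) auto
      also have "\<dots> = \<alpha> n i / (4 * C) + 1 / 2" using C by (simp add: field_simps)
      finally have r: "ramp (2 * C) (\<alpha> n i) = \<alpha> n i / (4 * C) + 1 / 2" .
      have "\<bar>\<alpha> n i / (4 * C)\<bar> \<le> 1 / 4" using a C by (simp add: abs_divide field_simps)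
      then show ?thesis unfolding r by simp
    qed
    then show ?case by simp
  qed
  then have "((\<lambda>n. (\<Sum>i<N n. ?q (ramp (2 * C) (\<alpha> n i))) / real (N n)) \<longlongrightarrow> 0) F" by (rule tendsto_eventually)
  then have "avg ?f = 0" using tendsto_unique[OF F_nontrivial lim] by blast
  then have 0: "(LINT z|symM. ?f z) = 0" by (simp add: avg_def)
  have "integrable symM ?f"
  proof (rule integrable_bounded_symbol)
    have "continuous_on UNIV (\<lambda>t. ?q (ramp (2 * C) t))"
      by (intro continuous_intros continuous_on_subset[OF continuous_ramp[OF C2]]) auto
    then show "?f \<in> borel_measurable symM"
      using measurable_compose[OF symbol_measurable borel_measurable_continuous_onI] by blast
    have "?f z \<le> 1" for z using ramp_bounds[of "2 * C" "\<tau> z"] by (auto simp: max_def abs_if)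
    then show "AE z in symM. norm (?f z) \<le> 1" by (intro AE_I2) auto
  qed
  then have "AE z in symM. ?f z = 0"
    using 0 integral_nonneg_eq_0_iff_AE[of "symM" ?f] by auto
  then show ?thesis
  proof (rule AE_mp, intro AE_I2 impI)
    fix z assume "?f z = 0"
    then have r: "1 / 4 \<le> ramp (2 * C) (\<tau> z)" "ramp (2 * C) (\<tau> z) \<le> 3 / 4" by linarith+
    then have "(\<tau> z + 2 * C) / (2 * (2 * C)) = ramp (2 * C) (\<tau> z)" unfolding ramp_def by linarith
    with r have "1 / 4 \<le> (\<tau> z + 2 * C) / (2 * (2 * C))" "(\<tau> z + 2 * C) / (2 * (2 * C)) \<le> 3 / 4" by auto
    then show "\<bar>\<tau> z\<bar> \<le> C" using C by (auto simp: field_simps)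
  qed
qed

text \<open>On \<open>[-C, C]\<close> the ramp has the inverse y -> 2 C y - C, so any continuous
  test function factors through it. The eigenvalues lie in the interval by assumption, the symbol
  almost everywhere by \<open>symbol_bounded\<close>.\<close>

lemma bounded_dist:
  assumes G: "continuous_on UNIV (G :: real \<Rightarrow> real)"
  shows "((\<lambda>n. (\<Sum>i<N n. G (\<alpha> n i)) / real (N n)) \<longlongrightarrow> avg (\<lambda>z. G (\<tau> z))) F"
proof -
  define q where "q y = G (2 * C * y - C)" for y
  have q: "continuous_on UNIV q" unfolding q_def by (intro continuous_on_compose2[OF G] continuous_intros) auto
  have qr: "q (ramp C t) = G t" if "\<bar>t\<bar> \<le> C" for t
    unfolding q_def ramp_inside[OF C that] using C by simp
  have "avg (\<lambda>z. q (ramp C (\<tau> z))) = avg (\<lambda>z. G (\<tau> z))"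
  proof -
    have "(LINT z|symM. q (ramp C (\<tau> z))) = (LINT z|symM. G (\<tau> z))"
    proof (rule integral_cong_AE)
      have "continuous_on UNIV (\<lambda>t. q (ramp C t))" by (rule continuous_on_compose2[OF q continuous_ramp[OF C]]) auto
      then show "(\<lambda>z. q (ramp C (\<tau> z))) \<in> borel_measurable symM"
        using measurable_compose[OF symbol_measurable borel_measurable_continuous_onI] by blast
      show "(\<lambda>z. G (\<tau> z)) \<in> borel_measurable symM"
        using measurable_compose[OF symbol_measurable borel_measurable_continuous_onI[OF G]] .
      show "AE z in symM. q (ramp C (\<tau> z)) = G (\<tau> z)"
        using symbol_bounded by (rule AE_mp) (auto simp: qr)
    qed
    then show ?thesis by (simp add: avg_def)
  qed
  moreover have "eventually (\<lambda>n. (\<Sum>i<N n. q (ramp C (\<alpha> n i))) / real (N n) = (\<Sum>i<N n. G (\<alpha> n i)) / real (N n)) F"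
    using ev_I by eventually_elim (simp add: qr \<alpha>C)
  ultimately show ?thesis using Lim_transform_eventually[OF ramp_dist[OF C q]] by simp
qed

lemma complex_dist:
  assumes G: "continuous_on UNIV (G :: real \<Rightarrow> complex)"
  shows "((\<lambda>n. (\<Sum>i<N n. G (\<alpha> n i)) / of_nat (N n)) \<longlongrightarrow> avg (\<lambda>z. G (\<tau> z))) F"
proof -
  have "bounded (G ` {- C..C})"
    by (rule compact_imp_bounded[OF compact_continuous_image[OF continuous_on_subset[OF G subset_UNIV]]]) simp
  then have "\<exists>B. \<forall>t\<in>{- C..C}. norm (G t) \<le> B" by (simp add: bounded_iff)
  then obtain B where B: "\<forall>t\<in>{- C..C}. norm (G t) \<le> B" by (rule exE)
  have int: "integrable symM (\<lambda>z. G (\<tau> z))"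
  proof (rule integrable_bounded_symbol)
    show "(\<lambda>z. G (\<tau> z)) \<in> borel_measurable symM"
      using measurable_compose[OF symbol_measurable borel_measurable_continuous_onI[OF G]] .
    show "AE z in symM. norm (G (\<tau> z)) \<le> B"
      using symbol_bounded by (rule AE_mp) (use B in \<open>auto simp: abs_le_iff\<close>)
  qed
  have R: "Re (avg (\<lambda>z. G (\<tau> z))) = avg (\<lambda>z. Re (G (\<tau> z)))" "Im (avg (\<lambda>z. G (\<tau> z))) = avg (\<lambda>z. Im (G (\<tau> z)))"
    using int by (simp_all add: avg_def)
  have "((\<lambda>n. (\<Sum>i<N n. Re (G (\<alpha> n i))) / real (N n)) \<longlongrightarrow> avg (\<lambda>z. Re (G (\<tau> z)))) F"
    "((\<lambda>n. (\<Sum>i<N n. Im (G (\<alpha> n i))) / real (N n)) \<longlongrightarrow> avg (\<lambda>z. Im (G (\<tau> z)))) F"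
    by (intro bounded_dist continuous_intros G)+
  then show ?thesis unfolding tendsto_complex_iff R by (simp add: Re_divide_of_nat Im_divide_of_nat)
qed

end

text \<open>The Neumann series \<open>\<Sum> C\<^sup>-\<^sup>1 (1 - x/C)\<^sup>j\<close> of \<open>1/x\<close> converges uniformly on \<open>[c, C]\<close>.\<close>

lemma glt_spec_inverse:
  assumes c: "0 < c" "c \<le> C" and \<alpha>: "\<And>n i. n \<in> I \<Longrightarrow> i < N n \<Longrightarrow> c \<le> \<alpha> n i \<and> \<alpha> n i \<le> C"
    and \<tau>: "\<And>z. z \<in> symbol_domain \<Longrightarrow> c \<le> \<tau> z"
  shows "glt (\<lambda>n. spec (N n) (U n) (\<lambda>i. of_real (inverse (\<alpha> n i)))) (\<lambda>z. of_real (inverse (\<tau> z)))"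
proof -
  have C: "0 < C" using c by simp
  define b where "b k x = (\<Sum>j<k. (1 / C) * (1 - x / C) ^ j)" for k and x :: real
  have b_Suc: "b (Suc k) x = 1 / C + (1 - x / C) * b k x" for k x
    unfolding b_def by (simp add: sum.lessThan_Suc_shift sum_distrib_left mult_ac del: sum.lessThan_Suc)
  \<comment> \<open>The exact remainder of the geometric series.\<close>
  have err: "inverse x - b k x = inverse x * (1 - x / C) ^ k" if "c \<le> x" for k x
  proof (induction k)
    case (Suc k)
    have x: "x \<noteq> 0" using that c by simp
    have "inverse x - b (Suc k) x = (1 - x / C) * (inverse x - b k x)"
      unfolding b_Suc using x C by (simp add: field_simps)
    then show ?case unfolding Suc by simp
  qed (simp add: b_def)
  define r where "r = 1 - c / C"
  have r: "0 \<le> r" "r < 1" using c C by (auto simp: r_def)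
  have bd: "\<bar>inverse x - b k x\<bar> \<le> inverse c * r ^ k" if "c \<le> x" "x \<le> C" for k x
  proof -
    have "0 \<le> 1 - x / C" "1 - x / C \<le> r" using that C by (auto simp: r_def divide_right_mono)
    then have "(1 - x / C) ^ k \<le> r ^ k" "0 \<le> (1 - x / C) ^ k" by (auto intro: power_mono)
    moreover have "inverse x \<le> inverse c" "0 \<le> inverse x" using that c by auto
    ultimately have "inverse x * (1 - x / C) ^ k \<le> inverse c * r ^ k" "0 \<le> inverse x * (1 - x / C) ^ k"
      using c r by (auto intro!: mult_mono simp del: inverse_nonnegative_iff_nonnegative)
    then show ?thesis unfolding err[OF that(1)] by (simp only: abs_of_nonneg)
  qed
  let ?B = "\<lambda>k n. spec (N n) (U n) (\<lambda>i. of_real (b k (\<alpha> n i)))"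
  \<comment> \<open>The factor 1 - A/C has eigenvalues in [0, 1], so it can stand on the left in
    \<open>glt_mult\<close> with bound 1; the partial sums are built by the recursion
    \<open>b_Suc\<close>.\<close>
  let ?E = "\<lambda>n. spec (N n) (U n) (\<lambda>i. 1 + complex_of_real (- (1 / C)) * complex_of_real (\<alpha> n i))"
  have E: "glt ?E (\<lambda>z. 1 + complex_of_real (- (1 / C)) * complex_of_real (\<tau> z))"
  proof (rule glt_cong[OF glt_add[OF glt_const[of 1] glt_smult[OF A, of "complex_of_real (- (1 / C))"]]])
    fix n assume n: "n \<in> I"
    show "1 \<cdot>\<^sub>m 1\<^sub>m (N n) + complex_of_real (- (1 / C)) \<cdot>\<^sub>m A n = ?E n"
      unfolding AU[OF n] spec_one[OF U[OF n], symmetric] spec_smult spec_add by simp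
  qed simp
  have nE: "nb (?E n) 1" if n: "n \<in> I" for n
  proof (rule spec_nb[OF U[OF n]])
    fix i assume i: "i < N n"
    have "1 + complex_of_real (- (1 / C)) * complex_of_real (\<alpha> n i) = complex_of_real (1 - \<alpha> n i / C)" by simp
    moreover have "0 \<le> 1 - \<alpha> n i / C" "1 - \<alpha> n i / C \<le> 1" using \<alpha>[OF n i] c C by (auto simp: field_simps)
    ultimately show "cmod (1 + complex_of_real (- (1 / C)) * complex_of_real (\<alpha> n i)) \<le> 1" by (simp only: norm_of_real)
  qed simp
  have B: "glt (?B k) (\<lambda>z. of_real (b k (\<tau> z)))" for k
  proof (induction k)
    case 0
    show ?case
    proof (rule glt_cong[OF glt_const[of 0]])
      fix n assume n: "n \<in> I"
      show "0 \<cdot>\<^sub>m 1\<^sub>m (N n) = ?B 0 n" unfolding spec_one[OF U[OF n], symmetric] spec_smult by (simp add: b_def)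
    qed (simp add: b_def)
  next
    case (Suc k)
    show ?case
    proof (rule glt_cong[OF glt_add[OF glt_const[of "complex_of_real (1 / C)"] glt_mult[OF E Suc nE]]])
      fix n assume n: "n \<in> I"
      show "complex_of_real (1 / C) \<cdot>\<^sub>m 1\<^sub>m (N n) + ?E n * ?B k n = ?B (Suc k) n"
        unfolding spec_one[OF U[OF n], symmetric] spec_smult spec_add spec_mult[OF U[OF n]] by (rule spec_cong) (simp add: b_Suc)
    qed (auto simp: b_Suc)
  qed
  show ?thesis
  proof (rule glt_lim)
    show "(\<lambda>z. complex_of_real (inverse (\<tau> z))) \<in> borel_measurable symM"
      using symbol_measurable by measurable
    fix \<epsilon> :: real assume e: "0 < \<epsilon>"
    have "(\<lambda>k. inverse c * r ^ k) \<longlonglongrightarrow> inverse c * 0" using r by (intro tendsto_mult_left LIMSEQ_realpow_zero) auto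
    then have "eventually (\<lambda>k. inverse c * r ^ k < \<epsilon>) sequentially" using e by (intro order_tendstoD) auto
    then obtain k where k: "inverse c * r ^ k < \<epsilon>" by (auto simp: eventually_sequentially)
    \<comment> \<open>The lower bound on the symbol is given at every point; the upper bound is
      inherited from the eigenvalues almost everywhere, and the null set is absorbed in the
      exceptional set.\<close>
    have "AE z in symM. \<bar>\<tau> z\<bar> \<le> C"
    proof (rule symbol_bounded[OF C])
      show "\<bar>\<alpha> n i\<bar> \<le> C" if "n \<in> I" "i < N n" for n i using \<alpha>[OF that] c by (auto simp: abs_le_iff)
    qed
    then obtain Z where Z: "{z \<in> space symM. \<not> \<bar>\<tau> z\<bar> \<le> C} \<subseteq> Z" "emeasure symM Z = 0" "Z \<in> sets symM"
      by (rule AE_E)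
    have Z': "Z \<in> sets lebesgue" "emeasure lebesgue Z = 0"
    proof -
      show 1: "Z \<in> sets lebesgue" using Z(3) by (simp add: sets_restrict_space_iff)
      show "emeasure lebesgue Z = 0" using Z(2,3) by (subst (asm) emeasure_restrict_space) (auto simp: sets_restrict_space_iff)
    qed
    have cl: "closeM \<epsilon> (\<lambda>z. complex_of_real (b k (\<tau> z))) (\<lambda>z. complex_of_real (inverse (\<tau> z)))"
      unfolding closeM_def
    proof (intro bexI[OF _ Z'(1)] conjI ballI)
      show "emeasure lebesgue Z \<le> ennreal \<epsilon>" using Z'(2) by simp
      fix z assume z: "z \<in> symbol_domain - Z"
      then have t: "c \<le> \<tau> z" "\<tau> z \<le> C" using \<tau>[of z] Z(1) by auto
      have "cmod (complex_of_real (b k (\<tau> z)) - complex_of_real (inverse (\<tau> z))) = \<bar>inverse (\<tau> z) - b k (\<tau> z)\<bar>"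
        unfolding of_real_diff[symmetric] norm_of_real by (rule abs_minus_commute)
      then show "cmod (complex_of_real (b k (\<tau> z)) - complex_of_real (inverse (\<tau> z))) \<le> \<epsilon>" using bd[OF t, of k] k by linarith
    qed
    from ev_I have "eventually (\<lambda>n. small_pert \<epsilon> (spec (N n) (U n) (\<lambda>i. of_real (inverse (\<alpha> n i))) - ?B k n)) F"
    proof eventually_elim
      case (elim n)
      have "nb (spec (N n) (U n) (\<lambda>i. of_real (inverse (\<alpha> n i)) - complex_of_real (b k (\<alpha> n i)))) \<epsilon>"
      proof (rule spec_nb[OF U[OF elim]])
        fix i assume "i < N n"
        then show "cmod (complex_of_real (inverse (\<alpha> n i)) - complex_of_real (b k (\<alpha> n i))) \<le> \<epsilon>"
          unfolding of_real_diff[symmetric] norm_of_real using bd[of "\<alpha> n i" k] \<alpha>[OF elim, of i] k by linarith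
      qed (use e in simp)
      then show ?case unfolding spec_minus using e by (intro small_pert_nb[of _ _ "N n"]) auto
    qed
    then show "\<exists>B \<mu>. glt B \<mu> \<and> closeM \<epsilon> \<mu> (\<lambda>z. of_real (inverse (\<tau> z))) \<and>
        eventually (\<lambda>n. small_pert \<epsilon> (spec (N n) (U n) (\<lambda>i. of_real (inverse (\<alpha> n i))) - B n)) F"
      using B[of k] cl by blast
  qed simp
qed

end

end

lemma sum_proots_spec:
  assumes U: "unitary d U"
  shows "(\<Sum>z\<in>#proots (char_poly (spec d U f)). h z) = (\<Sum>i<d. h (f i))"
proof -
  have "(\<Sum>z\<in>#proots (char_poly (spec d U f)). h z) = sum_list (map h (map f [0..<d]))"
    unfolding spec_proots[OF U] mset_map[symmetric] by (rule sum_mset_sum_list)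
  also have "\<dots> = (\<Sum>i<d. h (f i))"
    unfolding map_map by (simp add: interv_sum_list_conv_sum_set_nat lessThan_atLeast0 o_def)
  finally show ?thesis .
qed

lemma spec_psd:
  assumes U: "unitary d U" and x: "x \<in> carrier_vec d" and a: "\<And>i. i < d \<Longrightarrow> 0 \<le> a i"
  shows "0 \<le> Re ((spec d U (\<lambda>i. of_real (a i)) *\<^sub>v x) \<bullet>c x)"
  unfolding spec_quad[OF U x] Re_sum using a by (intro sum_nonneg) auto

context mlseq
begin

text \<open>The function \<open>\<phi>\<close> is built in so that a sequence and its inverse are
  covered at once: a test function of \<open>B\<close> is a test function of \<open>A\<close>
  composed with \<open>\<phi>\<close>.\<close>

lemma spectral_distributionI:
  fixes \<tau> :: "'d::{finite,linorder} sdom \<Rightarrow> real"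
  assumes A: "glt A (\<lambda>z. of_real (\<tau> z))" and U: "\<And>n. n \<in> I \<Longrightarrow> unitary (N n) (U n)"
    and AU: "\<And>n. n \<in> I \<Longrightarrow> A n = spec (N n) (U n) (\<lambda>i. of_real (\<alpha> n i))"
    and C: "0 < C" "\<And>n i. n \<in> I \<Longrightarrow> i < N n \<Longrightarrow> \<bar>\<alpha> n i\<bar> \<le> C"
    and \<phi>: "continuous_on UNIV \<phi>"
    and B: "\<And>n. n \<in> I \<Longrightarrow> B n = spec (N n) (U n) (\<lambda>i. of_real (\<phi> (\<alpha> n i)))"
    and \<sigma>: "\<And>z. z \<in> symbol_domain \<Longrightarrow> \<sigma> z = \<phi> (\<tau> z)"
  shows "spectral_distribution I B symbol_domain (\<lambda>z. complex_of_real (\<sigma> z))"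
  unfolding spectral_distribution_def
proof (intro conjI allI impI)
  have \<tau>m: "\<tau> \<in> borel_measurable symM" by (rule symbol_measurable[OF A U AU])
  have "(\<lambda>z. \<phi> (\<tau> z)) \<in> borel_measurable symM"
    using measurable_compose[OF \<tau>m borel_measurable_continuous_onI[OF \<phi>]] .
  then have "\<sigma> \<in> borel_measurable symM"
    using measurable_cong[of "symM" \<sigma> "\<lambda>z. \<phi> (\<tau> z)" borel] \<sigma> by auto
  then show "(\<lambda>z. complex_of_real (\<sigma> z)) \<in> borel_measurable symM" by measurable
  show "symbol_domain \<in> sets lebesgue" by simp
  show "0 < emeasure lebesgue (symbol_domain :: ('d::{finite,linorder} sdom) set)"
    "emeasure lebesgue (symbol_domain :: ('d::{finite,linorder} sdom) set) < \<infinity>"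
    by (simp_all add: emeasure_symbol_domain)
  fix h :: "complex \<Rightarrow> complex" assume h: "continuous_on UNIV h \<and> compact (closure {z. h z \<noteq> 0})"
  define G where "G x = h (complex_of_real (\<phi> x))" for x
  have G: "continuous_on UNIV G" unfolding G_def
    by (rule continuous_on_compose2[of UNIV h]) (use h in \<open>auto intro!: continuous_intros \<phi>\<close>)
  have lim: "((\<lambda>n. (\<Sum>i<N n. G (\<alpha> n i)) / of_nat (N n)) \<longlongrightarrow> avg (\<lambda>z. G (\<tau> z))) F"
    by (rule complex_dist[OF A U AU C G])
  have "eventually (\<lambda>n. (\<Sum>i<N n. G (\<alpha> n i)) / of_nat (N n) = (\<Sum>z\<in>#proots (char_poly (B n)). h z) / of_nat (dim_row (B n))) F"
    using ev_I by eventually_elim (simp add: B sum_proots_spec[OF U] G_def)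
  from Lim_transform_eventually[OF lim this]
  have "((\<lambda>n. (\<Sum>z\<in>#proots (char_poly (B n)). h z) / of_nat (dim_row (B n))) \<longlongrightarrow> avg (\<lambda>z. G (\<tau> z))) F" .
  moreover have "avg (\<lambda>z. G (\<tau> z)) = complex_of_real (1 / measure lebesgue (symbol_domain :: ('d::{finite,linorder} sdom) set)) *
      (LINT z|symM. h (complex_of_real (\<sigma> z)))"
  proof -
    have "(LINT z|symM. G (\<tau> z)) = (LINT z|symM. h (complex_of_real (\<sigma> z)))"
      by (rule Bochner_Integration.integral_cong) (auto simp: G_def \<sigma>)
    then show ?thesis by (simp add: avg_def measure_symbol_domain scaleR_conv_of_real)
  qed
  ultimately show "((\<lambda>n. (\<Sum>z\<in>#proots (char_poly (B n)). h z) / of_nat (dim_row (B n))) \<longlongrightarrow>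
     complex_of_real (1 / measure lebesgue (symbol_domain :: ('d::{finite,linorder} sdom) set)) *
      (LINT z|symM. h (complex_of_real (\<sigma> z)))) F" by simp
qed

end

section \<open>The Schur complements\<close>

theorem theorem3p1:
  fixes \<delta> \<rho> :: real
    and I :: "nat set"
    and nn :: "nat \<Rightarrow> 'd::{finite,linorder} \<Rightarrow> nat"
    and D J1 J2 :: "nat \<Rightarrow> complex Matrix.mat"
    and \<kappa> :: "(real ^ 'd::{finite,linorder}) \<times> (real ^ 'd::{finite,linorder}) \<Rightarrow> complex"
    and \<xi>1 \<xi>2 :: "(real ^ 'd::{finite,linorder}) \<times> (real ^ 'd::{finite,linorder}) \<Rightarrow> real"
  assumes "0 < \<delta>" and "0 < \<rho>" and "\<rho> < (sqrt 5 + 1) / 2"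
    and "multilevel_seq I nn D" and "multilevel_seq I nn J1" and "multilevel_seq I nn J2"
    and "\<forall>n\<in>I. hermitian_psd (J1 n)" and "\<forall>n\<in>I. hermitian_psd (J2 n)"
    and "\<exists>C. \<forall>n\<in>I. spectral_norm (D n) \<le> C \<and> spectral_norm (J1 n) \<le> C \<and> spectral_norm (J2 n) \<le> C"
    and "\<kappa> \<in> borel_measurable (lebesgue_on symbol_domain)"
    and "\<xi>1 \<in> borel_measurable (lebesgue_on symbol_domain)"
    and "\<xi>2 \<in> borel_measurable (lebesgue_on symbol_domain)"
    and "\<forall>z\<in>symbol_domain. 0 \<le> \<xi>1 z" and "\<forall>z\<in>symbol_domain. 0 \<le> \<xi>2 z"
    and "GLT_seq I nn D \<kappa>"
    and "GLT_seq I nn J1 (\<lambda>z. complex_of_real (\<xi>1 z))"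
    and "GLT_seq I nn J2 (\<lambda>z. complex_of_real (\<xi>2 z))"
  defines "S \<equiv> (\<lambda>n. schur_mat \<rho> \<delta> (D n) (J1 n) (J2 n))"
  shows "\<exists>\<tau> :: (real ^ 'd::{finite,linorder}) \<times> (real ^ 'd::{finite,linorder}) \<Rightarrow> real.
           \<tau> \<in> borel_measurable (lebesgue_on symbol_domain) \<and>
           (\<forall>z\<in>symbol_domain. 0 \<le> \<tau> z) \<and>
           (AE z in lebesgue_on symbol_domain. \<tau> z \<noteq> 0) \<and>
           GLT_seq I nn S (\<lambda>z. complex_of_real (\<tau> z)) \<and>
           (\<forall>n\<in>I. hermitian_pd (S n)) \<and>
           spectral_distribution I S symbol_domain (\<lambda>z. complex_of_real (\<tau> z)) \<and>
           spectral_distribution I (\<lambda>n. mat_inv (S n)) symbol_domain (\<lambda>z. complex_of_real (inverse (\<tau> z)))"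
proof -
  interpret mlseq I nn
    using \<open>multilevel_seq I nn D\<close> by unfold_locales (auto simp: multilevel_seq_def)
  have Dc: "D n \<in> carrier_mat (N n) (N n)" and J1c: "J1 n \<in> carrier_mat (N n) (N n)" and J2c: "J2 n \<in> carrier_mat (N n) (N n)" if "n \<in> I" for n
    using that \<open>multilevel_seq I nn D\<close> \<open>multilevel_seq I nn J1\<close> \<open>multilevel_seq I nn J2\<close> by (auto simp: multilevel_seq_def)
  obtain C0 where C0: "\<forall>n\<in>I. spectral_norm (D n) \<le> C0 \<and> spectral_norm (J1 n) \<le> C0 \<and> spectral_norm (J2 n) \<le> C0"
    using assms(9) by (rule exE)
  define K where "K = max C0 0"
  have K: "0 \<le> K" by (simp add: K_def)
  have nD: "nb (D n) K" and nJ1: "nb (J1 n) K" and nJ2: "nb (J2 n) K" if "n \<in> I" for n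
    using C0 that unfolding K_def by (auto intro: nb_spectral_norm)
  note gD = GLT_imp_glt[OF \<open>GLT_seq I nn D \<kappa>\<close>]
  note gJ1 = GLT_imp_glt[OF \<open>GLT_seq I nn J1 (\<lambda>z. complex_of_real (\<xi>1 z))\<close>]
  note gJ2 = GLT_imp_glt[OF \<open>GLT_seq I nn J2 (\<lambda>z. complex_of_real (\<xi>2 z))\<close>]
  \<comment> \<open>The scalar added to both \<open>\<rho> J1\<close> and \<open>\<rho> J2\<close>;
    its inverse is the scalar added to the inner inverse. It is also the uniform lower bound of
    \<open>S n\<close>.\<close>
  define c where "c = \<rho> / \<delta>"
  have c: "0 < c" using assms(1,2) by (simp add: c_def)
  let ?r = "complex_of_real \<rho>" and ?e = "complex_of_real \<delta>"
  have cc: "?r / ?e = complex_of_real c" "?e / ?r = complex_of_real (inverse c)" "?r * (1 / ?e) = complex_of_real c"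
    using assms(1,2) by (simp_all add: c_def)
  have J1h: "mat_adjoint (J1 n) = J1 n" and J2h: "mat_adjoint (J2 n) = J2 n" if "n \<in> I" for n
    using that assms(7,8) by (auto simp: hermitian_psd_def hermitian_mat_def)
  have J1p: "0 \<le> Re ((J1 n *\<^sub>v x) \<bullet>c x)" and J2p: "0 \<le> Re ((J2 n *\<^sub>v x) \<bullet>c x)" if "n \<in> I" "x \<in> carrier_vec (N n)" for n x
    using that assms(7,8) J1c[OF that(1)] J2c[OF that(1)] unfolding hermitian_psd_def by (metis carrier_matD(1))+
  \<comment> \<open>The nested inverse is a function of \<open>J2 n\<close> alone, so one
    diagonalization reduces it to scalars.\<close>
  have "\<exists>U \<alpha>. unitary (N n) U \<and> J2 n = spec (N n) U (\<lambda>i. of_real (\<alpha> i)) \<and> (\<forall>i<N n. 0 \<le> \<alpha> i)" if n: "n \<in> I" for n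
  proof (rule psd_spec[OF J2c[OF n] J2h[OF n], of 0])
    show "0 * (vec_nrm x)\<^sup>2 \<le> Re ((J2 n *\<^sub>v x) \<bullet>c x)" if "x \<in> carrier_vec (N n)" for x using J2p[OF n that] by simp
  qed blast
  then obtain U \<alpha> where U: "\<And>n. n \<in> I \<Longrightarrow> unitary (N n) (U n)"
    and J2: "\<And>n. n \<in> I \<Longrightarrow> J2 n = spec (N n) (U n) (\<lambda>i. of_real (\<alpha> n i))"
    and \<alpha>0: "\<And>n i. n \<in> I \<Longrightarrow> i < N n \<Longrightarrow> 0 \<le> \<alpha> n i" by metis
  have \<alpha>K: "\<alpha> n i \<le> K" if "n \<in> I" "i < N n" for n i
    using spec_eigen_bound[OF U[OF that(1)] that(2), of "\<lambda>i. complex_of_real (\<alpha> n i)" K] nJ2[OF that(1)] \<alpha>0[OF that]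
    unfolding J2[OF that(1)] by simp
  \<comment> \<open>In the eigenbasis of \<open>J2 n\<close>: \<open>a\<close> belongs to the inner
    matrix, \<open>b\<close> to its inverse plus the scalar, and the reciprocals of \<open>b\<close>
    to the factor \<open>W\<close> between the two copies of \<open>D\<close>.\<close>
  define a where "a n i = \<rho> * \<alpha> n i + c" for n i
  define b where "b n i = inverse (a n i) + inverse c" for n i
  have a: "c \<le> a n i" "a n i \<le> \<rho> * K + c" if "n \<in> I" "i < N n" for n i
    using \<alpha>0[OF that] \<alpha>K[OF that] assms(2) by (auto simp: a_def)
  have b: "inverse c \<le> b n i" "b n i \<le> 2 * inverse c" if "n \<in> I" "i < N n" for n i
  proof -
    have "0 < a n i" "inverse (a n i) \<le> inverse c" using a(1)[OF that] c by auto
    then show "inverse c \<le> b n i" "b n i \<le> 2 * inverse c" by (auto simp: b_def intro: less_imp_le)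
  qed
  have b0: "0 < b n i" if "n \<in> I" "i < N n" for n i using b(1)[OF that] c less_le_trans[of 0 "inverse c"] by simp
  have iK: "c \<le> \<rho> * K + c" using K assms(2) by simp
  let ?X = "\<lambda>n. spec (N n) (U n) (\<lambda>i. of_real (a n i))"
  let ?Y = "\<lambda>n. spec (N n) (U n) (\<lambda>i. of_real (b n i))"
  define W where "W n = spec (N n) (U n) (\<lambda>i. of_real (inverse (b n i)))" for n
  define \<omega> where "\<omega> z = inverse (inverse (\<rho> * \<xi>2 z + c) + inverse c)" for z
  have one: "1\<^sub>m (N n) = spec (N n) (U n) (\<lambda>_. 1)" if "n \<in> I" for n using spec_one[OF U[OF that]] by simp
  have X: "?r \<cdot>\<^sub>m J2 n + complex_of_real c \<cdot>\<^sub>m 1\<^sub>m (N n) = ?X n" if "n \<in> I" for n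
    unfolding J2[OF that] one[OF that] spec_smult spec_add a_def by (rule spec_cong) simp
  have iX: "mat_inv (?X n) = spec (N n) (U n) (\<lambda>i. of_real (inverse (a n i)))" if n: "n \<in> I" for n
  proof (subst spec_mat_inv[OF U[OF n]])
    show "complex_of_real (a n i) \<noteq> 0" if "i < N n" for i using a(1)[OF n that] c by auto
  qed simp
  have Y: "mat_inv (?X n) + complex_of_real (inverse c) \<cdot>\<^sub>m 1\<^sub>m (N n) = ?Y n" if "n \<in> I" for n
    unfolding iX[OF that] unfolding one[OF that] spec_smult spec_add b_def by (rule spec_cong) simp
  have iY: "mat_inv (?Y n) = W n" if n: "n \<in> I" for n
    unfolding W_def
  proof (subst spec_mat_inv[OF U[OF n]])
    show "complex_of_real (b n i) \<noteq> 0" if "i < N n" for i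
    proof -
      have "0 < inverse c" using c by simp
      then have "0 < b n i" using b(1)[OF n that] by linarith
      then show ?thesis by simp
    qed
  qed simp
  have S: "S n = (?r \<cdot>\<^sub>m J1 n + complex_of_real c \<cdot>\<^sub>m 1\<^sub>m (N n)) + mat_adjoint (D n) * W n * D n" if n: "n \<in> I" for n
  proof -
    have d: "dim_row (D n) = N n" using Dc[OF n] by auto
    have "?r \<cdot>\<^sub>m (J1 n + (1 / ?e) \<cdot>\<^sub>m 1\<^sub>m (N n)) = ?r \<cdot>\<^sub>m J1 n + complex_of_real c \<cdot>\<^sub>m 1\<^sub>m (N n)"
      unfolding cc(3)[symmetric] using J1c[OF n] by (intro eq_matI) (auto simp: algebra_simps)
    then show ?thesis unfolding S_def schur_mat_def Let_def d cc(1,2) X[OF n] Y[OF n] iY[OF n] by simp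
  qed
  have gX: "glt ?X (\<lambda>z. of_real (\<rho> * \<xi>2 z + c))"
    by (rule glt_cong[OF glt_add[OF glt_smult[OF gJ2, of ?r] glt_const[of "complex_of_real c"]]]) (auto simp: X)
  have giX: "glt (\<lambda>n. spec (N n) (U n) (\<lambda>i. of_real (inverse (a n i)))) (\<lambda>z. of_real (inverse (\<rho> * \<xi>2 z + c)))"
    by (rule glt_spec_inverse[OF gX U refl c iK]) (use a assms(2,14) in auto)
  have gY: "glt ?Y (\<lambda>z. of_real (inverse (\<rho> * \<xi>2 z + c) + inverse c))"
  proof (rule glt_cong[OF glt_add[OF giX glt_const[of "complex_of_real (inverse c)"]]])
    show "spec (N n) (U n) (\<lambda>i. of_real (inverse (a n i))) + complex_of_real (inverse c) \<cdot>\<^sub>m 1\<^sub>m (N n) = ?Y n" if "n \<in> I" for n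
      using Y[OF that] iX[OF that] by simp
  qed simp
  have ic: "0 < inverse c" "inverse c \<le> 2 * inverse c" using c by auto
  have \<xi>p: "c \<le> \<rho> * \<xi>2 z + c" if "z \<in> symbol_domain" for z using assms(2,14) that by simp
  have gW: "glt W (\<lambda>z. of_real (\<omega> z))"
    unfolding W_def \<omega>_def
  proof (rule glt_spec_inverse[OF gY U refl ic])
    fix z :: "'d::{finite,linorder} sdom" assume "z \<in> symbol_domain"
    then have "0 \<le> inverse (\<rho> * \<xi>2 z + c)" using \<xi>p[of z] c by (auto intro: order_trans less_imp_le)
    then show "inverse c \<le> inverse (\<rho> * \<xi>2 z + c) + inverse c" by simp
  qed (use b in auto)
  define \<tau> where "\<tau> z = \<rho> * \<xi>1 z + c + \<omega> z * (cmod (\<kappa> z))\<^sup>2" for z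
  have \<omega>p: "0 \<le> \<omega> z" if "z \<in> symbol_domain" for z
  proof -
    have "0 < \<rho> * \<xi>2 z + c" using \<xi>p[OF that] c by linarith
    then have "0 < inverse (\<rho> * \<xi>2 z + c) + inverse c" using c by (intro add_pos_pos) auto
    then show ?thesis by (simp add: \<omega>_def)
  qed
  have \<tau>c: "c \<le> \<tau> z" if "z \<in> symbol_domain" for z
    using \<omega>p[OF that] assms(2,13) that by (simp add: \<tau>_def)
  have Wc: "W n \<in> carrier_mat (N n) (N n)" for n by (simp add: W_def)
  \<comment> \<open>\<open>b\<close> is at least \<open>inverse c\<close>, so the eigenvalues of
    \<open>W n\<close> are at most \<open>c\<close>.\<close>
  have nW: "nb (W n) c" if n: "n \<in> I" for n
    unfolding W_def
  proof (rule spec_nb[OF U[OF n]])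
    fix i assume i: "i < N n"
    have "0 < inverse c" using c by simp
    then have "inverse (b n i) \<le> inverse (inverse c)" using b(1)[OF n i] by (intro le_imp_inverse_le)
    moreover have "0 < b n i" using b(1)[OF n i] \<open>0 < inverse c\<close> by linarith
    then have "0 \<le> inverse (b n i)" by simp
    ultimately show "cmod (complex_of_real (inverse (b n i))) \<le> c" by (simp only: norm_of_real) simp
  qed (use c in simp)
  have nDa: "nb (mat_adjoint (D n)) K" if "n \<in> I" for n using nb_adj[OF Dc[OF that] nD[OF that] K] .
  have nDW: "nb (mat_adjoint (D n) * W n) (K * c)" if "n \<in> I" for n
    using nDa[OF that] nW[OF that] K Dc[OF that] Wc by (intro nb_mult[of _ "N n" "N n"]) auto
  have Kc: "0 \<le> K * c" using K c by simp
  \<comment> \<open>\<open>glt_mult\<close> wants a uniformly bounded left factor: first the adjoint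
    of \<open>D\<close>, then that adjoint times \<open>W\<close>.\<close>
  have gS: "glt S (\<lambda>z. of_real (\<tau> z))"
  proof (rule glt_cong[OF glt_add[OF glt_add[OF glt_smult[OF gJ1, of ?r] glt_const[of "complex_of_real c"]]
        glt_mult[OF glt_mult[OF glt_adj[OF gD] gW nDa K] gD nDW Kc]]])
    show "?r \<cdot>\<^sub>m J1 n + complex_of_real c \<cdot>\<^sub>m 1\<^sub>m (N n) + mat_adjoint (D n) * W n * D n = S n" if "n \<in> I" for n
      using S[OF that] by simp
    show "?r * complex_of_real (\<xi>1 z) + complex_of_real c + cnj (\<kappa> z) * complex_of_real (\<omega> z) * \<kappa> z = complex_of_real (\<tau> z)" for z
    proof -
      have "cnj (\<kappa> z) * complex_of_real (\<omega> z) * \<kappa> z = complex_of_real (\<omega> z) * (\<kappa> z * cnj (\<kappa> z))" by (simp add: mult_ac)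
      then show ?thesis unfolding \<tau>_def by (simp only: of_real_add of_real_mult complex_norm_square)
    qed
  qed
  have Sc: "S n \<in> carrier_mat (N n) (N n)" if "n \<in> I" for n by (rule gltD(1)[OF gS that])
  have Sh: "mat_adjoint (S n) = S n" if n: "n \<in> I" for n
  proof -
    note cs = Dc[OF n] J1c[OF n] Wc[of n]
    have Wa: "mat_adjoint (W n) = W n" unfolding W_def spec_adj by simp
    have "mat_adjoint (mat_adjoint (D n) * W n * D n) = mat_adjoint (D n) * (W n * D n)"
      unfolding adj_mult[OF mult_carrier_mat[OF adj_carrier[OF cs(1)] cs(3)] cs(1)] adj_mult[OF adj_carrier[OF cs(1)] cs(3)] Wa
      by (simp add: adj_adj)
    also have "\<dots> = mat_adjoint (D n) * W n * D n" using cs by (intro assoc_mult_mat[symmetric]) auto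
    finally have 1: "mat_adjoint (mat_adjoint (D n) * W n * D n) = mat_adjoint (D n) * W n * D n" .
    have 2: "mat_adjoint (?r \<cdot>\<^sub>m J1 n + complex_of_real c \<cdot>\<^sub>m 1\<^sub>m (N n)) = ?r \<cdot>\<^sub>m J1 n + complex_of_real c \<cdot>\<^sub>m 1\<^sub>m (N n)"
      using cs J1h[OF n] by (simp add: adj_add[of _ "N n" "N n"] adj_smult)
    show ?thesis unfolding S[OF n] using cs 1 2 by (subst adj_add[of _ "N n" "N n"]) auto
  qed
  \<comment> \<open>\<open>J1\<close> and the term with \<open>W\<close> have nonnegative quadratic
    forms; the scalar term alone yields the bound \<open>c\<close>.\<close>
  have Sq: "c * (vec_nrm x)\<^sup>2 \<le> Re ((S n *\<^sub>v x) \<bullet>c x)" if n: "n \<in> I" and x: "x \<in> carrier_vec (N n)" for n x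
  proof -
    note cs = Dc[OF n] J1c[OF n] Wc[of n]
    let ?P = "mat_adjoint (D n) * W n * D n"
    have Dx: "D n *\<^sub>v x \<in> carrier_vec (N n)" using cs(1) x by (rule mult_mat_vec_carrier)
    have WDx: "W n *\<^sub>v (D n *\<^sub>v x) \<in> carrier_vec (N n)" using cs(3) Dx by (rule mult_mat_vec_carrier)
    have J1x: "J1 n *\<^sub>v x \<in> carrier_vec (N n)" using cs(2) x by (rule mult_mat_vec_carrier)
    have Pc: "?P \<in> carrier_mat (N n) (N n)" using cs by auto
    have Px: "?P *\<^sub>v x = mat_adjoint (D n) *\<^sub>v (W n *\<^sub>v (D n *\<^sub>v x))"
      unfolding assoc_mult_mat_vec[OF mult_carrier_mat[OF adj_carrier[OF cs(1)] cs(3)] cs(1) x] assoc_mult_mat_vec[OF adj_carrier[OF cs(1)] cs(3) Dx] ..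
    have Pxc: "?P *\<^sub>v x \<in> carrier_vec (N n)" using Pc x by (rule mult_mat_vec_carrier)
    have "(?P *\<^sub>v x) \<bullet>c x = (W n *\<^sub>v (D n *\<^sub>v x)) \<bullet>c (D n *\<^sub>v x)"
      unfolding Px using adj_cscalar[OF adj_carrier[OF cs(1)] WDx x] by simp
    moreover have "0 \<le> Re ((W n *\<^sub>v (D n *\<^sub>v x)) \<bullet>c (D n *\<^sub>v x))"
      unfolding W_def
    proof (rule spec_psd[OF U[OF n] Dx])
      show "0 \<le> inverse (b n i)" if "i < N n" for i using b0[OF n that] by simp
    qed
    ultimately have 1: "0 \<le> Re ((?P *\<^sub>v x) \<bullet>c x)" by simp
    have "S n *\<^sub>v x = (?r \<cdot>\<^sub>v (J1 n *\<^sub>v x) + complex_of_real c \<cdot>\<^sub>v x) + ?P *\<^sub>v x"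
    proof -
      have r: "?r \<cdot>\<^sub>m J1 n \<in> carrier_mat (N n) (N n)" "complex_of_real c \<cdot>\<^sub>m 1\<^sub>m (N n) \<in> carrier_mat (N n) (N n)" using cs by auto
      have "(?r \<cdot>\<^sub>m J1 n) *\<^sub>v x = ?r \<cdot>\<^sub>v (J1 n *\<^sub>v x)" "(complex_of_real c \<cdot>\<^sub>m 1\<^sub>m (N n)) *\<^sub>v x = complex_of_real c \<cdot>\<^sub>v x"
        using cs x by (auto simp: smult_mat_vec[of _ "N n" "N n"])
      then show ?thesis unfolding S[OF n] add_mult_distrib_mat_vec[OF add_carrier_mat[OF r(2)] Pc x] add_mult_distrib_mat_vec[OF r x] by simp
    qed
    then have "(S n *\<^sub>v x) \<bullet>c x = ?r * ((J1 n *\<^sub>v x) \<bullet>c x) + complex_of_real c * (x \<bullet>c x) + (?P *\<^sub>v x) \<bullet>c x"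
      using x J1x Pxc by (simp add: add_scalar_prod_distrib[of _ "N n"])
    then have "Re ((S n *\<^sub>v x) \<bullet>c x) = \<rho> * Re ((J1 n *\<^sub>v x) \<bullet>c x) + c * (vec_nrm x)\<^sup>2 + Re ((?P *\<^sub>v x) \<bullet>c x)"
      by (simp add: vec_nrm_sq_cscalar[OF x])
    then show ?thesis using 1 J1p[OF n x] assms(2) by simp
  qed
  have "\<exists>V \<beta>. unitary (N n) V \<and> S n = spec (N n) V (\<lambda>i. of_real (\<beta> i)) \<and> (\<forall>i<N n. c \<le> \<beta> i)" if n: "n \<in> I" for n
    by (rule psd_spec[OF Sc[OF n] Sh[OF n] Sq[OF n]]) blast+
  then obtain V \<beta> where V: "\<And>n. n \<in> I \<Longrightarrow> unitary (N n) (V n)"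
    and SV: "\<And>n. n \<in> I \<Longrightarrow> S n = spec (N n) (V n) (\<lambda>i. of_real (\<beta> n i))"
    and \<beta>c: "\<And>n i. n \<in> I \<Longrightarrow> i < N n \<Longrightarrow> c \<le> \<beta> n i" by metis
  define C where "C = (\<rho> * K + c) + K * c * K"
  have C: "0 < C" using K c assms(2) unfolding C_def by (intro add_pos_nonneg add_nonneg_pos) auto
  have nS: "nb (S n) C" if n: "n \<in> I" for n
  proof -
    note cs = Dc[OF n] J1c[OF n] Wc[of n]
    have "nb (?r \<cdot>\<^sub>m J1 n) (\<rho> * K)" using nb_smult[OF cs(2) nJ1[OF n], of ?r] assms(2) by simp
    moreover have "nb (complex_of_real c \<cdot>\<^sub>m 1\<^sub>m (N n)) c" using nb_smult[OF one_carrier_mat nb_one, of "complex_of_real c" "N n"] c by simp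
    moreover have "nb (mat_adjoint (D n) * W n * D n) (K * c * K)"
      by (rule nb_mult[OF mult_carrier_mat[OF adj_carrier[OF cs(1)] cs(3)] cs(1) nDW[OF n] nD[OF n] Kc])
    ultimately show ?thesis unfolding S[OF n] C_def using cs by (intro nb_add[of _ "N n" "N n"]) auto
  qed
  have \<beta>C: "\<bar>\<beta> n i\<bar> \<le> C" if "n \<in> I" "i < N n" for n i
    using spec_eigen_bound[OF V[OF that(1)] that(2), of "\<lambda>i. complex_of_real (\<beta> n i)" C] nS[OF that(1)] unfolding SV[OF that(1)] by simp
  have "\<tau> \<in> borel_measurable symM" by (rule symbol_measurable[OF gS V SV])
  moreover have "\<forall>z\<in>symbol_domain. 0 \<le> \<tau> z" using \<tau>c c by (meson less_imp_le order_trans)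
  moreover have "AE z in symM. \<tau> z \<noteq> 0" using \<tau>c c by (intro AE_I2) force
  moreover have "GLT_seq I nn S (\<lambda>z. complex_of_real (\<tau> z))" by (rule glt_imp_GLT[OF gS])
  moreover have "\<forall>n\<in>I. hermitian_pd (S n)"
  proof
    fix n assume n: "n \<in> I"
    have d: "dim_row (S n) = N n" "square_mat (S n)" using Sc[OF n] by auto
    show "hermitian_pd (S n)" unfolding hermitian_pd_def hermitian_mat_def d(1)
    proof (intro conjI ballI impI d(2) Sh[OF n])
      fix x :: "complex Matrix.vec" assume x: "x \<in> carrier_vec (N n)" "x \<noteq> 0\<^sub>v (N n)"
      then have "vec_nrm x \<noteq> 0" using vec_nrm_eq_0 by blast
      then have "0 < c * (vec_nrm x)\<^sup>2" using c by simp
      then show "0 < Re ((S n *\<^sub>v x) \<bullet>c x)" using Sq[OF n x(1)] by linarith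
    qed
  qed
  moreover have "spectral_distribution I S symbol_domain (\<lambda>z. complex_of_real (\<tau> z))"
    by (rule spectral_distributionI[OF gS V SV C \<beta>C, where \<phi> = "\<lambda>x. x"]) (use SV in auto)
  moreover have "spectral_distribution I (\<lambda>n. mat_inv (S n)) symbol_domain (\<lambda>z. complex_of_real (inverse (\<tau> z)))"
  \<comment> \<open>Cutting off at \<open>c\<close> makes inversion continuous on the whole line and
    changes nothing at the eigenvalues or at the values of \<open>\<tau>\<close>, which are all at
    least \<open>c\<close>.\<close>
  proof (rule spectral_distributionI[OF gS V SV C \<beta>C, where \<phi> = "\<lambda>x. inverse (max c x)"])
    show "continuous_on UNIV (\<lambda>x. inverse (max c x))" using c by (intro continuous_intros) auto
    show "mat_inv (S n) = spec (N n) (V n) (\<lambda>i. of_real (inverse (max c (\<beta> n i))))" if n: "n \<in> I" for n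
    proof -
      have "mat_inv (S n) = spec (N n) (V n) (\<lambda>i. inverse (complex_of_real (\<beta> n i)))"
        unfolding SV[OF n]
      proof (rule spec_mat_inv[OF V[OF n]])
        show "complex_of_real (\<beta> n i) \<noteq> 0" if "i < N n" for i using \<beta>c[OF n that] c by auto
      qed
      also have "\<dots> = spec (N n) (V n) (\<lambda>i. of_real (inverse (max c (\<beta> n i))))"
        by (rule spec_cong) (use \<beta>c[OF n] in \<open>simp add: max_absorb2\<close>)
      finally show ?thesis .
    qed
    show "inverse (\<tau> z) = inverse (max c (\<tau> z))" if "z \<in> symbol_domain" for z using \<tau>c[OF that] by (simp add: max_absorb2)
  qed
  ultimately show ?thesis by blast
qed

end
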